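(* Let $(v,u,\mathbf{w},\mathbf{b},\theta)$ be a sufficiently smooth solution of problem (P) of the context on $[0,1]\times[0,T]$, with initial data satisfying (I). Then for any $\varepsilon>0$ there is a constant $C(T)>0$, depending on the initial data, $T$ and $\varepsilon$, such that for all $t\in[0,T]$ $$\int_0^1v_y^2(y,t)\,dy+\int_0^t\int_0^1\theta v_y^2\,dy\,ds\le C(T)+\varepsilon\left(\int_0^t\int_0^1|\mathbf{w}_{yy}|^2\,dy\,ds\right)^{\frac12}+\varepsilon\left(\int_0^t\int_0^1|\mathbf{b}_{yy}|^2\,dy\,ds\right)^{\frac12}.$$
   Context: Unknowns, functions of $(y,t)$: $v>0$, $\theta>0$, $u\in\mathbb{R}$, $\mathbf{w},\mathbf{b}\in\mathbb{R}^2$; $\rho=1/v$. Parameters: positive constants $\lambda,\mu,\nu,R,a,C_v,\kappa_1,\kappa_2$ and $q\ge0$. Laws: $p=\frac{R\theta}{v}+\frac a3\theta^4$, $e=C_v\theta+av\theta^4$, and $\kappa=\kappa(\rho,\theta)$ with $\kappa_1(1+\theta^q)\le\kappa\le\kappa_2(1+\theta^q)$. Problem (P): on $(0,1)\times(0,T)$, $$v_t=u_y,\quad u_t=\Big(-p-\tfrac12|\mathbf{b}|^2+\tfrac{\lambda u_y}{v}\Big)_y,\quad \mathbf{w}_t=\Big(\mathbf{b}+\tfrac{\mu\mathbf{w}_y}{v}\Big)_y,\quad (v\mathbf{b})_t=\Big(\mathbf{w}+\tfrac{\nu\mathbf{b}_y}{v}\Big)_y,$$ $$e_t=\Big(\tfrac{\kappa}{v}\theta_y\Big)_y+\Big(-p+\tfrac{\lambda}{v}u_y\Big)u_y+\tfrac{\mu|\mathbf{w}_y|^2}{v}+\tfrac{\nu|\mathbf{b}_y|^2}{v},$$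 $(v,u,\theta,\mathbf{w},\mathbf{b})(y,0)=(v_0,u_0,\theta_0,\mathbf{w}_0,\mathbf{b}_0)(y)$, and $\big(\tfrac{\lambda u_y}{v}-p,\mathbf{w},\mathbf{b},\theta_y\big)=0$ at $y=0$ and $y=1$. (I): $C_0^{-1}\le v_0,\theta_0\le C_0$ for some $C_0>0$, $v_0\in C^{1+\alpha}(0,1)$ and $u_0,\mathbf{w}_0,\mathbf{b}_0,\theta_0$ have components in $C^{2+\alpha}(0,1)$, for some $\alpha\in(0,1)$. Constants may also depend on the fixed parameters and on the function $\kappa$. "Sufficiently smooth" means that all derivatives occurring exist. *)

theory Defs
  imports "HOL-Analysis.Analysis"
begin

text \<open>
  Functions of the space variable \<open>y \<in> [0,1]\<close> and of time \<open>t \<in> [0,T]\<close> are curried and take \<open>y\<close>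
  first. The partial derivatives are taken within the closed intervals: they are the ordinary
  partial derivatives in the interior and the one-sided ones at the end points.
\<close>

definition D_y :: "(real \<Rightarrow> real \<Rightarrow> 'a::real_normed_vector) \<Rightarrow> real \<Rightarrow> real \<Rightarrow> 'a" where
  "D_y f y t = vector_derivative (\<lambda>x. f x t) (at y within {0..1})"

definition D_t :: "real \<Rightarrow> (real \<Rightarrow> real \<Rightarrow> 'a::real_normed_vector) \<Rightarrow> real \<Rightarrow> real \<Rightarrow> 'a" where
  "D_t T f y t = vector_derivative (\<lambda>s. f y s) (at t within {0..T})"

definition has_cont_D_y :: "real \<Rightarrow> (real \<Rightarrow> real \<Rightarrow> 'a::real_normed_vector) \<Rightarrow> bool" where
  "has_cont_D_y T f \<longleftrightarrow>
     (\<forall>y\<in>{0..1}. \<forall>t\<in>{0..T}. (\<lambda>x. f x t) differentiable (at y within {0..1})) \<and>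
     continuous_on ({0..1} \<times> {0..T}) (\<lambda>(y, t). D_y f y t)"

definition has_cont_D_t :: "real \<Rightarrow> (real \<Rightarrow> real \<Rightarrow> 'a::real_normed_vector) \<Rightarrow> bool" where
  "has_cont_D_t T f \<longleftrightarrow>
     (\<forall>y\<in>{0..1}. \<forall>t\<in>{0..T}. (\<lambda>s. f y s) differentiable (at t within {0..T})) \<and>
     continuous_on ({0..1} \<times> {0..T}) (\<lambda>(y, t). D_t T f y t)"

text \<open>
  The Hoelder class \<open>C\<^sup>k\<^sup>+\<^sup>\<alpha>(S)\<close>. On a bounded interval the uniform Hoelder condition on the top
  derivative already makes all lower derivatives bounded.
\<close>

definition holder_on :: "real \<Rightarrow> real set \<Rightarrow> (real \<Rightarrow> real) \<Rightarrow> bool" where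
  "holder_on \<alpha> S f \<longleftrightarrow> (\<exists>K. \<forall>x\<in>S. \<forall>y\<in>S. \<bar>f x - f y\<bar> \<le> K * \<bar>x - y\<bar> powr \<alpha>)"

fun holder_class :: "nat \<Rightarrow> real \<Rightarrow> real set \<Rightarrow> (real \<Rightarrow> real) \<Rightarrow> bool" where
  "holder_class 0 \<alpha> S f \<longleftrightarrow> holder_on \<alpha> S f"
| "holder_class (Suc k) \<alpha> S f \<longleftrightarrow>
     (\<exists>f'. (\<forall>x\<in>S. (f has_real_derivative f' x) (at x within S)) \<and> holder_class k \<alpha> S f')"

definition initial_data ::
  "(real \<Rightarrow> real) \<Rightarrow> (real \<Rightarrow> real) \<Rightarrow> (real \<Rightarrow> real^2) \<Rightarrow> (real \<Rightarrow> real^2) \<Rightarrow> (real \<Rightarrow> real) \<Rightarrow> bool" where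
  "initial_data v0 u0 w0 b0 \<theta>0 \<longleftrightarrow>
     (\<exists>C0>0. \<forall>y\<in>{0<..<1}. inverse C0 \<le> v0 y \<and> v0 y \<le> C0 \<and> inverse C0 \<le> \<theta>0 y \<and> \<theta>0 y \<le> C0) \<and>
     (\<exists>\<alpha>\<in>{0<..<1}.
        holder_class 1 \<alpha> {0<..<1} v0 \<and>
        holder_class 2 \<alpha> {0<..<1} u0 \<and>
        (\<forall>i. holder_class 2 \<alpha> {0<..<1} (\<lambda>y. w0 y $ i)) \<and>
        (\<forall>i. holder_class 2 \<alpha> {0<..<1} (\<lambda>y. b0 y $ i)) \<and>
        holder_class 2 \<alpha> {0<..<1} \<theta>0)"

definition pressure :: "real \<Rightarrow> real \<Rightarrow> real \<Rightarrow> real \<Rightarrow> real" where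
  "pressure R a v \<theta> = R * \<theta> / v + a / 3 * \<theta> ^ 4"

definition internal_energy :: "real \<Rightarrow> real \<Rightarrow> real \<Rightarrow> real \<Rightarrow> real" where
  "internal_energy Cv a v \<theta> = Cv * \<theta> + a * v * \<theta> ^ 4"

definition conductivity :: "real \<Rightarrow> real \<Rightarrow> real \<Rightarrow> (real \<Rightarrow> real \<Rightarrow> real) \<Rightarrow> bool" where
  "conductivity \<kappa>1 \<kappa>2 q \<kappa> \<longleftrightarrow>
     (\<forall>\<rho>>0. \<forall>\<theta>>0. \<kappa>1 * (1 + \<theta> powr q) \<le> \<kappa> \<rho> \<theta> \<and> \<kappa> \<rho> \<theta> \<le> \<kappa>2 * (1 + \<theta> powr q))"

definition heat_flux ::
  "(real \<Rightarrow> real \<Rightarrow> real) \<Rightarrow> (real \<Rightarrow> real \<Rightarrow> real) \<Rightarrow> (real \<Rightarrow> real \<Rightarrow> real) \<Rightarrow> real \<Rightarrow> real \<Rightarrow> real" where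
  "heat_flux \<kappa> v \<theta> y t = \<kappa> (1 / v y t) (\<theta> y t) / v y t * D_y \<theta> y t"

text \<open>
  All derivatives that occur in the problem and in the estimate exist and are continuous on
  \<open>[0,1] \<times> [0,T]\<close>. The second space derivative of \<open>\<theta>\<close> enters only through the heat flux, so no
  regularity of \<open>\<kappa>\<close> itself is needed.
\<close>

definition sufficiently_smooth ::
  "(real \<Rightarrow> real \<Rightarrow> real) \<Rightarrow> real \<Rightarrow> (real \<Rightarrow> real \<Rightarrow> real) \<Rightarrow> (real \<Rightarrow> real \<Rightarrow> real) \<Rightarrow>
   (real \<Rightarrow> real \<Rightarrow> real^2) \<Rightarrow> (real \<Rightarrow> real \<Rightarrow> real^2) \<Rightarrow> (real \<Rightarrow> real \<Rightarrow> real) \<Rightarrow> bool" where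
  "sufficiently_smooth \<kappa> T v u w b \<theta> \<longleftrightarrow>
     has_cont_D_t T v \<and> has_cont_D_t T u \<and> has_cont_D_t T w \<and> has_cont_D_t T b \<and> has_cont_D_t T \<theta> \<and>
     has_cont_D_y T v \<and> has_cont_D_y T u \<and> has_cont_D_y T w \<and> has_cont_D_y T b \<and> has_cont_D_y T \<theta> \<and>
     has_cont_D_y T (D_y u) \<and> has_cont_D_y T (D_y w) \<and> has_cont_D_y T (D_y b) \<and>
     has_cont_D_y T (heat_flux \<kappa> v \<theta>)"

definition solves_P ::
  "real \<Rightarrow> real \<Rightarrow> real \<Rightarrow> real \<Rightarrow> real \<Rightarrow> real \<Rightarrow> (real \<Rightarrow> real \<Rightarrow> real) \<Rightarrow> real \<Rightarrow>
   (real \<Rightarrow> real) \<Rightarrow> (real \<Rightarrow> real) \<Rightarrow> (real \<Rightarrow> real^2) \<Rightarrow> (real \<Rightarrow> real^2) \<Rightarrow> (real \<Rightarrow> real) \<Rightarrow>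
   (real \<Rightarrow> real \<Rightarrow> real) \<Rightarrow> (real \<Rightarrow> real \<Rightarrow> real) \<Rightarrow> (real \<Rightarrow> real \<Rightarrow> real^2) \<Rightarrow> (real \<Rightarrow> real \<Rightarrow> real^2) \<Rightarrow>
   (real \<Rightarrow> real \<Rightarrow> real) \<Rightarrow> bool" where
  "solves_P lam \<mu> \<nu> R a Cv \<kappa> T v0 u0 w0 b0 \<theta>0 v u w b \<theta> \<longleftrightarrow>
     (let p = (\<lambda>y t. pressure R a (v y t) (\<theta> y t));
          e = (\<lambda>y t. internal_energy Cv a (v y t) (\<theta> y t))
      in
       (\<forall>y\<in>{0..1}. \<forall>t\<in>{0..T}. v y t > 0 \<and> \<theta> y t > 0) \<and>
       (\<forall>y\<in>{0<..<1}. \<forall>t\<in>{0<..<T}.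
          D_t T v y t = D_y u y t \<and>
          D_t T u y t =
            D_y (\<lambda>y t. - p y t - 1/2 * (norm (b y t))\<^sup>2 + lam * D_y u y t / v y t) y t \<and>
          D_t T w y t = D_y (\<lambda>y t. b y t + (\<mu> / v y t) *\<^sub>R D_y w y t) y t \<and>
          D_t T (\<lambda>y t. v y t *\<^sub>R b y t) y t = D_y (\<lambda>y t. w y t + (\<nu> / v y t) *\<^sub>R D_y b y t) y t \<and>
          D_t T e y t =
            D_y (heat_flux \<kappa> v \<theta>) y t
            + (- p y t + lam / v y t * D_y u y t) * D_y u y t
            + \<mu> * (norm (D_y w y t))\<^sup>2 / v y t
            + \<nu> * (norm (D_y b y t))\<^sup>2 / v y t) \<and>
       (\<forall>y\<in>{0<..<1}. v y 0 = v0 y \<and> u y 0 = u0 y \<and> \<theta> y 0 = \<theta>0 y \<and> w y 0 = w0 y \<and> b y 0 = b0 y) \<and>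
       (\<forall>y\<in>{0, 1}. \<forall>t\<in>{0<..<T}.
          lam * D_y u y t / v y t - p y t = 0 \<and> w y t = 0 \<and> b y t = 0 \<and> D_y \<theta> y t = 0))"

end

theory Submission
  imports Defs
begin

text \<open>
  As \<open>\<kappa>\<close> is only bounded above and below, the constant has to come from a priori estimates in terms of
  the data. The total energy and the entropy production control \<open>v\<close> from both sides and
  \<open>\<theta>\<^sup>4, u\<^sup>2, |w|\<^sup>2, |b|\<^sup>2\<close> by a function of time \<open>m\<close> with bounded integral. Because
  \<open>\<Phi> = \<lambda> v\<^sub>y / v - u\<close> satisfies \<open>\<Phi>\<^sub>t = p\<^sub>y + b \<bullet> b\<^sub>y\<close>, the left-hand side of the claim is at most
  \<open>C (1 + (\<integral> \<parallel>(1 + \<theta>\<^sup>3) \<theta>\<^sub>y\<parallel> dt)\<^sup>2)\<close>, with the \<open>L\<^sup>2\<close> norm in \<open>y\<close>.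

  For \<open>q \<ge> 2\<close> the entropy production bounds this integral. For \<open>q < 2\<close> the heat equation is tested with
  \<open>\<theta>\<^sup>2\<^sup>/\<^sup>3\<close>. The resulting production \<open>\<theta>\<^sup>2\<^sup>/\<^sup>3 u\<^sub>y\<^sup>2\<close> is compensated by twice a truncation \<open>\<Xi>\<close> of
  \<open>\<theta>\<^sup>2\<^sup>/\<^sup>3 u\<^sup>2 / 2\<close>, which is effective where \<open>\<theta>\<close> exceeds a level \<open>L\<close>; the remaining large values of \<open>u\<close> are
  handled by the moments of \<open>1 + u\<^sup>2\<close> of order \<open>5/3\<close>. With \<open>A = sup \<integral> v\<^sub>y\<^sup>2\<close> and
  \<open>N = \<integral>\<integral> \<theta>\<^sup>2\<^sup>/\<^sup>3 (|w\<^sub>y|\<^sup>2 + |b\<^sub>y|\<^sup>2)\<close> this gives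
  \<open>A \<le> C (1 + L\<^sup>2\<^sup>/\<^sup>3 + N + A / L\<^sup>2)\<^sup>3\<close>, and \<open>L = (1 + A)\<^sup>3\<^sup>/\<^sup>8\<close> yields \<open>A \<le> C (1 + N\<^sup>3)\<close>. By interpolation, \<open>N\<^sup>6\<close> is at
  most a multiple of \<open>1 + (\<integral>\<integral> |w\<^sub>y\<^sub>y|\<^sup>2)\<^sup>1\<^sup>/\<^sup>2 + (\<integral>\<integral> |b\<^sub>y\<^sub>y|\<^sup>2)\<^sup>1\<^sup>/\<^sup>2\<close>, so \<open>N\<^sup>3\<close> can be estimated with a factor \<open>\<epsilon>\<close>.
\<close>

section \<open>Calculus on a space-time rectangle\<close>

text \<open>Testing the heat equation with \<open>th^k\<close> yields the density
  \<open>th^(4+k)\<close> and the dissipation \<open>kap th^(k-1) th_y^2\<close>. To bound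
  \<open>(1 + th^3) th_y\<close> by that dissipation one needs the supremum of
  \<open>th^(7-k)\<close>, which Cauchy-Schwarz reduces to the dissipation times the integral of
  \<open>th^(6-2k)\<close>. The density controls this integral as soon as
  \<open>6 - 2k \<le> 4 + k\<close>; \<open>2/3\<close> is the smallest such exponent. The obstacle
  is the heating \<open>th^(2/3) u_y^2\<close>, as only \<open>u_y^2\<close> without weight is known
  to be integrable. The compensating kinetic term depends on \<open>th\<close> and so produces
  \<open>th_t\<close>, which the heat equation expresses by \<open>F_y\<close> over the heat
  capacity. Integration by parts then creates products of \<open>F\<close> with derivatives of the
  weight, and the dissipation absorbs these only if the kinetic factor stays below a small multiple
  of \<open>th\<close>; hence the truncation. As the heat capacity contains \<open>v\<close>, one
  product contains \<open>v_y\<close>. The level \<open>L\<close> is there to give it the factor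
  \<open>1 / L^2\<close>; with a fixed factor it would return as \<open>A^3\<close> on the right of
  a bound for \<open>A\<close>.\<close>

abbreviation jcont :: "real \<Rightarrow> (real \<Rightarrow> real \<Rightarrow> 'a::topological_space) \<Rightarrow> bool" where
  "jcont T f \<equiv> continuous_on ({0..1} \<times> {0..T}) (\<lambda>z. f (fst z) (snd z))"

lemma jcont_slice_y:
  assumes "jcont T f" "t \<in> {0..T}"
  shows "continuous_on {0..1} (\<lambda>y. f y t)"
  by (rule continuous_on_compose2[OF assms(1), where f = "\<lambda>y. (y, t)", simplified])
    (use assms(2) in \<open>auto intro!: continuous_intros\<close>)

lemma jcont_slice_t:
  assumes "jcont T f" "y \<in> {0..1}"
  shows "continuous_on {0..T} (\<lambda>t. f y t)"
  by (rule continuous_on_compose2[OF assms(1), where f = "\<lambda>t. (y, t)", simplified])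
    (use assms(2) in \<open>auto intro!: continuous_intros\<close>)

lemma jcont_swap:
  assumes "jcont T f"
  shows "continuous_on ({0..T} \<times> {0..1}) (\<lambda>(t, y). f y t)"
proof -
  have "continuous_on ({0..T} \<times> {0..1}) (\<lambda>z. f (fst (snd z, fst z)) (snd (snd z, fst z)))"
    by (rule continuous_on_compose2[OF assms, where f = "\<lambda>z. (snd z, fst z)"])
      (auto intro!: continuous_intros)
  then show ?thesis by (simp add: case_prod_unfold)
qed

lemma jcont_integral:
  fixes f :: "real \<Rightarrow> real \<Rightarrow> real"
  assumes "jcont T f"
  shows "continuous_on {0..T} (\<lambda>t. integral {0..1} (\<lambda>y. f y t))"
  using integral_continuous_on_param[of "{0..T}" 0 1 "\<lambda>t y. f y t"] jcont_swap[OF assms] by simp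

lemma jcont_integrable_y:
  fixes f :: "real \<Rightarrow> real \<Rightarrow> real"
  assumes "jcont T f" "t \<in> {0..T}"
  shows "(\<lambda>y. f y t) integrable_on {0..1}"
  by (intro integrable_continuous_real jcont_slice_y[OF assms])

lemma jcont_integrable_t:
  fixes f :: "real \<Rightarrow> real \<Rightarrow> real"
  assumes "jcont T f" "t \<in> {0..T}"
  shows "(\<lambda>s. integral {0..1} (\<lambda>y. f y s)) integrable_on {0..t}"
  by (intro integrable_continuous_real continuous_on_subset[OF jcont_integral[OF assms(1)]])
    (use assms in auto)

lemma jcont_restrict: "jcont T f \<Longrightarrow> t \<le> T \<Longrightarrow> jcont t f"
  by (rule continuous_on_subset) auto

lemma integral_mono_y:
  fixes f g :: "real \<Rightarrow> real"
  assumes "continuous_on {0..1} f" "continuous_on {0..1} g" "\<And>y. y \<in> {0..1} \<Longrightarrow> f y \<le> g y"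
  shows "integral {0..1} f \<le> integral {0..1} g"
  by (rule integral_le) (use assms integrable_continuous_real in auto)

lemma integral_nonneg_y:
  fixes f :: "real \<Rightarrow> real"
  assumes "continuous_on {0..1} f" "\<And>y. y \<in> {0..1} \<Longrightarrow> 0 \<le> f y"
  shows "0 \<le> integral {0..1} f"
  by (rule integral_nonneg) (use assms integrable_continuous_real in auto)

lemma integral_upper_mono:
  fixes f :: "real \<Rightarrow> real"
  assumes "continuous_on {0..T} f" "\<And>s. s \<in> {0..T} \<Longrightarrow> 0 \<le> f s" "0 \<le> r" "r \<le> t" "t \<le> T"
  shows "integral {0..r} f \<le> integral {0..t} f"
  by (rule integral_subset_le)
    (use assms in \<open>auto intro!: integrable_continuous_real intro: continuous_on_subset[OF assms(1)]\<close>)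

lemma leibniz_jcont:
  fixes f ft :: "real \<Rightarrow> real \<Rightarrow> real"
  assumes "jcont T f" "jcont T ft"
    and "\<And>y t. y \<in> {0..1} \<Longrightarrow> t \<in> {0..T} \<Longrightarrow> (f y has_real_derivative ft y t) (at t within {0..T})"
    and "t \<in> {0..T}"
  shows "((\<lambda>t. integral {0..1} (\<lambda>y. f y t)) has_real_derivative integral {0..1} (\<lambda>y. ft y t))
    (at t within {0..T})"
  using leibniz_rule_field_derivative[of "{0..T}" 0 1 "\<lambda>t y. f y t" "\<lambda>t y. ft y t" t]
    assms jcont_swap[OF assms(2)] jcont_integrable_y[OF assms(1)] by simp

lemma integral_real_derivative_le:
  fixes f :: "real \<Rightarrow> real"
  assumes "\<And>s. s \<in> {0..T} \<Longrightarrow> (f has_real_derivative f' s) (at s within {0..T})"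
    and "\<And>s. s \<in> {0..T} \<Longrightarrow> f' s \<le> g s" "continuous_on {0..T} g" "t \<in> {0..T}"
  shows "f t - f 0 \<le> integral {0..t} g"
proof -
  have "(f' has_integral (f t - f 0)) {0..t}"
    by (rule fundamental_theorem_of_calculus)
      (use assms in \<open>auto simp flip: has_real_derivative_iff_has_vector_derivative
        intro!: has_field_derivative_subset[OF assms(1)]\<close>)
  moreover have "(g has_integral integral {0..t} g) {0..t}"
    by (intro integrable_integral integrable_continuous_real continuous_on_subset[OF assms(3)])
      (use assms in auto)
  ultimately show ?thesis
    by (rule has_integral_le) (use assms in auto)
qed

text \<open>The scheme behind every energy-type estimate below: the flux \<open>Z\<close> vanishes
  at both ends, so by the fundamental theorem its derivative contributes nothing to the space
  integral. A pointwise inequality suffices, so that all estimates of densities can be done before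
  integrating.\<close>

lemma balance_law:
  fixes f ft g Z Zy :: "real \<Rightarrow> real \<Rightarrow> real"
  assumes "jcont T f" "jcont T ft" "jcont T g"
    and "\<And>y t. y \<in> {0..1} \<Longrightarrow> t \<in> {0..T} \<Longrightarrow> (f y has_real_derivative ft y t) (at t within {0..T})"
    and Z: "\<And>y t. y \<in> {0..1} \<Longrightarrow> t \<in> {0..T} \<Longrightarrow>
      ((\<lambda>y. Z y t) has_real_derivative Zy y t) (at y within {0..1})"
    and "\<And>t. t \<in> {0..T} \<Longrightarrow> Z 0 t = 0" "\<And>t. t \<in> {0..T} \<Longrightarrow> Z 1 t = 0"
    and le: "\<And>y t. y \<in> {0..1} \<Longrightarrow> t \<in> {0..T} \<Longrightarrow> ft y t \<le> g y t + Zy y t"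
    and "t \<in> {0..T}"
  shows "integral {0..1} (\<lambda>y. f y t)
    \<le> integral {0..1} (\<lambda>y. f y 0) + integral {0..t} (\<lambda>s. integral {0..1} (\<lambda>y. g y s))"
proof -
  have *: "integral {0..1} (\<lambda>y. ft y s) \<le> integral {0..1} (\<lambda>y. g y s)" if "s \<in> {0..T}" for s
  proof -
    have "((\<lambda>y. Zy y s) has_integral (Z 1 s - Z 0 s)) {0..1}"
      by (rule fundamental_theorem_of_calculus)
        (use Z that in \<open>auto simp flip: has_real_derivative_iff_has_vector_derivative\<close>)
    then have "((\<lambda>y. Zy y s) has_integral 0) {0..1}" using assms(6,7)[OF that] by simp
    then have "((\<lambda>y. g y s + Zy y s) has_integral (integral {0..1} (\<lambda>y. g y s) + 0)) {0..1}"
      by (intro has_integral_add integrable_integral jcont_integrable_y[OF assms(3) that])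
    moreover have "((\<lambda>y. ft y s) has_integral (integral {0..1} (\<lambda>y. ft y s))) {0..1}"
      by (intro integrable_integral jcont_integrable_y[OF assms(2) that])
    ultimately have "integral {0..1} (\<lambda>y. ft y s) \<le> integral {0..1} (\<lambda>y. g y s) + 0"
      by - (rule has_integral_le, assumption+, use le that in auto)
    then show ?thesis by simp
  qed
  have "integral {0..1} (\<lambda>y. f y t) - integral {0..1} (\<lambda>y. f y 0)
    \<le> integral {0..t} (\<lambda>s. integral {0..1} (\<lambda>y. g y s))"
    by (rule integral_real_derivative_le[OF leibniz_jcont[OF assms(1,2,4)] *])
      (use assms jcont_integral in auto)
  then show ?thesis by simp
qed

section \<open>Integral inequalities on the unit interval, Gronwall's inequality, joint
  continuity\<close>

lemma cauchy_schwarz_integral: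
  fixes f g :: "real \<Rightarrow> real"
  assumes f: "continuous_on {0..1} f" and g: "continuous_on {0..1} g"
  shows "(integral {0..1} (\<lambda>y. \<bar>f y * g y\<bar>))\<^sup>2
    \<le> integral {0..1} (\<lambda>y. (f y)\<^sup>2) * integral {0..1} (\<lambda>y. (g y)\<^sup>2)"
proof -
  define A B C where "A = integral {0..1} (\<lambda>y. (f y)\<^sup>2)" and "B = integral {0..1} (\<lambda>y. \<bar>f y * g y\<bar>)"
    and "C = integral {0..1} (\<lambda>y. (g y)\<^sup>2)"
  have int: "(\<lambda>y. (f y)\<^sup>2) integrable_on {0..1}" "(\<lambda>y. \<bar>f y * g y\<bar>) integrable_on {0..1}"
    "(\<lambda>y. (g y)\<^sup>2) integrable_on {0..1}"
    by (intro integrable_continuous_real continuous_intros f g)+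
  have A: "0 \<le> A" and C: "0 \<le> C" and B: "0 \<le> B"
    unfolding A_def B_def C_def using int by (auto intro!: integral_nonneg)
  \<comment> \<open>This integrates \<open>0 \<le> (x |f| - |g|)^2\<close>. It is used at the
    minimiser \<open>x = B / A\<close> and, for \<open>A = 0\<close>, at an \<open>x\<close> large
    enough to exclude \<open>B \<noteq> 0\<close>.\<close>
  have ineq: "2 * x * B \<le> x\<^sup>2 * A + C" for x :: real
  proof -
    have "2 * x * B = integral {0..1} (\<lambda>y. 2 * x * \<bar>f y * g y\<bar>)"
      unfolding B_def by simp
    also have "\<dots> \<le> integral {0..1} (\<lambda>y. x\<^sup>2 * (f y)\<^sup>2 + (g y)\<^sup>2)"
    proof (rule integral_le)
      fix y
      have "0 \<le> (x * \<bar>f y\<bar> - \<bar>g y\<bar>)\<^sup>2" by simp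
      then show "2 * x * \<bar>f y * g y\<bar> \<le> x\<^sup>2 * (f y)\<^sup>2 + (g y)\<^sup>2"
        by (simp add: power2_diff power_mult_distrib abs_mult)
    qed (intro integrable_continuous_real continuous_intros f g)+
    also have "\<dots> = x\<^sup>2 * A + C"
      unfolding A_def C_def by (subst integral_add) (use int in \<open>auto intro!: integrable_continuous_real continuous_intros f g\<close>)
    finally show ?thesis .
  qed
  have "B\<^sup>2 \<le> A * C"
  proof (cases "A = 0")
    case True
    have "B = 0"
    proof (rule ccontr)
      assume "B \<noteq> 0"
      then have "2 * ((C + 1) / B) * B = 2 * (C + 1)" by simp
      with ineq[of "(C + 1) / B"] True C show False by simp
    qed
    with A C show ?thesis by simp
  next
    case False
    with A have "A > 0" by simp
    with ineq[of "B / A"] show ?thesis by (simp add: power2_eq_square field_simps)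
  qed
  then show ?thesis unfolding A_def B_def C_def .
qed

lemma cauchy_schwarz_weighted:
  fixes f g \<rho> :: "real \<Rightarrow> real"
  assumes "continuous_on {0..1} f" "continuous_on {0..1} g" "continuous_on {0..1} \<rho>"
    and pos: "\<And>y. y \<in> {0..1} \<Longrightarrow> 0 < \<rho> y"
  shows "(integral {0..1} (\<lambda>y. \<bar>f y * g y\<bar>))\<^sup>2
    \<le> integral {0..1} (\<lambda>y. (f y)\<^sup>2 / \<rho> y) * integral {0..1} (\<lambda>y. \<rho> y * (g y)\<^sup>2)"
proof -
  have ne: "\<forall>y\<in>{0..1}. sqrt (\<rho> y) \<noteq> 0" "\<forall>y\<in>{0..1}. \<rho> y \<noteq> 0"
    using pos by force+
  have 1: "integral {0..1} (\<lambda>y. \<bar>(f y / sqrt (\<rho> y)) * (sqrt (\<rho> y) * g y)\<bar>)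
      = integral {0..1} (\<lambda>y. \<bar>f y * g y\<bar>)"
    by (rule integral_cong) (use ne in auto)
  have 2: "integral {0..1} (\<lambda>y. (f y / sqrt (\<rho> y))\<^sup>2) = integral {0..1} (\<lambda>y. (f y)\<^sup>2 / \<rho> y)"
    by (rule integral_cong) (use pos in \<open>auto simp: power_divide less_imp_le\<close>)
  have 3: "integral {0..1} (\<lambda>y. (sqrt (\<rho> y) * g y)\<^sup>2) = integral {0..1} (\<lambda>y. \<rho> y * (g y)\<^sup>2)"
    by (rule integral_cong) (use pos in \<open>auto simp: power_mult_distrib less_imp_le\<close>)
  have "continuous_on {0..1} (\<lambda>y. f y / sqrt (\<rho> y))" "continuous_on {0..1} (\<lambda>y. sqrt (\<rho> y) * g y)"
    using ne assms(1-3) by (auto intro!: continuous_intros)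
  from cauchy_schwarz_integral[OF this] show ?thesis unfolding 1 2 3 .
qed

lemma abs_diff_le_integral_deriv:
  fixes f f' :: "real \<Rightarrow> real"
  assumes f: "\<And>y. y \<in> {0..1} \<Longrightarrow> (f has_real_derivative f' y) (at y within {0..1})"
    and c: "continuous_on {0..1} f'" and "x \<in> {0..1}" "y \<in> {0..1}"
  shows "\<bar>f y - f x\<bar> \<le> integral {0..1} (\<lambda>y. \<bar>f' y\<bar>)"
proof -
  have *: "\<bar>f y - f x\<bar> \<le> integral {0..1} (\<lambda>y. \<bar>f' y\<bar>)" if "x \<in> {0..1}" "y \<in> {0..1}" "x \<le> y" for x y
  proof -
    have "(f' has_integral (f y - f x)) {x..y}"
      by (rule fundamental_theorem_of_calculus)
        (use that in \<open>auto simp flip: has_real_derivative_iff_has_vector_derivative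
          intro!: has_field_derivative_subset[OF f]\<close>)
    then have "\<bar>f y - f x\<bar> = norm (integral {x..y} f')" by (simp add: integral_unique)
    also have "\<dots> \<le> integral {x..y} (\<lambda>y. \<bar>f' y\<bar>)"
      by (rule integral_norm_bound_integral)
        (use that in \<open>auto intro!: integrable_continuous_real continuous_intros intro: continuous_on_subset[OF c]\<close>)
    also have "\<dots> \<le> integral {0..1} (\<lambda>y. \<bar>f' y\<bar>)"
      by (rule integral_subset_le)
        (use that in \<open>auto intro!: integrable_continuous_real continuous_intros intro: continuous_on_subset[OF c]\<close>)
    finally show ?thesis .
  qed
  show ?thesis
    using *[of x y] *[of y x] assms(3,4) by (cases "x \<le> y") (auto simp: abs_minus_commute)
qed

lemma exists_le_mean:
  fixes f :: "real \<Rightarrow> real"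
  assumes "continuous_on {0..1} f"
  obtains x where "x \<in> {0..1}" "f x \<le> integral {0..1} f"
proof -
  obtain x where x: "x \<in> {0..1}" "\<And>y. y \<in> {0..1} \<Longrightarrow> f x \<le> f y"
    using continuous_attains_inf[of "{0..1}" f] assms by auto
  have "integral {0..1} (\<lambda>y::real. f x) \<le> integral {0..1} f"
    by (rule integral_mono_y) (use assms x in auto)
  then show ?thesis using that[of x] x by simp
qed

lemma le_mean_plus_variation:
  fixes f f' :: "real \<Rightarrow> real"
  assumes f: "\<And>y. y \<in> {0..1} \<Longrightarrow> (f has_real_derivative f' y) (at y within {0..1})"
    and c: "continuous_on {0..1} f'" and "y \<in> {0..1}"
  shows "f y \<le> integral {0..1} f + integral {0..1} (\<lambda>y. \<bar>f' y\<bar>)"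
proof -
  have "continuous_on {0..1} f"
    by (rule DERIV_continuous_on) (use f in auto)
  then obtain x where "x \<in> {0..1}" "f x \<le> integral {0..1} f" using exists_le_mean by blast
  with abs_diff_le_integral_deriv[OF f c, of x y] assms show ?thesis by auto
qed

lemma norm_diff_le_integral_deriv:
  fixes f f' :: "real \<Rightarrow> 'a::euclidean_space"
  assumes f: "\<And>y. y \<in> {0..1} \<Longrightarrow> (f has_vector_derivative f' y) (at y within {0..1})"
    and c: "continuous_on {0..1} f'" and "y \<in> {0..1}" and "f 0 = 0"
  shows "norm (f y) \<le> integral {0..1} (\<lambda>y. norm (f' y))"
proof -
  have "(f' has_integral (f y - f 0)) {0..y}"
    by (rule fundamental_theorem_of_calculus)
      (use assms in \<open>auto intro!: has_vector_derivative_within_subset[OF f]\<close>)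
  then have "norm (f y) = norm (integral {0..y} f')" using assms by (simp add: integral_unique)
  also have "\<dots> \<le> integral {0..y} (\<lambda>y. norm (f' y))"
    by (rule integral_norm_bound_integral)
      (use assms in \<open>auto intro!: integrable_continuous_real continuous_intros intro: continuous_on_subset[OF c]\<close>)
  also have "\<dots> \<le> integral {0..1} (\<lambda>y. norm (f' y))"
    by (rule integral_subset_le)
      (use assms in \<open>auto intro!: integrable_continuous_real continuous_intros intro: continuous_on_subset[OF c]\<close>)
  finally show ?thesis .
qed

text \<open>The right-hand side \<open>W\<close> of the integral inequality dominates
  \<open>J\<close> because \<open>\<phi>\<close> is nonnegative, so \<open>W * exp (- P)\<close>,
  with \<open>P\<close> the primitive of \<open>m\<close>, grows at most by the integral of
  \<open>f\<close>. Keeping the integral of \<open>\<phi>\<close> on the left makes one application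
  yield the bound of the density together with that of the dissipation.\<close>

lemma gronwall:
  fixes J m f \<phi> :: "real \<Rightarrow> real"
  assumes cont: "continuous_on {0..T} J" "continuous_on {0..T} m" "continuous_on {0..T} f"
    "continuous_on {0..T} \<phi>"
    and nonneg: "\<And>t. t \<in> {0..T} \<Longrightarrow> 0 \<le> m t" "\<And>t. t \<in> {0..T} \<Longrightarrow> 0 \<le> f t"
      "\<And>t. t \<in> {0..T} \<Longrightarrow> 0 \<le> \<phi> t" "0 \<le> J0"
    and le: "\<And>t. t \<in> {0..T} \<Longrightarrow>
      J t + integral {0..t} \<phi> \<le> J0 + integral {0..t} (\<lambda>s. m s * J s + f s)"
    and t: "t \<in> {0..T}"
  shows "J t + integral {0..t} \<phi> \<le> exp (integral {0..T} m) * (J0 + integral {0..T} f)"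
proof -
  define W where "W t = J0 + integral {0..t} (\<lambda>s. m s * J s + f s)" for t
  define P where "P t = integral {0..t} m" for t
  have JW: "J s \<le> W s" if "s \<in> {0..T}" for s
  proof -
    have "0 \<le> integral {0..s} \<phi>"
      by (rule integral_nonneg)
        (use that nonneg in \<open>auto intro!: integrable_continuous_real intro: continuous_on_subset[OF cont(4)]\<close>)
    with le[OF that] show ?thesis by (simp add: W_def)
  qed
  have dW: "(W has_real_derivative m s * J s + f s) (at s within {0..T})" if "s \<in> {0..T}" for s
    unfolding W_def
    by (auto intro!: derivative_eq_intros integral_has_real_derivative continuous_intros cont that)
  have dP: "(P has_real_derivative m s) (at s within {0..T})" if "s \<in> {0..T}" for s
    unfolding P_def by (rule integral_has_real_derivative[OF cont(2) that])
  have P0: "0 \<le> P s" if "s \<in> {0..T}" for s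
    unfolding P_def by (rule integral_nonneg)
      (use that nonneg in \<open>auto intro!: integrable_continuous_real intro: continuous_on_subset[OF cont(2)]\<close>)
  have "W t * exp (- P t) - W 0 * exp (- P 0) \<le> integral {0..t} f"
  proof (rule integral_real_derivative_le[where T = T
        and f' = "\<lambda>s. (m s * J s + f s) * exp (- P s) + exp (- P s) * (- m s) * W s"])
    fix s assume s: "s \<in> {0..T}"
    show "((\<lambda>t. W t * exp (- P t)) has_real_derivative
        (m s * J s + f s) * exp (- P s) + exp (- P s) * (- m s) * W s) (at s within {0..T})"
      by (auto intro!: derivative_eq_intros dW dP s)
    have "m s * J s \<le> m s * W s" using JW s nonneg by (intro mult_left_mono) auto
    then have "(m s * J s + f s - m s * W s) * exp (- P s) \<le> f s * exp (- P s)"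
      by (intro mult_right_mono) auto
    also have "\<dots> \<le> f s * 1" using P0 s nonneg by (intro mult_left_mono) auto
    finally show "(m s * J s + f s) * exp (- P s) + exp (- P s) * (- m s) * W s \<le> f s"
      by (simp add: algebra_simps)
  qed (use cont t in auto)
  then have "W t * exp (- P t) \<le> J0 + integral {0..t} f"
    by (simp add: W_def P_def)
  also have "integral {0..t} f \<le> integral {0..T} f"
    by (rule integral_upper_mono) (use cont nonneg t in auto)
  finally have W: "W t * exp (- P t) \<le> J0 + integral {0..T} f" by simp
  have "J t + integral {0..t} \<phi> \<le> W t" using le[OF t] by (simp add: W_def)
  also have "W t = exp (P t) * (W t * exp (- P t))" by (simp add: exp_minus)
  also have "\<dots> \<le> exp (P t) * (J0 + integral {0..T} f)" using W by (intro mult_left_mono) auto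
  also have "\<dots> \<le> exp (integral {0..T} m) * (J0 + integral {0..T} f)"
  proof (intro mult_right_mono)
    have "P t \<le> integral {0..T} m"
      unfolding P_def by (rule integral_upper_mono) (use cont nonneg t in auto)
    then show "exp (P t) \<le> exp (integral {0..T} m)" by simp
    show "0 \<le> J0 + integral {0..T} f"
      using nonneg cont by (auto intro!: add_nonneg_nonneg integral_nonneg integrable_continuous_real)
  qed
  finally show ?thesis .
qed

text \<open>A derivative controlled only in \<open>L^2\<close> with weight \<open>1 / \<rho>\<close>
  still bounds the oscillation when \<open>\<rho>\<close> is integrable. In this way the weighted
  dissipations become suprema. The reference point \<open>x\<close> is left free, since it is
  sometimes chosen by the mean of another function.\<close>

lemma sup_square_bound_point:
  fixes f f' \<rho> :: "real \<Rightarrow> real"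
  assumes f: "\<And>y. y \<in> {0..1} \<Longrightarrow> (f has_real_derivative f' y) (at y within {0..1})"
    and c: "continuous_on {0..1} f'" "continuous_on {0..1} \<rho>"
    and pos: "\<And>y. y \<in> {0..1} \<Longrightarrow> 0 < \<rho> y" and x: "x \<in> {0..1}" and y: "y \<in> {0..1}"
  shows "(f y)\<^sup>2 \<le> 2 * (f x)\<^sup>2
    + 2 * (integral {0..1} (\<lambda>y. (f' y)\<^sup>2 / \<rho> y) * integral {0..1} \<rho>)"
proof -
  have "\<bar>f y - f x\<bar> \<le> integral {0..1} (\<lambda>y. \<bar>f' y\<bar>)"
    by (rule abs_diff_le_integral_deriv[OF f c(1) x y])
  then have "(f y - f x)\<^sup>2 \<le> (integral {0..1} (\<lambda>y. \<bar>f' y * 1\<bar>))\<^sup>2"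
    by (simp flip: abs_le_square_iff)
  moreover have "\<dots> \<le> integral {0..1} (\<lambda>y. (f' y)\<^sup>2 / \<rho> y) * integral {0..1} (\<lambda>y. \<rho> y * 1\<^sup>2)"
    by (rule cauchy_schwarz_weighted) (use c pos in auto)
  moreover have "(f y)\<^sup>2 \<le> 2 * (f x)\<^sup>2 + 2 * (f y - f x)\<^sup>2"
    using zero_le_power2[of "f y - 2 * f x"] by (simp add: power2_eq_square algebra_simps)
  ultimately show ?thesis by simp
qed

lemma sup_square_bound:
  fixes f f' \<rho> :: "real \<Rightarrow> real"
  assumes f: "\<And>y. y \<in> {0..1} \<Longrightarrow> (f has_real_derivative f' y) (at y within {0..1})"
    and c: "continuous_on {0..1} f'" "continuous_on {0..1} \<rho>"
    and pos: "\<And>y. y \<in> {0..1} \<Longrightarrow> 0 < \<rho> y" and y: "y \<in> {0..1}"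
  shows "(f y)\<^sup>2 \<le> 2 * integral {0..1} (\<lambda>y. (f y)\<^sup>2)
    + 2 * (integral {0..1} (\<lambda>y. (f' y)\<^sup>2 / \<rho> y) * integral {0..1} \<rho>)"
proof -
  have "continuous_on {0..1} f"
    by (rule DERIV_continuous_on) (use f in auto)
  then have "continuous_on {0..1} (\<lambda>y. (f y)\<^sup>2)" by (intro continuous_intros)
  then obtain x where x: "x \<in> {0..1}" "(f x)\<^sup>2 \<le> integral {0..1} (\<lambda>y. (f y)\<^sup>2)"
    using exists_le_mean by blast
  then show ?thesis using sup_square_bound_point[OF f c pos x(1) y] by linarith
qed

text \<open>For a function vanishing at \<open>0\<close> no mean value enters; this is the form for
  \<open>w\<close> and \<open>b\<close>.\<close>

lemma sup_norm_square_bound: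
  fixes f f' :: "real \<Rightarrow> 'a::euclidean_space" and \<rho> :: "real \<Rightarrow> real"
  assumes f: "\<And>y. y \<in> {0..1} \<Longrightarrow> (f has_vector_derivative f' y) (at y within {0..1})"
    and c: "continuous_on {0..1} f'" "continuous_on {0..1} \<rho>"
    and pos: "\<And>y. y \<in> {0..1} \<Longrightarrow> 0 < \<rho> y" and y: "y \<in> {0..1}" and "f 0 = 0"
  shows "f y \<bullet> f y \<le> integral {0..1} (\<lambda>y. (f' y \<bullet> f' y) / \<rho> y) * integral {0..1} \<rho>"
proof -
  have "norm (f y) \<le> integral {0..1} (\<lambda>y. norm (f' y))"
    by (rule norm_diff_le_integral_deriv[OF f c(1) y \<open>f 0 = 0\<close>])
  then have "(norm (f y))\<^sup>2 \<le> (integral {0..1} (\<lambda>y. \<bar>norm (f' y) * 1\<bar>))\<^sup>2"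
    by (intro power_mono) auto
  also have "\<dots> \<le> integral {0..1} (\<lambda>y. (norm (f' y))\<^sup>2 / \<rho> y) * integral {0..1} (\<lambda>y. \<rho> y * 1\<^sup>2)"
    by (rule cauchy_schwarz_weighted) (use c pos in \<open>auto intro!: continuous_intros\<close>)
  finally show ?thesis by (simp add: power2_norm_eq_inner)
qed

text \<open>Compactness bounds \<open>fy\<close>, so \<open>f\<close> is Lipschitz in
  \<open>y\<close> uniformly in \<open>t\<close>; continuity in \<open>t\<close> for each fixed
  \<open>y\<close> is then enough for joint continuity.\<close>

lemma jcont_of_slices:
  fixes f fy :: "real \<Rightarrow> real \<Rightarrow> 'a::euclidean_space"
  assumes fy: "\<And>y t. y \<in> {0..1} \<Longrightarrow> t \<in> {0..T} \<Longrightarrow>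
      ((\<lambda>y. f y t) has_vector_derivative fy y t) (at y within {0..1})"
    and c: "jcont T fy" and ft: "\<And>y. y \<in> {0..1} \<Longrightarrow> continuous_on {0..T} (f y)"
  shows "jcont T f"
proof -
  have "compact ({0..1::real} \<times> {0..T})" by (intro compact_Times) auto
  then have "bounded ((\<lambda>z. fy (fst z) (snd z)) ` ({0..1} \<times> {0..T}))"
    using c by (auto intro!: compact_imp_bounded compact_continuous_image)
  then obtain A where A: "\<And>y t. y \<in> {0..1} \<Longrightarrow> t \<in> {0..T} \<Longrightarrow> norm (fy y t) \<le> A"
    unfolding bounded_iff by force
  have lip: "norm (f y t - f y' t') \<le> A * \<bar>y - y'\<bar> + norm (f y' t - f y' t')"
    if "y \<in> {0..1}" "y' \<in> {0..1}" "t \<in> {0..T}" "t' \<in> {0..T}" for y y' t t'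
  proof -
    have nonneg: "0 \<le> A" using A[of y t] that norm_ge_zero order_trans by blast
    have "norm (f y t - f y' t) \<le> A * norm (y - y')"
      by (rule differentiable_bound[where S = "{0..1}" and f' = "\<lambda>x h. h *\<^sub>R fy x t"])
        (use fy A that nonneg in \<open>auto simp: has_vector_derivative_def intro!: onorm_le
          simp: mult.commute[of A] intro!: mult_left_mono onorm_bound\<close>)
    moreover have "norm (f y t - f y' t') \<le> norm (f y t - f y' t) + norm (f y' t - f y' t')"
      by (rule norm_diff_triangle_le[OF order.refl order.refl])
    ultimately show ?thesis by simp
  qed
  have "((\<lambda>z. f (fst z) (snd z)) \<longlongrightarrow> f (fst x) (snd x)) (at x within {0..1} \<times> {0..T})"
    if x: "x \<in> {0..1} \<times> {0..T}" for x
  proof (rule Lim_null_comparison[where f = "\<lambda>z. f (fst z) (snd z) - f (fst x) (snd x)", THEN LIM_zero_cancel])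
    show "\<forall>\<^sub>F z in at x within {0..1} \<times> {0..T}. norm (f (fst z) (snd z) - f (fst x) (snd x))
        \<le> A * \<bar>fst z - fst x\<bar> + norm (f (fst x) (snd z) - f (fst x) (snd x))"
      unfolding eventually_at_filter using x by (auto intro!: always_eventually lip)
    have "continuous_on ({0..1} \<times> {0..T}) (\<lambda>z. f (fst x) (snd z))"
      by (rule continuous_on_compose2[OF ft[of "fst x"]]) (use x in \<open>auto intro!: continuous_intros\<close>)
    then have "((\<lambda>z. f (fst x) (snd z)) \<longlongrightarrow> f (fst x) (snd x)) (at x within {0..1} \<times> {0..T})"
      using x by (auto simp: continuous_on_def)
    then have "((\<lambda>z. A * \<bar>fst z - fst x\<bar> + norm (f (fst x) (snd z) - f (fst x) (snd x)))
        \<longlongrightarrow> A * \<bar>fst x - fst x\<bar> + norm (f (fst x) (snd x) - f (fst x) (snd x))) (at x within {0..1} \<times> {0..T})"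
      by (intro tendsto_intros)
    then show "((\<lambda>z. A * \<bar>fst z - fst x\<bar> + norm (f (fst x) (snd z) - f (fst x) (snd x))) \<longlongrightarrow> 0)
        (at x within {0..1} \<times> {0..T})"
      by simp
  qed
  then show ?thesis by (simp add: continuous_on_def)
qed

lemma jcont_of_partials:
  fixes f fy ft :: "real \<Rightarrow> real \<Rightarrow> 'a::euclidean_space"
  assumes fy: "\<And>y t. y \<in> {0..1} \<Longrightarrow> t \<in> {0..T} \<Longrightarrow>
      ((\<lambda>y. f y t) has_vector_derivative fy y t) (at y within {0..1})"
    and ft: "\<And>y t. y \<in> {0..1} \<Longrightarrow> t \<in> {0..T} \<Longrightarrow> (f y has_vector_derivative ft y t) (at t within {0..T})"
    and c: "jcont T fy" "jcont T ft"
  shows "jcont T f"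
  by (rule jcont_of_slices[OF fy c(1)]) (auto intro: continuous_on_vector_derivative[OF ft])

section \<open>Energy and entropy\<close>

lemma has_real_derivative_inner:
  assumes "(f has_vector_derivative f') (at x within X)" "(g has_vector_derivative g') (at x within X)"
    and "D = f x \<bullet> g' + f' \<bullet> g x"
  shows "((\<lambda>x. f x \<bullet> g x) has_real_derivative D) (at x within X)"
  using has_derivative_inner[OF assms(1,2)[unfolded has_vector_derivative_def]] assms(3)
  by (auto simp: has_field_derivative_def algebra_simps fun_eq_iff elim: has_derivative_eq_rhs)

text \<open>\<open>S\<close> indexes all solutions with the given data, so that a constant chosen before \<open>s \<in> S\<close> is uniform.
  The equations are in reduced form: \<open>v\<^sub>t = u\<^sub>y\<close> is eliminated, \<open>F\<close> is the heat flux, and the energy balance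
  is solved for \<open>F\<^sub>y\<close>. The initial data enter only through \<open>K\<close>.\<close>

locale flows =
  fixes lam mu nu R a Cv k1 K T :: real
    and S :: "'s set"
    and v v_y u u_y u_t th th_y th_t F kap :: "'s \<Rightarrow> real \<Rightarrow> real \<Rightarrow> real"
    and w w_y w_yy w_t b b_y b_yy b_t :: "'s \<Rightarrow> real \<Rightarrow> real \<Rightarrow> 'a::euclidean_space"
  assumes param_pos: "0 < lam" "0 < mu" "0 < nu" "0 < R" "0 < a" "0 < Cv" "0 < k1" "1 \<le> K" "0 < T"
    and v_pos: "\<And>s y t. s \<in> S \<Longrightarrow> 0 \<le> y \<Longrightarrow> y \<le> 1 \<Longrightarrow> 0 \<le> t \<Longrightarrow> t \<le> T \<Longrightarrow> 0 < v s y t"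
    and th_pos: "\<And>s y t. s \<in> S \<Longrightarrow> 0 \<le> y \<Longrightarrow> y \<le> 1 \<Longrightarrow> 0 \<le> t \<Longrightarrow> t \<le> T \<Longrightarrow> 0 < th s y t"
    and jc: "\<And>s. s \<in> S \<Longrightarrow> jcont T (v s)" "\<And>s. s \<in> S \<Longrightarrow> jcont T (v_y s)"
      "\<And>s. s \<in> S \<Longrightarrow> jcont T (u s)" "\<And>s. s \<in> S \<Longrightarrow> jcont T (u_y s)" "\<And>s. s \<in> S \<Longrightarrow> jcont T (u_t s)"
      "\<And>s. s \<in> S \<Longrightarrow> jcont T (th s)" "\<And>s. s \<in> S \<Longrightarrow> jcont T (th_y s)" "\<And>s. s \<in> S \<Longrightarrow> jcont T (th_t s)"
      "\<And>s. s \<in> S \<Longrightarrow> jcont T (F s)"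
      "\<And>s. s \<in> S \<Longrightarrow> jcont T (w s)" "\<And>s. s \<in> S \<Longrightarrow> jcont T (w_y s)" "\<And>s. s \<in> S \<Longrightarrow> jcont T (w_yy s)"
      "\<And>s. s \<in> S \<Longrightarrow> jcont T (w_t s)"
      "\<And>s. s \<in> S \<Longrightarrow> jcont T (b s)" "\<And>s. s \<in> S \<Longrightarrow> jcont T (b_y s)" "\<And>s. s \<in> S \<Longrightarrow> jcont T (b_yy s)"
      "\<And>s. s \<in> S \<Longrightarrow> jcont T (b_t s)"
    and dt: "\<And>s y t. s \<in> S \<Longrightarrow> 0 \<le> y \<Longrightarrow> y \<le> 1 \<Longrightarrow> 0 \<le> t \<Longrightarrow> t \<le> T \<Longrightarrow> (v s y has_real_derivative u_y s y t) (at t within {0..T})"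
      "\<And>s y t. s \<in> S \<Longrightarrow> 0 \<le> y \<Longrightarrow> y \<le> 1 \<Longrightarrow> 0 \<le> t \<Longrightarrow> t \<le> T \<Longrightarrow> (u s y has_real_derivative u_t s y t) (at t within {0..T})"
      "\<And>s y t. s \<in> S \<Longrightarrow> 0 \<le> y \<Longrightarrow> y \<le> 1 \<Longrightarrow> 0 \<le> t \<Longrightarrow> t \<le> T \<Longrightarrow> (th s y has_real_derivative th_t s y t) (at t within {0..T})"
    and dtv: "\<And>s y t. s \<in> S \<Longrightarrow> 0 \<le> y \<Longrightarrow> y \<le> 1 \<Longrightarrow> 0 \<le> t \<Longrightarrow> t \<le> T \<Longrightarrow> (w s y has_vector_derivative w_t s y t) (at t within {0..T})"
      "\<And>s y t. s \<in> S \<Longrightarrow> 0 \<le> y \<Longrightarrow> y \<le> 1 \<Longrightarrow> 0 \<le> t \<Longrightarrow> t \<le> T \<Longrightarrow> (b s y has_vector_derivative b_t s y t) (at t within {0..T})"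
    and dy: "\<And>s y t. s \<in> S \<Longrightarrow> 0 \<le> y \<Longrightarrow> y \<le> 1 \<Longrightarrow> 0 \<le> t \<Longrightarrow> t \<le> T \<Longrightarrow> ((\<lambda>y. v s y t) has_real_derivative v_y s y t) (at y within {0..1})"
      "\<And>s y t. s \<in> S \<Longrightarrow> 0 \<le> y \<Longrightarrow> y \<le> 1 \<Longrightarrow> 0 \<le> t \<Longrightarrow> t \<le> T \<Longrightarrow> ((\<lambda>y. u s y t) has_real_derivative u_y s y t) (at y within {0..1})"
      "\<And>s y t. s \<in> S \<Longrightarrow> 0 \<le> y \<Longrightarrow> y \<le> 1 \<Longrightarrow> 0 \<le> t \<Longrightarrow> t \<le> T \<Longrightarrow> ((\<lambda>y. th s y t) has_real_derivative th_y s y t) (at y within {0..1})"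
    and dyv: "\<And>s y t. s \<in> S \<Longrightarrow> 0 \<le> y \<Longrightarrow> y \<le> 1 \<Longrightarrow> 0 \<le> t \<Longrightarrow> t \<le> T \<Longrightarrow> ((\<lambda>y. w s y t) has_vector_derivative w_y s y t) (at y within {0..1})"
      "\<And>s y t. s \<in> S \<Longrightarrow> 0 \<le> y \<Longrightarrow> y \<le> 1 \<Longrightarrow> 0 \<le> t \<Longrightarrow> t \<le> T \<Longrightarrow> ((\<lambda>y. b s y t) has_vector_derivative b_y s y t) (at y within {0..1})"
      "\<And>s y t. s \<in> S \<Longrightarrow> 0 \<le> y \<Longrightarrow> y \<le> 1 \<Longrightarrow> 0 \<le> t \<Longrightarrow> t \<le> T \<Longrightarrow> ((\<lambda>y. w_y s y t) has_vector_derivative w_yy s y t) (at y within {0..1})"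
      "\<And>s y t. s \<in> S \<Longrightarrow> 0 \<le> y \<Longrightarrow> y \<le> 1 \<Longrightarrow> 0 \<le> t \<Longrightarrow> t \<le> T \<Longrightarrow> ((\<lambda>y. b_y s y t) has_vector_derivative b_yy s y t) (at y within {0..1})"
    and momentum: "\<And>s y t. s \<in> S \<Longrightarrow> 0 \<le> y \<Longrightarrow> y \<le> 1 \<Longrightarrow> 0 \<le> t \<Longrightarrow> t \<le> T \<Longrightarrow>
      ((\<lambda>y. lam * u_y s y t / v s y t - pressure R a (v s y t) (th s y t)) has_real_derivative
        u_t s y t + b s y t \<bullet> b_y s y t) (at y within {0..1})"
    and transversal: "\<And>s y t. s \<in> S \<Longrightarrow> 0 \<le> y \<Longrightarrow> y \<le> 1 \<Longrightarrow> 0 \<le> t \<Longrightarrow> t \<le> T \<Longrightarrow>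
      ((\<lambda>y. b s y t + (mu / v s y t) *\<^sub>R w_y s y t) has_vector_derivative w_t s y t) (at y within {0..1})"
    and induction_eq: "\<And>s y t. s \<in> S \<Longrightarrow> 0 \<le> y \<Longrightarrow> y \<le> 1 \<Longrightarrow> 0 \<le> t \<Longrightarrow> t \<le> T \<Longrightarrow>
      ((\<lambda>y. w s y t + (nu / v s y t) *\<^sub>R b_y s y t) has_vector_derivative
        v s y t *\<^sub>R b_t s y t + u_y s y t *\<^sub>R b s y t) (at y within {0..1})"
    and heat: "\<And>s y t. s \<in> S \<Longrightarrow> 0 \<le> y \<Longrightarrow> y \<le> 1 \<Longrightarrow> 0 \<le> t \<Longrightarrow> t \<le> T \<Longrightarrow>
      ((\<lambda>y. F s y t) has_real_derivative
        (Cv + 4 * a * v s y t * th s y t ^ 3) * th_t s y t + a * th s y t ^ 4 * u_y s y t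
        - (lam * u_y s y t / v s y t - pressure R a (v s y t) (th s y t)) * u_y s y t
        - mu * (w_y s y t \<bullet> w_y s y t) / v s y t - nu * (b_y s y t \<bullet> b_y s y t) / v s y t)
      (at y within {0..1})"
    and flux: "\<And>s y t. s \<in> S \<Longrightarrow> 0 \<le> y \<Longrightarrow> y \<le> 1 \<Longrightarrow> 0 \<le> t \<Longrightarrow> t \<le> T \<Longrightarrow> F s y t = kap s y t * th_y s y t / v s y t"
      "\<And>s y t. s \<in> S \<Longrightarrow> 0 \<le> y \<Longrightarrow> y \<le> 1 \<Longrightarrow> 0 \<le> t \<Longrightarrow> t \<le> T \<Longrightarrow> k1 \<le> kap s y t"
    and boundary: "\<And>s y t. s \<in> S \<Longrightarrow> y = 0 \<or> y = 1 \<Longrightarrow> 0 \<le> t \<Longrightarrow> t \<le> T \<Longrightarrow>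
      lam * u_y s y t / v s y t - pressure R a (v s y t) (th s y t) = 0"
      "\<And>s y t. s \<in> S \<Longrightarrow> y = 0 \<or> y = 1 \<Longrightarrow> 0 \<le> t \<Longrightarrow> t \<le> T \<Longrightarrow> w s y t = 0"
      "\<And>s y t. s \<in> S \<Longrightarrow> y = 0 \<or> y = 1 \<Longrightarrow> 0 \<le> t \<Longrightarrow> t \<le> T \<Longrightarrow> b s y t = 0"
      "\<And>s y t. s \<in> S \<Longrightarrow> y = 0 \<or> y = 1 \<Longrightarrow> 0 \<le> t \<Longrightarrow> t \<le> T \<Longrightarrow> F s y t = 0"
    and init: "\<And>s y. s \<in> S \<Longrightarrow> 0 \<le> y \<Longrightarrow> y \<le> 1 \<Longrightarrow> 1 / K \<le> v s y 0 \<and> v s y 0 \<le> K \<and>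
      1 / K \<le> th s y 0 \<and> th s y 0 \<le> K \<and> \<bar>u s y 0\<bar> \<le> K \<and> norm (w s y 0) \<le> K \<and> norm (b s y 0) \<le> K \<and>
      \<bar>v_y s y 0\<bar> \<le> K"
begin

definition p :: "'s \<Rightarrow> real \<Rightarrow> real \<Rightarrow> real" where
  "p s y t = pressure R a (v s y t) (th s y t)"

text \<open>\<open>sg\<close>, \<open>ta\<close>, \<open>om\<close> are the fluxes of \<open>u\<close>, \<open>w\<close>, \<open>v b\<close>; the magnetic pressure is not included in \<open>sg\<close>,
  so that \<open>sg\<close> vanishes at the end points.\<close>

definition sg :: "'s \<Rightarrow> real \<Rightarrow> real \<Rightarrow> real" where
  "sg s y t = lam * u_y s y t / v s y t - p s y t"

definition ta :: "'s \<Rightarrow> real \<Rightarrow> real \<Rightarrow> 'a" where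
  "ta s y t = b s y t + (mu / v s y t) *\<^sub>R w_y s y t"

definition om :: "'s \<Rightarrow> real \<Rightarrow> real \<Rightarrow> 'a" where
  "om s y t = w s y t + (nu / v s y t) *\<^sub>R b_y s y t"

definition F_y :: "'s \<Rightarrow> real \<Rightarrow> real \<Rightarrow> real" where
  "F_y s y t = (Cv + 4 * a * v s y t * th s y t ^ 3) * th_t s y t + a * th s y t ^ 4 * u_y s y t
    - sg s y t * u_y s y t
    - mu * (w_y s y t \<bullet> w_y s y t) / v s y t - nu * (b_y s y t \<bullet> b_y s y t) / v s y t"

definition energy :: "'s \<Rightarrow> real \<Rightarrow> real \<Rightarrow> real" where
  "energy s y t = Cv * th s y t + a * v s y t * th s y t ^ 4 + (u s y t)\<^sup>2 / 2
    + (w s y t \<bullet> w s y t) / 2 + v s y t * (b s y t \<bullet> b s y t) / 2"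

definition dissip :: "'s \<Rightarrow> real \<Rightarrow> real \<Rightarrow> real" where
  "dissip s y t = F s y t * th_y s y t / (th s y t)\<^sup>2
    + (lam * (u_y s y t)\<^sup>2 + mu * (w_y s y t \<bullet> w_y s y t) + nu * (b_y s y t \<bullet> b_y s y t))
      / (v s y t * th s y t)"

text \<open>\<open>dissip\<close> is the entropy production; its space integral \<open>m - 1\<close> is bounded in \<open>L\<^sup>1(0,T)\<close> and serves as
  the weight in all Gronwall arguments.\<close>

definition m :: "'s \<Rightarrow> real \<Rightarrow> real" where
  "m s t = 1 + integral {0..1} (\<lambda>y. dissip s y t)"

lemma v_ne [simp]: "s \<in> S \<Longrightarrow> 0 \<le> y \<Longrightarrow> y \<le> 1 \<Longrightarrow> 0 \<le> t \<Longrightarrow> t \<le> T \<Longrightarrow> v s y t \<noteq> 0"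
  using v_pos[of s y t] by simp

lemma th_ne [simp]: "s \<in> S \<Longrightarrow> 0 \<le> y \<Longrightarrow> y \<le> 1 \<Longrightarrow> 0 \<le> t \<Longrightarrow> t \<le> T \<Longrightarrow> th s y t \<noteq> 0"
  using th_pos[of s y t] by simp

lemma params_ne [simp]: "lam \<noteq> 0" "mu \<noteq> 0" "nu \<noteq> 0" "R \<noteq> 0" "a \<noteq> 0" "Cv \<noteq> 0" "k1 \<noteq> 0" "K \<noteq> 0"
  using param_pos by auto

lemma jc_p: "s \<in> S \<Longrightarrow> jcont T (p s)"
  unfolding p_def pressure_def by (auto intro!: continuous_intros jc)

lemma jc_sg: "s \<in> S \<Longrightarrow> jcont T (sg s)"
  unfolding sg_def by (auto intro!: continuous_intros jc jc_p)

lemma jc_dissip: "s \<in> S \<Longrightarrow> jcont T (dissip s)"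
  unfolding dissip_def by (auto intro!: continuous_intros jc jc_p)

lemma jc_energy: "s \<in> S \<Longrightarrow> jcont T (energy s)"
  unfolding energy_def by (auto intro!: continuous_intros jc jc_p)

lemmas jcs = jc jc_p jc_sg jc_dissip jc_energy

lemma dy_sg: "s \<in> S \<Longrightarrow> 0 \<le> y \<Longrightarrow> y \<le> 1 \<Longrightarrow> 0 \<le> t \<Longrightarrow> t \<le> T \<Longrightarrow>
    ((\<lambda>y. sg s y t) has_real_derivative u_t s y t + b s y t \<bullet> b_y s y t) (at y within {0..1})"
  using momentum unfolding sg_def p_def .

lemma dy_F: "s \<in> S \<Longrightarrow> 0 \<le> y \<Longrightarrow> y \<le> 1 \<Longrightarrow> 0 \<le> t \<Longrightarrow> t \<le> T \<Longrightarrow>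
    ((\<lambda>y. F s y t) has_real_derivative F_y s y t) (at y within {0..1})"
  using heat unfolding sg_def p_def F_y_def .

lemma dy_ta: "s \<in> S \<Longrightarrow> 0 \<le> y \<Longrightarrow> y \<le> 1 \<Longrightarrow> 0 \<le> t \<Longrightarrow> t \<le> T \<Longrightarrow>
    ((\<lambda>y. ta s y t) has_vector_derivative w_t s y t) (at y within {0..1})"
  using transversal unfolding ta_def .

lemma dy_om: "s \<in> S \<Longrightarrow> 0 \<le> y \<Longrightarrow> y \<le> 1 \<Longrightarrow> 0 \<le> t \<Longrightarrow> t \<le> T \<Longrightarrow>
    ((\<lambda>y. om s y t) has_vector_derivative v s y t *\<^sub>R b_t s y t + u_y s y t *\<^sub>R b s y t) (at y within {0..1})"
  using induction_eq unfolding om_def .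

lemma sg_bdry: "s \<in> S \<Longrightarrow> y = 0 \<or> y = 1 \<Longrightarrow> 0 \<le> t \<Longrightarrow> t \<le> T \<Longrightarrow> sg s y t = 0"
  using boundary(1) unfolding sg_def p_def .

text \<open>The equations of \<open>u\<close>, \<open>w\<close> and \<open>b\<close> are tested with
  \<open>u\<close>, \<open>w\<close> and \<open>b\<close> and added to the heat equation, where all
  dissipation reappears as heat. The two corrections in the flux \<open>Z\<close> account for the
  magnetic pressure missing in \<open>sg\<close> and for the coupling
  \<open>w \<bullet> b_y + b \<bullet> w_y\<close>, a complete derivative that is counted twice
  otherwise.\<close>

lemma energy_nonincreasing:
  assumes s: "s \<in> S" and t: "t \<in> {0..T}"
  shows "integral {0..1} (\<lambda>y. energy s y t) \<le> integral {0..1} (\<lambda>y. energy s y 0)"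
proof -
  have "integral {0..1} (\<lambda>y. energy s y t) \<le> integral {0..1} (\<lambda>y. energy s y 0)
      + integral {0..t} (\<lambda>r. integral {0..1} (\<lambda>y::real. 0))"
  proof (rule balance_law[where T = T and f = "energy s" and g = "\<lambda>y t. 0"
        and ft = "\<lambda>y t. (Cv + 4 * a * v s y t * th s y t ^ 3) * th_t s y t + a * u_y s y t * th s y t ^ 4
          + u s y t * u_t s y t + w s y t \<bullet> w_t s y t + u_y s y t * (b s y t \<bullet> b s y t) / 2
          + v s y t * (b s y t \<bullet> b_t s y t)"
        and Z = "\<lambda>y t. F s y t + u s y t * sg s y t + w s y t \<bullet> ta s y t + b s y t \<bullet> om s y t
          - u s y t * (b s y t \<bullet> b s y t) / 2 - w s y t \<bullet> b s y t"
        and Zy = "\<lambda>y t. F_y s y t + (u s y t * (u_t s y t + b s y t \<bullet> b_y s y t) + u_y s y t * sg s y t)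
          + (w s y t \<bullet> w_t s y t + w_y s y t \<bullet> ta s y t)
          + (b s y t \<bullet> (v s y t *\<^sub>R b_t s y t + u_y s y t *\<^sub>R b s y t) + b_y s y t \<bullet> om s y t)
          - (u_y s y t * (b s y t \<bullet> b s y t) / 2 + u s y t * (b s y t \<bullet> b_y s y t))
          - (w s y t \<bullet> b_y s y t + w_y s y t \<bullet> b s y t)"])
    show "jcont T (energy s)" by (rule jc_energy[OF s])
    fix y r assume yr: "y \<in> {0..1::real}" "r \<in> {0..T}"
    show "(energy s y has_real_derivative (Cv + 4 * a * v s y r * th s y r ^ 3) * th_t s y r
        + a * u_y s y r * th s y r ^ 4
          + u s y r * u_t s y r + w s y r \<bullet> w_t s y r + u_y s y r * (b s y r \<bullet> b s y r) / 2
          + v s y r * (b s y r \<bullet> b_t s y r)) (at r within {0..T})"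
      unfolding energy_def using yr s
      by (auto intro!: derivative_eq_intros dt has_real_derivative_inner[OF dtv(1) dtv(1)]
          has_real_derivative_inner[OF dtv(2) dtv(2)] simp: inner_commute)
        (simp add: algebra_simps power2_eq_square power3_eq_cube inner_commute)
    show "((\<lambda>y. F s y r + u s y r * sg s y r + w s y r \<bullet> ta s y r + b s y r \<bullet> om s y r
          - u s y r * (b s y r \<bullet> b s y r) / 2 - w s y r \<bullet> b s y r) has_real_derivative
        F_y s y r + (u s y r * (u_t s y r + b s y r \<bullet> b_y s y r) + u_y s y r * sg s y r)
          + (w s y r \<bullet> w_t s y r + w_y s y r \<bullet> ta s y r)
          + (b s y r \<bullet> (v s y r *\<^sub>R b_t s y r + u_y s y r *\<^sub>R b s y r) + b_y s y r \<bullet> om s y r)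
          - (u_y s y r * (b s y r \<bullet> b s y r) / 2 + u s y r * (b s y r \<bullet> b_y s y r))
          - (w s y r \<bullet> b_y s y r + w_y s y r \<bullet> b s y r)) (at y within {0..1})"
      using yr s
      by (auto intro!: derivative_eq_intros dy dy_F dy_sg has_real_derivative_inner[OF dyv(1) dy_ta]
          has_real_derivative_inner[OF dyv(2) dy_om] has_real_derivative_inner[OF dyv(2) dyv(2)]
          has_real_derivative_inner[OF dyv(1) dyv(2)])
        (simp add: algebra_simps inner_commute)
    show "(Cv + 4 * a * v s y r * th s y r ^ 3) * th_t s y r + a * u_y s y r * th s y r ^ 4
          + u s y r * u_t s y r + w s y r \<bullet> w_t s y r + u_y s y r * (b s y r \<bullet> b s y r) / 2
          + v s y r * (b s y r \<bullet> b_t s y r)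
       \<le> 0 + (F_y s y r + (u s y r * (u_t s y r + b s y r \<bullet> b_y s y r) + u_y s y r * sg s y r)
          + (w s y r \<bullet> w_t s y r + w_y s y r \<bullet> ta s y r)
          + (b s y r \<bullet> (v s y r *\<^sub>R b_t s y r + u_y s y r *\<^sub>R b s y r) + b_y s y r \<bullet> om s y r)
          - (u_y s y r * (b s y r \<bullet> b s y r) / 2 + u s y r * (b s y r \<bullet> b_y s y r))
          - (w s y r \<bullet> b_y s y r + w_y s y r \<bullet> b s y r))"
      unfolding F_y_def ta_def om_def
      by (simp add: inner_add_right inner_commute algebra_simps)
  qed (use s t in \<open>auto intro!: continuous_intros jcs simp: boundary sg_bdry\<close>)
  then show ?thesis by simp
qed

end

lemma integral_add3:
  fixes f g h :: "real \<Rightarrow> real"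
  assumes "continuous_on {0..1} f" "continuous_on {0..1} g" "continuous_on {0..1} h"
  shows "integral {0..1} (\<lambda>y. f y + g y + h y) = integral {0..1} f + integral {0..1} g + integral {0..1} h"
  using assms by (simp add: integral_add integrable_continuous_real continuous_on_add)

lemma power_le_one_plus_power:
  fixes x :: real
  assumes "0 \<le> x" "m \<le> n"
  shows "x ^ m \<le> 1 + x ^ n"
proof (cases "x \<le> 1")
  case True
  then have "x ^ m \<le> 1" "0 \<le> x ^ n" using assms by (auto simp: power_le_one)
  then show ?thesis by linarith
next
  case False
  then have "x ^ m \<le> x ^ n" using assms by (intro power_increasing) auto
  then show ?thesis by linarith
qed

context flows
begin

section \<open>Bounds in terms of the data: energy, volume and entropy production\<close>

lemmas jcy = jcs[THEN jcont_slice_y]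

lemma integral_le_scaled:
  assumes "jcont T f" "jcont T g" "t \<in> {0..T}" "\<And>y. y \<in> {0..1} \<Longrightarrow> f y t \<le> c * g y t"
  shows "integral {0..1} (\<lambda>y. f y t) \<le> c * integral {0..1} (\<lambda>y. g y t :: real)"
proof -
  have "integral {0..1} (\<lambda>y. f y t) \<le> integral {0..1} (\<lambda>y. c * g y t)"
    by (rule integral_mono_y) (use assms in \<open>auto intro!: continuous_intros jcont_slice_y\<close>)
  then show ?thesis by simp
qed

lemma inner_le_square:
  assumes "norm x \<le> K" shows "(x :: 'a) \<bullet> x \<le> K\<^sup>2"
  using power_mono[OF assms norm_ge_zero, of 2] by (simp add: power2_norm_eq_inner)

lemma energy_bound: "\<exists>C>0. \<forall>s\<in>S. \<forall>t\<in>{0..T}. integral {0..1} (\<lambda>y. energy s y t) \<le> C"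
proof -
  let ?C = "Cv * K + a * K * K ^ 4 + K\<^sup>2 / 2 + K\<^sup>2 / 2 + K * K\<^sup>2 / 2"
  have "integral {0..1} (\<lambda>y. energy s y t) \<le> ?C" if s: "s \<in> S" and t: "t \<in> {0..T}" for s t
  proof -
    have "integral {0..1} (\<lambda>y. energy s y 0) \<le> integral {0..1} (\<lambda>y::real. ?C)"
    proof (rule integral_mono_y)
      show "continuous_on {0..1} (\<lambda>y. energy s y 0)"
        by (rule jcont_slice_y[OF jc_energy[OF s]]) (use param_pos in auto)
      fix y :: real assume y: "y \<in> {0..1}"
      note i = init[OF s, of y]
      have "(u s y 0)\<^sup>2 \<le> K\<^sup>2"
        using i y param_pos by (simp flip: abs_le_square_iff)
      moreover have "Cv * th s y 0 \<le> Cv * K"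
        using i y param_pos by (intro mult_left_mono) auto
      moreover have "a * v s y 0 * th s y 0 ^ 4 \<le> a * K * K ^ 4"
        using i y param_pos v_pos[OF s, of y 0] th_pos[OF s, of y 0] by (intro mult_mono power_mono) auto
      moreover have "v s y 0 * (b s y 0 \<bullet> b s y 0) \<le> K * K\<^sup>2"
        using i y param_pos v_pos[OF s, of y 0] by (intro mult_mono inner_le_square) auto
      moreover have "w s y 0 \<bullet> w s y 0 \<le> K\<^sup>2"
        using i y by (intro inner_le_square) auto
      ultimately show "energy s y 0 \<le> ?C" unfolding energy_def by linarith
    qed auto
    then show ?thesis using energy_nonincreasing[OF s t] by simp
  qed
  moreover have "0 < ?C" using param_pos by (intro add_pos_pos) auto
  ultimately show ?thesis by blast
qed

lemma energy_parts:
  "\<exists>C>0. \<forall>s\<in>S. \<forall>t\<in>{0..T}. integral {0..1} (\<lambda>y. th s y t) \<le> C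
    \<and> integral {0..1} (\<lambda>y. v s y t * th s y t ^ 4) \<le> C \<and> integral {0..1} (\<lambda>y. (u s y t)\<^sup>2) \<le> C
    \<and> integral {0..1} (\<lambda>y. v s y t * (b s y t \<bullet> b s y t)) \<le> C"
proof -
  obtain C where C: "C > 0" "\<And>s t. s \<in> S \<Longrightarrow> t \<in> {0..T} \<Longrightarrow> integral {0..1} (\<lambda>y. energy s y t) \<le> C"
    using energy_bound by blast
  define D where "D = (1 / Cv + 1 / a + 2) * C"
  have D: "1 / Cv * C \<le> D" "1 / a * C \<le> D" "2 * C \<le> D" "0 < D"
    using C param_pos by (auto simp: D_def algebra_simps add_pos_pos)
  have "integral {0..1} (\<lambda>y. th s y t) \<le> D
    \<and> integral {0..1} (\<lambda>y. v s y t * th s y t ^ 4) \<le> D \<and> integral {0..1} (\<lambda>y. (u s y t)\<^sup>2) \<le> D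
    \<and> integral {0..1} (\<lambda>y. v s y t * (b s y t \<bullet> b s y t)) \<le> D" if s: "s \<in> S" and t: "t \<in> {0..T}" for s t
  proof -
    have *: "c * integral {0..1} (\<lambda>y. energy s y t) \<le> c * C" if "0 \<le> c" for c
      using C(2)[OF s t] that by (intro mult_left_mono)
    have terms: "0 \<le> Cv * th s y t" "0 \<le> a * v s y t * th s y t ^ 4" "0 \<le> (u s y t)\<^sup>2 / 2"
      "0 \<le> (w s y t \<bullet> w s y t) / 2" "0 \<le> v s y t * (b s y t \<bullet> b s y t) / 2" if "y \<in> {0..1}" for y
      using that param_pos s t v_pos[OF s, of y t] th_pos[OF s, of y t]
      by auto
    have "integral {0..1} (\<lambda>y. th s y t) \<le> 1 / Cv * integral {0..1} (\<lambda>y. energy s y t)"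
    proof (rule integral_le_scaled[OF _ jc_energy[OF s] t])
      fix y :: real assume y: "y \<in> {0..1}"
      from terms[OF y] have "Cv * th s y t \<le> energy s y t" unfolding energy_def by linarith
      then show "th s y t \<le> 1 / Cv * energy s y t" using param_pos by (simp add: field_simps)
    qed (use s in \<open>auto intro!: jcs\<close>)
    moreover have "integral {0..1} (\<lambda>y. v s y t * th s y t ^ 4) \<le> 1 / a * integral {0..1} (\<lambda>y. energy s y t)"
    proof (rule integral_le_scaled[OF _ jc_energy[OF s] t])
      fix y :: real assume y: "y \<in> {0..1}"
      from terms[OF y] have "a * v s y t * th s y t ^ 4 \<le> energy s y t" unfolding energy_def by linarith
      then show "v s y t * th s y t ^ 4 \<le> 1 / a * energy s y t" using param_pos by (simp add: field_simps)
    qed (use s in \<open>auto intro!: continuous_intros jcs\<close>)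
    moreover have "integral {0..1} (\<lambda>y. (u s y t)\<^sup>2) \<le> 2 * integral {0..1} (\<lambda>y. energy s y t)"
    proof (rule integral_le_scaled[OF _ jc_energy[OF s] t])
      fix y :: real assume y: "y \<in> {0..1}"
      from terms[OF y] have "(u s y t)\<^sup>2 / 2 \<le> energy s y t" unfolding energy_def by linarith
      then show "(u s y t)\<^sup>2 \<le> 2 * energy s y t" by simp
    qed (use s in \<open>auto intro!: continuous_intros jcs\<close>)
    moreover have "integral {0..1} (\<lambda>y. v s y t * (b s y t \<bullet> b s y t)) \<le> 2 * integral {0..1} (\<lambda>y. energy s y t)"
    proof (rule integral_le_scaled[OF _ jc_energy[OF s] t])
      fix y :: real assume y: "y \<in> {0..1}"
      from terms[OF y] have "v s y t * (b s y t \<bullet> b s y t) / 2 \<le> energy s y t" unfolding energy_def by linarith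
      then show "v s y t * (b s y t \<bullet> b s y t) \<le> 2 * energy s y t" by simp
    qed (use s in \<open>auto intro!: continuous_intros jcs\<close>)
    ultimately show ?thesis
      using *[of "1 / Cv"] *[of "1 / a"] *[of 2] D param_pos by (auto simp: less_imp_le)
  qed
  then show ?thesis using D by blast
qed

text \<open>The primitive of the velocity turns the momentum equation into one without a space
  derivative: as \<open>sg\<close> and \<open>b\<close> vanish at \<open>0\<close>, \<open>U\<close>
  has the time derivative \<open>sg - b \<bullet> b / 2\<close>. Since \<open>lam * u_y / v\<close>
  is the time derivative of \<open>lam * ln v\<close>, the quantity \<open>lam * ln v - U\<close>
  grows exactly at the rate \<open>p + b \<bullet> b / 2\<close>. All bounds of \<open>v\<close>
  come from this.\<close>

definition U :: "'s \<Rightarrow> real \<Rightarrow> real \<Rightarrow> real" where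
  "U s y t = integral {0..y} (\<lambda>x. u s x t)"

lemma dy_U: "s \<in> S \<Longrightarrow> 0 \<le> y \<Longrightarrow> y \<le> 1 \<Longrightarrow> 0 \<le> t \<Longrightarrow> t \<le> T \<Longrightarrow>
    ((\<lambda>y. U s y t) has_real_derivative u s y t) (at y within {0..1})"
  unfolding U_def by (rule integral_has_real_derivative) (auto intro!: jcy)

lemma dt_U:
  assumes s: "s \<in> S" and y: "0 \<le> y" "y \<le> 1" and t: "0 \<le> t" "t \<le> T"
  shows "(U s y has_real_derivative sg s y t - (b s y t \<bullet> b s y t) / 2) (at t within {0..T})"
proof -
  have sub: "{0..T} \<times> {0..y} \<subseteq> {0..T} \<times> {0..1}" using y by auto
  have "((\<lambda>t. integral (cbox 0 y) (\<lambda>x. u s x t)) has_real_derivative integral (cbox 0 y) (\<lambda>x. u_t s x t))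
      (at t within {0..T})"
  proof (rule leibniz_rule_field_derivative)
    show "(\<lambda>x. u s x r) integrable_on cbox 0 y" if "r \<in> {0..T}" for r
      using that y s by (auto intro!: integrable_continuous_real continuous_on_subset[OF jcont_slice_y[of T]] jcs)
    show "continuous_on ({0..T} \<times> cbox 0 y) (\<lambda>(r, x). u_t s x r)"
      using continuous_on_subset[OF jcont_swap[OF jc(5)[OF s]] sub] by simp
  qed (use s y t dt in auto)
  moreover have "((\<lambda>x. u_t s x t) has_integral (sg s y t - (b s y t \<bullet> b s y t) / 2)
      - (sg s 0 t - (b s 0 t \<bullet> b s 0 t) / 2)) {0..y}"
  proof (rule fundamental_theorem_of_calculus)
    fix x assume x: "x \<in> {0..y}"
    have "((\<lambda>y. sg s y t - (b s y t \<bullet> b s y t) / 2) has_real_derivative u_t s x t) (at x within {0..1})"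
      using x y s t
      by (auto intro!: derivative_eq_intros dy_sg has_real_derivative_inner[OF dyv(2) dyv(2)] simp: inner_commute)
    then show "((\<lambda>y. sg s y t - (b s y t \<bullet> b s y t) / 2) has_vector_derivative u_t s x t) (at x within {0..y})"
      using y by (auto simp flip: has_real_derivative_iff_has_vector_derivative
          intro: has_field_derivative_subset)
  qed (use y in auto)
  ultimately show ?thesis
    using s t by (auto simp: U_def[abs_def] integral_unique sg_bdry boundary)
qed

lemma jc_U: "s \<in> S \<Longrightarrow> jcont T (U s)"
  by (rule jcont_of_partials[where fy = "u s" and ft = "\<lambda>y t. sg s y t - (b s y t \<bullet> b s y t) / 2"])
    (auto simp flip: has_real_derivative_iff_has_vector_derivative intro!: dy_U dt_U continuous_intros jcs)

lemma U_bound: "\<exists>C>0. \<forall>s\<in>S. \<forall>t\<in>{0..T}. \<forall>y\<in>{0..1}. \<bar>U s y t\<bar> \<le> C"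
proof -
  obtain C where C: "C > 0" "\<And>s t. s \<in> S \<Longrightarrow> t \<in> {0..T} \<Longrightarrow> integral {0..1} (\<lambda>y. (u s y t)\<^sup>2) \<le> C"
    using energy_parts by blast
  have "\<bar>U s y t\<bar> \<le> 1 + C" if s: "s \<in> S" and t: "t \<in> {0..T}" and y: "y \<in> {0..1}" for s t y
  proof -
    have "\<bar>U s y t - U s 0 t\<bar> \<le> integral {0..1} (\<lambda>y. \<bar>u s y t\<bar>)"
      by (rule abs_diff_le_integral_deriv) (use s t y in \<open>auto intro!: dy_U jcy\<close>)
    also have "\<dots> \<le> integral {0..1} (\<lambda>y. 1 + (u s y t)\<^sup>2)"
    proof (rule integral_mono_y)
      show "\<bar>u s y t\<bar> \<le> 1 + (u s y t)\<^sup>2" for y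
        using zero_le_power2[of "\<bar>u s y t\<bar> - 1"] zero_le_power2[of "u s y t"] by (simp add: power2_diff)
    qed (use s t in \<open>auto intro!: continuous_intros jcy\<close>)
    also have "\<dots> = 1 + integral {0..1} (\<lambda>y. (u s y t)\<^sup>2)"
      by (subst integral_add) (use s t in \<open>auto intro!: integrable_continuous_real continuous_intros jcy\<close>)
    finally show ?thesis using C(2)[OF s t] by (simp add: U_def)
  qed
  then show ?thesis using C(1) by (intro exI[of _ "1 + C"]) auto
qed

lemma dt_lnv: "s \<in> S \<Longrightarrow> 0 \<le> y \<Longrightarrow> y \<le> 1 \<Longrightarrow> 0 \<le> t \<Longrightarrow> t \<le> T \<Longrightarrow>
  ((\<lambda>t. lam * ln (v s y t) - U s y t) has_real_derivative p s y t + (b s y t \<bullet> b s y t) / 2) (at t within {0..T})"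
  by (auto intro!: derivative_eq_intros dt dt_U v_pos simp: sg_def)

lemma p_nonneg: "s \<in> S \<Longrightarrow> 0 \<le> y \<Longrightarrow> y \<le> 1 \<Longrightarrow> 0 \<le> t \<Longrightarrow> t \<le> T \<Longrightarrow> 0 \<le> p s y t"
  using v_pos[of s y t] th_pos[of s y t] param_pos unfolding p_def pressure_def by auto

text \<open>\<open>lam * ln v - U\<close> is nondecreasing in time because both pressures are
  nonnegative, and \<open>U\<close> is bounded by the energy, so \<open>ln v\<close> cannot fall far
  below its initial value.\<close>

lemma v_lower: "\<exists>c>0. \<forall>s\<in>S. \<forall>t\<in>{0..T}. \<forall>y\<in>{0..1}. c \<le> v s y t"
proof -
  obtain C where C: "C > 0" "\<And>s t y. s \<in> S \<Longrightarrow> t \<in> {0..T} \<Longrightarrow> y \<in> {0..1} \<Longrightarrow> \<bar>U s y t\<bar> \<le> C"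
    using U_bound by blast
  have "exp (- ln K - 2 * C / lam) \<le> v s y t" if s: "s \<in> S" and t: "t \<in> {0..T}" and y: "y \<in> {0..1}" for s t y
  proof -
    have "- (lam * ln (v s y t) - U s y t) - - (lam * ln (v s y 0) - U s y 0) \<le> integral {0..t} (\<lambda>t. 0)"
      by (rule integral_real_derivative_le[where T = T and f = "\<lambda>t. - (lam * ln (v s y t) - U s y t)"
          and f' = "\<lambda>t. - (p s y t + (b s y t \<bullet> b s y t) / 2)"])
        (use s t y DERIV_minus[OF dt_lnv[OF s]] p_nonneg[OF s] in \<open>auto simp del: minus_add_distrib minus_diff_eq\<close>)
    moreover have "ln (1 / K) \<le> ln (v s y 0)"
      using init[OF s, of y] y param_pos v_pos[OF s, of y 0] by (subst ln_le_cancel_iff) auto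
    then have "- ln K \<le> ln (v s y 0)" using param_pos by (simp add: ln_div)
    then have "lam * (- ln K) \<le> lam * ln (v s y 0)" using param_pos by (intro mult_left_mono) auto
    ultimately have "- lam * ln K - 2 * C \<le> lam * ln (v s y t)"
      using C(2)[OF s t y] C(2)[OF s _ y, of 0] t by auto
    then have "- ln K - 2 * C / lam \<le> ln (v s y t)" using param_pos by (simp add: field_simps)
    then show ?thesis using v_pos[OF s, of y t] t y by (simp add: ln_ge_iff)
  qed
  then show ?thesis by (intro exI[of _ "exp (- ln K - 2 * C / lam)"]) auto
qed

text \<open>The ends carry a stress condition and not \<open>u = 0\<close>, so the total volume is
  not conserved and has to be estimated. \<open>v * exp (- U / lam)\<close> grows at the relative
  rate \<open>(p + b \<bullet> b / 2) / lam\<close>, and the factor \<open>v\<close> turns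
  \<open>p\<close> into \<open>R th + a / 3 v th^4\<close>, whose integral the energy controls. A
  pointwise upper bound has to wait for suprema of \<open>th\<close> and \<open>b\<close>.\<close>

lemma v_mass: "\<exists>C>0. \<forall>s\<in>S. \<forall>t\<in>{0..T}. integral {0..1} (\<lambda>y. v s y t) \<le> C"
proof -
  obtain C where C: "C > 0" "\<And>s t y. s \<in> S \<Longrightarrow> t \<in> {0..T} \<Longrightarrow> y \<in> {0..1} \<Longrightarrow> \<bar>U s y t\<bar> \<le> C"
    using U_bound by blast
  obtain E where E: "E > 0" and E': "\<And>s t. s \<in> S \<Longrightarrow> t \<in> {0..T} \<Longrightarrow> integral {0..1} (\<lambda>y. th s y t) \<le> E
    \<and> integral {0..1} (\<lambda>y. v s y t * th s y t ^ 4) \<le> E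
    \<and> integral {0..1} (\<lambda>y. v s y t * (b s y t \<bullet> b s y t)) \<le> E"
    using energy_parts by blast
  define M where "M = exp (C / lam)"
  define N where "N = M / lam"
  have N: "0 < N" and M: "0 < M" using param_pos by (auto simp: M_def N_def)
  define f where "f s y t = v s y t * exp (- U s y t / lam)" for s y t
  have jf: "jcont T (f s)" if "s \<in> S" for s
    unfolding f_def using that by (auto intro!: continuous_intros jcs jc_U)
  define Q where "Q = R * E + a / 3 * E + E / 2"
  have Q: "0 \<le> Q" using E param_pos by (auto simp: Q_def)
  have "integral {0..1} (\<lambda>y. v s y t) \<le> M * (M * K + N * Q * T)" if s: "s \<in> S" and t: "t \<in> {0..T}" for s t
  proof -
    have e: "exp (- U s y r / lam) \<le> M" "exp (U s y r / lam) \<le> M" if "r \<in> {0..T}" "y \<in> {0..1}" for r y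
      using C(2)[OF s that] param_pos divide_right_mono[of "- U s y r" C lam] divide_right_mono[of "U s y r" C lam]
      by (auto simp: M_def abs_le_iff)
    let ?g = "\<lambda>y t. N * (v s y t * (p s y t + (b s y t \<bullet> b s y t) / 2))"
    have "integral {0..1} (\<lambda>y. f s y t) \<le> integral {0..1} (\<lambda>y. f s y 0)
        + integral {0..t} (\<lambda>r. integral {0..1} (\<lambda>y. ?g y r))"
    proof (rule balance_law[where T = T and f = "f s" and g = ?g and Z = "\<lambda>y t. 0" and Zy = "\<lambda>y t. 0"
          and ft = "\<lambda>y t. f s y t * ((p s y t + (b s y t \<bullet> b s y t) / 2) / lam)"])
      fix y r assume yr: "y \<in> {0..1::real}" "r \<in> {0..T}"
      show "(f s y has_real_derivative f s y r * ((p s y r + (b s y r \<bullet> b s y r) / 2) / lam)) (at r within {0..T})"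
        unfolding f_def using yr s param_pos v_pos[OF s, of y r]
        by (auto intro!: derivative_eq_intros dt dt_U simp: sg_def) (simp add: field_simps)
      have "f s y r * ((p s y r + (b s y r \<bullet> b s y r) / 2) / lam)
          = exp (- U s y r / lam) * (v s y r * (p s y r + (b s y r \<bullet> b s y r) / 2) / lam)"
        by (simp add: f_def)
      also have "\<dots> \<le> M * (v s y r * (p s y r + (b s y r \<bullet> b s y r) / 2) / lam)"
        using e(1)[OF yr(2,1)] yr v_pos[OF s, of y r] p_nonneg[OF s, of y r] param_pos
        by (intro mult_right_mono) auto
      finally show "f s y r * ((p s y r + (b s y r \<bullet> b s y r) / 2) / lam) \<le> ?g y r + 0"
        by (simp add: N_def)
    qed (use s t in \<open>auto intro!: continuous_intros jcs jf\<close>)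
    also have "integral {0..1} (\<lambda>y. f s y 0) \<le> integral {0..1} (\<lambda>y::real. M * K)"
    proof (rule integral_mono_y)
      fix y :: real assume y: "y \<in> {0..1}"
      show "f s y 0 \<le> M * K"
        unfolding f_def using init[OF s, of y] y e(1)[of 0 y] v_pos[OF s, of y 0] param_pos
        by (subst mult.commute) (intro mult_mono, auto)
    qed (use s param_pos in \<open>auto intro!: jcont_slice_y[of T "f s"] jf\<close>)
    also have "integral {0..t} (\<lambda>r. integral {0..1} (\<lambda>y. ?g y r)) \<le> integral {0..t} (\<lambda>r::real. N * Q)"
    proof (rule integral_le)
      fix r assume r: "r \<in> {0..t}"
      then have r': "r \<in> {0..T}" using t by auto
      have "integral {0..1} (\<lambda>y. ?g y r) = integral {0..1} (\<lambda>y. N * (R * th s y r + a / 3 * (v s y r * th s y r ^ 4)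
          + v s y r * (b s y r \<bullet> b s y r) / 2))"
        by (rule integral_cong) (use s r' in \<open>auto simp: p_def pressure_def algebra_simps\<close>)
      also have "\<dots> = N * (R * integral {0..1} (\<lambda>y. th s y r) + a / 3 * integral {0..1} (\<lambda>y. v s y r * th s y r ^ 4)
          + integral {0..1} (\<lambda>y. v s y r * (b s y r \<bullet> b s y r)) / 2)"
      proof -
        have "integral {0..1} (\<lambda>y. R * th s y r + a / 3 * (v s y r * th s y r ^ 4)
          + v s y r * (b s y r \<bullet> b s y r) / 2) = integral {0..1} (\<lambda>y. R * th s y r)
          + integral {0..1} (\<lambda>y. a / 3 * (v s y r * th s y r ^ 4)) + integral {0..1} (\<lambda>y. v s y r * (b s y r \<bullet> b s y r) / 2)"
          by (rule integral_add3, use s r' in \<open>auto intro!: continuous_intros jcy\<close>)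
        then show ?thesis by (simp only: integral_mult_right integral_divide)
      qed
      also have "\<dots> \<le> N * Q"
        unfolding Q_def using E'[OF s r'] param_pos N by (intro mult_left_mono add_mono divide_right_mono) auto
      finally show "integral {0..1} (\<lambda>y. ?g y r) \<le> N * Q" .
    next
      show "(\<lambda>r. integral {0..1} (\<lambda>y. ?g y r)) integrable_on {0..t}"
        by (rule jcont_integrable_t) (use s t in \<open>auto intro!: continuous_intros jcs\<close>)
    qed auto
    also have "\<dots> \<le> N * Q * T" using t N Q by (simp add: mult.commute[of t] mult_left_mono)
    finally have f: "integral {0..1} (\<lambda>y. f s y t) \<le> M * K + N * Q * T" by simp
    have "integral {0..1} (\<lambda>y. v s y t) \<le> M * integral {0..1} (\<lambda>y. f s y t)"
    proof (rule integral_le_scaled[OF _ jf t])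
      fix y :: real assume y: "y \<in> {0..1}"
      have "v s y t = exp (U s y t / lam) * f s y t" by (simp add: f_def exp_minus)
      also have "\<dots> \<le> M * f s y t"
        using e(2)[OF t y] v_pos[OF s, of y t] t y by (intro mult_right_mono) (auto simp: f_def)
      finally show "v s y t \<le> M * f s y t" .
    qed (use s in \<open>auto intro!: jcs\<close>)
    also have "\<dots> \<le> M * (M * K + N * Q * T)" using f M by (intro mult_left_mono) auto
    finally show ?thesis .
  qed
  moreover have "0 < M * (M * K + N * Q * T)" using M N Q param_pos
    by (intro mult_pos_pos add_pos_nonneg) auto
  ultimately show ?thesis by blast
qed

lemma dissip_lower:
  assumes "s \<in> S" "0 \<le> y" "y \<le> 1" "0 \<le> t" "t \<le> T"
  shows "k1 * ((th_y s y t)\<^sup>2 / (v s y t * (th s y t)\<^sup>2)) \<le> dissip s y t"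
    "lam * ((u_y s y t)\<^sup>2 / (v s y t * th s y t)) \<le> dissip s y t"
    "mu * ((w_y s y t \<bullet> w_y s y t) / (v s y t * th s y t)) \<le> dissip s y t"
    "nu * ((b_y s y t \<bullet> b_y s y t) / (v s y t * th s y t)) \<le> dissip s y t"
    "k1 \<le> kap s y t" "F s y t * th_y s y t = kap s y t * (th_y s y t)\<^sup>2 / v s y t"
    "kap s y t * (th_y s y t)\<^sup>2 / (v s y t * (th s y t)\<^sup>2) \<le> dissip s y t"
    "0 \<le> dissip s y t"
proof -
  have pos: "0 < v s y t" "0 < th s y t" using v_pos th_pos assms by auto
  show k: "k1 \<le> kap s y t" using flux assms by auto
  show F: "F s y t * th_y s y t = kap s y t * (th_y s y t)\<^sup>2 / v s y t"
    using flux assms by (simp add: power2_eq_square)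
  have F': "F s y t * th_y s y t / (th s y t)\<^sup>2 = kap s y t * ((th_y s y t)\<^sup>2 / (v s y t * (th s y t)\<^sup>2))"
    unfolding F by simp
  have 0: "k1 * ((th_y s y t)\<^sup>2 / (v s y t * (th s y t)\<^sup>2)) \<le> F s y t * th_y s y t / (th s y t)\<^sup>2"
    unfolding F' using k pos by (intro mult_right_mono) auto
  have 1: "0 \<le> k1 * ((th_y s y t)\<^sup>2 / (v s y t * (th s y t)\<^sup>2))" "0 \<le> lam * ((u_y s y t)\<^sup>2 / (v s y t * th s y t))"
    "0 \<le> mu * ((w_y s y t \<bullet> w_y s y t) / (v s y t * th s y t))"
    "0 \<le> nu * ((b_y s y t \<bullet> b_y s y t) / (v s y t * th s y t))"
    using pos param_pos by auto
  have 2: "dissip s y t = F s y t * th_y s y t / (th s y t)\<^sup>2 + lam * ((u_y s y t)\<^sup>2 / (v s y t * th s y t))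
    + mu * ((w_y s y t \<bullet> w_y s y t) / (v s y t * th s y t)) + nu * ((b_y s y t \<bullet> b_y s y t) / (v s y t * th s y t))"
    by (simp add: dissip_def add_divide_distrib)
  show "k1 * ((th_y s y t)\<^sup>2 / (v s y t * (th s y t)\<^sup>2)) \<le> dissip s y t"
    "lam * ((u_y s y t)\<^sup>2 / (v s y t * th s y t)) \<le> dissip s y t"
    "mu * ((w_y s y t \<bullet> w_y s y t) / (v s y t * th s y t)) \<le> dissip s y t"
    "nu * ((b_y s y t \<bullet> b_y s y t) / (v s y t * th s y t)) \<le> dissip s y t"
    "kap s y t * (th_y s y t)\<^sup>2 / (v s y t * (th s y t)\<^sup>2) \<le> dissip s y t"
    "0 \<le> dissip s y t"
    using 0 1 F' unfolding 2 by simp_all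
qed

lemma cont_m: "s \<in> S \<Longrightarrow> continuous_on {0..T} (m s)"
  unfolding m_def by (intro continuous_intros jcont_integral jc_dissip)

lemma m_ge_1: "s \<in> S \<Longrightarrow> t \<in> {0..T} \<Longrightarrow> 1 \<le> m s t"
  unfolding m_def using integral_nonneg_y[OF jcont_slice_y[OF jc_dissip]] dissip_lower(8) by auto

text \<open>Divided by \<open>th\<close>, the heat equation becomes the entropy balance:
  \<open>- ent\<close> is the entropy and \<open>dissip\<close> its production. The total production
  is the gain of entropy; the initial entropy is bounded below by the data and the final one above,
  through \<open>ln x \<le> x\<close>, by the energy and the volume.\<close>

lemma m_integral: "\<exists>C>0. \<forall>s\<in>S. integral {0..T} (m s) \<le> C"
proof -
  obtain E where E: "E > 0" and E': "\<And>s t. s \<in> S \<Longrightarrow> t \<in> {0..T} \<Longrightarrow> integral {0..1} (\<lambda>y. th s y t) \<le> E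
    \<and> integral {0..1} (\<lambda>y. v s y t * th s y t ^ 4) \<le> E"
    using energy_parts by blast
  obtain N where N: "N > 0" "\<And>s t. s \<in> S \<Longrightarrow> t \<in> {0..T} \<Longrightarrow> integral {0..1} (\<lambda>y. v s y t) \<le> N"
    using v_mass by blast
  define ent where "ent s y t = - (Cv * ln (th s y t) + R * ln (v s y t) + 4 / 3 * a * v s y t * th s y t ^ 3)" for s y t
  have je: "jcont T (ent s)" if "s \<in> S" for s
    unfolding ent_def using that by (auto intro!: continuous_intros jcs)
  let ?C = "T + (Cv * ln K + R * ln K) + (Cv * E + (R + 4 / 3 * a) * N + 4 / 3 * a * E)"
  have "integral {0..T} (m s) \<le> ?C" if s: "s \<in> S" for s
  proof -
    have TT: "T \<in> {0..T}" "0 \<in> {0..T}" using param_pos by auto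
    have "integral {0..1} (\<lambda>y. ent s y T) \<le> integral {0..1} (\<lambda>y. ent s y 0)
        + integral {0..T} (\<lambda>r. integral {0..1} (\<lambda>y. - dissip s y r))"
    proof (rule balance_law[where T = T and f = "ent s" and g = "\<lambda>y r. - dissip s y r"
          and ft = "\<lambda>y t. - (Cv * (th_t s y t / th s y t) + R * (u_y s y t / v s y t)
            + 4 / 3 * a * u_y s y t * th s y t ^ 3 + 4 * a * v s y t * (th s y t)\<^sup>2 * th_t s y t)"
          and Z = "\<lambda>y t. - (F s y t / th s y t)"
          and Zy = "\<lambda>y t. - (F_y s y t / th s y t - F s y t * th_y s y t / (th s y t)\<^sup>2)"])
      fix y r assume yr: "y \<in> {0..1::real}" "r \<in> {0..T}"
      have pos: "0 < v s y r" "0 < th s y r" using v_pos[OF s] th_pos[OF s] yr by auto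
      show "(ent s y has_real_derivative - (Cv * (th_t s y r / th s y r) + R * (u_y s y r / v s y r)
            + 4 / 3 * a * u_y s y r * th s y r ^ 3 + 4 * a * v s y r * (th s y r)\<^sup>2 * th_t s y r)) (at r within {0..T})"
        unfolding ent_def using yr s pos
        by (auto intro!: derivative_eq_intros dt) (simp add: field_simps)
      show "((\<lambda>y. - (F s y r / th s y r)) has_real_derivative
          - (F_y s y r / th s y r - F s y r * th_y s y r / (th s y r)\<^sup>2)) (at y within {0..1})"
        using yr s pos by (auto intro!: derivative_eq_intros dy dy_F simp: field_simps power2_eq_square)
      show "- (Cv * (th_t s y r / th s y r) + R * (u_y s y r / v s y r)
            + 4 / 3 * a * u_y s y r * th s y r ^ 3 + 4 * a * v s y r * (th s y r)\<^sup>2 * th_t s y r)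
        \<le> - dissip s y r + - (F_y s y r / th s y r - F s y r * th_y s y r / (th s y r)\<^sup>2)"
        using pos by (simp add: dissip_def F_y_def sg_def p_def pressure_def field_simps power2_eq_square
            power3_eq_cube power4_eq_xxxx)
    qed (use s TT in \<open>auto intro!: continuous_intros jcs je simp: boundary\<close>)
    moreover have "integral {0..1} (\<lambda>y. ent s y 0) \<le> integral {0..1} (\<lambda>y::real. Cv * ln K + R * ln K)"
    proof (rule integral_mono_y)
      fix y :: real assume y: "y \<in> {0..1}"
      have pos: "0 < v s y 0" "0 < th s y 0" using v_pos[OF s] th_pos[OF s] y param_pos by auto
      have "- ln K \<le> ln (v s y 0)" "- ln K \<le> ln (th s y 0)"
        using init[OF s, of y] y param_pos pos ln_le_cancel_iff[of "1 / K" "v s y 0"]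
          ln_le_cancel_iff[of "1 / K" "th s y 0"] by (auto simp: ln_div)
      then have "R * (- ln K) \<le> R * ln (v s y 0)" "Cv * (- ln K) \<le> Cv * ln (th s y 0)"
        using param_pos by (intro mult_left_mono; simp)+
      moreover have "0 \<le> 4 / 3 * a * v s y 0 * th s y 0 ^ 3" using pos param_pos by auto
      ultimately show "ent s y 0 \<le> Cv * ln K + R * ln K" unfolding ent_def by linarith
    qed (use s TT in \<open>auto intro!: jcont_slice_y[of T "ent s"] je\<close>)
    moreover have "integral {0..1} (\<lambda>y. - ent s y T)
        \<le> integral {0..1} (\<lambda>y. Cv * th s y T + (R + 4 / 3 * a) * v s y T + 4 / 3 * a * (v s y T * th s y T ^ 4))"
    proof (rule integral_mono_y)
      fix y :: real assume y: "y \<in> {0..1}"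
      have pos: "0 < v s y T" "0 < th s y T" using v_pos[OF s] th_pos[OF s] y param_pos by auto
      have "ln (v s y T) \<le> v s y T" "ln (th s y T) \<le> th s y T"
        using pos by (auto intro: ln_bound)
      then have "R * ln (v s y T) \<le> R * v s y T" "Cv * ln (th s y T) \<le> Cv * th s y T"
        using param_pos by (auto intro!: mult_left_mono)
      moreover have "th s y T ^ 3 \<le> 1 + th s y T ^ 4"
        using pos by (intro power_le_one_plus_power) auto
      then have "(4 / 3 * a * v s y T) * th s y T ^ 3 \<le> (4 / 3 * a * v s y T) * (1 + th s y T ^ 4)"
        using pos param_pos by (intro mult_left_mono) auto
      ultimately show "- ent s y T \<le> Cv * th s y T + (R + 4 / 3 * a) * v s y T + 4 / 3 * a * (v s y T * th s y T ^ 4)"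
        unfolding ent_def by (simp add: algebra_simps)
    qed (use s TT in \<open>auto intro!: continuous_intros jcy jcont_slice_y[OF je]\<close>)
    moreover have "\<dots> = Cv * integral {0..1} (\<lambda>y. th s y T) + (R + 4 / 3 * a) * integral {0..1} (\<lambda>y. v s y T)
        + 4 / 3 * a * integral {0..1} (\<lambda>y. v s y T * th s y T ^ 4)"
    proof -
      have "integral {0..1} (\<lambda>y. Cv * th s y T + (R + 4 / 3 * a) * v s y T + 4 / 3 * a * (v s y T * th s y T ^ 4))
        = integral {0..1} (\<lambda>y. Cv * th s y T) + integral {0..1} (\<lambda>y. (R + 4 / 3 * a) * v s y T)
        + integral {0..1} (\<lambda>y. 4 / 3 * a * (v s y T * th s y T ^ 4))"
        by (rule integral_add3, use s TT in \<open>auto intro!: continuous_intros jcy\<close>)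
      then show ?thesis by (simp only: integral_mult_right)
    qed
    moreover have "\<dots> \<le> Cv * E + (R + 4 / 3 * a) * N + 4 / 3 * a * E"
      using E'[OF s TT(1)] N(2)[OF s TT(1)] param_pos by (intro mult_left_mono add_mono) auto
    moreover have "integral {0..T} (m s) = T + integral {0..T} (\<lambda>r. integral {0..1} (\<lambda>y. dissip s y r))"
      unfolding m_def using s param_pos
      by (subst integral_add) (auto intro!: jcont_integrable_t jc_dissip)
    ultimately show ?thesis by simp
  qed
  moreover have "0 < ?C"
    using param_pos E N by (intro add_pos_nonneg add_nonneg_nonneg) auto
  ultimately show ?thesis by blast
qed

end

lemma young:
  fixes x y e :: real
  assumes "0 < e"
  shows "x * y \<le> e * x\<^sup>2 + y\<^sup>2 / (4 * e)"
proof -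
  have "0 \<le> (2 * e * x - y)\<^sup>2 / (4 * e)" using assms by simp
  also have "\<dots> = e * x\<^sup>2 - x * y + y\<^sup>2 / (4 * e)"
    using assms by (simp add: power2_eq_square field_simps)
  finally show ?thesis by simp
qed

text \<open>\<open>G\<close> depends on time only and may contain the space integral of
  \<open>f\<close>; this is how the estimates reach the form required by
  \<open>gronwall\<close>.\<close>

lemma balance_law_dissipative:
  fixes f ft g h Z Zy :: "real \<Rightarrow> real \<Rightarrow> real" and G :: "real \<Rightarrow> real"
  assumes "jcont T f" "jcont T ft" "jcont T g" "jcont T h" "continuous_on {0..T} G"
    and "\<And>y t. y \<in> {0..1} \<Longrightarrow> t \<in> {0..T} \<Longrightarrow> (f y has_real_derivative ft y t) (at t within {0..T})"
    and "\<And>y t. y \<in> {0..1} \<Longrightarrow> t \<in> {0..T} \<Longrightarrow>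
      ((\<lambda>y. Z y t) has_real_derivative Zy y t) (at y within {0..1})"
    and "\<And>t. t \<in> {0..T} \<Longrightarrow> Z 0 t = 0" "\<And>t. t \<in> {0..T} \<Longrightarrow> Z 1 t = 0"
    and le: "\<And>y t. y \<in> {0..1} \<Longrightarrow> t \<in> {0..T} \<Longrightarrow> ft y t + h y t \<le> g y t + Zy y t"
    and G: "\<And>t. t \<in> {0..T} \<Longrightarrow> integral {0..1} (\<lambda>y. g y t) \<le> G t"
    and t: "t \<in> {0..T}"
  shows "integral {0..1} (\<lambda>y. f y t) + integral {0..t} (\<lambda>s. integral {0..1} (\<lambda>y. h y s))
    \<le> integral {0..1} (\<lambda>y. f y 0) + integral {0..t} G"
proof -
  have "integral {0..1} (\<lambda>y. f y t) \<le> integral {0..1} (\<lambda>y. f y 0)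
      + integral {0..t} (\<lambda>s. integral {0..1} (\<lambda>y. g y s - h y s))"
  proof (rule balance_law[where T = T and f = f and ft = ft and Z = Z and Zy = Zy and g = "\<lambda>y s. g y s - h y s"])
    show "ft y r \<le> g y r - h y r + Zy y r" if "y \<in> {0..1}" "r \<in> {0..T}" for y r
      using le[OF that] by simp
  qed (use assms in \<open>auto intro!: continuous_intros\<close>)
  also have "integral {0..t} (\<lambda>s. integral {0..1} (\<lambda>y. g y s - h y s))
      \<le> integral {0..t} (\<lambda>s. G s - integral {0..1} (\<lambda>y. h y s))"
  proof (rule integral_le)
    show "(\<lambda>s. integral {0..1} (\<lambda>y. g y s - h y s)) integrable_on {0..t}"
      by (rule jcont_integrable_t[OF _ t]) (use assms in \<open>auto intro!: continuous_intros\<close>)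
    show "(\<lambda>s. G s - integral {0..1} (\<lambda>y. h y s)) integrable_on {0..t}"
      using t by (intro integrable_diff jcont_integrable_t[OF assms(4) t] integrable_continuous_real
          continuous_on_subset[OF assms(5)]) auto
    fix s assume "s \<in> {0..t}"
    then have s: "s \<in> {0..T}" using t by auto
    have "integral {0..1} (\<lambda>y. g y s - h y s) = integral {0..1} (\<lambda>y. g y s) - integral {0..1} (\<lambda>y. h y s)"
      by (rule integral_diff[OF jcont_integrable_y[OF assms(3) s] jcont_integrable_y[OF assms(4) s]])
    then show "integral {0..1} (\<lambda>y. g y s - h y s) \<le> G s - integral {0..1} (\<lambda>y. h y s)"
      using G[OF s] by simp
  qed
  also have "\<dots> = integral {0..t} G - integral {0..t} (\<lambda>s. integral {0..1} (\<lambda>y. h y s))"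
    using t by (intro integral_diff jcont_integrable_t[OF assms(4) t] integrable_continuous_real
          continuous_on_subset[OF assms(5)]) auto
  finally show ?thesis by simp
qed

lemma integral_le_const:
  fixes f :: "real \<Rightarrow> real"
  assumes "continuous_on {0..1} f" "\<And>y. y \<in> {0..1} \<Longrightarrow> f y \<le> c"
  shows "integral {0..1} f \<le> c"
  using integral_mono_y[OF assms(1), of "\<lambda>y. c"] assms(2) by simp

lemma integral_mult_bound:
  fixes f g :: "real \<Rightarrow> real"
  assumes "continuous_on {0..1} f" "continuous_on {0..1} g" "\<And>y. y \<in> {0..1} \<Longrightarrow> f y \<le> c * g y"
    "integral {0..1} g \<le> D" "0 \<le> c"
  shows "integral {0..1} f \<le> c * D"
proof -
  have "integral {0..1} f \<le> integral {0..1} (\<lambda>y. c * g y)"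
    by (rule integral_mono_y) (use assms in \<open>auto intro!: continuous_intros\<close>)
  also have "\<dots> = c * integral {0..1} g" by simp
  also have "\<dots> \<le> c * D" by (rule mult_left_mono) (use assms in auto)
  finally show ?thesis .
qed

context flows
begin

lemma dissip_le_m:
  assumes "s \<in> S" "t \<in> {0..T}" "continuous_on {0..1} f" "0 \<le> c"
    "\<And>y. y \<in> {0..1} \<Longrightarrow> f y \<le> c * dissip s y t"
  shows "integral {0..1} f \<le> c * m s t"
  by (rule integral_mult_bound[where g = "\<lambda>y. dissip s y t"]) (use assms in \<open>auto intro!: jcy simp: m_def\<close>)

text \<open>Each supremum uses the weight that turns the squared derivative into a part of
  \<open>dissip\<close>: \<open>v th^4\<close> for \<open>th^2\<close>, and \<open>v th\<close> for
  \<open>u\<close>, \<open>w\<close> and \<open>b\<close>. The integrals of these weights are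
  bounded by energy and volume, so that \<open>m\<close> is all that remains as a function of
  time.\<close>

lemma sup_bounds: "\<exists>C>0. \<forall>s\<in>S. \<forall>t\<in>{0..T}. \<forall>y\<in>{0..1}. th s y t ^ 4 \<le> C * m s t \<and> (u s y t)\<^sup>2 \<le> C * m s t
    \<and> w s y t \<bullet> w s y t \<le> C * m s t \<and> b s y t \<bullet> b s y t \<le> C * m s t"
proof -
  obtain E where E: "E > 0" and E': "\<And>s t. s \<in> S \<Longrightarrow> t \<in> {0..T} \<Longrightarrow>
      integral {0..1} (\<lambda>y. v s y t * th s y t ^ 4) \<le> E \<and> integral {0..1} (\<lambda>y. (u s y t)\<^sup>2) \<le> E"
    using energy_parts by blast
  obtain N where N: "N > 0" "\<And>s t. s \<in> S \<Longrightarrow> t \<in> {0..T} \<Longrightarrow> integral {0..1} (\<lambda>y. v s y t) \<le> N"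
    using v_mass by blast
  obtain c where c: "c > 0" "\<And>s t y. s \<in> S \<Longrightarrow> t \<in> {0..T} \<Longrightarrow> y \<in> {0..1} \<Longrightarrow> c \<le> v s y t"
    using v_lower by blast
  define C where "C = (2 * (1 / c * E) + 2 * (4 / k1 * E)) + (2 * E + 2 * (1 / lam * (N + E)))
    + 1 / mu * (N + E) + 1 / nu * (N + E)"
  have Cs: "0 < 2 * (1 / c * E) + 2 * (4 / k1 * E)" "0 < 2 * E + 2 * (1 / lam * (N + E))"
    "0 < 1 / mu * (N + E)" "0 < 1 / nu * (N + E)"
    using E N c param_pos by (auto intro!: add_pos_pos)
  have C: "0 < C" "2 * (1 / c * E) + 2 * (4 / k1 * E) \<le> C" "2 * E + 2 * (1 / lam * (N + E)) \<le> C"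
    "1 / mu * (N + E) \<le> C" "1 / nu * (N + E) \<le> C"
    using Cs unfolding C_def by linarith+
  have "th s y t ^ 4 \<le> C * m s t \<and> (u s y t)\<^sup>2 \<le> C * m s t
    \<and> w s y t \<bullet> w s y t \<le> C * m s t \<and> b s y t \<bullet> b s y t \<le> C * m s t"
    if s: "s \<in> S" and t: "t \<in> {0..T}" and y: "y \<in> {0..1}" for s t y
  proof -
    have pos: "0 < v s y t" "0 < th s y t" if "y \<in> {0..1}" for y
      using v_pos[OF s] th_pos[OF s] t that by auto
    have m1: "1 \<le> m s t" by (rule m_ge_1[OF s t])
    have Cm: "A * m s t \<le> C * m s t" if "A \<le> C" for A using that m1 by (intro mult_right_mono) auto
    have vth: "integral {0..1} (\<lambda>y. v s y t * th s y t) \<le> N + E"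
    proof -
      have "integral {0..1} (\<lambda>y. v s y t * th s y t) \<le> integral {0..1} (\<lambda>y. v s y t + v s y t * th s y t ^ 4)"
      proof (rule integral_mono_y)
        fix y :: real assume y: "y \<in> {0..1}"
        have "v s y t * th s y t \<le> v s y t * (1 + th s y t ^ 4)"
          using pos[OF y] power_le_one_plus_power[of "th s y t" 1 4] by (intro mult_left_mono) auto
        then show "v s y t * th s y t \<le> v s y t + v s y t * th s y t ^ 4" by (simp add: algebra_simps)
      qed (use s t in \<open>auto intro!: continuous_intros jcy\<close>)
      also have "\<dots> = integral {0..1} (\<lambda>y. v s y t) + integral {0..1} (\<lambda>y. v s y t * th s y t ^ 4)"
        by (intro integral_add integrable_continuous_real) (use s t in \<open>auto intro!: continuous_intros jcy\<close>)
      finally show ?thesis using E'[OF s t] N(2)[OF s t] by simp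
    qed
    have nn: "0 \<le> integral {0..1} (\<lambda>y. v s y t * th s y t)" "0 \<le> integral {0..1} (\<lambda>y. v s y t * th s y t ^ 4)"
      by (rule integral_nonneg_y, use s t pos in \<open>auto intro!: continuous_intros jcy simp: less_imp_le\<close>)+
    have "((th s y t)\<^sup>2)\<^sup>2 \<le> 2 * integral {0..1} (\<lambda>y. ((th s y t)\<^sup>2)\<^sup>2)
        + 2 * (integral {0..1} (\<lambda>y. (2 * th s y t * th_y s y t)\<^sup>2 / (v s y t * th s y t ^ 4))
          * integral {0..1} (\<lambda>y. v s y t * th s y t ^ 4))"
      by (rule sup_square_bound[where f = "\<lambda>y. (th s y t)\<^sup>2"])
        (use s t y pos in \<open>auto intro!: derivative_eq_intros dy continuous_intros jcy\<close>)
    moreover have "integral {0..1} (\<lambda>y. ((th s y t)\<^sup>2)\<^sup>2) \<le> 1 / c * E"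
    proof (rule integral_mult_bound[where g = "\<lambda>y. v s y t * th s y t ^ 4"])
      fix y :: real assume y: "y \<in> {0..1}"
      have "c * th s y t ^ 4 \<le> v s y t * th s y t ^ 4"
        using c(2)[OF s t y] pos[OF y] by (intro mult_right_mono) auto
      then show "((th s y t)\<^sup>2)\<^sup>2 \<le> 1 / c * (v s y t * th s y t ^ 4)"
        using c(1) by (simp add: field_simps flip: power_mult)
    qed (use s t E' c(1) in \<open>auto intro!: continuous_intros jcy\<close>)
    moreover have "integral {0..1} (\<lambda>y. (2 * th s y t * th_y s y t)\<^sup>2 / (v s y t * th s y t ^ 4)) \<le> 4 / k1 * m s t"
    proof (rule dissip_le_m[OF s t])
      fix y :: real assume y: "y \<in> {0..1}"
      have "(2 * th s y t * th_y s y t)\<^sup>2 / (v s y t * th s y t ^ 4)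
          = 4 / k1 * (k1 * ((th_y s y t)\<^sup>2 / (v s y t * (th s y t)\<^sup>2)))"
        using pos[OF y] param_pos by (simp add: field_simps power2_eq_square power4_eq_xxxx)
      also have "\<dots> \<le> 4 / k1 * dissip s y t"
        using dissip_lower(1)[OF s, of y t] t y param_pos by (intro mult_left_mono) auto
      finally show "(2 * th s y t * th_y s y t)\<^sup>2 / (v s y t * th s y t ^ 4) \<le> 4 / k1 * dissip s y t" .
    qed (use s t pos param_pos in \<open>auto intro!: continuous_intros jcy\<close>)
    ultimately have "((th s y t)\<^sup>2)\<^sup>2 \<le> 2 * (1 / c * E) + 2 * (4 / k1 * m s t * E)"
      using E'[OF s t] nn m1 param_pos mult_mono[of _ "4 / k1 * m s t" _ E]
      by (smt (verit, best) divide_nonneg_pos mult_nonneg_nonneg)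
    also have "\<dots> \<le> (2 * (1 / c * E) + 2 * (4 / k1 * E)) * m s t"
      using m1 E c(1) by (simp add: algebra_simps mult_left_mono divide_right_mono)
    finally have th4: "th s y t ^ 4 \<le> C * m s t" using Cm[OF C(2)] by (simp flip: power_mult)
    have "(u s y t)\<^sup>2 \<le> 2 * integral {0..1} (\<lambda>y. (u s y t)\<^sup>2)
        + 2 * (integral {0..1} (\<lambda>y. (u_y s y t)\<^sup>2 / (v s y t * th s y t)) * integral {0..1} (\<lambda>y. v s y t * th s y t))"
      by (rule sup_square_bound[where f = "\<lambda>y. u s y t"])
        (use s t y pos in \<open>auto intro!: dy continuous_intros jcy\<close>)
    moreover have "integral {0..1} (\<lambda>y. (u_y s y t)\<^sup>2 / (v s y t * th s y t)) \<le> 1 / lam * m s t"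
      by (rule dissip_le_m[OF s t])
        (use s t pos param_pos dissip_lower(2)[OF s, of _ t] in
          \<open>auto intro!: continuous_intros jcy simp: field_simps\<close>)
    ultimately have "(u s y t)\<^sup>2 \<le> 2 * E + 2 * (1 / lam * m s t * (N + E))"
      using E'[OF s t] vth nn m1 param_pos mult_mono[of _ "1 / lam * m s t" _ "N + E"]
      by (smt (verit, best) divide_nonneg_pos mult_nonneg_nonneg)
    also have "\<dots> \<le> (2 * E + 2 * (1 / lam * (N + E))) * m s t"
      using m1 E by (simp add: algebra_simps mult_left_mono divide_right_mono)
    finally have u2: "(u s y t)\<^sup>2 \<le> C * m s t" using Cm[OF C(3)] by simp
    have "w s y t \<bullet> w s y t \<le> integral {0..1} (\<lambda>y. (w_y s y t \<bullet> w_y s y t) / (v s y t * th s y t))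
        * integral {0..1} (\<lambda>y. v s y t * th s y t)"
      by (rule sup_norm_square_bound[where f = "\<lambda>y. w s y t"])
        (use s t y pos in \<open>auto intro!: dyv continuous_intros jcy simp: boundary\<close>)
    also have "\<dots> \<le> (1 / mu * m s t) * (N + E)"
    proof (rule mult_mono)
      show "integral {0..1} (\<lambda>y. (w_y s y t \<bullet> w_y s y t) / (v s y t * th s y t)) \<le> 1 / mu * m s t"
        by (rule dissip_le_m[OF s t])
          (use s t pos param_pos dissip_lower(3)[OF s, of _ t] in
            \<open>auto intro!: continuous_intros jcy simp: field_simps\<close>)
    qed (use vth nn m1 param_pos in auto)
    finally have w2: "w s y t \<bullet> w s y t \<le> C * m s t" using Cm[OF C(4)] by (simp add: ac_simps)
    have "b s y t \<bullet> b s y t \<le> integral {0..1} (\<lambda>y. (b_y s y t \<bullet> b_y s y t) / (v s y t * th s y t))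
        * integral {0..1} (\<lambda>y. v s y t * th s y t)"
      by (rule sup_norm_square_bound[where f = "\<lambda>y. b s y t"])
        (use s t y pos in \<open>auto intro!: dyv continuous_intros jcy simp: boundary\<close>)
    also have "\<dots> \<le> (1 / nu * m s t) * (N + E)"
    proof (rule mult_mono)
      show "integral {0..1} (\<lambda>y. (b_y s y t \<bullet> b_y s y t) / (v s y t * th s y t)) \<le> 1 / nu * m s t"
        by (rule dissip_le_m[OF s t])
          (use s t pos param_pos dissip_lower(4)[OF s, of _ t] in
            \<open>auto intro!: continuous_intros jcy simp: field_simps\<close>)
    qed (use vth nn m1 param_pos in auto)
    finally have b2: "b s y t \<bullet> b s y t \<le> C * m s t" using Cm[OF C(5)] by (simp add: ac_simps)
    show ?thesis using th4 u2 w2 b2 by simp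
  qed
  then show ?thesis using C(1) by blast
qed

text \<open>By \<open>sup_bounds\<close> and \<open>v_lower\<close> the growth rate
  \<open>p + b \<bullet> b / 2\<close> of \<open>lam * ln v - U\<close> is at every point at most a
  multiple of \<open>m\<close>, which has a bounded time integral.\<close>

lemma v_upper: "\<exists>C>0. \<forall>s\<in>S. \<forall>t\<in>{0..T}. \<forall>y\<in>{0..1}. v s y t \<le> C"
proof -
  obtain C where C: "C > 0" and C': "\<And>s t y. s \<in> S \<Longrightarrow> t \<in> {0..T} \<Longrightarrow> y \<in> {0..1} \<Longrightarrow>
      th s y t ^ 4 \<le> C * m s t \<and> b s y t \<bullet> b s y t \<le> C * m s t"
    using sup_bounds by blast
  obtain D where D: "D > 0" "\<And>s t y. s \<in> S \<Longrightarrow> t \<in> {0..T} \<Longrightarrow> y \<in> {0..1} \<Longrightarrow> \<bar>U s y t\<bar> \<le> D"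
    using U_bound by blast
  obtain N where N: "N > 0" "\<And>s. s \<in> S \<Longrightarrow> integral {0..T} (m s) \<le> N"
    using m_integral by blast
  obtain c where c: "c > 0" "\<And>s t y. s \<in> S \<Longrightarrow> t \<in> {0..T} \<Longrightarrow> y \<in> {0..1} \<Longrightarrow> c \<le> v s y t"
    using v_lower by blast
  define A where "A = R / c * (1 + C) + a / 3 * C + C / 2"
  have A: "0 < A" unfolding A_def using param_pos c C by (intro add_pos_pos) auto
  have "v s y t \<le> exp (ln K + (2 * D + A * N) / lam)" if s: "s \<in> S" and t: "t \<in> {0..T}" and y: "y \<in> {0..1}" for s t y
  proof -
    have "(lam * ln (v s y t) - U s y t) - (lam * ln (v s y 0) - U s y 0) \<le> integral {0..t} (\<lambda>t. A * m s t)"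
    proof (rule integral_real_derivative_le[where T = T and f = "\<lambda>t. lam * ln (v s y t) - U s y t"])
      fix r assume r: "r \<in> {0..T}"
      show "((\<lambda>t. lam * ln (v s y t) - U s y t) has_real_derivative p s y r + (b s y r \<bullet> b s y r) / 2) (at r within {0..T})"
        by (rule dt_lnv) (use s y r in auto)
      have pos: "0 < v s y r" "0 < th s y r"
        using v_pos[OF s] th_pos[OF s] y r by auto
      have m1: "1 \<le> m s r" by (rule m_ge_1[OF s r])
      have "R * th s y r / v s y r \<le> R * th s y r / c"
        using c(2)[OF s r y] c(1) pos param_pos by (intro divide_left_mono) auto
      also have "\<dots> = R / c * th s y r" by simp
      also have "\<dots> \<le> R / c * (m s r + C * m s r)"
        using power_le_one_plus_power[of "th s y r" 1 4] pos C'[OF s r y] m1 c(1) param_pos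
        by (intro mult_left_mono) auto
      finally have "R * th s y r / v s y r \<le> R / c * (m s r + C * m s r)" .
      moreover have "a / 3 * th s y r ^ 4 \<le> a / 3 * (C * m s r)"
        using C'[OF s r y] param_pos by (intro mult_left_mono) auto
      ultimately have "p s y r \<le> R / c * (m s r + C * m s r) + a / 3 * (C * m s r)"
        unfolding p_def pressure_def by linarith
      moreover have "A * m s r = R / c * (m s r + C * m s r) + a / 3 * (C * m s r) + C * m s r / 2"
        by (simp add: A_def algebra_simps add_divide_distrib)
      ultimately show "p s y r + (b s y r \<bullet> b s y r) / 2 \<le> A * m s r"
        using C'[OF s r y] by linarith
    qed (use s t cont_m in \<open>auto intro!: continuous_intros\<close>)
    also have "\<dots> \<le> integral {0..T} (\<lambda>t. A * m s t)"
      by (rule integral_upper_mono[of T]) (use s t A cont_m m_ge_1[OF s] in \<open>auto intro!: continuous_intros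
          mult_nonneg_nonneg intro: order_trans[OF zero_le_one]\<close>)
    also have "\<dots> = A * integral {0..T} (m s)" by simp
    also have "\<dots> \<le> A * N" using N(2)[OF s] A by (intro mult_left_mono) auto
    also have "lam * ln (v s y 0) \<le> lam * ln K"
      using init[OF s, of y] y param_pos v_pos[OF s, of y 0] by (intro mult_left_mono) auto
    ultimately have "lam * ln (v s y t) \<le> lam * ln K + 2 * D + A * N"
      using D(2)[OF s t y] D(2)[OF s _ y, of 0] t
      by (smt (verit, ccfv_SIG) atLeastAtMost_iff)
    then have "ln (v s y t) \<le> ln K + (2 * D + A * N) / lam" using param_pos by (simp add: field_simps)
    then have "exp (ln (v s y t)) \<le> exp (ln K + (2 * D + A * N) / lam)" by simp
    moreover have "exp (ln (v s y t)) = v s y t" using v_pos[OF s, of y t] t y by simp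
    ultimately show ?thesis by argo
  qed
  then show ?thesis by (intro exI[of _ "exp (ln K + (2 * D + A * N) / lam)"]) auto
qed

end

text \<open>One constant \<open>B\<close> replaces all bounds found so far. With \<open>v\<close>
  between \<open>1 / B\<close> and \<open>B\<close>, its powers can from here on be absorbed into
  constants.\<close>

locale bounded_flows = flows lam mu nu R a Cv k1 K T S v v_y u u_y u_t th th_y th_t F kap w w_y w_yy w_t b b_y b_yy b_t
  for lam mu nu R a Cv k1 K T :: real
    and S :: "'s set"
    and v v_y u u_y u_t th th_y th_t F kap :: "'s \<Rightarrow> real \<Rightarrow> real \<Rightarrow> real"
    and w w_y w_yy w_t b b_y b_yy b_t :: "'s \<Rightarrow> real \<Rightarrow> real \<Rightarrow> 'a::euclidean_space" +
  fixes B :: real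
  assumes B_ge_1: "1 \<le> B"
    and bd: "\<And>s t y. s \<in> S \<Longrightarrow> t \<in> {0..T} \<Longrightarrow> y \<in> {0..1} \<Longrightarrow> 1 / B \<le> v s y t \<and> v s y t \<le> B
      \<and> th s y t ^ 4 \<le> B * m s t \<and> (u s y t)\<^sup>2 \<le> B * m s t
      \<and> w s y t \<bullet> w s y t \<le> B * m s t \<and> b s y t \<bullet> b s y t \<le> B * m s t"
    and bdi: "\<And>s t. s \<in> S \<Longrightarrow> t \<in> {0..T} \<Longrightarrow> integral {0..1} (\<lambda>y. th s y t ^ 4) \<le> B"
      "\<And>s t. s \<in> S \<Longrightarrow> t \<in> {0..T} \<Longrightarrow> integral {0..1} (\<lambda>y. (u s y t)\<^sup>2) \<le> B"
      "\<And>s t. s \<in> S \<Longrightarrow> t \<in> {0..T} \<Longrightarrow> integral {0..1} (\<lambda>y. b s y t \<bullet> b s y t) \<le> B"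
      "\<And>s. s \<in> S \<Longrightarrow> integral {0..T} (m s) \<le> B"

lemma (in flows) bounded_flows_exists:
  "\<exists>B. bounded_flows lam mu nu R a Cv k1 K T S v v_y u u_y u_t th th_y th_t F kap w w_y w_yy w_t b b_y b_yy b_t B"
proof -
  obtain E where E: "E > 0" and E': "\<And>s t. s \<in> S \<Longrightarrow> t \<in> {0..T} \<Longrightarrow>
      integral {0..1} (\<lambda>y. v s y t * th s y t ^ 4) \<le> E \<and> integral {0..1} (\<lambda>y. (u s y t)\<^sup>2) \<le> E
      \<and> integral {0..1} (\<lambda>y. v s y t * (b s y t \<bullet> b s y t)) \<le> E"
    using energy_parts by blast
  obtain N where N: "N > 0" "\<And>s. s \<in> S \<Longrightarrow> integral {0..T} (m s) \<le> N"
    using m_integral by blast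
  obtain c where c: "c > 0" "\<And>s t y. s \<in> S \<Longrightarrow> t \<in> {0..T} \<Longrightarrow> y \<in> {0..1} \<Longrightarrow> c \<le> v s y t"
    using v_lower by blast
  obtain D where D: "D > 0" "\<And>s t y. s \<in> S \<Longrightarrow> t \<in> {0..T} \<Longrightarrow> y \<in> {0..1} \<Longrightarrow> v s y t \<le> D"
    using v_upper by blast
  obtain C where C: "C > 0" and C': "\<And>s t y. s \<in> S \<Longrightarrow> t \<in> {0..T} \<Longrightarrow> y \<in> {0..1} \<Longrightarrow>
      th s y t ^ 4 \<le> C * m s t \<and> (u s y t)\<^sup>2 \<le> C * m s t
      \<and> w s y t \<bullet> w s y t \<le> C * m s t \<and> b s y t \<bullet> b s y t \<le> C * m s t"
    using sup_bounds by blast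
  define B where "B = 1 + C + D + 1 / c + N + E + 1 / c * E"
  have B: "1 \<le> B" "C \<le> B" "D \<le> B" "1 / c \<le> B" "N \<le> B" "E \<le> B" "1 / c * E \<le> B"
    using C D c N E unfolding B_def by (auto intro!: add_nonneg_nonneg)
  have Bm: "x \<le> B * m s t" if "x \<le> C * m s t" "s \<in> S" "t \<in> {0..T}" for x s t
  proof -
    have "C * m s t \<le> B * m s t" using B(2) m_ge_1[OF that(2,3)] by (intro mult_right_mono) auto
    with that(1) show ?thesis by simp
  qed
  have scaled: "integral {0..1} (\<lambda>y. f y) \<le> B"
    if "continuous_on {0..1} f" "s \<in> S" "t \<in> {0..T}" "integral {0..1} (\<lambda>y. v s y t * f y) \<le> E"
      "\<And>y. y \<in> {0..1} \<Longrightarrow> 0 \<le> f y" for f :: "real \<Rightarrow> real" and s t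
  proof -
    have "integral {0..1} f \<le> 1 / c * E"
    proof (rule integral_mult_bound[where g = "\<lambda>y. v s y t * f y"])
      fix y :: real assume y: "y \<in> {0..1}"
      have "c * f y \<le> v s y t * f y" using c(2)[OF that(2,3) y] that(5)[OF y] by (rule mult_right_mono)
      then show "f y \<le> 1 / c * (v s y t * f y)" using c(1) by (simp add: field_simps)
    qed (use that c(1) in \<open>auto intro!: continuous_intros jcy\<close>)
    with B show ?thesis by simp
  qed
  show ?thesis
  proof (rule exI[of _ B], unfold_locales)
    show "1 \<le> B" by (rule B)
    fix s assume s: "s \<in> S"
    show "integral {0..T} (m s) \<le> B" using N(2)[OF s] B by simp
    fix t assume t: "t \<in> {0..T}"
    show "integral {0..1} (\<lambda>y. th s y t ^ 4) \<le> B" 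
      by (rule scaled[OF _ s t]) (use s t E' in \<open>auto intro!: continuous_intros jcy\<close>)
    show "integral {0..1} (\<lambda>y. b s y t \<bullet> b s y t) \<le> B" 
      by (rule scaled[OF _ s t]) (use s t E' in \<open>auto intro!: continuous_intros jcy\<close>)
    show "integral {0..1} (\<lambda>y. (u s y t)\<^sup>2) \<le> B" using E'[OF s t] B by simp
    fix y :: real assume y: "y \<in> {0..1}"
    have "1 / B \<le> c" using B c(1) by (simp add: field_simps)
    then show "1 / B \<le> v s y t \<and> v s y t \<le> B
      \<and> th s y t ^ 4 \<le> B * m s t \<and> (u s y t)\<^sup>2 \<le> B * m s t
      \<and> w s y t \<bullet> w s y t \<le> B * m s t \<and> b s y t \<bullet> b s y t \<le> B * m s t"
      using c(2)[OF s t y] D(2)[OF s t y] B C'[OF s t y] Bm[OF _ s t] by auto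
  qed
qed

section \<open>Dissipation and the specific volume\<close>

text \<open>Here \<open>f\<close> enters by its mean and not by its mean square: the applications
  take for \<open>f\<close> powers of \<open>th\<close> up to \<open>th^4\<close>, whose integrals
  the energy bounds, whereas it need not bound those of \<open>f^2\<close>.\<close>

lemma sup_square_bound_mean:
  fixes f f' \<rho> :: "real \<Rightarrow> real"
  assumes f: "\<And>y. y \<in> {0..1} \<Longrightarrow> (f has_real_derivative f' y) (at y within {0..1})"
    and c: "continuous_on {0..1} f'" "continuous_on {0..1} \<rho>"
    and pos: "\<And>y. y \<in> {0..1} \<Longrightarrow> 0 < \<rho> y" and y: "y \<in> {0..1}"
  shows "(f y)\<^sup>2 \<le> 2 * (integral {0..1} (\<lambda>y. \<bar>f y\<bar>))\<^sup>2
    + 2 * (integral {0..1} (\<lambda>y. (f' y)\<^sup>2 / \<rho> y) * integral {0..1} \<rho>)"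
proof -
  have "continuous_on {0..1} f"
    by (rule DERIV_continuous_on) (use f in auto)
  then have "continuous_on {0..1} (\<lambda>y. \<bar>f y\<bar>)" by (intro continuous_intros)
  then obtain x where x: "x \<in> {0..1}" "\<bar>f x\<bar> \<le> integral {0..1} (\<lambda>y. \<bar>f y\<bar>)"
    using exists_le_mean by blast
  have "(f x)\<^sup>2 \<le> (integral {0..1} (\<lambda>y. \<bar>f y\<bar>))\<^sup>2"
    using power_mono[OF x(2), of 2] by simp
  moreover have "\<bar>f y - f x\<bar> \<le> integral {0..1} (\<lambda>y. \<bar>f' y\<bar>)"
    by (rule abs_diff_le_integral_deriv[OF f c(1) x(1) y])
  then have "(f y - f x)\<^sup>2 \<le> (integral {0..1} (\<lambda>y. \<bar>f' y * 1\<bar>))\<^sup>2"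
    by (simp flip: abs_le_square_iff)
  moreover have "\<dots> \<le> integral {0..1} (\<lambda>y. (f' y)\<^sup>2 / \<rho> y) * integral {0..1} (\<lambda>y. \<rho> y * 1\<^sup>2)"
    by (rule cauchy_schwarz_weighted) (use c pos in auto)
  moreover have "(f y)\<^sup>2 \<le> 2 * (f x)\<^sup>2 + 2 * (f y - f x)\<^sup>2"
    using zero_le_power2[of "f y - 2 * f x"] by (simp add: power2_eq_square algebra_simps)
  ultimately show ?thesis by simp
qed

lemma sqrt_mult_le: "0 \<le> x \<Longrightarrow> 0 \<le> y \<Longrightarrow> sqrt (x * y) \<le> x + y"
  by (rule order_trans[OF arith_geo_mean_sqrt]) auto

context bounded_flows
begin

lemma v_bounds: "s \<in> S \<Longrightarrow> y \<in> {0..1} \<Longrightarrow> t \<in> {0..T} \<Longrightarrow> 0 < v s y t"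
    "s \<in> S \<Longrightarrow> y \<in> {0..1} \<Longrightarrow> t \<in> {0..T} \<Longrightarrow> v s y t \<le> B"
    "s \<in> S \<Longrightarrow> y \<in> {0..1} \<Longrightarrow> t \<in> {0..T} \<Longrightarrow> 1 / B \<le> v s y t"
    "s \<in> S \<Longrightarrow> y \<in> {0..1} \<Longrightarrow> t \<in> {0..T} \<Longrightarrow> 1 / v s y t \<le> B"
    "s \<in> S \<Longrightarrow> y \<in> {0..1} \<Longrightarrow> t \<in> {0..T} \<Longrightarrow> 1 / B \<le> 1 / v s y t"
    "s \<in> S \<Longrightarrow> y \<in> {0..1} \<Longrightarrow> t \<in> {0..T} \<Longrightarrow> 0 < th s y t"
proof -
  assume a: "s \<in> S" "y \<in> {0..1}" "t \<in> {0..T}"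
  show v: "0 < v s y t" "v s y t \<le> B" "1 / B \<le> v s y t" "0 < th s y t"
    using v_pos[OF a(1)] th_pos[OF a(1)] bd[OF a(1,3,2)] a by auto
  then show "1 / v s y t \<le> B" "1 / B \<le> 1 / v s y t"
    using B_ge_1 by (auto simp: field_simps)
qed

definition cp :: real where "cp = 2 * (R * B + a)\<^sup>2"

lemma cp_pos: "0 < cp"
proof -
  have "0 < R * B + a" using param_pos B_ge_1 by (intro add_pos_pos mult_pos_pos) auto
  then show ?thesis by (simp add: cp_def)
qed

lemma p_square_le:
  assumes "s \<in> S" "y \<in> {0..1}" "t \<in> {0..T}"
  shows "(p s y t)\<^sup>2 \<le> cp * (1 + th s y t ^ 8)"
proof -
  let ?x = "th s y t"
  note vb = v_bounds[OF assms]
  have "R * ?x / v s y t = R * ?x * (1 / v s y t)" by simp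
  also have "\<dots> \<le> R * ?x * B" using vb param_pos by (intro mult_left_mono) auto
  also have "\<dots> = R * B * ?x" by simp
  also have "\<dots> \<le> R * B * (1 + ?x ^ 4)"
    using power_le_one_plus_power[of ?x 1 4] vb param_pos B_ge_1 by (intro mult_left_mono) auto
  finally have 1: "R * ?x / v s y t \<le> R * B * (1 + ?x ^ 4)" .
  have "a / 3 * ?x ^ 4 \<le> a * (1 + ?x ^ 4)"
    using vb param_pos by (intro mult_mono) auto
  with 1 have "p s y t \<le> (R * B + a) * (1 + ?x ^ 4)"
    unfolding p_def pressure_def by (simp add: algebra_simps)
  then have "(p s y t)\<^sup>2 \<le> ((R * B + a) * (1 + ?x ^ 4))\<^sup>2"
    using p_nonneg[OF assms(1)] assms by (intro power_mono) auto
  also have "\<dots> = (R * B + a)\<^sup>2 * (1 + ?x ^ 4)\<^sup>2" by (simp add: power_mult_distrib)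
  also have "\<dots> \<le> (R * B + a)\<^sup>2 * (2 * (1 + ?x ^ 8))"
  proof (rule mult_left_mono)
    have "0 \<le> (?x ^ 4 - 1)\<^sup>2" by simp
    then show "(1 + ?x ^ 4)\<^sup>2 \<le> 2 * (1 + ?x ^ 8)"
      by (simp add: power2_sum power2_diff flip: power_mult)
  qed simp
  finally show ?thesis by (simp add: cp_def algebra_simps)
qed

lemma th8_integral:
  assumes s: "s \<in> S" and t: "t \<in> {0..T}"
  shows "integral {0..1} (\<lambda>y. th s y t ^ 8) \<le> B * m s t * B"
proof (rule integral_mult_bound[where g = "\<lambda>y. th s y t ^ 4"])
  fix y :: real assume y: "y \<in> {0..1}"
  have "th s y t ^ 4 * th s y t ^ 4 \<le> B * m s t * th s y t ^ 4"
    using bd[OF s t y] by (intro mult_right_mono) auto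
  then show "th s y t ^ 8 \<le> B * m s t * th s y t ^ 4" by (simp flip: power_add)
qed (use s t bdi m_ge_1[OF s t] B_ge_1 in \<open>auto intro!: continuous_intros jcy\<close>)

section \<open>Dissipation of \<open>u\<close>, \<open>w\<close> and \<open>b\<close> without the
  weight \<open>1 / th\<close>\<close>

definition D :: "'s \<Rightarrow> real \<Rightarrow> real" where
  "D s t = integral {0..1} (\<lambda>y. (u_y s y t)\<^sup>2 + w_y s y t \<bullet> w_y s y t + b_y s y t \<bullet> b_y s y t)"

lemma cont_D: "s \<in> S \<Longrightarrow> continuous_on {0..T} (D s)"
  unfolding D_def by (rule jcont_integral) (auto intro!: continuous_intros jcs)

lemma D_nonneg: "s \<in> S \<Longrightarrow> t \<in> {0..T} \<Longrightarrow> 0 \<le> D s t"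
  unfolding D_def by (rule integral_nonneg_y) (auto intro!: continuous_intros jcy)

lemma m_integral_le:
  assumes "s \<in> S" "t \<in> {0..T}"
  shows "integral {0..t} (m s) \<le> B" "0 \<le> integral {0..t} (m s)"
proof -
  have "integral {0..t} (m s) \<le> integral {0..T} (m s)"
    by (rule integral_upper_mono[of T]) (use assms cont_m m_ge_1[OF assms(1)] in \<open>auto intro: order_trans[OF zero_le_one]\<close>)
  then show "integral {0..t} (m s) \<le> B" using bdi(4)[OF assms(1)] by simp
  show "0 \<le> integral {0..t} (m s)"
    by (rule integral_nonneg)
      (use assms cont_m[OF assms(1)] m_ge_1[OF assms(1)] in \<open>auto intro!: integrable_continuous_real
        intro: order_trans[OF zero_le_one] continuous_on_subset\<close>)
qed

text \<open>This is the mechanical part of the energy balance, without the heat equation. The only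
  term without a sign is the work \<open>p * u_y\<close>. Half of the viscous dissipation absorbs it
  and leaves \<open>p^2\<close>, of order \<open>1 + th^8\<close>, whose space integral is at most a
  multiple of \<open>m\<close> by \<open>th8_integral\<close>.\<close>

lemma D_integral: "\<exists>C>0. \<forall>s\<in>S. \<forall>t\<in>{0..T}. integral {0..t} (D s) \<le> C"
proof -
  define d0 where "d0 = 1 / B * min (lam / 2) (min mu nu)"
  have d0: "0 < d0" using param_pos B_ge_1 by (auto simp: d0_def)
  have d0': "d0 \<le> 1 / B * (lam / 2)" "d0 \<le> 1 / B * mu" "d0 \<le> 1 / B * nu"
    unfolding d0_def using B_ge_1 by (intro mult_left_mono; simp)+
  define c1 where "c1 = B * cp / (2 * lam)"
  have c1: "0 < c1" using B_ge_1 cp_pos param_pos by (auto simp: c1_def)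
  define f where "f s y t = (u s y t)\<^sup>2 / 2 + (w s y t \<bullet> w s y t) / 2 + v s y t * (b s y t \<bullet> b s y t) / 2" for s y t
  define f0 where "f0 = K\<^sup>2 / 2 + K\<^sup>2 / 2 + K * K\<^sup>2 / 2"
  define C where "C = 1 / d0 * (f0 + c1 * (1 + B * B) * B)"
  have "integral {0..t} (D s) \<le> C" if s: "s \<in> S" and t: "t \<in> {0..T}" for s t
  proof -
    have vb: "\<And>y r. y \<in> {0..1} \<Longrightarrow> r \<in> {0..T} \<Longrightarrow> 0 < v s y r \<and> v s y r \<le> B \<and> 1 / B \<le> 1 / v s y r"
      using v_bounds[OF s] by blast
    have "integral {0..1} (\<lambda>y. f s y t)
        + integral {0..t} (\<lambda>r. integral {0..1} (\<lambda>y. d0 * ((u_y s y r)\<^sup>2 + w_y s y r \<bullet> w_y s y r + b_y s y r \<bullet> b_y s y r)))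
      \<le> integral {0..1} (\<lambda>y. f s y 0) + integral {0..t} (\<lambda>r. c1 * (1 + B * B) * m s r)"
    proof (rule balance_law_dissipative[where T = T and f = "f s"
          and h = "\<lambda>y r. d0 * ((u_y s y r)\<^sup>2 + w_y s y r \<bullet> w_y s y r + b_y s y r \<bullet> b_y s y r)"
          and g = "\<lambda>y r. c1 * (1 + th s y r ^ 8)"
          and ft = "\<lambda>y t. u s y t * u_t s y t + w s y t \<bullet> w_t s y t + u_y s y t * (b s y t \<bullet> b s y t) / 2
            + v s y t * (b s y t \<bullet> b_t s y t)"
          and Z = "\<lambda>y t. u s y t * sg s y t + w s y t \<bullet> ta s y t + b s y t \<bullet> om s y t
            - u s y t * (b s y t \<bullet> b s y t) / 2 - w s y t \<bullet> b s y t"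
          and Zy = "\<lambda>y t. (u s y t * (u_t s y t + b s y t \<bullet> b_y s y t) + u_y s y t * sg s y t)
            + (w s y t \<bullet> w_t s y t + w_y s y t \<bullet> ta s y t)
            + (b s y t \<bullet> (v s y t *\<^sub>R b_t s y t + u_y s y t *\<^sub>R b s y t) + b_y s y t \<bullet> om s y t)
            - (u_y s y t * (b s y t \<bullet> b s y t) / 2 + u s y t * (b s y t \<bullet> b_y s y t))
            - (w s y t \<bullet> b_y s y t + w_y s y t \<bullet> b s y t)"])
      fix y r assume yr: "y \<in> {0..1::real}" "r \<in> {0..T}"
      show "(f s y has_real_derivative u s y r * u_t s y r + w s y r \<bullet> w_t s y r
          + u_y s y r * (b s y r \<bullet> b s y r) / 2 + v s y r * (b s y r \<bullet> b_t s y r)) (at r within {0..T})"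
        unfolding f_def using yr s
        by (auto intro!: derivative_eq_intros dt has_real_derivative_inner[OF dtv(1) dtv(1)]
            has_real_derivative_inner[OF dtv(2) dtv(2)] simp: inner_commute)
          (simp add: algebra_simps inner_commute)?
      show "((\<lambda>y. u s y r * sg s y r + w s y r \<bullet> ta s y r + b s y r \<bullet> om s y r
            - u s y r * (b s y r \<bullet> b s y r) / 2 - w s y r \<bullet> b s y r) has_real_derivative
          (u s y r * (u_t s y r + b s y r \<bullet> b_y s y r) + u_y s y r * sg s y r)
            + (w s y r \<bullet> w_t s y r + w_y s y r \<bullet> ta s y r)
            + (b s y r \<bullet> (v s y r *\<^sub>R b_t s y r + u_y s y r *\<^sub>R b s y r) + b_y s y r \<bullet> om s y r)
            - (u_y s y r * (b s y r \<bullet> b s y r) / 2 + u s y r * (b s y r \<bullet> b_y s y r))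
            - (w s y r \<bullet> b_y s y r + w_y s y r \<bullet> b s y r)) (at y within {0..1})"
        using yr s
        by (auto intro!: derivative_eq_intros dy dy_sg has_real_derivative_inner[OF dyv(1) dy_ta]
            has_real_derivative_inner[OF dyv(2) dy_om] has_real_derivative_inner[OF dyv(2) dyv(2)]
            has_real_derivative_inner[OF dyv(1) dyv(2)])
          (simp add: algebra_simps inner_commute)
      have vv: "0 < v s y r" "v s y r \<le> B" "1 / B \<le> 1 / v s y r" using vb[OF yr] by auto
      have uu: "- (u_y s y r * sg s y r) \<le> - (d0 * (u_y s y r)\<^sup>2) + c1 * (1 + th s y r ^ 8)"
      proof -
        have "u_y s y r * p s y r \<le> lam / (2 * v s y r) * (u_y s y r)\<^sup>2 + (p s y r)\<^sup>2 / (4 * (lam / (2 * v s y r)))"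
          by (rule young) (use vv param_pos in auto)
        also have "(p s y r)\<^sup>2 / (4 * (lam / (2 * v s y r))) = v s y r * ((p s y r)\<^sup>2 / (2 * lam))"
          using vv by simp
        also have "\<dots> \<le> B * (cp * (1 + th s y r ^ 8) / (2 * lam))"
          using vv param_pos p_square_le[OF s yr] by (intro mult_mono divide_right_mono) auto
        also have "\<dots> = c1 * (1 + th s y r ^ 8)" by (simp add: c1_def)
        finally have 1: "u_y s y r * p s y r \<le> lam / (2 * v s y r) * (u_y s y r)\<^sup>2 + c1 * (1 + th s y r ^ 8)" by simp
        have "d0 \<le> lam / 2 * (1 / v s y r)"
          using d0'(1) mult_left_mono[OF vv(3), of "lam / 2"] param_pos by simp
        then have "d0 * (u_y s y r)\<^sup>2 \<le> lam / 2 * (1 / v s y r) * (u_y s y r)\<^sup>2"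
          by (rule mult_right_mono) simp
        moreover have "u_y s y r * sg s y r = lam / (2 * v s y r) * (u_y s y r)\<^sup>2
            + lam / 2 * (1 / v s y r) * (u_y s y r)\<^sup>2 - u_y s y r * p s y r"
          using vv by (simp add: sg_def field_simps power2_eq_square)
        ultimately show ?thesis using 1 by linarith
      qed
      have dd: "d0 \<le> mu / v s y r" "d0 \<le> nu / v s y r"
        using d0'(2,3) mult_left_mono[OF vv(3), of mu] mult_left_mono[OF vv(3), of nu] param_pos by auto
      have ww: "d0 * (w_y s y r \<bullet> w_y s y r) \<le> mu / v s y r * (w_y s y r \<bullet> w_y s y r)"
        "d0 * (b_y s y r \<bullet> b_y s y r) \<le> nu / v s y r * (b_y s y r \<bullet> b_y s y r)"
        by (rule mult_right_mono[OF dd(1)], simp) (rule mult_right_mono[OF dd(2)], simp)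
      show "u s y r * u_t s y r + w s y r \<bullet> w_t s y r
          + u_y s y r * (b s y r \<bullet> b s y r) / 2 + v s y r * (b s y r \<bullet> b_t s y r)
          + d0 * ((u_y s y r)\<^sup>2 + w_y s y r \<bullet> w_y s y r + b_y s y r \<bullet> b_y s y r)
         \<le> c1 * (1 + th s y r ^ 8) + ((u s y r * (u_t s y r + b s y r \<bullet> b_y s y r) + u_y s y r * sg s y r)
            + (w s y r \<bullet> w_t s y r + w_y s y r \<bullet> ta s y r)
            + (b s y r \<bullet> (v s y r *\<^sub>R b_t s y r + u_y s y r *\<^sub>R b s y r) + b_y s y r \<bullet> om s y r)
            - (u_y s y r * (b s y r \<bullet> b s y r) / 2 + u s y r * (b s y r \<bullet> b_y s y r))
            - (w s y r \<bullet> b_y s y r + w_y s y r \<bullet> b s y r))"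
        using uu ww unfolding ta_def om_def
        by (simp add: inner_add_right inner_commute algebra_simps)
    next
      fix r assume r: "r \<in> {0..T}"
      have "integral {0..1} (\<lambda>y. c1 * (1 + th s y r ^ 8)) = c1 * (1 + integral {0..1} (\<lambda>y. th s y r ^ 8))"
        by (subst integral_mult_right, subst integral_add)
          (use s r in \<open>auto intro!: integrable_continuous_real continuous_intros jcy\<close>)
      also have "\<dots> \<le> c1 * (m s r + B * m s r * B)"
        using th8_integral[OF s r] m_ge_1[OF s r] c1 by (intro mult_left_mono add_mono) auto
      finally show "integral {0..1} (\<lambda>y. c1 * (1 + th s y r ^ 8)) \<le> c1 * (1 + B * B) * m s r"
        by (simp add: algebra_simps)
    qed (use s t in \<open>auto simp: f_def intro!: continuous_intros jcs cont_m simp: boundary sg_bdry\<close>)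
    moreover have "0 \<le> integral {0..1} (\<lambda>y. f s y t)"
      by (rule integral_nonneg_y) (use s t vb in \<open>auto simp: f_def less_imp_le intro!: continuous_intros jcy add_nonneg_nonneg\<close>)
    moreover have "integral {0..1} (\<lambda>y. f s y 0) \<le> f0"
    proof (rule integral_le_const)
      fix y :: real assume y: "y \<in> {0..1}"
      note i = init[OF s, of y]
      have "(u s y 0)\<^sup>2 \<le> K\<^sup>2"
        using i y param_pos by (simp flip: abs_le_square_iff)
      moreover have "v s y 0 * (b s y 0 \<bullet> b s y 0) \<le> K * K\<^sup>2"
        using i y param_pos v_pos[OF s, of y 0] by (intro mult_mono inner_le_square) auto
      moreover have "w s y 0 \<bullet> w s y 0 \<le> K\<^sup>2"
        using i y by (intro inner_le_square) auto
      ultimately show "f s y 0 \<le> f0" unfolding f_def f0_def by linarith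
    qed (use s param_pos in \<open>auto simp: f_def intro!: continuous_intros jcy\<close>)
    moreover have "integral {0..t} (\<lambda>r. c1 * (1 + B * B) * m s r) \<le> c1 * (1 + B * B) * B"
      using m_integral_le[OF s t] c1 by (simp add: mult_left_mono)
    ultimately have "d0 * integral {0..t} (D s) \<le> f0 + c1 * (1 + B * B) * B"
      by (simp add: D_def[abs_def])
    then show ?thesis using d0 by (simp add: C_def field_simps)
  qed
  moreover have "0 < C" unfolding C_def f0_def using d0 c1 B_ge_1 param_pos
    by (intro mult_pos_pos add_pos_pos add_nonneg_pos) auto
  ultimately show ?thesis by blast
qed

text \<open>The induction equation is tested with \<open>|b|^2 b\<close>. The compression term
  leaves \<open>3/4 u_y |b|^4\<close>, which is integrated by parts through the flux so that only
  \<open>u\<close> itself appears; \<open>u^2 |b|^4\<close> is at most a multiple of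
  \<open>m\<close> times the density, and Gronwall applies. The bound serves the magnetic force in
  the moment estimate of \<open>u\<close>.\<close>

lemma magnetic_dissipation:
  "\<exists>C>0. \<forall>s\<in>S. \<forall>t\<in>{0..T}.
    integral {0..t} (\<lambda>r. integral {0..1} (\<lambda>y. (b s y r \<bullet> b s y r) * (b_y s y r \<bullet> b_y s y r))) \<le> C"
proof -
  define d1 where "d1 = nu / (2 * B)"
  have d1: "0 < d1" using param_pos B_ge_1 by (simp add: d1_def)
  define c2 where "c2 = 9 * B / nu"
  have c2: "0 < c2" using param_pos B_ge_1 by (simp add: c2_def)
  define f where "f s y t = v s y t * (b s y t \<bullet> b s y t)\<^sup>2 / 4" for s y t
  define f0 where "f0 = K * (K\<^sup>2)\<^sup>2 / 4"
  define c3 where "c3 = c2 * B * B"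
  define c4 where "c4 = c2 * B * (4 * B)"
  define C where "C = 1 / d1 * (exp (c4 * B) * (f0 + c3 * B))"
  have c34: "0 < c3" "0 < c4" using c2 B_ge_1 by (auto simp: c3_def c4_def)
  have f0: "0 < f0" using param_pos by (auto simp: f0_def)
  let ?bb = "\<lambda>s y r. (b s y r \<bullet> b s y r) * (b_y s y r \<bullet> b_y s y r)"
  have "integral {0..t} (\<lambda>r. integral {0..1} (\<lambda>y. ?bb s y r)) \<le> C" if s: "s \<in> S" and t: "t \<in> {0..T}" for s t
  proof -
    define J where "J r = integral {0..1} (\<lambda>y. f s y r)" for r
    define ph where "ph r = integral {0..1} (\<lambda>y. d1 * ?bb s y r)" for r
    have jf: "jcont T (f s)" unfolding f_def using s by (auto intro!: continuous_intros jcs)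
    have cJ: "continuous_on {0..T} J" unfolding J_def by (rule jcont_integral[OF jf])
    have m0: "0 \<le> m s r" if "r \<in> {0..T}" for r using m_ge_1[OF s that] by simp
    have f_nonneg: "0 \<le> f s y r" if "y \<in> {0..1}" "r \<in> {0..T}" for y r
      using v_bounds[OF s that] by (simp add: f_def)
    have J0: "0 \<le> J r" if "r \<in> {0..T}" for r
      unfolding J_def using that f_nonneg by (intro integral_nonneg_y jcont_slice_y[OF jf]) auto
    have main: "J r + integral {0..r} ph \<le> J 0 + integral {0..r} (\<lambda>r. c4 * m s r * J r + c3 * m s r)"
      if r: "r \<in> {0..T}" for r
      unfolding J_def ph_def
    proof (rule balance_law_dissipative[where T = T and f = "f s" and h = "\<lambda>y r. d1 * ?bb s y r"
          and g = "\<lambda>y r. c2 * ((w s y r \<bullet> w s y r) * (b s y r \<bullet> b s y r) + (u s y r)\<^sup>2 * (b s y r \<bullet> b s y r)\<^sup>2)"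
          and ft = "\<lambda>y t. u_y s y t * (b s y t \<bullet> b s y t)\<^sup>2 / 4 + v s y t * (b s y t \<bullet> b s y t) * (b s y t \<bullet> b_t s y t)"
          and Z = "\<lambda>y t. (b s y t \<bullet> b s y t) * (b s y t \<bullet> om s y t) - 3 / 4 * (u s y t * (b s y t \<bullet> b s y t)\<^sup>2)"
          and Zy = "\<lambda>y t. 2 * (b s y t \<bullet> b_y s y t) * (b s y t \<bullet> om s y t)
            + (b s y t \<bullet> b s y t) * (b s y t \<bullet> (v s y t *\<^sub>R b_t s y t + u_y s y t *\<^sub>R b s y t) + b_y s y t \<bullet> om s y t)
            - 3 / 4 * (u_y s y t * (b s y t \<bullet> b s y t)\<^sup>2 + u s y t * (2 * (b s y t \<bullet> b s y t) * (2 * (b s y t \<bullet> b_y s y t))))"])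
      fix y r assume yr: "y \<in> {0..1::real}" "r \<in> {0..T}"
      show "(f s y has_real_derivative u_y s y r * (b s y r \<bullet> b s y r)\<^sup>2 / 4
          + v s y r * (b s y r \<bullet> b s y r) * (b s y r \<bullet> b_t s y r)) (at r within {0..T})"
        unfolding f_def using yr s
        by (auto intro!: derivative_eq_intros dt has_real_derivative_inner[OF dtv(2) dtv(2)])
          (simp add: algebra_simps inner_commute)
      show "((\<lambda>y. (b s y r \<bullet> b s y r) * (b s y r \<bullet> om s y r) - 3 / 4 * (u s y r * (b s y r \<bullet> b s y r)\<^sup>2))
          has_real_derivative 2 * (b s y r \<bullet> b_y s y r) * (b s y r \<bullet> om s y r)
            + (b s y r \<bullet> b s y r) * (b s y r \<bullet> (v s y r *\<^sub>R b_t s y r + u_y s y r *\<^sub>R b s y r) + b_y s y r \<bullet> om s y r)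
            - 3 / 4 * (u_y s y r * (b s y r \<bullet> b s y r)\<^sup>2 + u s y r * (2 * (b s y r \<bullet> b s y r) * (2 * (b s y r \<bullet> b_y s y r)))))
          (at y within {0..1})"
        using yr s
        by (auto intro!: derivative_eq_intros dy has_real_derivative_inner[OF dyv(2) dy_om]
             has_real_derivative_inner[OF dyv(2) dyv(2)])
          (simp add: algebra_simps inner_commute)
      have vv: "0 < v s y r" "v s y r \<le> B" "1 / B \<le> 1 / v s y r" using v_bounds[OF s yr] by auto
      define \<beta> where "\<beta> = norm (b s y r) * norm (b_y s y r)"
      define n where "n = nu / v s y r"
      have n: "0 < n" "2 * d1 \<le> n"
        using vv param_pos mult_left_mono[OF vv(3), of nu] by (auto simp: n_def d1_def)
      have \<beta>2: "\<beta>\<^sup>2 = ?bb s y r" by (simp add: \<beta>_def power_mult_distrib power2_norm_eq_inner)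
      have n9: "9 / n \<le> c2"
        using vv param_pos by (simp add: n_def c2_def divide_right_mono)
      have 1: "- (2 * (b s y r \<bullet> b_y s y r) * (b s y r \<bullet> w s y r)) \<le> 2 * (\<beta> * (norm (b s y r) * norm (w s y r)))"
      proof -
        have "\<bar>(b s y r \<bullet> b_y s y r) * (b s y r \<bullet> w s y r)\<bar> \<le> \<beta> * (norm (b s y r) * norm (w s y r))"
          unfolding \<beta>_def abs_mult by (intro mult_mono Cauchy_Schwarz_ineq2) auto
        then show ?thesis by linarith
      qed
      have 2: "- ((b s y r \<bullet> b s y r) * (b_y s y r \<bullet> w s y r)) \<le> \<beta> * (norm (b s y r) * norm (w s y r))"
      proof -
        have "\<bar>(b s y r \<bullet> b s y r) * (b_y s y r \<bullet> w s y r)\<bar> \<le> (norm (b s y r))\<^sup>2 * (norm (b_y s y r) * norm (w s y r))"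
          unfolding abs_mult by (intro mult_mono Cauchy_Schwarz_ineq2) (auto simp: power2_norm_eq_inner)
        then show ?thesis unfolding \<beta>_def by (simp add: power2_eq_square ac_simps)
      qed
      have 3: "3 * (u s y r * ((b s y r \<bullet> b s y r) * (b s y r \<bullet> b_y s y r))) \<le> 3 * (\<beta> * (\<bar>u s y r\<bar> * (b s y r \<bullet> b s y r)))"
      proof -
        have "\<bar>u s y r * ((b s y r \<bullet> b s y r) * (b s y r \<bullet> b_y s y r))\<bar> \<le> \<bar>u s y r\<bar> * ((b s y r \<bullet> b s y r) * \<beta>)"
          unfolding abs_mult \<beta>_def by (intro mult_mono Cauchy_Schwarz_ineq2) auto
        then show ?thesis by (simp add: ac_simps)
      qed
      have 4: "\<beta> * (3 * (norm (b s y r) * norm (w s y r))) \<le> n / 4 * \<beta>\<^sup>2 + 9 / n * ((w s y r \<bullet> w s y r) * (b s y r \<bullet> b s y r))"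
      proof -
        have "\<beta> * (3 * (norm (b s y r) * norm (w s y r)))
            \<le> n / 4 * \<beta>\<^sup>2 + (3 * (norm (b s y r) * norm (w s y r)))\<^sup>2 / (4 * (n / 4))"
          by (rule young) (use n in auto)
        also have "(3 * (norm (b s y r) * norm (w s y r)))\<^sup>2 / (4 * (n / 4))
            = 9 / n * ((w s y r \<bullet> w s y r) * (b s y r \<bullet> b s y r))"
          by (simp add: power_mult_distrib power2_norm_eq_inner)
        finally show ?thesis .
      qed
      have 5: "\<beta> * (3 * (\<bar>u s y r\<bar> * (b s y r \<bullet> b s y r))) \<le> n / 4 * \<beta>\<^sup>2 + 9 / n * ((u s y r)\<^sup>2 * (b s y r \<bullet> b s y r)\<^sup>2)"
      proof -
        have "\<beta> * (3 * (\<bar>u s y r\<bar> * (b s y r \<bullet> b s y r)))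
            \<le> n / 4 * \<beta>\<^sup>2 + (3 * (\<bar>u s y r\<bar> * (b s y r \<bullet> b s y r)))\<^sup>2 / (4 * (n / 4))"
          by (rule young) (use n in auto)
        also have "(3 * (\<bar>u s y r\<bar> * (b s y r \<bullet> b s y r)))\<^sup>2 / (4 * (n / 4))
            = 9 / n * ((u s y r)\<^sup>2 * (b s y r \<bullet> b s y r)\<^sup>2)"
          by (simp add: power_mult_distrib)
        finally show ?thesis .
      qed
      have 6: "9 / n * ((w s y r \<bullet> w s y r) * (b s y r \<bullet> b s y r) + (u s y r)\<^sup>2 * (b s y r \<bullet> b s y r)\<^sup>2)
          \<le> c2 * ((w s y r \<bullet> w s y r) * (b s y r \<bullet> b s y r) + (u s y r)\<^sup>2 * (b s y r \<bullet> b s y r)\<^sup>2)"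
        by (intro mult_right_mono n9) auto
      have 7: "(d1 + n / 4 + n / 4) * \<beta>\<^sup>2 \<le> n * \<beta>\<^sup>2" by (rule mult_right_mono) (use n in auto)
      have 8: "0 \<le> 2 * n * (b s y r \<bullet> b_y s y r)\<^sup>2" using n by simp
      have "u_y s y r * (b s y r \<bullet> b s y r)\<^sup>2 / 4 + v s y r * (b s y r \<bullet> b s y r) * (b s y r \<bullet> b_t s y r)
          - (2 * (b s y r \<bullet> b_y s y r) * (b s y r \<bullet> om s y r)
            + (b s y r \<bullet> b s y r) * (b s y r \<bullet> (v s y r *\<^sub>R b_t s y r + u_y s y r *\<^sub>R b s y r) + b_y s y r \<bullet> om s y r)
            - 3 / 4 * (u_y s y r * (b s y r \<bullet> b s y r)\<^sup>2 + u s y r * (2 * (b s y r \<bullet> b s y r) * (2 * (b s y r \<bullet> b_y s y r)))))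
          = - (2 * (b s y r \<bullet> b_y s y r) * (b s y r \<bullet> w s y r)) - 2 * n * (b s y r \<bullet> b_y s y r)\<^sup>2
            - (b s y r \<bullet> b s y r) * (b_y s y r \<bullet> w s y r) - n * \<beta>\<^sup>2
            + 3 * (u s y r * ((b s y r \<bullet> b s y r) * (b s y r \<bullet> b_y s y r)))"
        unfolding \<beta>2 n_def om_def
        by (simp add: inner_add_right inner_commute algebra_simps power2_eq_square)
      then show "u_y s y r * (b s y r \<bullet> b s y r)\<^sup>2 / 4 + v s y r * (b s y r \<bullet> b s y r) * (b s y r \<bullet> b_t s y r)
          + d1 * ?bb s y r
         \<le> c2 * ((w s y r \<bullet> w s y r) * (b s y r \<bullet> b s y r) + (u s y r)\<^sup>2 * (b s y r \<bullet> b s y r)\<^sup>2)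
          + (2 * (b s y r \<bullet> b_y s y r) * (b s y r \<bullet> om s y r)
            + (b s y r \<bullet> b s y r) * (b s y r \<bullet> (v s y r *\<^sub>R b_t s y r + u_y s y r *\<^sub>R b s y r) + b_y s y r \<bullet> om s y r)
            - 3 / 4 * (u_y s y r * (b s y r \<bullet> b s y r)\<^sup>2 + u s y r * (2 * (b s y r \<bullet> b s y r) * (2 * (b s y r \<bullet> b_y s y r)))))"
        using 1 2 3 4 5 6 7 8 unfolding \<beta>2[symmetric]
        by (simp add: algebra_simps)
    next
      fix r assume r: "r \<in> {0..T}"
      have "integral {0..1} (\<lambda>y. c2 * ((w s y r \<bullet> w s y r) * (b s y r \<bullet> b s y r) + (u s y r)\<^sup>2 * (b s y r \<bullet> b s y r)\<^sup>2))
          \<le> integral {0..1} (\<lambda>y. c4 * m s r * f s y r + c2 * B * m s r * (b s y r \<bullet> b s y r))"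
      proof (rule integral_mono_y)
        fix y :: real assume y: "y \<in> {0..1}"
        have vv: "0 < v s y r" "1 / B \<le> v s y r" using v_bounds[OF s y r] by auto
        have bb: "(b s y r \<bullet> b s y r)\<^sup>2 \<le> 4 * B * f s y r"
          using mult_right_mono[OF vv(2), of "B * (b s y r \<bullet> b s y r)\<^sup>2"] B_ge_1 by (simp add: f_def ac_simps)
        have "(u s y r)\<^sup>2 * (b s y r \<bullet> b s y r)\<^sup>2 \<le> B * m s r * (4 * B * f s y r)"
          using bd[OF s r y] bb m0[OF r] B_ge_1 by (intro mult_mono) auto
        moreover have "(w s y r \<bullet> w s y r) * (b s y r \<bullet> b s y r) \<le> B * m s r * (b s y r \<bullet> b s y r)"
          using bd[OF s r y] by (intro mult_right_mono) auto
        ultimately have "c2 * ((w s y r \<bullet> w s y r) * (b s y r \<bullet> b s y r) + (u s y r)\<^sup>2 * (b s y r \<bullet> b s y r)\<^sup>2)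
            \<le> c2 * (B * m s r * (b s y r \<bullet> b s y r) + B * m s r * (4 * B * f s y r))"
          using c2 by (intro mult_left_mono add_mono) auto
        then show "c2 * ((w s y r \<bullet> w s y r) * (b s y r \<bullet> b s y r) + (u s y r)\<^sup>2 * (b s y r \<bullet> b s y r)\<^sup>2)
            \<le> c4 * m s r * f s y r + c2 * B * m s r * (b s y r \<bullet> b s y r)"
          by (simp add: c4_def algebra_simps)
      qed (use s r jcont_slice_y[OF jf r] in \<open>auto intro!: continuous_intros jcy\<close>)
      also have "\<dots> = c4 * m s r * J r + c2 * B * m s r * integral {0..1} (\<lambda>y. b s y r \<bullet> b s y r)"
        unfolding J_def by (subst integral_add)
          (use s r jcont_slice_y[OF jf r] in \<open>auto intro!: integrable_continuous_real continuous_intros jcy\<close>)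
      also have "c2 * B * m s r * integral {0..1} (\<lambda>y. b s y r \<bullet> b s y r) \<le> c2 * B * m s r * B"
        using bdi(3)[OF s r] c2 B_ge_1 m0[OF r] by (intro mult_left_mono) auto
      finally show "integral {0..1} (\<lambda>y. c2 * ((w s y r \<bullet> w s y r) * (b s y r \<bullet> b s y r)
          + (u s y r)\<^sup>2 * (b s y r \<bullet> b s y r)\<^sup>2))
        \<le> c4 * m s r * integral {0..1} (\<lambda>y. f s y r) + c3 * m s r"
        by (simp add: J_def c3_def algebra_simps)
    qed (use s r cJ[unfolded J_def] in \<open>auto intro!: continuous_intros jcs jf cont_m simp: boundary\<close>)
    have "J t + integral {0..t} ph \<le> exp (integral {0..T} (\<lambda>r. c4 * m s r)) * (J 0 + integral {0..T} (\<lambda>r. c3 * m s r))"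
    proof (rule gronwall[OF cJ])
      show "continuous_on {0..T} ph"
        unfolding ph_def by (rule jcont_integral) (use s in \<open>auto intro!: continuous_intros jcs\<close>)
      show "0 \<le> ph r" if "r \<in> {0..T}" for r
        unfolding ph_def by (rule integral_nonneg_y) (use s that d1 in \<open>auto intro!: continuous_intros jcy\<close>)
    qed (use s t c34 m0 main J0 param_pos in \<open>auto intro!: continuous_intros cont_m\<close>)
    also have "\<dots> \<le> exp (c4 * B) * (f0 + c3 * B)"
    proof (intro mult_mono add_mono)
      show "exp (integral {0..T} (\<lambda>r. c4 * m s r)) \<le> exp (c4 * B)"
        using c34 bdi(4)[OF s] by (simp add: mult_left_mono)
      show "integral {0..T} (\<lambda>r. c3 * m s r) \<le> c3 * B"
        using c34 bdi(4)[OF s] by (simp add: mult_left_mono)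
      show "J 0 \<le> f0"
        unfolding J_def
      proof (rule integral_le_const)
        fix y :: real assume y: "y \<in> {0..1}"
        note i = init[OF s, of y]
        have "v s y 0 * (b s y 0 \<bullet> b s y 0)\<^sup>2 \<le> K * (K\<^sup>2)\<^sup>2"
          using i y param_pos v_pos[OF s, of y 0] by (intro mult_mono power_mono inner_le_square) auto
        then show "f s y 0 \<le> f0" unfolding f_def f0_def by simp
      qed (use param_pos in \<open>auto intro!: jcont_slice_y[OF jf]\<close>)
      show "0 \<le> J 0 + integral {0..T} (\<lambda>r. c3 * m s r)"
        using J0[of 0] m_integral_le[OF s, of T] c34 param_pos by auto
    qed auto
    finally have "integral {0..t} ph \<le> exp (c4 * B) * (f0 + c3 * B)" using J0[OF t] by simp
    then show ?thesis using d1 by (simp add: ph_def[abs_def] C_def field_simps)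
  qed
  moreover have "0 < C" unfolding C_def using d1 f0 c34 B_ge_1
    by (intro mult_pos_pos add_pos_pos) auto
  ultimately show ?thesis by blast
qed

end

section \<open>The quantity \<open>Phi\<close> and the reduction of \<open>v_y\<close> to the
  temperature gradient\<close>

context flows
begin

definition p_y :: "'s \<Rightarrow> real \<Rightarrow> real \<Rightarrow> real" where
  "p_y s y t = R * th_y s y t / v s y t - R * th s y t * v_y s y t / (v s y t)\<^sup>2
    + 4 / 3 * a * th s y t ^ 3 * th_y s y t"

text \<open>As \<open>v\<^sub>y / v = (ln v)\<^sub>y\<close> and \<open>v\<^sub>t = u\<^sub>y\<close>, the viscous term of the momentum equation is a time derivative,
  and \<open>\<Phi>\<^sub>t\<close> contains no second derivatives.\<close>

definition Phi :: "'s \<Rightarrow> real \<Rightarrow> real \<Rightarrow> real" where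
  "Phi s y t = lam * v_y s y t / v s y t - u s y t"

lemma jc_p_y: "s \<in> S \<Longrightarrow> jcont T (p_y s)"
  unfolding p_y_def by (auto intro!: continuous_intros jcs)

lemma jc_Phi: "s \<in> S \<Longrightarrow> jcont T (Phi s)"
  unfolding Phi_def by (auto intro!: continuous_intros jcs)

text \<open>No mixed derivative of \<open>v\<close> is available, so \<open>v_y\<close> cannot be
  differentiated in time directly. The identity for \<open>lam * ln v - U\<close> is first
  integrated in time and then differentiated in \<open>y\<close> under the integral sign; this
  exhibits \<open>Phi\<close> as a primitive in time of a continuous function.\<close>

lemma dt_Phi:
  assumes s: "s \<in> S" and y: "0 \<le> y" "y \<le> 1" and t: "0 \<le> t" "t \<le> T"
  shows "(Phi s y has_real_derivative p_y s y t + b s y t \<bullet> b_y s y t) (at t within {0..T})"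
proof -
  let ?q = "\<lambda>y t. p s y t + (b s y t \<bullet> b s y t) / 2"
  let ?qy = "\<lambda>y t. p_y s y t + b s y t \<bullet> b_y s y t"
  have Phi_eq: "Phi s y t = Phi s y 0 + integral {0..t} (\<lambda>r. ?qy y r)" if t: "t \<in> {0..T}" for t
  proof -
    have G: "lam * ln (v s x t) - U s x t = (lam * ln (v s x 0) - U s x 0) + integral {0..t} (\<lambda>r. ?q x r)"
      if x: "x \<in> {0..1}" for x
    proof -
      have "((\<lambda>r. ?q x r) has_integral (lam * ln (v s x t) - U s x t) - (lam * ln (v s x 0) - U s x 0)) {0..t}"
      proof (rule fundamental_theorem_of_calculus)
        fix r assume "r \<in> {0..t}"
        then have "((\<lambda>t. lam * ln (v s x t) - U s x t) has_real_derivative ?q x r) (at r within {0..T})"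
          using x t by (intro dt_lnv s) auto
        then show "((\<lambda>t. lam * ln (v s x t) - U s x t) has_vector_derivative ?q x r) (at r within {0..t})"
          using t by (auto simp flip: has_real_derivative_iff_has_vector_derivative
              intro: has_field_derivative_subset)
      qed (use t in auto)
      then show ?thesis by (simp add: integral_unique)
    qed
    have sub: "{0..1} \<times> {0..t} \<subseteq> {0..1} \<times> {0..T}" using t by auto
    have L: "((\<lambda>x. integral (cbox 0 t) (\<lambda>r. ?q x r)) has_real_derivative integral (cbox 0 t) (\<lambda>r. ?qy y r)) (at y within {0..1})"
    proof (rule leibniz_rule_field_derivative)
      fix x r :: real assume xr: "x \<in> {0..1}" "r \<in> cbox 0 t"
      then have xr': "x \<in> {0..1}" "r \<in> {0..T}" using t by auto
      have pos: "0 < v s x r" "0 < th s x r" using xr' v_pos[OF s] th_pos[OF s] by auto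
      show "((\<lambda>x. ?q x r) has_real_derivative ?qy x r) (at x within {0..1})"
        unfolding p_def pressure_def p_y_def using xr' s pos
        by (auto intro!: derivative_eq_intros dy has_real_derivative_inner[OF dyv(2) dyv(2)] simp: inner_commute)
          (simp add: field_simps power2_eq_square)
    next
      show "(\<lambda>r. ?q x r) integrable_on cbox 0 t" if "x \<in> {0..1}" for x
      proof -
        have "jcont T ?q" using s by (auto intro!: continuous_intros jcs)
        then have "continuous_on {0..t} (\<lambda>r. ?q x r)"
          using t that by (intro continuous_on_subset[OF jcont_slice_t[of T ?q]]) auto
        then show ?thesis unfolding box_real by (rule integrable_continuous_real)
      qed
      have "jcont T ?qy" using s by (auto intro!: continuous_intros jcs jc_p_y)
      then show "continuous_on ({0..1} \<times> cbox 0 t) (\<lambda>(x, r). ?qy x r)"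
        using continuous_on_subset[OF _ sub] by (auto simp: case_prod_unfold)
    qed (use y in auto)
    have M: "((\<lambda>x. lam * ln (v s x 0) - U s x 0) has_real_derivative Phi s y 0) (at y within {0..1})"
      unfolding Phi_def using s y param_pos v_pos[OF s, of y 0]
      by (auto intro!: derivative_eq_intros dy dy_U)
    have 1: "((\<lambda>x. (lam * ln (v s x 0) - U s x 0) + integral {0..t} (\<lambda>r. ?q x r)) has_real_derivative
        Phi s y 0 + integral {0..t} (\<lambda>r. ?qy y r)) (at y within {0..1})"
      using DERIV_add[OF M L] by simp
    have 2: "((\<lambda>x. lam * ln (v s x t) - U s x t) has_real_derivative Phi s y t) (at y within {0..1})"
      unfolding Phi_def using s y t v_pos[OF s, of y t]
      by (auto intro!: derivative_eq_intros dy dy_U)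
    have "((\<lambda>x. lam * ln (v s x t) - U s x t) has_real_derivative
        Phi s y 0 + integral {0..t} (\<lambda>r. ?qy y r)) (at y within {0..1})"
      by (rule has_field_derivative_transform_within[OF 1, of 1]) (use y G[symmetric] in auto)
    with 2 show ?thesis
      using vector_derivative_unique_within_closed_interval[of 0 1 y] y
      by (auto simp: has_real_derivative_iff_has_vector_derivative)
  qed
  have cont: "continuous_on {0..T} (\<lambda>r. ?qy y r)"
    by (rule jcont_slice_t) (use s y in \<open>auto intro!: continuous_intros jcs jc_p_y\<close>)
  have "((\<lambda>t. Phi s y 0 + integral {0..t} (\<lambda>r. ?qy y r)) has_real_derivative ?qy y t) (at t within {0..T})"
    using integral_has_real_derivative[OF cont, of t] t by (auto intro!: derivative_eq_intros)
  then show ?thesis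
    by (rule has_field_derivative_transform_within[of _ _ _ _ 1]) (use t Phi_eq[symmetric] in auto)
qed

end

context bounded_flows
begin

definition HH :: "'s \<Rightarrow> real \<Rightarrow> real" where
  "HH s t = sqrt (integral {0..1} (\<lambda>y. ((1 + th s y t ^ 3) * th_y s y t)\<^sup>2))"

lemma cont_HH: "s \<in> S \<Longrightarrow> continuous_on {0..T} (HH s)"
  unfolding HH_def by (intro continuous_intros jcont_integral) (auto intro!: continuous_intros jcs)

lemma HH_nonneg: "s \<in> S \<Longrightarrow> t \<in> {0..T} \<Longrightarrow> 0 \<le> HH s t"
  unfolding HH_def by (auto intro!: integral_nonneg_y continuous_intros jcy)

lemma th_u_square:
  assumes s: "s \<in> S" and t: "t \<in> {0..T}"
  shows "integral {0..1} (\<lambda>y. th s y t * (u s y t)\<^sup>2) \<le> 2 * B * m s t * B"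
proof (rule integral_mult_bound[where g = "\<lambda>y. (u s y t)\<^sup>2"])
  fix y :: real assume y: "y \<in> {0..1}"
  have "th s y t \<le> 1 + th s y t ^ 4"
    using power_le_one_plus_power[of "th s y t" 1 4] v_bounds(6)[OF s y t] by simp
  also have "\<dots> \<le> B * m s t + B * m s t"
  proof (rule add_mono)
    show "1 \<le> B * m s t" using B_ge_1 m_ge_1[OF s t] mult_mono[of 1 B 1 "m s t"] by simp
  qed (use bd[OF s t y] in auto)
  finally have "th s y t \<le> 2 * B * m s t" by simp
  then show "th s y t * (u s y t)\<^sup>2 \<le> 2 * B * m s t * (u s y t)\<^sup>2"
    by (rule mult_right_mono) simp
qed (use s t bdi m_ge_1[OF s t] B_ge_1 in \<open>auto intro!: continuous_intros jcy\<close>)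

text \<open>\<open>Phi\<close> is tested with itself. The part of \<open>p_y\<close> that contains
  \<open>v_y\<close> acts as damping and yields the integral of \<open>th * Phi^2\<close>. The
  temperature gradient is paired with the maximum in time of the norm of \<open>Phi\<close>, so that
  \<open>HH\<close> is needed only in \<open>L^1\<close> of time. The end time \<open>\<tau>\<close>
  is free because the final estimate at time \<open>t\<close> may involve integrals up to
  \<open>t\<close> only.\<close>

lemma Phi_bound:
  "\<exists>C>0. \<forall>s\<in>S. \<forall>\<tau>\<in>{0..T}. \<forall>t\<in>{0..\<tau>}.
    integral {0..1} (\<lambda>y. (Phi s y t)\<^sup>2)
    + integral {0..t} (\<lambda>r. integral {0..1} (\<lambda>y. th s y r * (Phi s y r)\<^sup>2))
    \<le> C * (1 + (integral {0..\<tau>} (HH s))\<^sup>2)"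
proof -
  obtain CD where CD: "CD > 0" "\<And>s t. s \<in> S \<Longrightarrow> t \<in> {0..T} \<Longrightarrow> integral {0..t} (D s) \<le> CD"
    using D_integral by blast
  define c0 where "c0 = R / (2 * lam * B)"
  define c1 where "c1 = R * B / (2 * lam)"
  define c3 where "c3 = R * B + 2 * a"
  define c4 where "c4 = c1 * (2 * B * B)"
  define F0 where "F0 = (2 * (lam * K * K)\<^sup>2 + 2 * K\<^sup>2) / 2"
  define C0 where "C0 = F0 + c4 * B"
  define C1 where "C1 = B * B + CD"
  have pos: "0 < c0" "0 < c1" "0 < c3" "0 < c4" "0 < F0" "0 < C0" "0 < C1"
    using param_pos B_ge_1 CD
    by (auto simp: c0_def c1_def c3_def c4_def F0_def C0_def C1_def intro!: add_pos_pos add_nonneg_pos)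
  define C where "C = (4 + 2 / c0) * (C0 + 2 * C1\<^sup>2 + 2 * c3\<^sup>2)"
  have C: "0 < C" unfolding C_def using pos by (intro mult_pos_pos add_pos_nonneg) auto
  have "integral {0..1} (\<lambda>y. (Phi s y t)\<^sup>2)
      + integral {0..t} (\<lambda>r. integral {0..1} (\<lambda>y. th s y r * (Phi s y r)\<^sup>2))
      \<le> C * (1 + (integral {0..\<tau>} (HH s))\<^sup>2)"
    if s: "s \<in> S" and \<tau>: "\<tau> \<in> {0..T}" and t: "t \<in> {0..\<tau>}" for s \<tau> t
  proof -
    have sub: "r \<in> {0..T}" if "r \<in> {0..\<tau>}" for r using that \<tau> by auto
    note jr = jcont_restrict[of T _ \<tau>]
    define N where "N r = integral {0..1} (\<lambda>y. (Phi s y r)\<^sup>2)" for r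
    have jPhi2: "jcont T (\<lambda>y r. (Phi s y r)\<^sup>2)" using s by (auto intro!: continuous_intros jc_Phi)
    have cN: "continuous_on {0..T} N" unfolding N_def by (rule jcont_integral[OF jPhi2])
    have N0: "0 \<le> N r" if "r \<in> {0..T}" for r
      unfolding N_def by (rule integral_nonneg_y) (use jcont_slice_y[OF jPhi2 that] in auto)
    obtain r0 where r0: "r0 \<in> {0..\<tau>}" "\<And>r. r \<in> {0..\<tau>} \<Longrightarrow> N r \<le> N r0"
      using continuous_attains_sup[of "{0..\<tau>}" N] continuous_on_subset[OF cN, of "{0..\<tau>}"] \<tau> by auto
    \<comment> \<open>\<open>X\<close> is the maximal norm of \<open>Phi\<close> on
      \<open>{0..\<tau>}\<close>. At the maximum point the estimate is quadratic in \<open>X\<close>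
      on the left and linear on the right, hence bounds \<open>X\<close>.\<close>
    define X where "X = sqrt (N r0)"
    have X: "0 \<le> X" "X\<^sup>2 = N r0" using N0[OF sub[OF r0(1)]] by (auto simp: X_def)
    have sqN: "sqrt (N r) \<le> X" if "r \<in> {0..\<tau>}" for r using r0(2)[OF that] by (simp add: X_def)
    define I where "I = integral {0..\<tau>} (HH s)"
    define G where "G r = c4 * m s r + X * (c3 * HH s r + (B * m s r + D s r))" for r
    have m0: "0 \<le> m s r" if "r \<in> {0..T}" for r using m_ge_1[OF s that] by simp
    have cG: "continuous_on {0..T} G"
      unfolding G_def by (intro continuous_intros cont_m cont_HH cont_D s)
    have G0: "0 \<le> G r" if "r \<in> {0..T}" for r
      unfolding G_def using that pos m0 X HH_nonneg[OF s] D_nonneg[OF s] B_ge_1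
      by (intro add_nonneg_nonneg mult_nonneg_nonneg) auto
    define h where "h y r = c0 * (th s y r * (Phi s y r)\<^sup>2)" for y r
    have jh: "jcont T h" unfolding h_def using s by (auto intro!: continuous_intros jcs jc_Phi)
    let ?g = "\<lambda>y r. c1 * (th s y r * (u s y r)\<^sup>2) + (c3 * \<bar>Phi s y r * ((1 + th s y r ^ 3) * th_y s y r)\<bar>
        + \<bar>Phi s y r * (b s y r \<bullet> b_y s y r)\<bar>)"
    have main: "integral {0..1} (\<lambda>y. (Phi s y r)\<^sup>2 / 2) + integral {0..r} (\<lambda>r. integral {0..1} (\<lambda>y. h y r))
        \<le> integral {0..1} (\<lambda>y. (Phi s y 0)\<^sup>2 / 2) + integral {0..r} G" if r: "r \<in> {0..\<tau>}" for r
    proof (rule balance_law_dissipative[where T = \<tau> and f = "\<lambda>y r. (Phi s y r)\<^sup>2 / 2" and h = h and g = ?g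
          and Z = "\<lambda>y t. 0" and Zy = "\<lambda>y t. 0"
          and ft = "\<lambda>y r. Phi s y r * (p_y s y r + b s y r \<bullet> b_y s y r)"])
      fix y q assume y: "y \<in> {0..1::real}" and q': "q \<in> {0..\<tau>}"
      have q: "q \<in> {0..T}" by (rule sub[OF q'])
      have "((\<lambda>q. (Phi s y q)\<^sup>2 / 2) has_real_derivative Phi s y q * (p_y s y q + b s y q \<bullet> b_y s y q)) (at q within {0..T})"
        using y q by (auto intro!: derivative_eq_intros dt_Phi s)
      then show "((\<lambda>q. (Phi s y q)\<^sup>2 / 2) has_real_derivative Phi s y q * (p_y s y q + b s y q \<bullet> b_y s y q)) (at q within {0..\<tau>})"
        by (rule has_field_derivative_subset) (use \<tau> in auto)
      note vb = v_bounds[OF s y q]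
      \<comment> \<open>\<open>z\<close> is the damping coefficient: \<open>R th v_y / v^2\<close>,
        which occurs in \<open>- p_y\<close>, equals \<open>z * (Phi + u)\<close> because
        \<open>v_y = v (Phi + u) / lam\<close>.\<close>
      define z where "z = R * th s y q / (lam * v s y q)"
      have zpos: "0 < z" using vb param_pos by (simp add: z_def)
      have z1: "c0 * th s y q \<le> z / 2"
        using mult_left_mono[OF vb(5), of "R * th s y q / (2 * lam)"] vb param_pos
        by (simp add: z_def c0_def field_simps)
      have z2: "z / 2 \<le> c1 * th s y q"
        using mult_left_mono[OF vb(4), of "R * th s y q / (2 * lam)"] vb param_pos
        by (simp add: z_def c1_def field_simps)
      have Rth: "R * th s y q * v_y s y q / (v s y q)\<^sup>2 = z * (Phi s y q + u s y q)"
        using vb param_pos by (simp add: z_def Phi_def field_simps power2_eq_square)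
      have 1: "- (Phi s y q * (z * (Phi s y q + u s y q))) \<le> - (z / 2 * (Phi s y q)\<^sup>2) + z / 2 * (u s y q)\<^sup>2"
      proof -
        have "0 \<le> z / 2 * (Phi s y q + u s y q)\<^sup>2" using zpos by simp
        then show ?thesis by (simp add: power2_eq_square algebra_simps)
      qed
      have 2: "z / 2 * (u s y q)\<^sup>2 \<le> c1 * (th s y q * (u s y q)\<^sup>2)"
        using mult_right_mono[OF z2, of "(u s y q)\<^sup>2"] by (simp add: ac_simps)
      have 3: "h y q \<le> z / 2 * (Phi s y q)\<^sup>2"
        using mult_right_mono[OF z1, of "(Phi s y q)\<^sup>2"] by (simp add: h_def ac_simps)
      have 4: "Phi s y q * (R * th_y s y q / v s y q + 4 / 3 * a * th s y q ^ 3 * th_y s y q)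
          \<le> c3 * \<bar>Phi s y q * ((1 + th s y q ^ 3) * th_y s y q)\<bar>"
      proof -
        have nn: "0 \<le> th s y q ^ 3" using vb by simp
        have "R / v s y q + 4 / 3 * a * th s y q ^ 3 \<le> R * B + 2 * a * th s y q ^ 3"
          using mult_left_mono[OF vb(4), of R] param_pos nn by (intro add_mono mult_right_mono) auto
        also have "\<dots> \<le> c3 * (1 + th s y q ^ 3)"
          using nn param_pos B_ge_1 by (simp add: c3_def algebra_simps)
        finally have le: "\<bar>R / v s y q + 4 / 3 * a * th s y q ^ 3\<bar> \<le> c3 * (1 + th s y q ^ 3)"
          using nn vb param_pos by (simp add: add_nonneg_nonneg)
        have "Phi s y q * (R * th_y s y q / v s y q + 4 / 3 * a * th s y q ^ 3 * th_y s y q)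
            = (R / v s y q + 4 / 3 * a * th s y q ^ 3) * (Phi s y q * th_y s y q)"
          by (simp add: algebra_simps)
        also have "\<dots> \<le> \<bar>(R / v s y q + 4 / 3 * a * th s y q ^ 3) * (Phi s y q * th_y s y q)\<bar>" by simp
        also have "\<dots> \<le> c3 * (1 + th s y q ^ 3) * \<bar>Phi s y q * th_y s y q\<bar>"
          unfolding abs_mult[of "R / v s y q + 4 / 3 * a * th s y q ^ 3"] by (rule mult_right_mono[OF le]) simp
        also have "\<dots> = c3 * \<bar>Phi s y q * ((1 + th s y q ^ 3) * th_y s y q)\<bar>"
          using nn by (simp add: abs_mult)
        finally show ?thesis .
      qed
      have "Phi s y q * (p_y s y q + b s y q \<bullet> b_y s y q)
          = Phi s y q * (R * th_y s y q / v s y q + 4 / 3 * a * th s y q ^ 3 * th_y s y q)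
            - Phi s y q * (z * (Phi s y q + u s y q)) + Phi s y q * (b s y q \<bullet> b_y s y q)"
        unfolding p_y_def Rth by (simp add: algebra_simps)
      then show "Phi s y q * (p_y s y q + b s y q \<bullet> b_y s y q) + h y q \<le> ?g y q + 0"
        using 1 2 3 4 abs_ge_self[of "Phi s y q * (b s y q \<bullet> b_y s y q)"] by linarith
    next
      fix q assume q': "q \<in> {0..\<tau>}"
      have q: "q \<in> {0..T}" by (rule sub[OF q'])
      let ?I1 = "integral {0..1} (\<lambda>y. \<bar>Phi s y q * ((1 + th s y q ^ 3) * th_y s y q)\<bar>)"
      let ?I2 = "integral {0..1} (\<lambda>y. \<bar>Phi s y q * (b s y q \<bullet> b_y s y q)\<bar>)"
      note cPhi = jcont_slice_y[OF jc_Phi[OF s] q]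
      have "?I1\<^sup>2 \<le> N q * integral {0..1} (\<lambda>y. ((1 + th s y q ^ 3) * th_y s y q)\<^sup>2)"
        unfolding N_def by (rule cauchy_schwarz_integral) (use s q cPhi in \<open>auto intro!: continuous_intros jcy\<close>)
      then have "?I1 \<le> sqrt (N q * integral {0..1} (\<lambda>y. ((1 + th s y q ^ 3) * th_y s y q)\<^sup>2))"
        by (rule real_le_rsqrt)
      also have "\<dots> = sqrt (N q) * HH s q" by (simp add: real_sqrt_mult HH_def)
      also have "\<dots> \<le> X * HH s q" using sqN[OF q'] HH_nonneg[OF s q] by (rule mult_right_mono)
      finally have I1: "?I1 \<le> X * HH s q" .
      have "?I2\<^sup>2 \<le> N q * integral {0..1} (\<lambda>y. (b s y q \<bullet> b_y s y q)\<^sup>2)"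
        unfolding N_def by (rule cauchy_schwarz_integral) (use s q cPhi in \<open>auto intro!: continuous_intros jcy\<close>)
      then have "?I2 \<le> sqrt (N q * integral {0..1} (\<lambda>y. (b s y q \<bullet> b_y s y q)\<^sup>2))"
        by (rule real_le_rsqrt)
      also have "\<dots> = sqrt (N q) * sqrt (integral {0..1} (\<lambda>y. (b s y q \<bullet> b_y s y q)\<^sup>2))" by (simp add: real_sqrt_mult)
      also have "\<dots> \<le> X * (B * m s q + D s q)"
      proof (rule mult_mono)
        have "integral {0..1} (\<lambda>y. (b s y q \<bullet> b_y s y q)\<^sup>2) \<le> B * m s q * D s q"
          unfolding D_def
        proof (rule integral_mult_bound[OF _ _ _ order.refl])
          fix y :: real assume y: "y \<in> {0..1}"
          have "(b s y q \<bullet> b_y s y q)\<^sup>2 \<le> (b s y q \<bullet> b s y q) * (b_y s y q \<bullet> b_y s y q)"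
            by (rule Cauchy_Schwarz_ineq)
          also have "\<dots> \<le> B * m s q * ((u_y s y q)\<^sup>2 + w_y s y q \<bullet> w_y s y q + b_y s y q \<bullet> b_y s y q)"
            using bd[OF s q y] m0[OF q] B_ge_1 by (intro mult_mono) auto
          finally show "(b s y q \<bullet> b_y s y q)\<^sup>2 \<le> B * m s q * ((u_y s y q)\<^sup>2 + w_y s y q \<bullet> w_y s y q + b_y s y q \<bullet> b_y s y q)" .
        qed (use s q m0[OF q] B_ge_1 in \<open>auto intro!: continuous_intros jcy\<close>)
        then have "sqrt (integral {0..1} (\<lambda>y. (b s y q \<bullet> b_y s y q)\<^sup>2)) \<le> sqrt (B * m s q * D s q)" by simp
        also have "\<dots> \<le> B * m s q + D s q"
          by (rule sqrt_mult_le) (use D_nonneg[OF s q] m0[OF q] B_ge_1 in auto)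
        finally show "sqrt (integral {0..1} (\<lambda>y. (b s y q \<bullet> b_y s y q)\<^sup>2)) \<le> B * m s q + D s q" .
      qed (use sqN[OF q'] X in \<open>auto intro!: integral_nonneg_y continuous_intros jcy s q\<close>)
      finally have I2: "?I2 \<le> X * (B * m s q + D s q)" .
      have "integral {0..1} (\<lambda>y. ?g y q) = integral {0..1} (\<lambda>y. c1 * (th s y q * (u s y q)\<^sup>2)
          + c3 * \<bar>Phi s y q * ((1 + th s y q ^ 3) * th_y s y q)\<bar> + \<bar>Phi s y q * (b s y q \<bullet> b_y s y q)\<bar>)"
        by (simp add: add.assoc)
      also have "\<dots> = c1 * integral {0..1} (\<lambda>y. th s y q * (u s y q)\<^sup>2) + c3 * ?I1 + ?I2"
        by (subst integral_add3) (use s q cPhi in \<open>auto intro!: continuous_intros jcy\<close>)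
      also have "\<dots> \<le> c1 * (2 * B * m s q * B) + c3 * (X * HH s q) + X * (B * m s q + D s q)"
        using th_u_square[OF s q] I1 I2 pos by (intro add_mono mult_left_mono) auto
      also have "\<dots> = G q" by (simp add: G_def c4_def algebra_simps)
      finally show "integral {0..1} (\<lambda>y. ?g y q) \<le> G q" .
    next
      show "jcont \<tau> h" by (rule jr[OF jh]) (use \<tau> in auto)
      show "jcont \<tau> ?g" by (rule jr) (use s \<tau> in \<open>auto intro!: continuous_intros jcs jc_Phi\<close>)
      show "jcont \<tau> (\<lambda>y r. (Phi s y r)\<^sup>2 / 2)" by (rule jr) (use s \<tau> in \<open>auto intro!: continuous_intros jcs jc_Phi\<close>)
      show "jcont \<tau> (\<lambda>y r. Phi s y r * (p_y s y r + b s y r \<bullet> b_y s y r))"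
        by (rule jr) (use s \<tau> in \<open>auto intro!: continuous_intros jcs jc_Phi jc_p_y\<close>)
      show "continuous_on {0..\<tau>} G" by (rule continuous_on_subset[OF cG]) (use \<tau> in auto)
    qed (use r in auto)
    have init': "integral {0..1} (\<lambda>y. (Phi s y 0)\<^sup>2 / 2) \<le> F0"
    proof (rule integral_le_const)
      fix y :: real assume y: "y \<in> {0..1}"
      note i = init[OF s, of y]
      have vp: "0 < v s y 0" using v_bounds(1)[OF s y] param_pos by auto
      have "1 / v s y 0 \<le> K" using i y param_pos vp by (auto simp: field_simps)
      then have "lam * (\<bar>v_y s y 0\<bar> * (1 / v s y 0)) \<le> lam * (K * K)"
        using i y param_pos vp by (intro mult_left_mono mult_mono) auto
      then have "\<bar>lam * v_y s y 0 / v s y 0\<bar> \<le> lam * K * K"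
        using param_pos vp by (simp add: abs_mult)
      then have "\<bar>lam * v_y s y 0 / v s y 0\<bar>\<^sup>2 \<le> (lam * K * K)\<^sup>2"
        by (rule power_mono) simp
      then have q1: "(lam * v_y s y 0 / v s y 0)\<^sup>2 \<le> (lam * K * K)\<^sup>2" by (simp only: power2_abs)
      have q2: "(u s y 0)\<^sup>2 \<le> K\<^sup>2" using i y param_pos by (simp flip: abs_le_square_iff)
      have "(Phi s y 0)\<^sup>2 \<le> 2 * (lam * v_y s y 0 / v s y 0)\<^sup>2 + 2 * (u s y 0)\<^sup>2"
        using zero_le_power2[of "lam * v_y s y 0 / v s y 0 + u s y 0"]
        unfolding Phi_def by (simp add: power2_sum power2_diff)
      also have "\<dots> \<le> 2 * (lam * K * K)\<^sup>2 + 2 * K\<^sup>2"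
        by (intro add_mono mult_left_mono q1 q2) auto
      finally show "(Phi s y 0)\<^sup>2 / 2 \<le> F0" unfolding F0_def by (rule divide_right_mono) simp
    qed (use s param_pos in \<open>auto intro!: continuous_intros jcont_slice_y[OF jc_Phi]\<close>)
    have intG: "integral {0..r} G \<le> c4 * B + X * (c3 * I + C1)" if r: "r \<in> {0..\<tau>}" for r
    proof -
      have int: "m s integrable_on {0..\<tau>}" "HH s integrable_on {0..\<tau>}" "D s integrable_on {0..\<tau>}"
        using \<tau> s by (auto intro!: integrable_continuous_real intro: continuous_on_subset[OF cont_m]
            continuous_on_subset[OF cont_HH] continuous_on_subset[OF cont_D])
      have "integral {0..r} G \<le> integral {0..\<tau>} G"
        by (rule integral_upper_mono[OF cG]) (use G0 r \<tau> in auto)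
      also have "\<dots> = c4 * integral {0..\<tau>} (m s) + X * (c3 * I + (B * integral {0..\<tau>} (m s) + integral {0..\<tau>} (D s)))"
        unfolding G_def I_def
        by (intro integral_unique has_integral_add has_integral_mult_right integrable_integral int)
      also have "\<dots> \<le> c4 * B + X * (c3 * I + C1)"
        unfolding C1_def
        using m_integral_le[OF s \<tau>] CD(2)[OF s \<tau>] pos X B_ge_1
        by (intro add_mono mult_left_mono) auto
      finally show ?thesis .
    qed
    have h0: "0 \<le> integral {0..r} (\<lambda>r. integral {0..1} (\<lambda>y. h y r))" if "r \<in> {0..\<tau>}" for r
    proof (rule integral_nonneg)
      show "(\<lambda>r. integral {0..1} (\<lambda>y. h y r)) integrable_on {0..r}"
        by (rule jcont_integrable_t[OF jh sub[OF that]])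
      fix q assume "q \<in> {0..r}"
      then have q: "q \<in> {0..T}" using that \<tau> by auto
      show "0 \<le> integral {0..1} (\<lambda>y. h y q)"
        by (rule integral_nonneg_y[OF jcont_slice_y[OF jh q]])
          (use v_bounds(6)[OF s _ q] pos in \<open>auto simp: h_def less_imp_le\<close>)
    qed
    define Q where "Q = c3 * I + C1"
    have est: "N r / 2 + integral {0..r} (\<lambda>r. integral {0..1} (\<lambda>y. h y r)) \<le> C0 + X * Q" if r: "r \<in> {0..\<tau>}" for r
      using main[OF r] init' intG[OF r] by (simp add: N_def C0_def Q_def)
    have XQ: "X * Q \<le> X\<^sup>2 / 4 + Q\<^sup>2"
      using zero_le_power2[of "X / 2 - Q"] by (simp add: power2_diff power_divide)
    have X2: "X\<^sup>2 / 4 \<le> C0 + Q\<^sup>2"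
      using est[OF r0(1)] h0[OF r0(1)] XQ X(2) by linarith
    have Q2: "Q\<^sup>2 \<le> 2 * c3\<^sup>2 * I\<^sup>2 + 2 * C1\<^sup>2"
      using zero_le_power2[of "c3 * I - C1"] unfolding Q_def
      by (simp add: power2_sum power2_diff power_mult_distrib algebra_simps)
    define W where "W = C0 + Q\<^sup>2"
    have W: "W \<le> (C0 + 2 * C1\<^sup>2 + 2 * c3\<^sup>2) * (1 + I\<^sup>2)"
    proof -
      have "0 \<le> (C0 + 2 * C1\<^sup>2) * I\<^sup>2 + 2 * c3\<^sup>2" using pos by (intro add_nonneg_nonneg mult_nonneg_nonneg) auto
      then show ?thesis using Q2 by (simp add: W_def algebra_simps)
    qed
    have X2': "X\<^sup>2 / 4 \<le> W" using X2 by (simp only: W_def)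
    have Nt: "N t \<le> 4 * W" using r0(2)[OF t] X2' X(2) by linarith
    have "integral {0..t} (\<lambda>r. integral {0..1} (\<lambda>y. h y r)) \<le> 2 * W"
      using est[OF t] XQ X2' N0[OF sub[OF t]] W_def by linarith
    moreover have "integral {0..t} (\<lambda>r. integral {0..1} (\<lambda>y. h y r))
        = c0 * integral {0..t} (\<lambda>r. integral {0..1} (\<lambda>y. th s y r * (Phi s y r)\<^sup>2))"
      by (simp add: h_def)
    ultimately have "integral {0..t} (\<lambda>r. integral {0..1} (\<lambda>y. th s y r * (Phi s y r)\<^sup>2)) \<le> 2 / c0 * W"
      using pos by (simp add: field_simps)
    with Nt have "N t + integral {0..t} (\<lambda>r. integral {0..1} (\<lambda>y. th s y r * (Phi s y r)\<^sup>2)) \<le> (4 + 2 / c0) * W"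
      by (simp add: algebra_simps)
    also have "\<dots> \<le> (4 + 2 / c0) * ((C0 + 2 * C1\<^sup>2 + 2 * c3\<^sup>2) * (1 + I\<^sup>2))"
      using W pos by (intro mult_left_mono) auto
    finally show ?thesis by (simp add: N_def I_def C_def)
  qed
  then show ?thesis using C by blast
qed

text \<open>\<open>v_y = v (Phi + u) / lam\<close> carries the bound over from \<open>Phi\<close>;
  what \<open>u\<close> contributes is bounded by the energy and by
  \<open>th_u_square\<close>.\<close>

lemma v_y_bound:
  "\<exists>C>0. \<forall>s\<in>S. \<forall>\<tau>\<in>{0..T}. \<forall>t\<in>{0..\<tau>}.
    integral {0..1} (\<lambda>y. (v_y s y t)\<^sup>2)
    + integral {0..t} (\<lambda>r. integral {0..1} (\<lambda>y. th s y r * (v_y s y r)\<^sup>2))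
    \<le> C * (1 + (integral {0..\<tau>} (HH s))\<^sup>2)"
proof -
  obtain C where C: "C > 0" and C': "\<And>s \<tau> t. s \<in> S \<Longrightarrow> \<tau> \<in> {0..T} \<Longrightarrow> t \<in> {0..\<tau>} \<Longrightarrow>
    integral {0..1} (\<lambda>y. (Phi s y t)\<^sup>2)
    + integral {0..t} (\<lambda>r. integral {0..1} (\<lambda>y. th s y r * (Phi s y r)\<^sup>2))
    \<le> C * (1 + (integral {0..\<tau>} (HH s))\<^sup>2)"
    using Phi_bound by blast
  define e where "e = 2 * B\<^sup>2 / lam\<^sup>2"
  have e: "0 < e" using param_pos B_ge_1 by (simp add: e_def)
  define C2 where "C2 = e * (C + (B + 2 * B * B * B))"
  have C2: "0 < C2" unfolding C2_def using e C B_ge_1 by (intro mult_pos_pos add_pos_pos) auto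
  have "integral {0..1} (\<lambda>y. (v_y s y t)\<^sup>2)
      + integral {0..t} (\<lambda>r. integral {0..1} (\<lambda>y. th s y r * (v_y s y r)\<^sup>2))
      \<le> C2 * (1 + (integral {0..\<tau>} (HH s))\<^sup>2)"
    if s: "s \<in> S" and \<tau>: "\<tau> \<in> {0..T}" and t: "t \<in> {0..\<tau>}" for s \<tau> t
  proof -
    have t': "t \<in> {0..T}" using t \<tau> by auto
    have pt: "(v_y s y r)\<^sup>2 \<le> e * ((Phi s y r)\<^sup>2 + (u s y r)\<^sup>2)" if y: "y \<in> {0..1}" and r: "r \<in> {0..T}" for y r
    proof -
      note vb = v_bounds[OF s y r]
      have "v_y s y r = v s y r * (Phi s y r + u s y r) / lam"
        using vb param_pos by (simp add: Phi_def)
      then have "(v_y s y r)\<^sup>2 = (v s y r)\<^sup>2 * (Phi s y r + u s y r)\<^sup>2 / lam\<^sup>2"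
        by (simp add: power_mult_distrib power_divide)
      also have "\<dots> \<le> B\<^sup>2 * (2 * ((Phi s y r)\<^sup>2 + (u s y r)\<^sup>2)) / lam\<^sup>2"
      proof -
        have "(Phi s y r + u s y r)\<^sup>2 \<le> 2 * ((Phi s y r)\<^sup>2 + (u s y r)\<^sup>2)"
          using zero_le_power2[of "Phi s y r - u s y r"] by (simp add: power2_sum power2_diff)
        then show ?thesis using vb param_pos by (intro divide_right_mono mult_mono power_mono) auto
      qed
      finally show ?thesis by (simp add: e_def algebra_simps add_divide_distrib)
    qed
    have A: "integral {0..1} (\<lambda>y. (v_y s y t)\<^sup>2) \<le> e * (integral {0..1} (\<lambda>y. (Phi s y t)\<^sup>2) + B)"
    proof (rule integral_mult_bound[where g = "\<lambda>y. (Phi s y t)\<^sup>2 + (u s y t)\<^sup>2"])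
      have "integral {0..1} (\<lambda>y. (Phi s y t)\<^sup>2 + (u s y t)\<^sup>2) = integral {0..1} (\<lambda>y. (Phi s y t)\<^sup>2) + integral {0..1} (\<lambda>y. (u s y t)\<^sup>2)"
        by (intro integral_add integrable_continuous_real)
          (use s t' jcont_slice_y[OF jc_Phi] in \<open>auto intro!: continuous_intros jcy\<close>)
      then show "integral {0..1} (\<lambda>y. (Phi s y t)\<^sup>2 + (u s y t)\<^sup>2) \<le> integral {0..1} (\<lambda>y. (Phi s y t)\<^sup>2) + B"
        using bdi(2)[OF s t'] by simp
    qed (use s t' e pt jcont_slice_y[OF jc_Phi] in \<open>auto intro!: continuous_intros jcy\<close>)
    have "integral {0..t} (\<lambda>r. integral {0..1} (\<lambda>y. th s y r * (v_y s y r)\<^sup>2))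
        \<le> integral {0..t} (\<lambda>r. e * (integral {0..1} (\<lambda>y. th s y r * (Phi s y r)\<^sup>2) + 2 * B * B * m s r))"
    proof (rule integral_le)
      fix r assume "r \<in> {0..t}"
      then have r: "r \<in> {0..T}" using t' by auto
      show "integral {0..1} (\<lambda>y. th s y r * (v_y s y r)\<^sup>2)
          \<le> e * (integral {0..1} (\<lambda>y. th s y r * (Phi s y r)\<^sup>2) + 2 * B * B * m s r)"
      proof (rule integral_mult_bound[where g = "\<lambda>y. th s y r * (Phi s y r)\<^sup>2 + th s y r * (u s y r)\<^sup>2"])
        fix y :: real assume y: "y \<in> {0..1}"
        show "th s y r * (v_y s y r)\<^sup>2 \<le> e * (th s y r * (Phi s y r)\<^sup>2 + th s y r * (u s y r)\<^sup>2)"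
          using mult_left_mono[OF pt[OF y r], of "th s y r"] v_bounds(6)[OF s y r] by (simp add: algebra_simps)
      next
        have "integral {0..1} (\<lambda>y. th s y r * (Phi s y r)\<^sup>2 + th s y r * (u s y r)\<^sup>2)
            = integral {0..1} (\<lambda>y. th s y r * (Phi s y r)\<^sup>2) + integral {0..1} (\<lambda>y. th s y r * (u s y r)\<^sup>2)"
          by (intro integral_add integrable_continuous_real)
            (use s r jcont_slice_y[OF jc_Phi] in \<open>auto intro!: continuous_intros jcy\<close>)
        then show "integral {0..1} (\<lambda>y. th s y r * (Phi s y r)\<^sup>2 + th s y r * (u s y r)\<^sup>2)
            \<le> integral {0..1} (\<lambda>y. th s y r * (Phi s y r)\<^sup>2) + 2 * B * B * m s r"
          using th_u_square[OF s r] by (simp add: ac_simps)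
      qed (use s r e jcont_slice_y[OF jc_Phi] in \<open>auto intro!: continuous_intros jcy\<close>)
    next
      show "(\<lambda>r. integral {0..1} (\<lambda>y. th s y r * (v_y s y r)\<^sup>2)) integrable_on {0..t}"
        by (rule jcont_integrable_t[OF _ t']) (use s in \<open>auto intro!: continuous_intros jcs\<close>)
      show "(\<lambda>r. e * (integral {0..1} (\<lambda>y. th s y r * (Phi s y r)\<^sup>2) + 2 * B * B * m s r)) integrable_on {0..t}"
      proof -
        have "jcont T (\<lambda>y r. th s y r * (Phi s y r)\<^sup>2)"
          using s by (auto intro!: continuous_intros jcs jc_Phi)
        from jcont_integral[OF this]
        have "continuous_on {0..T} (\<lambda>r. e * (integral {0..1} (\<lambda>y. th s y r * (Phi s y r)\<^sup>2) + 2 * B * B * m s r))"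
          by (intro continuous_intros cont_m s)
        then show ?thesis
          using t' by (intro integrable_continuous_real) (auto intro: continuous_on_subset)
      qed
    qed
    also have "\<dots> = e * (integral {0..t} (\<lambda>r. integral {0..1} (\<lambda>y. th s y r * (Phi s y r)\<^sup>2)) + 2 * B * B * integral {0..t} (m s))"
    proof -
      have "(\<lambda>r. integral {0..1} (\<lambda>y. th s y r * (Phi s y r)\<^sup>2)) integrable_on {0..t}"
        by (rule jcont_integrable_t[OF _ t']) (use s in \<open>auto intro!: continuous_intros jcs jc_Phi\<close>)
      moreover have "m s integrable_on {0..t}"
        using s t' by (auto intro!: integrable_continuous_real continuous_on_subset[OF cont_m[OF s]])
      ultimately show ?thesis
        by (intro integral_unique has_integral_add has_integral_mult_right integrable_integral)
    qed
    also have "\<dots> \<le> e * (integral {0..t} (\<lambda>r. integral {0..1} (\<lambda>y. th s y r * (Phi s y r)\<^sup>2)) + 2 * B * B * B)"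
      using m_integral_le[OF s t'] e B_ge_1 by (intro mult_left_mono add_left_mono) auto
    finally have "integral {0..1} (\<lambda>y. (v_y s y t)\<^sup>2)
      + integral {0..t} (\<lambda>r. integral {0..1} (\<lambda>y. th s y r * (v_y s y r)\<^sup>2))
      \<le> e * ((integral {0..1} (\<lambda>y. (Phi s y t)\<^sup>2)
        + integral {0..t} (\<lambda>r. integral {0..1} (\<lambda>y. th s y r * (Phi s y r)\<^sup>2))) + (B + 2 * B * B * B))"
      using A by (simp add: algebra_simps)
    also have "\<dots> \<le> e * (C * (1 + (integral {0..\<tau>} (HH s))\<^sup>2) + (B + 2 * B * B * B) * (1 + (integral {0..\<tau>} (HH s))\<^sup>2))"
    proof (intro mult_left_mono add_mono)
      have "0 \<le> B + 2 * B * B * B" using B_ge_1 by simp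
      then have "(B + 2 * B * B * B) * 1 \<le> (B + 2 * B * B * B) * (1 + (integral {0..\<tau>} (HH s))\<^sup>2)"
        by (intro mult_left_mono) auto
      then show "B + 2 * B * B * B \<le> (B + 2 * B * B * B) * (1 + (integral {0..\<tau>} (HH s))\<^sup>2)" by simp
    qed (use C'[OF s \<tau> t] e in auto)
    finally show ?thesis by (simp add: C2_def algebra_simps)
  qed
  then show ?thesis using C2 by blast
qed

text \<open>Growth of \<open>kap\<close> at least like \<open>1 + th^2\<close> makes a multiple of
  \<open>dissip\<close> dominate \<open>th_y^2\<close> without weight. With the weight
  \<open>th^4\<close> this yields a bound of \<open>th^6\<close> by a multiple of \<open>m\<close>,
  so the square of \<open>HH\<close> is at most a multiple of \<open>m^2\<close>. No second
  derivatives enter in this case.\<close>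

lemma HH_integral_large_conductivity:
  assumes k2: "0 < k2" and kap: "\<And>s y t. s \<in> S \<Longrightarrow> y \<in> {0..1} \<Longrightarrow> t \<in> {0..T} \<Longrightarrow> k2 * (1 + (th s y t)\<^sup>2) \<le> kap s y t"
  shows "\<exists>C>0. \<forall>s\<in>S. \<forall>t\<in>{0..T}. integral {0..t} (HH s) \<le> C"
proof -
  define e where "e = B / k2"
  have e: "0 < e" using k2 B_ge_1 by (simp add: e_def)
  define c where "c = 2 * (2 + B)\<^sup>2 + 18 * (e * B)"
  have c: "0 < c" using e B_ge_1 by (auto simp: c_def intro!: add_pos_pos)
  define C where "C = sqrt (2 * (1 + c) * e)"
  have C: "0 < C" using c e by (simp add: C_def)
  have *: "HH s t \<le> C * m s t" if s: "s \<in> S" and t: "t \<in> {0..T}" for s t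
  proof -
    have m1: "1 \<le> m s t" by (rule m_ge_1[OF s t])
    have pt: "(th_y s y t)\<^sup>2 \<le> e * dissip s y t" if y: "y \<in> {0..1}" for y
    proof -
      note vb = v_bounds[OF s y t]
      have k0: "0 \<le> kap s y t" using dissip_lower(5)[OF s] y t param_pos by fastforce
      have "k2 * (th s y t)\<^sup>2 \<le> kap s y t"
        using kap[OF s y t] k2 by (simp add: algebra_simps)
      then have "k2 * (th_y s y t)\<^sup>2 / v s y t \<le> kap s y t * (th_y s y t)\<^sup>2 / (v s y t * (th s y t)\<^sup>2)"
        using vb mult_right_mono[of "k2 * (th s y t)\<^sup>2" "kap s y t" "(th_y s y t)\<^sup>2"]
        by (simp add: field_simps)
      also have "\<dots> \<le> dissip s y t" using dissip_lower(7)[OF s] y t by auto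
      finally have "k2 * (th_y s y t)\<^sup>2 \<le> v s y t * dissip s y t" using vb by (simp add: field_simps)
      also have "\<dots> \<le> B * dissip s y t" using vb dissip_lower(8)[OF s, of y t] y t by (intro mult_right_mono) auto
      finally show ?thesis using k2 by (simp add: e_def field_simps)
    qed
    have th6: "(th s y t ^ 3)\<^sup>2 \<le> c * m s t" if y: "y \<in> {0..1}" for y
    proof -
      have "(th s y t ^ 3)\<^sup>2 \<le> 2 * (integral {0..1} (\<lambda>y. \<bar>th s y t ^ 3\<bar>))\<^sup>2
          + 2 * (integral {0..1} (\<lambda>y. (3 * (th s y t)\<^sup>2 * th_y s y t)\<^sup>2 / (th s y t ^ 4)) * integral {0..1} (\<lambda>y. th s y t ^ 4))"
        by (rule sup_square_bound_mean[where f = "\<lambda>y. th s y t ^ 3"])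
          (use s t y v_bounds(6)[OF s _ t] in \<open>auto intro!: derivative_eq_intros dy continuous_intros jcy\<close>)
      also have "\<dots> \<le> 2 * (2 + B)\<^sup>2 + 2 * (9 * e * m s t * B)"
      proof (intro add_mono mult_left_mono mult_mono power_mono)
        have "integral {0..1} (\<lambda>y. \<bar>th s y t ^ 3\<bar>) \<le> integral {0..1} (\<lambda>y. 1 + th s y t ^ 4)"
        proof (rule integral_mono_y)
          fix y :: real assume y: "y \<in> {0..1}"
          have th: "0 \<le> th s y t" using v_bounds(6)[OF s y t] by simp
          then have "\<bar>th s y t ^ 3\<bar> = th s y t ^ 3" by simp
          also have "\<dots> \<le> 1 + th s y t ^ 4" using th by (intro power_le_one_plus_power) auto
          finally show "\<bar>th s y t ^ 3\<bar> \<le> 1 + th s y t ^ 4" .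
        qed (use s t in \<open>auto intro!: continuous_intros jcy\<close>)
        also have "\<dots> = 1 + integral {0..1} (\<lambda>y. th s y t ^ 4)"
          by (subst integral_add) (use s t in \<open>auto intro!: integrable_continuous_real continuous_intros jcy\<close>)
        also have "\<dots> \<le> 2 + B" using bdi(1)[OF s t] by simp
        finally show "integral {0..1} (\<lambda>y. \<bar>th s y t ^ 3\<bar>) \<le> 2 + B" .
        show "integral {0..1} (\<lambda>y. (3 * (th s y t)\<^sup>2 * th_y s y t)\<^sup>2 / (th s y t ^ 4)) \<le> 9 * e * m s t"
        proof (rule dissip_le_m[OF s t])
          fix y :: real assume y: "y \<in> {0..1}"
          have "(3 * (th s y t)\<^sup>2 * th_y s y t)\<^sup>2 / (th s y t ^ 4) = 9 * (th_y s y t)\<^sup>2"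
            using v_bounds(6)[OF s y t] by (simp add: power_mult_distrib flip: power_mult)
          then show "(3 * (th s y t)\<^sup>2 * th_y s y t)\<^sup>2 / (th s y t ^ 4) \<le> 9 * e * dissip s y t"
            using pt[OF y] by simp
        qed (use s t e v_bounds(6)[OF s _ t] in \<open>auto intro!: continuous_intros jcy\<close>)
      qed (use s t bdi(1)[OF s t] e m1 B_ge_1 in \<open>auto intro!: integral_nonneg_y continuous_intros jcy\<close>)
      also have "\<dots> \<le> c * m s t"
      proof -
        have "2 * (2 + B)\<^sup>2 * 1 \<le> 2 * (2 + B)\<^sup>2 * m s t" using m1 by (intro mult_left_mono) auto
        then show ?thesis by (simp add: c_def algebra_simps)
      qed
      finally show ?thesis .
    qed
    have "integral {0..1} (\<lambda>y. ((1 + th s y t ^ 3) * th_y s y t)\<^sup>2) \<le> 2 * (1 + c) * e * m s t * m s t"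
    proof (rule dissip_le_m[OF s t])
      fix y :: real assume y: "y \<in> {0..1}"
      have "(1 + th s y t ^ 3)\<^sup>2 \<le> 2 * (1 + (th s y t ^ 3)\<^sup>2)"
        using zero_le_power2[of "1 - th s y t ^ 3"] by (simp add: power2_sum power2_diff)
      also have "\<dots> \<le> 2 * ((1 + c) * m s t)" using th6[OF y] m1 by (simp add: algebra_simps)
      finally have "(1 + th s y t ^ 3)\<^sup>2 * (th_y s y t)\<^sup>2 \<le> 2 * ((1 + c) * m s t) * (e * dissip s y t)"
        using pt[OF y] c m1 by (intro mult_mono) auto
      then show "((1 + th s y t ^ 3) * th_y s y t)\<^sup>2 \<le> 2 * (1 + c) * e * m s t * dissip s y t"
        unfolding power_mult_distrib by (simp add: algebra_simps)
    qed (use s t e c m1 in \<open>auto intro!: continuous_intros jcy\<close>)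
    then have "HH s t \<le> sqrt (2 * (1 + c) * e * (m s t)\<^sup>2)"
      unfolding HH_def by (simp add: power2_eq_square)
    also have "\<dots> = C * m s t" using m1 by (simp add: C_def real_sqrt_mult)
    finally show ?thesis .
  qed
  have "integral {0..t} (HH s) \<le> C * B" if s: "s \<in> S" and t: "t \<in> {0..T}" for s t
  proof -
    have "integral {0..t} (HH s) \<le> integral {0..t} (\<lambda>r. C * m s r)"
      by (rule integral_le)
        (use s t * in \<open>auto intro!: integrable_continuous_real continuous_intros
          intro: continuous_on_subset[OF cont_m[OF s]] continuous_on_subset[OF cont_HH[OF s]]\<close>)
    also have "\<dots> \<le> C * B" using m_integral_le[OF s t] C by simp
    finally show ?thesis .
  qed
  then show ?thesis using C B_ge_1 by (intro exI[of _ "C * B"]) auto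
qed

end

section \<open>The truncated weight\<close>

text \<open>\<open>cut u r\<close> is \<open>u\<^sup>2 / 2\<close> for \<open>u\<^sup>2\<close> much smaller than \<open>r\<close> and at most \<open>r / 2\<close> everywhere. The width \<open>r\<close> will be
  \<open>c \<theta>\<^sup>2 / (\<theta> + L)\<close>, comparable with \<open>\<theta>\<close> only above the level \<open>L\<close>.\<close>

definition cut :: "real \<Rightarrow> real \<Rightarrow> real" where
  "cut u r = r * u\<^sup>2 / (2 * (r + u\<^sup>2))"
definition cut_u :: "real \<Rightarrow> real \<Rightarrow> real" where
  "cut_u u r = u * r\<^sup>2 / (r + u\<^sup>2)\<^sup>2"
definition cut_r :: "real \<Rightarrow> real \<Rightarrow> real" where
  "cut_r u r = u ^ 4 / (2 * (r + u\<^sup>2)\<^sup>2)"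
definition cut_uu :: "real \<Rightarrow> real \<Rightarrow> real" where
  "cut_uu u r = r\<^sup>2 * (r - 3 * u\<^sup>2) / (r + u\<^sup>2) ^ 3"
definition cut_ur :: "real \<Rightarrow> real \<Rightarrow> real" where
  "cut_ur u r = 2 * u ^ 3 * r / (r + u\<^sup>2) ^ 3"
definition cut_rr :: "real \<Rightarrow> real \<Rightarrow> real" where
  "cut_rr u r = - (u ^ 4) / (r + u\<^sup>2) ^ 3"

lemma cut_denominator: "0 < r \<Longrightarrow> 0 < r + (u::real)\<^sup>2"
  by (simp add: add_pos_nonneg)

lemma deriv_cut:
  assumes "(u has_real_derivative u') (at x within X)" "(r has_real_derivative r') (at x within X)" "0 < r x"
  shows "((\<lambda>x. cut (u x) (r x)) has_real_derivative cut_u (u x) (r x) * u' + cut_r (u x) (r x) * r') (at x within X)"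
proof -
  have D: "r x + (u x)\<^sup>2 \<noteq> 0" using cut_denominator[OF assms(3), of "u x"] by simp
  show ?thesis
    unfolding cut_def cut_u_def cut_r_def using D
    by (auto intro!: derivative_eq_intros assms(1,2)) (simp add: divide_simps, algebra)
qed

lemma deriv_cut_u:
  assumes "(u has_real_derivative u') (at x within X)" "(r has_real_derivative r') (at x within X)" "0 < r x"
  shows "((\<lambda>x. cut_u (u x) (r x)) has_real_derivative cut_uu (u x) (r x) * u' + cut_ur (u x) (r x) * r') (at x within X)"
proof -
  have D: "r x + (u x)\<^sup>2 \<noteq> 0" using cut_denominator[OF assms(3), of "u x"] by simp
  show ?thesis
    unfolding cut_u_def cut_uu_def cut_ur_def using D
    by (auto intro!: derivative_eq_intros assms(1,2)) (simp add: divide_simps, algebra)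
qed

lemma deriv_cut_r:
  assumes "(u has_real_derivative u') (at x within X)" "(r has_real_derivative r') (at x within X)" "0 < r x"
  shows "((\<lambda>x. cut_r (u x) (r x)) has_real_derivative cut_ur (u x) (r x) * u' + cut_rr (u x) (r x) * r') (at x within X)"
proof -
  have D: "r x + (u x)\<^sup>2 \<noteq> 0" using cut_denominator[OF assms(3), of "u x"] by simp
  show ?thesis
    unfolding cut_r_def cut_rr_def cut_ur_def using D
    by (auto intro!: derivative_eq_intros assms(1,2)) (simp add: divide_simps, algebra)
qed

text \<open>\<open>cut\<close> is homogeneous of degree one in \<open>(u^2, r)\<close>, so each
  derivative in \<open>u\<close> costs \<open>r^(-1/2)\<close> and each derivative in
  \<open>r\<close> costs \<open>1 / r\<close>, with constants independent of \<open>u\<close>.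
  \<open>1 - cut_uu\<close> measures the deviation from \<open>u^2 / 2\<close>: it is bounded
  everywhere and small where \<open>u^2\<close> is small against \<open>r\<close>.\<close>

lemma cut_bounds:
  assumes r: "0 < r"
  shows "0 \<le> cut u r" "cut u r \<le> r / 2" "(cut_u u r)\<^sup>2 \<le> r / 4" "0 \<le> cut_r u r" "cut_r u r \<le> 1 / 2"
    "(cut_ur u r)\<^sup>2 \<le> 1 / r" "\<bar>cut_rr u r\<bar> \<le> 1 / r"
    "0 \<le> 1 - cut_uu u r" "1 - cut_uu u r \<le> 2" "1 - cut_uu u r \<le> 6 * u\<^sup>2 / r"
proof -
  define D where "D = r + u\<^sup>2"
  have D: "0 < D" "r \<le> D" "u\<^sup>2 \<le> D" using r by (auto simp: D_def add_pos_nonneg)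
  have amgm: "4 * (u\<^sup>2 * r) \<le> D\<^sup>2"
    using zero_le_power2[of "r - u\<^sup>2"] unfolding D_def by (simp add: power2_sum power2_diff)
  show "0 \<le> cut u r" using r D unfolding cut_def D_def[symmetric] by (simp)
  have "r * u\<^sup>2 \<le> r * D" using D r by (intro mult_left_mono) auto
  then show "cut u r \<le> r / 2" using D r unfolding cut_def D_def[symmetric] by (simp add: field_simps)
  have "4 * (u\<^sup>2 * r ^ 4) = 4 * (u\<^sup>2 * r) * r ^ 3" by (simp add: power_numeral_reduce)
  also have "\<dots> \<le> D\<^sup>2 * (D\<^sup>2 * r)"
    using amgm D r by (intro mult_mono) (auto simp: power_numeral_reduce intro!: mult_mono)
  also have "\<dots> = r * D ^ 4" by (simp add: power_numeral_reduce)
  finally have "(u * r\<^sup>2)\<^sup>2 / (D\<^sup>2)\<^sup>2 \<le> r / 4"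
    using D by (simp add: power_mult_distrib field_simps flip: power_mult)
  then show "(cut_u u r)\<^sup>2 \<le> r / 4" unfolding cut_u_def D_def[symmetric] by (simp add: power_divide)
  show "0 \<le> cut_r u r" using D unfolding cut_r_def D_def[symmetric] by (simp)
  have u4: "u ^ 4 \<le> D\<^sup>2" using power_mono[OF D(3), of 2] by (simp flip: power_mult)
  then show "cut_r u r \<le> 1 / 2" using D unfolding cut_r_def D_def[symmetric] by (simp add: field_simps)
  have "4 * u ^ 6 * r ^ 3 = (4 * (u\<^sup>2 * r)) * (u ^ 4 * r\<^sup>2)" by (simp add: power_numeral_reduce)
  also have "\<dots> \<le> D\<^sup>2 * (D\<^sup>2 * D\<^sup>2)"
    using amgm u4 D r by (intro mult_mono power_mono) auto
  finally have "4 * u ^ 6 * r ^ 3 \<le> D ^ 6" by (simp add: power_numeral_reduce)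
  then have "(2 * u ^ 3 * r)\<^sup>2 / (D ^ 3)\<^sup>2 \<le> 1 / r"
    using D r by (simp add: power_mult_distrib field_simps power_numeral_reduce flip: power_mult)
  then show "(cut_ur u r)\<^sup>2 \<le> 1 / r" unfolding cut_ur_def D_def[symmetric] by (simp add: power_divide)
  have "u ^ 4 * r \<le> D\<^sup>2 * D" using u4 D r by (intro mult_mono) auto
  then show "\<bar>cut_rr u r\<bar> \<le> 1 / r"
    using D r unfolding cut_rr_def D_def[symmetric] by (simp add: abs_mult field_simps power_numeral_reduce)
  have eq: "1 - cut_uu u r = u\<^sup>2 * (6 * r\<^sup>2 + 3 * u\<^sup>2 * r + u ^ 4) / D ^ 3"
    using D unfolding cut_uu_def D_def[symmetric] by (simp add: field_simps D_def) algebra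
  show "0 \<le> 1 - cut_uu u r" unfolding eq using D r by (intro divide_nonneg_pos mult_nonneg_nonneg) auto
  have D3: "D ^ 3 = r ^ 3 + 3 * r\<^sup>2 * u\<^sup>2 + 3 * r * u ^ 4 + u ^ 6"
    unfolding D_def by algebra
  have "u\<^sup>2 * (6 * r\<^sup>2 + 3 * u\<^sup>2 * r + u ^ 4) \<le> 2 * D ^ 3"
  proof -
    have "0 \<le> 2 * r ^ 3 + 3 * r * u ^ 4 + u ^ 6" using r by simp
    moreover have "2 * D ^ 3 - u\<^sup>2 * (6 * r\<^sup>2 + 3 * u\<^sup>2 * r + u ^ 4) = 2 * r ^ 3 + 3 * r * u ^ 4 + u ^ 6"
      unfolding D3 by algebra
    ultimately show ?thesis by linarith
  qed
  then show "1 - cut_uu u r \<le> 2" unfolding eq using D by (simp add: divide_le_eq)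
  have "r * (6 * r\<^sup>2 + 3 * u\<^sup>2 * r + u ^ 4) \<le> 6 * D ^ 3"
  proof -
    have "0 \<le> 15 * r\<^sup>2 * u\<^sup>2 + 17 * r * u ^ 4 + 6 * u ^ 6" using r by simp
    moreover have "6 * D ^ 3 - r * (6 * r\<^sup>2 + 3 * u\<^sup>2 * r + u ^ 4) = 15 * r\<^sup>2 * u\<^sup>2 + 17 * r * u ^ 4 + 6 * u ^ 6"
      unfolding D3 by algebra
    ultimately show ?thesis by linarith
  qed
  then have "u\<^sup>2 * (r * (6 * r\<^sup>2 + 3 * u\<^sup>2 * r + u ^ 4)) \<le> u\<^sup>2 * (6 * D ^ 3)" by (rule mult_left_mono) simp
  then show "1 - cut_uu u r \<le> 6 * u\<^sup>2 / r" unfolding eq using D r by (simp add: field_simps)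
qed

definition width :: "real \<Rightarrow> real \<Rightarrow> real \<Rightarrow> real" where
  "width c L x = c * x\<^sup>2 / (x + L)"
definition width1 :: "real \<Rightarrow> real \<Rightarrow> real \<Rightarrow> real" where
  "width1 c L x = c * (x\<^sup>2 + 2 * L * x) / (x + L)\<^sup>2"
definition width2 :: "real \<Rightarrow> real \<Rightarrow> real \<Rightarrow> real" where
  "width2 c L x = 2 * c * L\<^sup>2 / (x + L) ^ 3"

lemma deriv_width:
  assumes "(f has_real_derivative f') (at x within X)" "0 < f x" "0 < L"
  shows "((\<lambda>x. width c L (f x)) has_real_derivative width1 c L (f x) * f') (at x within X)"
    "((\<lambda>x. width1 c L (f x)) has_real_derivative width2 c L (f x) * f') (at x within X)"
proof -
  have D: "f x + L \<noteq> 0" using assms by simp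
  show "((\<lambda>x. width c L (f x)) has_real_derivative width1 c L (f x) * f') (at x within X)"
    unfolding width_def width1_def using D
    by (auto intro!: derivative_eq_intros assms(1)) (simp add: divide_simps, algebra)
  show "((\<lambda>x. width1 c L (f x)) has_real_derivative width2 c L (f x) * f') (at x within X)"
    unfolding width1_def width2_def using D
    by (auto intro!: derivative_eq_intros assms(1)) (simp add: divide_simps, algebra)
qed

text \<open>\<open>width\<close> behaves like a power of \<open>x\<close> with exponent between
  \<open>1\<close> and \<open>2\<close>, which explains the bounds of \<open>x * width1\<close> and
  of \<open>x^2\<close> times \<open>width2\<close>. The estimate by \<open>c x^2 / L\<close>
  supplies the small factor of the \<open>v_y\<close> term; the lower bound above \<open>L\<close>
  makes the compensation effective there.\<close>

lemma width_bounds: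
  assumes x: "0 < x" and L: "0 < L" and c: "0 < c"
  shows "0 < width c L x" "width c L x \<le> c * x" "width c L x \<le> c * x\<^sup>2 / L"
    "0 \<le> width1 c L x" "x * width1 c L x \<le> 2 * width c L x"
    "0 \<le> width2 c L x" "x\<^sup>2 * width2 c L x \<le> 2 * width c L x"
    "L \<le> x \<Longrightarrow> c * x / 2 \<le> width c L x"
proof -
  define D where "D = x + L"
  have D: "0 < D" "L \<le> D" "x \<le> D" using x L by (auto simp: D_def)
  show "0 < width c L x" using x L c by (simp add: width_def)
  show "width c L x \<le> c * x"
    using x L c by (simp add: width_def divide_le_eq power2_eq_square mult_left_mono algebra_simps)
  show "width c L x \<le> c * x\<^sup>2 / L" unfolding width_def using x L c by (intro divide_left_mono) auto
  show "0 \<le> width1 c L x" using x L c by (simp add: width1_def)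
  show "0 \<le> width2 c L x" using x L c by (simp add: width2_def)
  have "x * (x\<^sup>2 + 2 * L * x) \<le> 2 * x\<^sup>2 * D"
    using x L by (simp add: D_def power2_eq_square algebra_simps)
  then have "c * (x * (x\<^sup>2 + 2 * L * x)) \<le> c * (2 * x\<^sup>2 * D)" using c by (intro mult_left_mono) auto
  then have "c * (x * (x\<^sup>2 + 2 * L * x)) / D\<^sup>2 \<le> c * (2 * x\<^sup>2 * D) / D\<^sup>2"
    by (rule divide_right_mono) simp
  moreover have "c * (2 * x\<^sup>2 * D) / D\<^sup>2 = 2 * (c * x\<^sup>2 / D)" using D by (simp add: power2_eq_square)
  moreover have "x * width1 c L x = c * (x * (x\<^sup>2 + 2 * L * x)) / D\<^sup>2"
    by (simp add: width1_def D_def)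
  ultimately show "x * width1 c L x \<le> 2 * width c L x" by (simp add: width_def D_def)
  have "L\<^sup>2 \<le> D\<^sup>2" using D L by (intro power_mono) auto
  then have "c * x\<^sup>2 * L\<^sup>2 \<le> c * x\<^sup>2 * D\<^sup>2" using c by (intro mult_left_mono) auto
  then show "x\<^sup>2 * width2 c L x \<le> 2 * width c L x"
    using D unfolding width_def width2_def D_def[symmetric] by (simp add: field_simps power_numeral_reduce)
  show "c * x / 2 \<le> width c L x" if "L \<le> x"
  proof -
    have "x * D \<le> 2 * x\<^sup>2" using that x by (simp add: D_def power2_eq_square algebra_simps)
    then have "c * (x * D) \<le> c * (2 * x\<^sup>2)" using c by (intro mult_left_mono) auto
    then show ?thesis using D unfolding width_def D_def[symmetric] by (simp add: field_simps)
  qed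
qed

text \<open>With \<open>z = \<theta>\<^sup>1\<^sup>/\<^sup>3\<close>, all powers of \<open>\<theta>\<close> in the weighted estimate are integral powers of \<open>z\<close>.
  The suffixes \<open>u\<close> and \<open>th\<close> denote partial derivatives with respect to \<open>u\<close> and \<open>\<theta>\<close>.\<close>

definition Xi :: "real \<Rightarrow> real \<Rightarrow> real \<Rightarrow> real \<Rightarrow> real" where
  "Xi c L u z = z\<^sup>2 * cut u (width c L (z ^ 3))"
definition Xi_u :: "real \<Rightarrow> real \<Rightarrow> real \<Rightarrow> real \<Rightarrow> real" where
  "Xi_u c L u z = z\<^sup>2 * cut_u u (width c L (z ^ 3))"
definition Xi_uu :: "real \<Rightarrow> real \<Rightarrow> real \<Rightarrow> real \<Rightarrow> real" where
  "Xi_uu c L u z = z\<^sup>2 * cut_uu u (width c L (z ^ 3))"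
definition Xi_th :: "real \<Rightarrow> real \<Rightarrow> real \<Rightarrow> real \<Rightarrow> real" where
  "Xi_th c L u z = 2 / (3 * z) * cut u (width c L (z ^ 3))
    + z\<^sup>2 * (cut_r u (width c L (z ^ 3)) * width1 c L (z ^ 3))"
definition Xi_uth :: "real \<Rightarrow> real \<Rightarrow> real \<Rightarrow> real \<Rightarrow> real" where
  "Xi_uth c L u z = 2 / (3 * z) * cut_u u (width c L (z ^ 3))
    + z\<^sup>2 * (cut_ur u (width c L (z ^ 3)) * width1 c L (z ^ 3))"
definition Xi_thth :: "real \<Rightarrow> real \<Rightarrow> real \<Rightarrow> real \<Rightarrow> real" where
  "Xi_thth c L u z = - (2 / (9 * z ^ 4)) * cut u (width c L (z ^ 3))
    + 4 / (3 * z) * (cut_r u (width c L (z ^ 3)) * width1 c L (z ^ 3))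
    + z\<^sup>2 * (cut_rr u (width c L (z ^ 3)) * (width1 c L (z ^ 3))\<^sup>2)
    + z\<^sup>2 * (cut_r u (width c L (z ^ 3)) * width2 c L (z ^ 3))"

lemma deriv_Xi:
  assumes u: "(u has_real_derivative u') (at x within X)"
    and z: "(z has_real_derivative th' / (3 * (z x)\<^sup>2)) (at x within X)"
    and pos: "0 < z x" "0 < c" "0 < L"
  shows "((\<lambda>x. Xi c L (u x) (z x)) has_real_derivative Xi_u c L (u x) (z x) * u' + Xi_th c L (u x) (z x) * th') (at x within X)"
    "((\<lambda>x. Xi_u c L (u x) (z x)) has_real_derivative Xi_uu c L (u x) (z x) * u' + Xi_uth c L (u x) (z x) * th') (at x within X)"
    "((\<lambda>x. Xi_th c L (u x) (z x)) has_real_derivative Xi_uth c L (u x) (z x) * u' + Xi_thth c L (u x) (z x) * th') (at x within X)"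
proof -
  have z3: "((\<lambda>x. z x ^ 3) has_real_derivative th') (at x within X)"
    using pos by (auto intro!: derivative_eq_intros z simp: field_simps)
  have z3p: "0 < z x ^ 3" using pos by simp
  note w = deriv_width[OF z3 z3p pos(3), of c]
  note wp = width_bounds(1)[OF z3p pos(3,2)]
  note c = deriv_cut[OF u w(1) wp] and cu = deriv_cut_u[OF u w(1) wp] and cr = deriv_cut_r[OF u w(1) wp]
  show "((\<lambda>x. Xi c L (u x) (z x)) has_real_derivative Xi_u c L (u x) (z x) * u' + Xi_th c L (u x) (z x) * th') (at x within X)"
    unfolding Xi_def using pos
    by (auto intro!: derivative_eq_intros z c)
      (simp add: Xi_u_def Xi_th_def divide_simps, algebra)
  show "((\<lambda>x. Xi_u c L (u x) (z x)) has_real_derivative Xi_uu c L (u x) (z x) * u' + Xi_uth c L (u x) (z x) * th') (at x within X)"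
    unfolding Xi_u_def using pos
    by (auto intro!: derivative_eq_intros z cu)
      (simp add: Xi_uu_def Xi_uth_def divide_simps, algebra)
  show "((\<lambda>x. Xi_th c L (u x) (z x)) has_real_derivative Xi_uth c L (u x) (z x) * u' + Xi_thth c L (u x) (z x) * th') (at x within X)"
    unfolding Xi_th_def using pos
    by (auto intro!: derivative_eq_intros z c cr w)
      (simp add: Xi_uth_def Xi_thth_def divide_simps, algebra)
qed

text \<open>Apart from the last bound, homogeneity of \<open>cut\<close> and
  \<open>width \<le> c th\<close> give everything: a derivative in \<open>u\<close> costs
  \<open>th^(-1/2)\<close>, one in \<open>th\<close> costs \<open>1 / th\<close>, and a positive
  power of \<open>c\<close> remains, so that small \<open>c\<close> makes the cross terms small. The
  bound with \<open>l ^ 3\<close> uses \<open>width \<le> c th^2 / L\<close> instead. The last bound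
  has \<open>c\<close> in the denominator; the term it controls goes to the remainder, where large
  constants are harmless.\<close>

lemma Xi_bounds:
  assumes z: "0 < z" and c: "0 < c" and l: "1 \<le> l" and w: "1 \<le> w" "u\<^sup>2 \<le> w ^ 3"
  defines "L \<equiv> l ^ 3"
  shows "0 \<le> Xi c L u z" "Xi c L u z \<le> c * z ^ 5 / 2"
    "(Xi_u c L u z)\<^sup>2 \<le> c * z ^ 7 / 4"
    "0 \<le> Xi_th c L u z" "Xi_th c L u z \<le> 2 * c * z\<^sup>2" "Xi_th c L u z \<le> 2 * c * z ^ 5 / l ^ 3"
    "(Xi_uth c L u z)\<^sup>2 \<le> 9 * c * z" "\<bar>Xi_thth c L u z\<bar> \<le> 7 * c / z"
    "\<bar>z\<^sup>2 - Xi_uu c L u z\<bar> \<le> (2 + 12 / c) * (l\<^sup>2 + w\<^sup>2)"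
proof -
  let ?x = "z ^ 3"
  define r where "r = width c L ?x"
  have x: "0 < ?x" and L: "0 < L" using z l by (auto simp: L_def)
  note wb = width_bounds[OF x L c, folded r_def]
  note cb = cut_bounds[OF wb(1), of u]
  define r1 r2 where "r1 = width1 c L ?x" and "r2 = width2 c L ?x"
  note wb' = wb[folded r1_def r2_def]
  have r1: "r1 \<le> 2 * r / z ^ 3" using wb'(5) z by (simp add: field_simps)
  have r2: "r2 \<le> 2 * r / z ^ 6" using wb'(7) z by (simp add: field_simps power_numeral_reduce)
  have rz: "r \<le> c * z ^ 3" using wb by simp
  show "0 \<le> Xi c L u z" using cb unfolding Xi_def r_def[symmetric] by (simp)
  have "z\<^sup>2 * cut u r \<le> z\<^sup>2 * (c * z ^ 3 / 2)" using cb(2) rz by (intro mult_left_mono) auto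
  then show "Xi c L u z \<le> c * z ^ 5 / 2"
    unfolding Xi_def r_def[symmetric] by (simp add: power_numeral_reduce algebra_simps)
  have "(z\<^sup>2)\<^sup>2 * (cut_u u r)\<^sup>2 \<le> (z\<^sup>2)\<^sup>2 * (c * z ^ 3 / 4)" using cb(3) rz by (intro mult_left_mono) auto
  then show "(Xi_u c L u z)\<^sup>2 \<le> c * z ^ 7 / 4"
    unfolding Xi_u_def r_def[symmetric] by (simp add: power_mult_distrib power_numeral_reduce algebra_simps)
  show "0 \<le> Xi_th c L u z" using cb wb' z unfolding Xi_th_def r_def[symmetric] r1_def[symmetric] by (simp)
  have Xth: "Xi_th c L u z \<le> 2 * r / z"
  proof -
    have "2 / (3 * z) * cut u r \<le> 2 / (3 * z) * (r / 2)" using cb(2) z by (intro mult_left_mono) auto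
    moreover have "z\<^sup>2 * (cut_r u r * r1) \<le> z\<^sup>2 * (1 / 2 * (2 * r / z ^ 3))"
      using cb r1 wb' by (intro mult_left_mono mult_mono) auto
    moreover have "2 / (3 * z) * (r / 2) + z\<^sup>2 * (1 / 2 * (2 * r / z ^ 3)) = (4 / 3) * (r / z)"
      using z by (simp add: field_simps power_numeral_reduce)
    moreover have "(4 / 3) * (r / z) \<le> 2 * (r / z)" using wb z by (intro mult_right_mono) auto
    ultimately show ?thesis unfolding Xi_th_def r_def[symmetric] r1_def[symmetric] by (simp)
  qed
  have "2 * r / z \<le> 2 * (c * z ^ 3) / z" using rz z by (intro divide_right_mono) auto
  also have "\<dots> = 2 * c * z\<^sup>2" using z by (simp add: power_numeral_reduce)
  finally show "Xi_th c L u z \<le> 2 * c * z\<^sup>2" using Xth by simp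
  have "2 * r / z \<le> 2 * (c * ?x\<^sup>2 / L) / z" using wb z by (intro divide_right_mono) auto
  also have "\<dots> = 2 * c * z ^ 5 / l ^ 3" using z by (simp add: L_def power_numeral_reduce)
  finally show "Xi_th c L u z \<le> 2 * c * z ^ 5 / l ^ 3" using Xth by simp
  show "(Xi_uth c L u z)\<^sup>2 \<le> 9 * c * z"
  proof -
    define p1 p2 where "p1 = 2 / (3 * z) * cut_u u r" and "p2 = z\<^sup>2 * (cut_ur u r * r1)"
    have "p1\<^sup>2 = 4 / (9 * z\<^sup>2) * (cut_u u r)\<^sup>2" by (simp add: p1_def power_mult_distrib power_divide)
    also have "\<dots> \<le> 4 / (9 * z\<^sup>2) * (r / 4)" using cb(3) by (intro mult_left_mono) auto
    finally have p1: "p1\<^sup>2 \<le> (1 / 9) * (r / z\<^sup>2)" by simp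
    have "p2\<^sup>2 = z ^ 4 * ((cut_ur u r)\<^sup>2 * r1\<^sup>2)" by (simp add: p2_def power_mult_distrib flip: power_mult)
    also have "\<dots> \<le> z ^ 4 * (1 / r * (2 * r / z ^ 3)\<^sup>2)"
      using cb(6) r1 wb' by (intro mult_left_mono mult_mono power_mono) auto
    also have "\<dots> = 4 * (r / z\<^sup>2)" using z wb(1) by (simp add: field_simps power_numeral_reduce)
    finally have p2: "p2\<^sup>2 \<le> 4 * (r / z\<^sup>2)" .
    have "(p1 + p2)\<^sup>2 \<le> 2 * p1\<^sup>2 + 2 * p2\<^sup>2"
      using zero_le_power2[of "p1 - p2"] by (simp add: power2_sum power2_diff)
    also have "\<dots> \<le> 9 * (r / z\<^sup>2)" using p1 p2 wb(1) z by (simp add: field_simps)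
    also have "\<dots> \<le> 9 * (c * z ^ 3 / z\<^sup>2)" using rz z by (intro mult_left_mono divide_right_mono) auto
    also have "\<dots> = 9 * c * z" using z by (simp add: power_numeral_reduce)
    finally show ?thesis unfolding Xi_uth_def p1_def p2_def r_def[symmetric] r1_def[symmetric] by (simp)
  qed
  show "\<bar>Xi_thth c L u z\<bar> \<le> 7 * c / z"
  proof -
    let ?m = "r / z ^ 4"
    have t1: "\<bar>- (2 / (9 * z ^ 4)) * cut u r\<bar> \<le> 1 / 9 * ?m"
      using cb(1,2) z mult_left_mono[OF cb(2), of "2 / (9 * z ^ 4)"] by (simp add: abs_mult)
    have t2: "\<bar>4 / (3 * z) * (cut_r u r * r1)\<bar> \<le> 4 / 3 * ?m"
    proof -
      have "4 / (3 * z) * (cut_r u r * r1) \<le> 4 / (3 * z) * (1 / 2 * (2 * r / z ^ 3))"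
        using cb r1 wb' z by (intro mult_left_mono mult_mono) auto
      also have "\<dots> = 4 / 3 * ?m" using z by (simp add: field_simps power_numeral_reduce)
      finally show ?thesis using cb wb' z by (simp add: abs_mult)
    qed
    have t3: "\<bar>z\<^sup>2 * (cut_rr u r * r1\<^sup>2)\<bar> \<le> 4 * ?m"
    proof -
      have "\<bar>z\<^sup>2 * (cut_rr u r * r1\<^sup>2)\<bar> = z\<^sup>2 * (\<bar>cut_rr u r\<bar> * r1\<^sup>2)" by (simp add: abs_mult)
      also have "\<dots> \<le> z\<^sup>2 * (1 / r * (2 * r / z ^ 3)\<^sup>2)"
        using cb(7) r1 wb' by (intro mult_left_mono mult_mono power_mono) auto
      also have "\<dots> = 4 * ?m" using z wb(1) by (simp add: field_simps power_numeral_reduce)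
      finally show ?thesis .
    qed
    have t4: "\<bar>z\<^sup>2 * (cut_r u r * r2)\<bar> \<le> ?m"
    proof -
      have "z\<^sup>2 * (cut_r u r * r2) \<le> z\<^sup>2 * (1 / 2 * (2 * r / z ^ 6))"
        using cb r2 wb' z by (intro mult_left_mono mult_mono) auto
      also have "\<dots> = ?m" using z by (simp add: field_simps power_numeral_reduce)
      finally show ?thesis using cb wb' z by (simp add: abs_mult)
    qed
    have "\<bar>Xi_thth c L u z\<bar> \<le> 1 / 9 * ?m + 4 / 3 * ?m + 4 * ?m + ?m"
      unfolding Xi_thth_def r_def[symmetric] r1_def[symmetric] r2_def[symmetric]
      using t1 t2 t3 t4 by linarith
    also have "\<dots> \<le> 7 * ?m" using wb(1) z by (simp add: field_simps)
    also have "\<dots> \<le> 7 * (c * z ^ 3 / z ^ 4)" using rz z by (intro mult_left_mono divide_right_mono) auto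
    also have "\<dots> = 7 * c / z" using z by (simp add: power_numeral_reduce)
    finally show ?thesis .
  qed
  show "\<bar>z\<^sup>2 - Xi_uu c L u z\<bar> \<le> (2 + 12 / c) * (l\<^sup>2 + w\<^sup>2)"
  proof -
    have eq: "z\<^sup>2 - Xi_uu c L u z = z\<^sup>2 * (1 - cut_uu u r)" unfolding Xi_uu_def r_def[symmetric] by (simp add: algebra_simps)
    have nn: "0 \<le> z\<^sup>2 * (1 - cut_uu u r)" using cb by simp
    have le2: "z\<^sup>2 * (1 - cut_uu u r) \<le> z\<^sup>2 * 2" using cb by (intro mult_left_mono) auto
    have c12: "0 \<le> 12 / c * (l\<^sup>2 + w\<^sup>2)" using c by simp
    \<comment> \<open>Three regimes: \<open>z\<close> below the level, \<open>z\<close> below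
      \<open>w\<close>, and \<open>z\<close> above both. Only in the last one is \<open>r\<close>
      comparable with \<open>z^3\<close>; there \<open>1 - cut_uu\<close> is of order
      \<open>w^3 / z^3\<close>, and \<open>w^3 / z \<le> w^2\<close>.\<close>
    consider "z \<le> l" | "l < z" "z \<le> w" | "l < z" "w < z" by linarith
    then have "z\<^sup>2 * (1 - cut_uu u r) \<le> (2 + 12 / c) * (l\<^sup>2 + w\<^sup>2)"
    proof cases
      case 1
      then have "z\<^sup>2 \<le> l\<^sup>2" using z by (intro power_mono) auto
      then have "z\<^sup>2 * 2 \<le> 2 * (l\<^sup>2 + w\<^sup>2)"
        using zero_le_power2[of w] zero_le_power2[of l] unfolding distrib_left by linarith
      with le2 c12 show ?thesis unfolding distrib_right by linarith
    next
      case 2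
      then have "z\<^sup>2 \<le> w\<^sup>2" using z by (intro power_mono) auto
      then have "z\<^sup>2 * 2 \<le> 2 * (l\<^sup>2 + w\<^sup>2)"
        using zero_le_power2[of w] zero_le_power2[of l] unfolding distrib_left by linarith
      with le2 c12 show ?thesis unfolding distrib_right by linarith
    next
      case 3
      have "L \<le> ?x" unfolding L_def using 3 l by (intro power_mono) auto
      then have r': "c * ?x / 2 \<le> r" using wb by simp
      have "z\<^sup>2 * (1 - cut_uu u r) \<le> z\<^sup>2 * (6 * u\<^sup>2 / r)" using cb by (intro mult_left_mono) auto
      also have "\<dots> \<le> z\<^sup>2 * (6 * w ^ 3 / (c * ?x / 2))"
        using w r' c x wb(1) by (intro mult_left_mono frac_le) auto
      also have "\<dots> = 12 / c * (w ^ 3 / z)" using z c by (simp add: field_simps power_numeral_reduce)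
      also have "\<dots> \<le> 12 / c * w\<^sup>2"
      proof (intro mult_left_mono)
        have "w\<^sup>2 * w \<le> w\<^sup>2 * z" using 3 by (intro mult_left_mono) auto
        then show "w ^ 3 / z \<le> w\<^sup>2" using z by (simp add: field_simps power_numeral_reduce)
      qed (use c in auto)
      also have "\<dots> \<le> 12 / c * (l\<^sup>2 + w\<^sup>2)" using c by (intro mult_left_mono) auto
      also have "\<dots> \<le> (2 + 12 / c) * (l\<^sup>2 + w\<^sup>2)" by (intro mult_right_mono) auto
      finally show ?thesis .
    qed
    then show ?thesis unfolding eq using nn by simp
  qed
qed

section \<open>Pointwise control of the weighted balance\<close>

lemma young_weighted:
  fixes x y e z :: real
  assumes "0 < e" "0 < z"
  shows "\<bar>x * y\<bar> \<le> e * (x\<^sup>2 / z) + z * y\<^sup>2 / (4 * e)"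
proof -
  have "\<bar>x\<bar> * \<bar>y\<bar> \<le> (e / z) * \<bar>x\<bar>\<^sup>2 + \<bar>y\<bar>\<^sup>2 / (4 * (e / z))"
    by (rule young) (use assms in auto)
  then show ?thesis using assms by (simp add: abs_mult ac_simps)
qed

text \<open>The estimate of the integrand of the weighted balance at a single point. The values \<open>ty\<close>, \<open>uy\<close>, \<open>vy\<close>
  are those of \<open>\<theta>\<^sub>y\<close>, \<open>u\<^sub>y\<close>, \<open>v\<^sub>y\<close>, while \<open>bb\<close>, \<open>by'\<close>, \<open>bby\<close>, \<open>wy\<close> stand for
  \<open>b \<bullet> b\<close>, \<open>b\<^sub>y \<bullet> b\<^sub>y\<close>, \<open>b \<bullet> b\<^sub>y\<close>, \<open>w\<^sub>y \<bullet> w\<^sub>y\<close>.\<close>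

locale weighted_point =
  fixes lam mu nu a Cv k1 k3 cp B c \<delta> l w z u v ty uy vy kap p bb by' bby wy :: real
  assumes params: "0 < lam" "0 < mu" "0 < nu" "0 < a" "0 < Cv" "0 < k1" "0 < k3" "0 < cp" "1 \<le> B"
    and c: "0 < c" "c \<le> 1" and \<delta>: "0 < \<delta>"
    and l: "1 \<le> l" and w: "1 \<le> w" "u\<^sup>2 \<le> w ^ 3" and z: "0 < z"
    and v: "0 < v" "1 / v \<le> B" "1 / B \<le> 1 / v"
    and kap: "k1 \<le> kap" "kap \<le> k3 * (1 + z ^ 6)"
    and p: "p\<^sup>2 \<le> cp * (1 + z ^ 24)"
    and nonneg: "0 \<le> bb" "0 \<le> by'" "0 \<le> wy" and bby: "bby\<^sup>2 \<le> bb * by'"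
begin

definition d where "d = Cv + 4 * a * v * z ^ 9"
definition sg where "sg = lam * uy / v - p"
definition F where "F = kap * ty / v"
definition Gd where "Gd = kap * ty\<^sup>2 / z"
definition Gu where "Gu = z\<^sup>2 * uy\<^sup>2"
definition Q8 where "Q8 = z\<^sup>2 * (1 + z ^ 24)"
definition Wt where "Wt = (l\<^sup>2 + w\<^sup>2) * (uy\<^sup>2 + 1 + z ^ 24)"
definition Qw where "Qw = mu * wy / v + nu * by' / v"

abbreviation (input) "X \<equiv> Xi c (l ^ 3) u z"
abbreviation (input) "Xu \<equiv> Xi_u c (l ^ 3) u z"
abbreviation (input) "Xuu \<equiv> Xi_uu c (l ^ 3) u z"
abbreviation (input) "Xth \<equiv> Xi_th c (l ^ 3) u z"
abbreviation (input) "Xuth \<equiv> Xi_uth c (l ^ 3) u z"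
abbreviation (input) "Xthth \<equiv> Xi_thth c (l ^ 3) u z"

lemmas Xb = Xi_bounds[OF z c(1) l w]

lemma kap_pos: "0 < kap" using kap(1) params by linarith

lemma nn: "0 \<le> Gd" "0 \<le> Gu" "0 \<le> Q8" "0 \<le> Wt" "0 \<le> Qw"
  using kap_pos z nonneg params v by (auto simp: Gd_def Gu_def Q8_def Wt_def Qw_def)

lemma d_bounds: "Cv \<le> d" "4 * a * v * z ^ 9 \<le> d" "4 * a / B * z ^ 9 \<le> d" "0 < d"
proof -
  show 1: "Cv \<le> d" "4 * a * v * z ^ 9 \<le> d" "0 < d" using params v z by (auto simp: d_def add_pos_nonneg)
  have "1 / B \<le> v" using v params by (simp add: field_simps)
  then have "4 * a * z ^ 9 * (1 / B) \<le> 4 * a * z ^ 9 * v" using params z by (intro mult_left_mono) auto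
  then show "4 * a / B * z ^ 9 \<le> d" using 1(2) by (simp add: ac_simps)
qed

definition kd where "kd = 2 * k3 * ((1 / Cv)\<^sup>2 + (B / (4 * a))\<^sup>2)"
definition ke where "ke = 2 * k3 * ((1 / Cv) ^ 4 + (B / (4 * a)) ^ 4)"

lemma kde_pos: "0 < kd" "0 < ke"
  using params by (auto simp: kd_def ke_def intro!: mult_pos_pos add_pos_pos)

lemma inv_d: "1 / d \<le> 1 / Cv" "z ^ 9 / d \<le> B / (4 * a)"
proof -
  show "1 / d \<le> 1 / Cv" using d_bounds params by (intro divide_left_mono) auto
  show "z ^ 9 / d \<le> B / (4 * a)" using d_bounds params by (simp add: field_simps)
qed

text \<open>Here the slow growth of \<open>kap\<close> enters: it is at most of order
  \<open>1 + z^6\<close>, while \<open>d^2\<close> grows like \<open>z^18\<close>.\<close>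

lemma kap_d2: "kap / d\<^sup>2 \<le> kd"
proof -
  have "kap / d\<^sup>2 \<le> (k3 * (2 * (1 + z ^ 18))) / d\<^sup>2"
  proof (intro divide_right_mono order_trans[OF kap(2)] mult_left_mono)
    have "z ^ 6 \<le> 1 + z ^ 18" "0 \<le> z ^ 18" using power_le_one_plus_power[of z 6 18] z by auto
    then show "1 + z ^ 6 \<le> 2 * (1 + z ^ 18)" unfolding distrib_left by linarith
  qed (use params in auto)
  also have "\<dots> = 2 * k3 * ((1 / d)\<^sup>2 + (z ^ 9 / d)\<^sup>2)"
    by (simp add: power_divide algebra_simps add_divide_distrib flip: power_mult)
  also have "\<dots> \<le> kd"
    unfolding kd_def using inv_d d_bounds z params
    by (intro mult_left_mono add_mono power_mono) auto
  finally show ?thesis .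
qed

text \<open>\<open>kap z^29\<close> grows at most like \<open>z^35\<close> and \<open>d^4\<close>
  like \<open>z^36\<close>, so one power of \<open>z\<close> is to spare. The exponent
  \<open>29\<close> collects \<open>z\<close> from the weighted Young inequality,
  \<open>z^18\<close> from the squared derivative of the heat capacity and \<open>z^10\<close> from
  the square of \<open>Xth\<close>.\<close>

lemma kap_d4: "kap * z ^ 29 / d ^ 4 \<le> ke"
proof -
  have "kap * z ^ 29 \<le> k3 * (1 + z ^ 6) * z ^ 29" using kap(2) z by (intro mult_right_mono) auto
  also have "\<dots> = k3 * (z ^ 29 + z ^ 35)" by (simp add: algebra_simps flip: power_add)
  also have "\<dots> \<le> k3 * (2 * (1 + z ^ 36))"
    using power_le_one_plus_power[of z 29 36] power_le_one_plus_power[of z 35 36] z params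
    by (intro mult_left_mono) auto
  finally have "kap * z ^ 29 / d ^ 4 \<le> k3 * (2 * (1 + z ^ 36)) / d ^ 4"
    by (rule divide_right_mono) simp
  also have "\<dots> = 2 * k3 * ((1 / d) ^ 4 + (z ^ 9 / d) ^ 4)"
    by (simp add: power_divide algebra_simps add_divide_distrib flip: power_mult)
  also have "\<dots> \<le> ke"
    unfolding ke_def using inv_d d_bounds z params
    by (intro mult_left_mono add_mono power_mono) auto
  finally show ?thesis .
qed

lemma abs_sg_uy: "\<bar>sg * uy\<bar> \<le> (lam * B + 1) * (uy\<^sup>2 + cp * (1 + z ^ 24))"
proof -
  have "\<bar>sg * uy\<bar> \<le> \<bar>lam * (1 / v) * uy\<^sup>2\<bar> + \<bar>p * uy\<bar>"
    using abs_triangle_ineq4[of "lam * (1 / v) * uy\<^sup>2" "p * uy"]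
    by (simp add: sg_def algebra_simps power2_eq_square)
  also have "\<bar>lam * (1 / v) * uy\<^sup>2\<bar> \<le> lam * B * uy\<^sup>2"
  proof -
    have "lam * (1 / v) * uy\<^sup>2 \<le> lam * B * uy\<^sup>2" "0 \<le> lam * (1 / v) * uy\<^sup>2"
      using v params by (intro mult_right_mono mult_left_mono mult_nonneg_nonneg; simp)+
    then show ?thesis by linarith
  qed
  also have "\<bar>p * uy\<bar> \<le> uy\<^sup>2 + p\<^sup>2"
  proof -
    have "0 \<le> \<bar>p\<bar> * \<bar>uy\<bar>" by simp
    moreover have "2 * (\<bar>p\<bar> * \<bar>uy\<bar>) \<le> p\<^sup>2 + uy\<^sup>2"
      using zero_le_power2[of "\<bar>p\<bar> - \<bar>uy\<bar>"] by (simp add: power2_diff)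
    ultimately show ?thesis unfolding abs_mult by linarith
  qed
  finally have "\<bar>sg * uy\<bar> \<le> lam * B * uy\<^sup>2 + (uy\<^sup>2 + cp * (1 + z ^ 24))" using p by simp
  also have "\<dots> \<le> (lam * B + 1) * (uy\<^sup>2 + cp * (1 + z ^ 24))"
    using params z by (simp add: algebra_simps)
  finally show ?thesis .
qed

lemma sg_square: "sg\<^sup>2 \<le> 2 * (lam * B)\<^sup>2 * uy\<^sup>2 + 2 * cp * (1 + z ^ 24)"
proof -
  have "sg\<^sup>2 \<le> 2 * (lam * (1 / v) * uy)\<^sup>2 + 2 * p\<^sup>2"
    using zero_le_power2[of "lam * (1 / v) * uy + p"] unfolding sg_def by (simp add: power2_sum power2_diff)
  also have "(lam * (1 / v) * uy)\<^sup>2 = (lam * (1 / v))\<^sup>2 * uy\<^sup>2" by (rule power_mult_distrib)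
  also have "(lam * (1 / v))\<^sup>2 * uy\<^sup>2 \<le> (lam * B)\<^sup>2 * uy\<^sup>2"
    using v params by (intro mult_right_mono power_mono mult_left_mono) auto
  finally show ?thesis using p by simp
qed

lemma t_a: "- (2 / (3 * z) * ty * F) \<le> - (2 / (3 * B) * Gd)"
proof -
  have "2 / 3 * (kap * ty\<^sup>2 / z) * (1 / B) \<le> 2 / 3 * (kap * ty\<^sup>2 / z) * (1 / v)"
    using v z kap_pos by (intro mult_left_mono) auto
  moreover have "2 / 3 * (kap * ty\<^sup>2 / z) * (1 / v) = 2 / (3 * z) * ty * F"
    by (simp add: F_def power2_eq_square)
  moreover have "2 / 3 * (kap * ty\<^sup>2 / z) * (1 / B) = 2 / (3 * B) * Gd"
    by (simp add: Gd_def)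
  ultimately show ?thesis by linarith
qed

text \<open>The heating contributes \<open>z^2 sg uy\<close> and the doubled kinetic term
  \<open>- 2 z^2 sg uy\<close>, up to the error treated in \<open>t_c\<close>. The sum is
  dissipative except for the work of the pressure.\<close>

lemma t_b: "- (z\<^sup>2 * (sg * uy)) \<le> - (lam / (2 * B) * Gu) + B * cp / (2 * lam) * Q8"
proof -
  have "uy * p \<le> lam / (2 * v) * uy\<^sup>2 + p\<^sup>2 / (4 * (lam / (2 * v)))"
    by (rule young) (use v params in auto)
  also have "p\<^sup>2 / (4 * (lam / (2 * v))) = v * (p\<^sup>2 / (2 * lam))" using v by simp
  also have "\<dots> \<le> B * (cp * (1 + z ^ 24) / (2 * lam))"
    using v params p by (intro mult_mono divide_right_mono) (auto simp: field_simps)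
  finally have 1: "uy * p \<le> lam / (2 * v) * uy\<^sup>2 + B * cp / (2 * lam) * (1 + z ^ 24)" by (simp add: ac_simps)
  have "lam / 2 * uy\<^sup>2 * (1 / B) \<le> lam / 2 * uy\<^sup>2 * (1 / v)"
    using v params by (intro mult_left_mono) auto
  moreover have "sg * uy = 2 * (lam / 2 * uy\<^sup>2 * (1 / v)) - uy * p"
    by (simp add: sg_def algebra_simps power2_eq_square)
  moreover have "lam / (2 * v) * uy\<^sup>2 = lam / 2 * uy\<^sup>2 * (1 / v)" by simp
  ultimately have "- (sg * uy) \<le> - (lam / 2 * uy\<^sup>2 * (1 / B)) + B * cp / (2 * lam) * (1 + z ^ 24)"
    using 1 by linarith
  then have "z\<^sup>2 * - (sg * uy) \<le> z\<^sup>2 * (- (lam / 2 * uy\<^sup>2 * (1 / B)) + B * cp / (2 * lam) * (1 + z ^ 24))"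
    by (rule mult_left_mono) simp
  then show ?thesis by (simp add: Gu_def Q8_def algebra_simps)
qed

text \<open>The error of replacing \<open>Xuu\<close> by \<open>z^2\<close>. It is the source of the
  term \<open>w^2 uy^2\<close> in \<open>Wt\<close>, which has to be paid by the dissipation of a
  higher moment of \<open>u\<close>.\<close>

lemma t_c: "2 * (z\<^sup>2 - Xuu) * (sg * uy) \<le> 2 * (2 + 12 / c) * (lam * B + 1) * (1 + cp) * Wt"
proof -
  have "2 * (z\<^sup>2 - Xuu) * (sg * uy) \<le> 2 * (\<bar>z\<^sup>2 - Xuu\<bar> * \<bar>sg * uy\<bar>)"
    using abs_ge_self[of "(z\<^sup>2 - Xuu) * (sg * uy)"] unfolding abs_mult[of "z\<^sup>2 - Xuu"] mult.assoc[of 2]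
    by (intro mult_left_mono) auto
  also have "\<dots> \<le> 2 * ((2 + 12 / c) * (l\<^sup>2 + w\<^sup>2) * ((lam * B + 1) * (uy\<^sup>2 + cp * (1 + z ^ 24))))"
    using Xb(9) abs_sg_uy c by (intro mult_left_mono mult_mono) auto
  also have "\<dots> \<le> 2 * ((2 + 12 / c) * (l\<^sup>2 + w\<^sup>2) * ((lam * B + 1) * ((1 + cp) * (uy\<^sup>2 + 1 + z ^ 24))))"
    using c params z by (intro mult_left_mono) (auto simp: algebra_simps)
  also have "\<dots> = 2 * (2 + 12 / c) * (lam * B + 1) * (1 + cp) * Wt" by (simp add: Wt_def)
  finally show ?thesis .
qed

lemma ty_le_Gd: "ty\<^sup>2 / z \<le> 1 / k1 * Gd"
proof -
  have "k1 * (ty\<^sup>2 / z) \<le> kap * (ty\<^sup>2 / z)" using kap z by (intro mult_right_mono) auto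
  then have "1 / k1 * (k1 * (ty\<^sup>2 / z)) \<le> 1 / k1 * (kap * (ty\<^sup>2 / z))"
    using params by (intro mult_left_mono) auto
  then show ?thesis using params by (simp add: Gd_def)
qed

text \<open>Young's inequality with the weight \<open>1 / z\<close> sends \<open>ty\<close> into
  \<open>Gd\<close>, while the other factor carries \<open>c / \<delta>\<close>. Hence
  \<open>\<delta>\<close> has to be fixed before \<open>c\<close>.\<close>

lemma t_d: "- (2 * (Xuth * ty) * sg) \<le> 2 * \<delta> / k1 * Gd + 9 * c * (lam * B)\<^sup>2 / \<delta> * Gu + 9 * c * cp / \<delta> * Q8"
proof -
  have "\<bar>ty * (Xuth * sg)\<bar> \<le> \<delta> * (ty\<^sup>2 / z) + z * (Xuth * sg)\<^sup>2 / (4 * \<delta>)"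
    by (rule young_weighted[OF \<delta> z])
  also have "\<delta> * (ty\<^sup>2 / z) \<le> \<delta> * (1 / k1 * Gd)" using ty_le_Gd \<delta> by (intro mult_left_mono) auto
  also have "z * (Xuth * sg)\<^sup>2 / (4 * \<delta>) = (Xuth\<^sup>2 * sg\<^sup>2) * (z / (4 * \<delta>))" by (simp add: power_mult_distrib)
  also have "\<dots> \<le> (9 * c * z * (2 * (lam * B)\<^sup>2 * uy\<^sup>2 + 2 * cp * (1 + z ^ 24))) * (z / (4 * \<delta>))"
    using Xb(7) sg_square z \<delta> c by (intro mult_right_mono mult_mono) auto
  also have "\<dots> = 9 * c * (lam * B)\<^sup>2 / (2 * \<delta>) * Gu + 9 * c * cp / (2 * \<delta>) * Q8"
    using \<delta> by (simp add: Gu_def Q8_def field_simps power2_eq_square)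
  finally have "\<bar>ty * (Xuth * sg)\<bar> \<le> \<delta> * (1 / k1 * Gd) + (9 * c * (lam * B)\<^sup>2 / (2 * \<delta>) * Gu + 9 * c * cp / (2 * \<delta>) * Q8)"
    by simp
  then have "2 * \<bar>ty * (Xuth * sg)\<bar> \<le> 2 * (\<delta> * (1 / k1 * Gd) + (9 * c * (lam * B)\<^sup>2 / (2 * \<delta>) * Gu + 9 * c * cp / (2 * \<delta>) * Q8))"
    by (rule mult_left_mono) simp
  moreover have "- (2 * (Xuth * ty) * sg) \<le> 2 * \<bar>ty * (Xuth * sg)\<bar>"
    using abs_ge_minus_self[of "ty * (Xuth * sg)"] by (simp add: ac_simps)
  ultimately have "- (2 * (Xuth * ty) * sg) \<le> 2 * (\<delta> * (1 / k1 * Gd) + (9 * c * (lam * B)\<^sup>2 / (2 * \<delta>) * Gu + 9 * c * cp / (2 * \<delta>) * Q8))"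
    by linarith
  also have "\<dots> = 2 * \<delta> / k1 * Gd + 9 * c * (lam * B)\<^sup>2 / \<delta> * Gu + 9 * c * cp / \<delta> * Q8"
    using \<delta> by (simp add: field_simps)
  finally show ?thesis .
qed

text \<open>The magnetic force is split so that \<open>by'\<close> is integrable by the unweighted
  dissipation, and \<open>bb * (1 + z ^ 12)\<close> by the supremum of \<open>b\<close> and the
  energy. \<open>Xu^2\<close> grows only like \<open>z^7\<close>, well below
  \<open>z^12\<close>.\<close>

lemma t_e: "- (2 * Xu * bby) \<le> by' + bb * (1 + z ^ 12)"
proof -
  have "(Xu * bby)\<^sup>2 \<le> (Xu\<^sup>2 * bb) * by'"
    using mult_left_mono[OF bby, of "Xu\<^sup>2"] by (simp add: power_mult_distrib ac_simps)
  then have "\<bar>Xu * bby\<bar> \<le> sqrt ((Xu\<^sup>2 * bb) * by')" by (simp add: real_le_rsqrt)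
  also have "\<dots> \<le> (Xu\<^sup>2 * bb + by') / 2" using nonneg by (intro arith_geo_mean_sqrt) auto
  finally have "- (2 * (Xu * bby)) \<le> Xu\<^sup>2 * bb + by'" using abs_ge_minus_self[of "Xu * bby"] unfolding add_divide_distrib by linarith
  moreover have "Xu\<^sup>2 * bb \<le> (1 + z ^ 12) * bb"
  proof (rule mult_right_mono)
    have "Xu\<^sup>2 \<le> c * z ^ 7 / 4" by (rule Xb)
    also have "\<dots> \<le> 1 * z ^ 7" using c z by simp
    also have "\<dots> \<le> 1 + z ^ 12" using power_le_one_plus_power[of z 7 12] z by simp
    finally show "Xu\<^sup>2 \<le> 1 + z ^ 12" .
  qed (rule nonneg)
  ultimately have "- (2 * (Xu * bby)) \<le> (1 + z ^ 12) * bb + by'" by linarith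
  then show ?thesis by (simp add: ac_simps)
qed

lemma F_le: "\<bar>x * F\<bar> \<le> B * (kap * \<bar>ty * x\<bar>)"
proof -
  have "\<bar>x * F\<bar> = (1 / v) * (kap * \<bar>ty * x\<bar>)" using v kap_pos by (simp add: F_def abs_mult)
  also have "\<dots> \<le> B * (kap * \<bar>ty * x\<bar>)" using v kap_pos by (intro mult_right_mono) auto
  finally show ?thesis .
qed

lemma F_young: "\<bar>x * F\<bar> \<le> B * \<delta> * Gd + B / (4 * \<delta>) * (kap * z * x\<^sup>2)"
proof -
  have "\<bar>x * F\<bar> \<le> B * (kap * \<bar>ty * x\<bar>)" by (rule F_le)
  also have "\<dots> \<le> B * (kap * (\<delta> * (ty\<^sup>2 / z) + z * x\<^sup>2 / (4 * \<delta>)))"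
    using young_weighted[OF \<delta> z] params kap_pos by (intro mult_left_mono) auto
  also have "\<dots> = B * \<delta> * Gd + B / (4 * \<delta>) * (kap * z * x\<^sup>2)"
    using \<delta> z by (simp add: Gd_def field_simps)
  finally show ?thesis .
qed

text \<open>This term and the next three come from differentiating \<open>Xth / d\<close> in the
  product with \<open>F\<close>: the derivatives of \<open>Xth\<close> in \<open>u\<close> and in
  \<open>th\<close>, and those of the heat capacity through \<open>v\<close> and through
  \<open>th\<close>.\<close>

lemma t_f1: "- (2 * (Xuth * uy / d) * F) \<le> 2 * B * \<delta> * Gd + 9 * B * c * kd / (2 * \<delta>) * Gu"
proof -
  have "kap * z * (Xuth * uy / d)\<^sup>2 = (kap / d\<^sup>2) * (Xuth\<^sup>2 * (z * uy\<^sup>2))"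
    by (simp add: power_mult_distrib power_divide)
  also have "\<dots> \<le> kd * ((9 * c * z) * (z * uy\<^sup>2))"
    using kap_d2 Xb(7) z kde_pos by (intro mult_mono mult_right_mono) auto
  also have "\<dots> = 9 * c * kd * Gu" by (simp add: Gu_def power2_eq_square)
  finally have "B / (4 * \<delta>) * (kap * z * (Xuth * uy / d)\<^sup>2) \<le> B / (4 * \<delta>) * (9 * c * kd * Gu)"
    using params \<delta> by (intro mult_left_mono) auto
  moreover have "2 * (B / (4 * \<delta>) * (9 * c * kd * Gu)) = 9 * B * c * kd / (2 * \<delta>) * Gu"
    using \<delta> by (simp add: field_simps)
  ultimately show ?thesis using F_young[of "Xuth * uy / d"] abs_ge_minus_self[of "Xuth * uy / d * F"]
    by linarith
qed

lemma t_f2: "- (2 * (Xthth * ty / d) * F) \<le> 14 * B * c / Cv * Gd"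
proof -
  have "\<bar>Xthth * ty / d * F\<bar> \<le> B * (kap * \<bar>ty * (Xthth * ty / d)\<bar>)" by (rule F_le)
  also have "\<bar>ty * (Xthth * ty / d)\<bar> = \<bar>Xthth\<bar> * ty\<^sup>2 * (1 / d)"
    using d_bounds by (simp add: abs_mult power2_eq_square)
  also have "B * (kap * (\<bar>Xthth\<bar> * ty\<^sup>2 * (1 / d))) \<le> B * (kap * ((7 * c / z) * ty\<^sup>2 * (1 / Cv)))"
    using Xb(8) inv_d d_bounds params kap_pos z c by (intro mult_left_mono mult_mono) auto
  also have "\<dots> = 7 * B * c / Cv * Gd" by (simp add: Gd_def ac_simps)
  finally show ?thesis using abs_ge_minus_self[of "Xthth * ty / d * F"] by simp
qed

text \<open>The only term with \<open>v_y\<close>. Estimating \<open>Xth\<close> with the factor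
  \<open>1 / l ^ 3\<close> puts \<open>1 / l ^ 6\<close> in front of the square of
  \<open>vy\<close>, which is the purpose of the level.\<close>

lemma t_f3: "2 * (Xth * (4 * a * z ^ 9 * vy) / d\<^sup>2) * F \<le> 2 * B * \<delta> * Gd + 32 * B * a\<^sup>2 * ke / \<delta> * (vy\<^sup>2 / l ^ 6)"
proof -
  have X5: "Xth\<^sup>2 \<le> (2 * c * z ^ 5 / l ^ 3)\<^sup>2" by (rule power_mono[OF Xb(6) Xb(4)])
  have "(Xth * (4 * a * z ^ 9 * vy) / d\<^sup>2)\<^sup>2 = Xth\<^sup>2 * (16 * a\<^sup>2 * (z ^ 18 * vy\<^sup>2 / d ^ 4))"
    by (simp add: power_mult_distrib power_divide flip: power_mult)
  moreover have "z * z ^ 18 = z ^ 19" using power_Suc[of z 18] by simp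
  ultimately have "kap * z * (Xth * (4 * a * z ^ 9 * vy) / d\<^sup>2)\<^sup>2 = Xth\<^sup>2 * (16 * a\<^sup>2 * (kap * z ^ 19 * vy\<^sup>2 / d ^ 4))"
    by (simp add: ac_simps)
  also have "\<dots> \<le> (2 * c * z ^ 5 / l ^ 3)\<^sup>2 * (16 * a\<^sup>2 * (kap * z ^ 19 * vy\<^sup>2 / d ^ 4))"
    using kap_pos z d_bounds by (intro mult_right_mono X5) auto
  also have "\<dots> = c\<^sup>2 * (64 * a\<^sup>2) * (kap * (z ^ 10 * z ^ 19) / d ^ 4) * (vy\<^sup>2 / l ^ 6)"
  proof -
    have "(2 * c * z ^ 5 / l ^ 3)\<^sup>2 = 4 * (c\<^sup>2 * (z ^ 10 / l ^ 6))"
      by (simp add: power_mult_distrib power_divide flip: power_mult)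
    then show ?thesis by (simp add: ac_simps del: power_add_numeral power_add_numeral2)
  qed
  also have "z ^ 10 * z ^ 19 = z ^ 29" by (simp flip: power_add)
  also have "c\<^sup>2 * (64 * a\<^sup>2) * (kap * z ^ 29 / d ^ 4) * (vy\<^sup>2 / l ^ 6) \<le> 1 * (64 * a\<^sup>2) * ke * (vy\<^sup>2 / l ^ 6)"
    using kap_d4 c l kap_pos z d_bounds by (intro mult_right_mono mult_mono) (auto simp: power_le_one)
  finally have "B / (4 * \<delta>) * (kap * z * (Xth * (4 * a * z ^ 9 * vy) / d\<^sup>2)\<^sup>2)
      \<le> B / (4 * \<delta>) * (64 * a\<^sup>2 * ke * (vy\<^sup>2 / l ^ 6))"
    using params \<delta> by (intro mult_left_mono) auto
  moreover have "2 * (B / (4 * \<delta>) * (64 * a\<^sup>2 * ke * (vy\<^sup>2 / l ^ 6))) = 32 * B * a\<^sup>2 * ke / \<delta> * (vy\<^sup>2 / l ^ 6)"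
    using \<delta> by (simp add: field_simps)
  ultimately show ?thesis using F_young[of "Xth * (4 * a * z ^ 9 * vy) / d\<^sup>2"]
      abs_ge_self[of "Xth * (4 * a * z ^ 9 * vy) / d\<^sup>2 * F"]
    by linarith
qed

text \<open>The logarithmic derivative of the heat capacity in \<open>th\<close> is at most
  \<open>3 / th\<close>, so this term is a multiple of \<open>Gd\<close> with the factor
  \<open>c\<close>, and Young's inequality is avoided.\<close>

lemma t_f4: "2 * (Xth * (12 * a * v * z ^ 6 * ty) / d\<^sup>2) * F \<le> 12 * B * c / Cv * Gd"
proof -
  let ?x = "Xth * (12 * a * v * z ^ 6 * ty) / d\<^sup>2"
  have "12 * a * v * z ^ 6 = 3 * (4 * a * v * z ^ 9) / z ^ 3" using z by (simp add: power_numeral_reduce)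
  also have "\<dots> \<le> 3 * d / z ^ 3" using d_bounds z by (intro divide_right_mono mult_left_mono) auto
  finally have k: "12 * a * v * z ^ 6 \<le> 3 * d / z ^ 3" .
  have "\<bar>?x * F\<bar> \<le> B * (kap * \<bar>ty * ?x\<bar>)" by (rule F_le)
  also have "\<bar>ty * ?x\<bar> = Xth * (12 * a * v * z ^ 6) * (ty\<^sup>2 / d\<^sup>2)"
    using Xb(4) params v z by (simp add: abs_mult power2_eq_square)
  also have "B * (kap * (Xth * (12 * a * v * z ^ 6) * (ty\<^sup>2 / d\<^sup>2)))
      \<le> B * (kap * ((2 * c * z\<^sup>2) * (3 * d / z ^ 3) * (ty\<^sup>2 / d\<^sup>2)))"
    using Xb(4,5) k params kap_pos v z c d_bounds by (intro mult_left_mono mult_right_mono mult_mono) auto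
  also have "\<dots> = 6 * B * c * Gd * (1 / d)"
    using z d_bounds by (simp add: Gd_def field_simps power_numeral_reduce)
  also have "\<dots> \<le> 6 * B * c * Gd * (1 / Cv)"
    using inv_d nn params c by (intro mult_left_mono) auto
  finally show ?thesis using abs_ge_self[of "?x * F"] by simp
qed

lemma Xth_d: "0 \<le> Xth / d" "Xth / d \<le> 2 * c / Cv * z\<^sup>2"
proof -
  show "0 \<le> Xth / d" using Xb(4) d_bounds by simp
  have "Xth * (1 / d) \<le> (2 * c * z\<^sup>2) * (1 / Cv)"
    using Xb(4,5) inv_d d_bounds c by (intro mult_mono) auto
  then show "Xth / d \<le> 2 * c / Cv * z\<^sup>2" by simp
qed

lemma t_g1: "2 * (Xth / d) * (sg * uy) \<le> 4 * c / Cv * (lam * B + 1) * (Gu + cp * Q8)"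
proof -
  have "2 * (Xth / d) * (sg * uy) \<le> 2 * (Xth / d) * \<bar>sg * uy\<bar>"
    using Xth_d by (intro mult_left_mono) auto
  also have "\<dots> \<le> 2 * (2 * c / Cv * z\<^sup>2) * ((lam * B + 1) * (uy\<^sup>2 + cp * (1 + z ^ 24)))"
    using Xth_d abs_sg_uy params c by (intro mult_mono) auto
  also have "\<dots> = 4 * c / Cv * (lam * B + 1) * (Gu + cp * Q8)"
    by (simp add: Gu_def Q8_def algebra_simps add_divide_distrib)
  finally show ?thesis .
qed

text \<open>The radiative part of the heat capacity makes \<open>z ^ 12 / d\<close> of order
  \<open>z^3\<close>; together with \<open>Xth\<close> of order \<open>z^2\<close> this leaves the
  weight \<open>z^2\<close> times \<open>z^3 |uy|\<close>.\<close>

lemma t_g2: "- (2 * (Xth / d) * (a * z ^ 12 * uy)) \<le> c * B * Gu + c * B * Q8"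
proof -
  have "a * z ^ 12 / d = a * z ^ 3 * (z ^ 9 / d)" by (simp add: power_numeral_reduce)
  also have "\<dots> \<le> a * z ^ 3 * (B / (4 * a))" using inv_d z params by (intro mult_left_mono) auto
  also have "\<dots> = B / 4 * z ^ 3" using params by simp
  finally have 1: "a * z ^ 12 / d \<le> B / 4 * z ^ 3" .
  have "- (2 * (Xth / d) * (a * z ^ 12 * uy)) \<le> 2 * (Xth * (a * z ^ 12 / d)) * \<bar>uy\<bar>"
  proof -
    have "(2 * (Xth * (a * z ^ 12 / d))) * - uy \<le> (2 * (Xth * (a * z ^ 12 / d))) * \<bar>uy\<bar>"
      using Xb(4) params z d_bounds by (intro mult_left_mono) auto
    then show ?thesis by simp
  qed
  also have "\<dots> \<le> 2 * ((2 * c * z\<^sup>2) * (B / 4 * z ^ 3)) * \<bar>uy\<bar>"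
    using 1 Xb(4,5) params z c d_bounds by (intro mult_right_mono mult_left_mono mult_mono) auto
  also have "\<dots> = c * B * z\<^sup>2 * (z ^ 3 * \<bar>uy\<bar>)" by simp
  also have "\<dots> \<le> c * B * z\<^sup>2 * (uy\<^sup>2 + (1 + z ^ 24))"
  proof (rule mult_left_mono)
    have "2 * (z ^ 3 * \<bar>uy\<bar>) \<le> uy\<^sup>2 + z ^ 6"
      using zero_le_power2[of "z ^ 3 - \<bar>uy\<bar>"] by (simp add: power2_diff flip: power_mult)
    moreover have "0 \<le> z ^ 3 * \<bar>uy\<bar>" using z by simp
    ultimately have "z ^ 3 * \<bar>uy\<bar> \<le> uy\<^sup>2 + z ^ 6" by linarith
    then show "z ^ 3 * \<bar>uy\<bar> \<le> uy\<^sup>2 + (1 + z ^ 24)"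
      using power_le_one_plus_power[of z 6 24] z by simp
  qed (use c params in auto)
  also have "\<dots> = c * B * Gu + c * B * Q8" by (simp add: Gu_def Q8_def algebra_simps)
  finally show ?thesis .
qed

lemma Qw_le: "Qw \<le> B * (mu + nu) * (wy + by')"
proof -
  have "Qw = (1 / v) * (mu * wy + nu * by')" by (simp add: Qw_def add_divide_distrib)
  also have "\<dots> \<le> B * (mu * wy + nu * by')" using v params nonneg by (intro mult_right_mono) auto
  also have "\<dots> \<le> B * ((mu + nu) * (wy + by'))"
    using params nonneg by (intro mult_left_mono) (auto simp: algebra_simps)
  finally show ?thesis by simp
qed

text \<open>The heating by \<open>w_y\<close> and \<open>b_y\<close> is left uncompensated. It
  appears once with the weight \<open>z^2\<close> and once with the multiplier
  \<open>Xth / d\<close> of the same order, and produces the integrand of \<open>N\<close>.\<close>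

lemma t_gh: "2 * (Xth / d) * Qw + z\<^sup>2 * Qw \<le> (4 / Cv + 1) * (B * (mu + nu)) * (z\<^sup>2 * (wy + by'))"
proof -
  have "2 * (Xth / d) \<le> 2 * (2 * c / Cv * z\<^sup>2)" using Xth_d by simp
  also have "\<dots> \<le> 2 * (2 * 1 / Cv * z\<^sup>2)" using c params by (intro mult_left_mono mult_right_mono divide_right_mono) auto
  finally have "2 * (Xth / d) + z\<^sup>2 \<le> (4 / Cv + 1) * z\<^sup>2" by (simp add: algebra_simps)
  then have "(2 * (Xth / d) + z\<^sup>2) * Qw \<le> (4 / Cv + 1) * z\<^sup>2 * (B * (mu + nu) * (wy + by'))"
    using Qw_le nn params z by (intro mult_mono) auto
  moreover have "(2 * (Xth / d) + z\<^sup>2) * Qw = 2 * (Xth / d) * Qw + z\<^sup>2 * Qw" by (rule distrib_right)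
  moreover have "(4 / Cv + 1) * z\<^sup>2 * (B * (mu + nu) * (wy + by')) = (4 / Cv + 1) * (B * (mu + nu)) * (z\<^sup>2 * (wy + by'))"
    by (simp only: ac_simps)
  ultimately show ?thesis by simp
qed

text \<open>The coefficient is \<open>6/7 - 1\<close>: the density \<open>6/7 a v z^14\<close>
  contributes \<open>6/7\<close> through \<open>v_t = u_y\<close>, and the weighted heat equation
  contains the full \<open>a z^14 u_y\<close>.\<close>

lemma t_i: "- (a / 7 * z ^ 14 * uy) \<le> lam / (8 * B) * Gu + 2 * B * a\<^sup>2 / (49 * lam) * Q8"
proof -
  have "- uy * (a / 7 * z ^ 12) \<le> lam / (8 * B) * (- uy)\<^sup>2 + (a / 7 * z ^ 12)\<^sup>2 / (4 * (lam / (8 * B)))"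
    by (rule young) (use params in auto)
  also have "(a / 7 * z ^ 12)\<^sup>2 / (4 * (lam / (8 * B))) = 2 * B * a\<^sup>2 / (49 * lam) * z ^ 24"
    using params by (simp add: power_mult_distrib power_divide field_simps flip: power_mult)
  also have "\<dots> \<le> 2 * B * a\<^sup>2 / (49 * lam) * (1 + z ^ 24)" using params by (intro mult_left_mono) auto
  finally have "z\<^sup>2 * (- uy * (a / 7 * z ^ 12)) \<le> z\<^sup>2 * (lam / (8 * B) * (- uy)\<^sup>2 + 2 * B * a\<^sup>2 / (49 * lam) * (1 + z ^ 24))"
    by (intro mult_left_mono) auto
  then show ?thesis by (simp add: Gu_def Q8_def algebra_simps flip: power_add)
qed

definition rest where
  "rest = Wt + by' + bb * (1 + z ^ 12) + z\<^sup>2 * (wy + by') + Q8 + vy\<^sup>2 / l ^ 6"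

definition const where
  "const = 2 * (2 + 12 / c) * (lam * B + 1) * (1 + cp) + 1 + (4 / Cv + 1) * (B * (mu + nu))
    + (B * cp / (2 * lam) + 9 * c * cp / \<delta> + 4 * c / Cv * (lam * B + 1) * cp + c * B + 2 * B * a\<^sup>2 / (49 * lam))
    + 32 * B * a\<^sup>2 * ke / \<delta>"

definition integrand where
  "integrand = - (2 / (3 * z) * ty * F) - z\<^sup>2 * (sg * uy) + 2 * (z\<^sup>2 - Xuu) * (sg * uy)
    - 2 * (Xuth * ty) * sg - 2 * Xu * bby
    - 2 * ((Xuth * uy + Xthth * ty) / d - Xth * (4 * a * z ^ 9 * vy + 12 * a * v * z ^ 6 * ty) / d\<^sup>2) * F
    + 2 * (Xth / d) * (sg * uy - a * z ^ 12 * uy + Qw) + z\<^sup>2 * Qw - a / 7 * z ^ 14 * uy"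

text \<open>The first two assumptions let the small terms consume half of the coefficient of
  \<open>Gd\<close>; the third one together with \<open>t_i\<close> consumes half of that of
  \<open>Gu\<close>. The other halves remain on the left.\<close>

lemma integrand_le:
  assumes "(2 / k1 + 4 * B) * \<delta> \<le> 1 / (6 * B)" "26 * B / Cv * c \<le> 1 / (6 * B)"
    and "(9 * (lam * B)\<^sup>2 / \<delta> + 9 * B * kd / (2 * \<delta>) + 4 / Cv * (lam * B + 1) + B) * c \<le> lam / (8 * B)"
  shows "integrand + 1 / (3 * B) * Gd + lam / (4 * B) * Gu \<le> const * rest"
proof -
  have f: "- (2 * ((Xuth * uy + Xthth * ty) / d - Xth * (4 * a * z ^ 9 * vy + 12 * a * v * z ^ 6 * ty) / d\<^sup>2) * F)
    = - (2 * (Xuth * uy / d) * F) - 2 * (Xthth * ty / d) * F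
      + 2 * (Xth * (4 * a * z ^ 9 * vy) / d\<^sup>2) * F + 2 * (Xth * (12 * a * v * z ^ 6 * ty) / d\<^sup>2) * F"
    by (simp add: add_divide_distrib algebra_simps)
  have g: "2 * (Xth / d) * (sg * uy - a * z ^ 12 * uy + Qw)
    = 2 * (Xth / d) * (sg * uy) - 2 * (Xth / d) * (a * z ^ 12 * uy) + 2 * (Xth / d) * Qw"
    by (simp add: algebra_simps add_divide_distrib)
  define q1 q2 q3 q4 q5 where "q1 = 2 * (2 + 12 / c) * (lam * B + 1) * (1 + cp)"
    and "q2 = (4 / Cv + 1) * (B * (mu + nu))"
    and "q3 = B * cp / (2 * lam) + 9 * c * cp / \<delta> + 4 * c / Cv * (lam * B + 1) * cp + c * B + 2 * B * a\<^sup>2 / (49 * lam)"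
    and "q4 = 32 * B * a\<^sup>2 * ke / \<delta>" and "q5 = (1::real)"
  have q: "0 \<le> q1" "0 \<le> q2" "0 \<le> q3" "0 \<le> q4"
    unfolding q1_def q2_def q3_def q4_def using params c \<delta> kde_pos by auto
  have cq: "const = q1 + q5 + q2 + q3 + q4" by (simp add: const_def q1_def q2_def q3_def q4_def q5_def)
  have r: "0 \<le> by' + bb * (1 + z ^ 12)" "0 \<le> z\<^sup>2 * (wy + by')" "0 \<le> vy\<^sup>2 / l ^ 6"
    using nonneg z l by auto
  have A: "integrand \<le> - (2 / (3 * B) * Gd) + (2 * \<delta> / k1 * Gd + 2 * B * \<delta> * Gd + 14 * B * c / Cv * Gd + 2 * B * \<delta> * Gd + 12 * B * c / Cv * Gd)
    - lam / (2 * B) * Gu + (9 * c * (lam * B)\<^sup>2 / \<delta> * Gu + 9 * B * c * kd / (2 * \<delta>) * Gu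
      + 4 * c / Cv * (lam * B + 1) * Gu + c * B * Gu + lam / (8 * B) * Gu)
    + q1 * Wt + (by' + bb * (1 + z ^ 12)) + q2 * (z\<^sup>2 * (wy + by')) + q3 * Q8 + q4 * (vy\<^sup>2 / l ^ 6)"
  proof -
    have q3': "q3 * Q8 = B * cp / (2 * lam) * Q8 + 9 * c * cp / \<delta> * Q8 + 4 * c / Cv * (lam * B + 1) * (cp * Q8) + c * B * Q8
        + 2 * B * a\<^sup>2 / (49 * lam) * Q8" unfolding q3_def by (simp only: distrib_right mult.assoc)
    have g1': "4 * c / Cv * (lam * B + 1) * (Gu + cp * Q8) = 4 * c / Cv * (lam * B + 1) * Gu + 4 * c / Cv * (lam * B + 1) * (cp * Q8)"
      by (rule distrib_left)
    show ?thesis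
      unfolding integrand_def g q3' using f t_a t_b t_c[folded q1_def] t_d t_e t_f1 t_f2 t_f3[folded q4_def] t_f4 t_g1[unfolded g1'] t_g2 t_gh[folded q2_def] t_i
      by linarith
  qed
  have Gd: "2 * \<delta> / k1 * Gd + 2 * B * \<delta> * Gd + 14 * B * c / Cv * Gd + 2 * B * \<delta> * Gd + 12 * B * c / Cv * Gd \<le> 1 / (3 * B) * Gd"
  proof -
    have "2 * \<delta> / k1 * Gd + 2 * B * \<delta> * Gd + 14 * B * c / Cv * Gd + 2 * B * \<delta> * Gd + 12 * B * c / Cv * Gd
        = ((2 / k1 + 4 * B) * \<delta> + 26 * B / Cv * c) * Gd" by (simp add: algebra_simps)
    also have "\<dots> \<le> (1 / (6 * B) + 1 / (6 * B)) * Gd" using assms nn by (intro mult_right_mono add_mono) auto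
    finally show ?thesis by simp
  qed
  have Gu: "9 * c * (lam * B)\<^sup>2 / \<delta> * Gu + 9 * B * c * kd / (2 * \<delta>) * Gu
      + 4 * c / Cv * (lam * B + 1) * Gu + c * B * Gu + lam / (8 * B) * Gu \<le> lam / (4 * B) * Gu"
  proof -
    have "9 * c * (lam * B)\<^sup>2 / \<delta> * Gu + 9 * B * c * kd / (2 * \<delta>) * Gu
      + 4 * c / Cv * (lam * B + 1) * Gu + c * B * Gu + lam / (8 * B) * Gu
      = ((9 * (lam * B)\<^sup>2 / \<delta> + 9 * B * kd / (2 * \<delta>) + 4 / Cv * (lam * B + 1) + B) * c + lam / (8 * B)) * Gu"
      by (simp add: algebra_simps)
    also have "\<dots> \<le> (lam / (8 * B) + lam / (8 * B)) * Gu" using assms nn by (intro mult_right_mono add_mono) auto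
    finally show ?thesis by (simp add: field_simps)
  qed
  have R: "q1 * Wt + (by' + bb * (1 + z ^ 12)) + q2 * (z\<^sup>2 * (wy + by')) + q3 * Q8 + q4 * (vy\<^sup>2 / l ^ 6) \<le> const * rest"
  proof -
    have qs: "q1 \<le> const" "1 \<le> const" "q2 \<le> const" "q3 \<le> const" "q4 \<le> const"
      using q by (simp_all add: cq q5_def)
    have "q1 * Wt \<le> const * Wt" "1 * (by' + bb * (1 + z ^ 12)) \<le> const * (by' + bb * (1 + z ^ 12))"
      "q2 * (z\<^sup>2 * (wy + by')) \<le> const * (z\<^sup>2 * (wy + by'))" "q3 * Q8 \<le> const * Q8"
      "q4 * (vy\<^sup>2 / l ^ 6) \<le> const * (vy\<^sup>2 / l ^ 6)"
      by (rule mult_right_mono; use qs r nn in blast)+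
    moreover have "const * rest = const * Wt + const * (by' + bb * (1 + z ^ 12)) + const * (z\<^sup>2 * (wy + by')) + const * Q8 + const * (vy\<^sup>2 / l ^ 6)"
      unfolding rest_def by (simp only: distrib_left add.assoc)
    ultimately show ?thesis unfolding mult_1_left by linarith
  qed
  have "2 / (3 * B) * Gd = 1 / (3 * B) * Gd + 1 / (3 * B) * Gd" by simp
  moreover have "lam / (2 * B) * Gu = lam / (4 * B) * Gu + lam / (4 * B) * Gu" by simp
  ultimately show ?thesis using A Gd Gu R by linarith
qed

end

section \<open>The weighted estimate for slowly growing conductivity\<close>

lemma has_real_derivative_powr_const:
  assumes "(f has_real_derivative D) (at x within X)" "0 < f x"
  shows "((\<lambda>x. f x powr r) has_real_derivative r * f x powr (r - 1) * D) (at x within X)"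
  by (rule DERIV_chain2[OF has_real_derivative_powr[OF assms(2)] assms(1)])

text \<open>\<open>2/8 + 12/17 < 1\<close>, so Young's inequality holds with arbitrarily small
  coefficients at the price of an additive constant. Comparing \<open>z^5\<close> with
  \<open>w^2\<close> decides which of the two powers dominates.\<close>

lemma mixed_power_bound:
  assumes \<delta>: "0 < \<delta>"
  shows "\<exists>C>0. \<forall>w z. 1 \<le> w \<longrightarrow> 0 < z \<longrightarrow> w\<^sup>2 * z ^ 12 \<le> \<delta> * w ^ 8 + \<delta> * z ^ 17 + (C::real)"
proof -
  define k where "k = 1 / \<delta>"
  \<comment> \<open>For \<open>w > n\<close> the factor \<open>k^12\<close> is at most
    \<open>\<delta>^5 w^6\<close>; this uses the room between the powers \<open>w^24\<close> and
    \<open>w^30\<close> in the third case.\<close>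
  define n where "n = 1 + k ^ 12 / \<delta> ^ 5"
  have k: "0 < k" using \<delta> by (simp add: k_def)
  have n: "1 \<le> n" using k \<delta> by (simp add: n_def)
  define C where "C = n\<^sup>2 * (1 + k * n\<^sup>2) ^ 12"
  have C: "0 < C" using n k by (auto simp: C_def intro!: mult_pos_pos zero_less_power add_pos_nonneg)
  have "w\<^sup>2 * z ^ 12 \<le> \<delta> * w ^ 8 + \<delta> * z ^ 17 + C" if w: "1 \<le> w" and z: "0 < z" for w z
  proof -
    have nn: "0 \<le> \<delta> * w ^ 8" "0 \<le> \<delta> * z ^ 17" using \<delta> w z by auto
    consider "k * w\<^sup>2 \<le> z ^ 5" | "z ^ 5 < k * w\<^sup>2" "w \<le> n" | "z ^ 5 < k * w\<^sup>2" "n < w" by linarith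
    then show ?thesis
    proof cases
      case 1
      have "w\<^sup>2 \<le> \<delta> * z ^ 5" using 1 \<delta> by (simp add: k_def field_simps)
      then have "w\<^sup>2 * z ^ 12 \<le> \<delta> * z ^ 5 * z ^ 12" using z by (intro mult_right_mono) auto
      then have "w\<^sup>2 * z ^ 12 \<le> \<delta> * z ^ 17" by (simp add: mult.assoc)
      then show ?thesis using nn C by linarith
    next
      case 2
      have w2: "w\<^sup>2 \<le> n\<^sup>2" using 2 w by (intro power_mono) auto
      then have "z ^ 5 \<le> k * n\<^sup>2" using 2 mult_left_mono[OF w2, of k] k by linarith
      then have "z ^ 1 \<le> 1 + k * n\<^sup>2" using power_le_one_plus_power[of z 1 5] z by linarith
      then have "z ^ 12 \<le> (1 + k * n\<^sup>2) ^ 12" using z by (intro power_mono) auto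
      then have "w\<^sup>2 * z ^ 12 \<le> C" unfolding C_def using w2 z by (intro mult_mono) auto
      then show ?thesis using nn by linarith
    next
      case 3
      have "(z ^ 12) ^ 5 = (z ^ 5) ^ 12" by (simp flip: power_mult)
      also have "\<dots> \<le> (k * w\<^sup>2) ^ 12" using 3 z by (intro power_mono) auto
      also have "\<dots> = k ^ 12 * w ^ 24" by (simp add: power_mult_distrib flip: power_mult)
      also have "\<dots> \<le> (\<delta> ^ 5 * w ^ 6) * w ^ 24"
      proof (rule mult_right_mono)
        have "k ^ 12 / \<delta> ^ 5 \<le> w" using 3 by (simp add: n_def)
        also have "\<dots> \<le> w ^ 6" using w power_increasing[of 1 6 w] by simp
        finally show "k ^ 12 \<le> \<delta> ^ 5 * w ^ 6" using \<delta> by (simp add: field_simps)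
      qed (use w in auto)
      also have "\<dots> = (\<delta> * w ^ 6) ^ 5"
        by (simp add: power_mult_distrib flip: power_mult power_add)
      finally have "z ^ 12 \<le> \<delta> * w ^ 6"
        using \<delta> w by (intro power_le_imp_le_base[of "z ^ 12" 4 "\<delta> * w ^ 6"]) auto
      then have "w\<^sup>2 * z ^ 12 \<le> w\<^sup>2 * (\<delta> * w ^ 6)" using w by (intro mult_left_mono) auto
      also have "\<dots> = \<delta> * w ^ 8" by (simp flip: power_add)
      finally show ?thesis using nn C by linarith
    qed
  qed
  then show ?thesis using C by blast
qed

locale slow_flows = bounded_flows lam mu nu R a Cv k1 K T S v v_y u u_y u_t th th_y th_t F kap w w_y w_yy w_t b b_y b_yy b_t B
  for lam mu nu R a Cv k1 K T :: real
    and S :: "'s set"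
    and v v_y u u_y u_t th th_y th_t F kap :: "'s \<Rightarrow> real \<Rightarrow> real \<Rightarrow> real"
    and w w_y w_yy w_t b b_y b_yy b_t :: "'s \<Rightarrow> real \<Rightarrow> real \<Rightarrow> 'a::euclidean_space"
    and B :: real +
  fixes k3 :: real
  assumes k3: "0 < k3"
    and kap_le: "\<And>s y t. s \<in> S \<Longrightarrow> y \<in> {0..1} \<Longrightarrow> t \<in> {0..T} \<Longrightarrow> kap s y t \<le> k3 * (1 + (th s y t)\<^sup>2)"
begin

text \<open>The sixth root is there for the suprema: \<open>z^(n+5)\<close> is the square of
  \<open>z6^(n+5)\<close>, whereas for even \<open>n\<close> its square root is not an integral
  power of \<open>z\<close>.\<close>

definition z6 :: "'s \<Rightarrow> real \<Rightarrow> real \<Rightarrow> real" where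
  "z6 s y t = th s y t powr (1 / 6)"
definition z :: "'s \<Rightarrow> real \<Rightarrow> real \<Rightarrow> real" where
  "z s y t = (z6 s y t)\<^sup>2"
text \<open>The cube root puts \<open>1 + u^2\<close> on the same scale as \<open>th\<close>:
  \<open>z\<close> against \<open>\<omega>\<close> compares \<open>th\<close> with
  \<open>1 + u^2\<close>, and the moment of order \<open>5/3\<close> becomes
  \<open>\<omega>^5\<close>.\<close>

definition \<omega> :: "'s \<Rightarrow> real \<Rightarrow> real \<Rightarrow> real" where
  "\<omega> s y t = (1 + (u s y t)\<^sup>2) powr (1 / 3)"

lemma z6_pos: "s \<in> S \<Longrightarrow> y \<in> {0..1} \<Longrightarrow> t \<in> {0..T} \<Longrightarrow> 0 < z6 s y t"
  using v_bounds(6)[of s y t] by (simp add: z6_def)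

lemma z_pos: "s \<in> S \<Longrightarrow> y \<in> {0..1} \<Longrightarrow> t \<in> {0..T} \<Longrightarrow> 0 < z s y t"
  using z6_pos[of s y t] by (simp add: z_def)

lemma z_ne [simp]: "s \<in> S \<Longrightarrow> 0 \<le> y \<Longrightarrow> y \<le> 1 \<Longrightarrow> 0 \<le> t \<Longrightarrow> t \<le> T \<Longrightarrow> z s y t \<noteq> 0"
  "s \<in> S \<Longrightarrow> 0 \<le> y \<Longrightarrow> y \<le> 1 \<Longrightarrow> 0 \<le> t \<Longrightarrow> t \<le> T \<Longrightarrow> z6 s y t \<noteq> 0"
  using z_pos[of s y t] z6_pos[of s y t] by auto

lemma z6_power: "s \<in> S \<Longrightarrow> y \<in> {0..1} \<Longrightarrow> t \<in> {0..T} \<Longrightarrow> z6 s y t ^ 6 = th s y t"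
  using v_bounds(6)[of s y t] by (simp add: z6_def powr_power)

lemma z_power:
  assumes "s \<in> S" "y \<in> {0..1}" "t \<in> {0..T}"
  shows "z s y t ^ 3 = th s y t" "z s y t ^ 6 = (th s y t)\<^sup>2" "z s y t ^ 9 = th s y t ^ 3"
    "z s y t ^ 12 = th s y t ^ 4" "z s y t ^ 24 = th s y t ^ 8"
proof -
  show 3: "z s y t ^ 3 = th s y t" using z6_power[OF assms] by (simp add: z_def flip: power_mult)
  show "z s y t ^ 6 = (th s y t)\<^sup>2" "z s y t ^ 9 = th s y t ^ 3"
    "z s y t ^ 12 = th s y t ^ 4" "z s y t ^ 24 = th s y t ^ 8"
    unfolding 3[symmetric] by (simp_all flip: power_mult)
qed

lemma \<omega>_power: "\<omega> s y t ^ 3 = 1 + (u s y t)\<^sup>2"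
proof -
  have "0 < 1 + (u s y t)\<^sup>2" by (simp add: add_pos_nonneg)
  then show ?thesis by (simp add: \<omega>_def powr_power)
qed

lemma \<omega>_ge_1: "1 \<le> \<omega> s y t"
  unfolding \<omega>_def by (intro ge_one_powr_ge_zero) auto

lemma \<omega>_ne [simp]: "\<omega> s y t \<noteq> 0"
  using \<omega>_ge_1[of s y t] by auto

lemma deriv_z6:
  assumes pos: "s \<in> S" "y \<in> {0..1}" "t \<in> {0..T}"
    and "((\<lambda>x. th s (f x) (g x)) has_real_derivative \<Delta>) (at x within X)" "f x = y" "g x = t"
  shows "((\<lambda>x. z6 s (f x) (g x)) has_real_derivative \<Delta> / (6 * z6 s y t ^ 5)) (at x within X)"
proof -
  have th: "0 < th s y t" using v_bounds(6)[OF pos] .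
  have "th s y t powr (1 / 6 - 1) = z6 s y t / z6 s y t ^ 6"
    unfolding powr_diff z6_power[OF pos] using th by (simp add: z6_def)
  also have "\<dots> = 1 / z6 s y t ^ 5" using z6_pos[OF pos] by (simp add: power_numeral_reduce)
  finally have "1 / 6 * th s y t powr (1 / 6 - 1) = 1 / (6 * z6 s y t ^ 5)" by simp
  moreover have "((\<lambda>x. z6 s (f x) (g x)) has_real_derivative 1 / 6 * th s (f x) (g x) powr (1 / 6 - 1) * \<Delta>) (at x within X)"
    unfolding z6_def by (rule has_real_derivative_powr_const) (use assms th in auto)
  ultimately show ?thesis using assms(5,6) by simp
qed

lemma deriv_z:
  assumes pos: "s \<in> S" "y \<in> {0..1}" "t \<in> {0..T}"
    and "((\<lambda>x. th s (f x) (g x)) has_real_derivative \<Delta>) (at x within X)" "f x = y" "g x = t"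
  shows "((\<lambda>x. z s (f x) (g x)) has_real_derivative \<Delta> / (3 * (z s y t)\<^sup>2)) (at x within X)"
  unfolding z_def using z6_pos[OF pos] assms(5,6)
  by (auto intro!: derivative_eq_intros deriv_z6[OF assms])
    (simp add: field_simps power_numeral_reduce)

lemma deriv_\<omega>:
  assumes "((\<lambda>x. u s (f x) (g x)) has_real_derivative \<Delta>) (at x within X)" "f x = y" "g x = t"
  shows "((\<lambda>x. \<omega> s (f x) (g x)) has_real_derivative 2 * u s y t * \<Delta> / (3 * (\<omega> s y t)\<^sup>2)) (at x within X)"
proof -
  have p: "0 < 1 + (u s y t)\<^sup>2" by (simp add: add_pos_nonneg)
  have "(1 + (u s y t)\<^sup>2) powr (1 / 3 - 1) = \<omega> s y t / \<omega> s y t ^ 3"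
    unfolding \<omega>_power powr_diff using p by (simp add: \<omega>_def)
  also have "\<dots> = 1 / (\<omega> s y t)\<^sup>2" by (simp add: power_numeral_reduce)
  finally have e: "(1 + (u s y t)\<^sup>2) powr (1 / 3 - 1) = 1 / (\<omega> s y t)\<^sup>2" .
  have "((\<lambda>x. 1 + (u s (f x) (g x))\<^sup>2) has_real_derivative 2 * u s y t * \<Delta>) (at x within X)"
    using assms by (auto intro!: derivative_eq_intros)
  then have "((\<lambda>x. \<omega> s (f x) (g x)) has_real_derivative
      1 / 3 * (1 + (u s (f x) (g x))\<^sup>2) powr (1 / 3 - 1) * (2 * u s y t * \<Delta>)) (at x within X)"
    unfolding \<omega>_def by (rule has_real_derivative_powr_const) (use p assms in auto)
  then show ?thesis using assms(2,3) e by (simp add: ac_simps)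
qed

lemma dt_z: "s \<in> S \<Longrightarrow> 0 \<le> y \<Longrightarrow> y \<le> 1 \<Longrightarrow> 0 \<le> t \<Longrightarrow> t \<le> T \<Longrightarrow>
    (z s y has_real_derivative th_t s y t / (3 * (z s y t)\<^sup>2)) (at t within {0..T})"
  using deriv_z[of s y t "\<lambda>_. y" "\<lambda>t. t"] dt(3) by simp

lemma dy_z: "s \<in> S \<Longrightarrow> 0 \<le> y \<Longrightarrow> y \<le> 1 \<Longrightarrow> 0 \<le> t \<Longrightarrow> t \<le> T \<Longrightarrow>
    ((\<lambda>y. z s y t) has_real_derivative th_y s y t / (3 * (z s y t)\<^sup>2)) (at y within {0..1})"
  using deriv_z[of s y t "\<lambda>y. y" "\<lambda>_. t"] dy(3) by simp

lemma dy_z6: "s \<in> S \<Longrightarrow> 0 \<le> y \<Longrightarrow> y \<le> 1 \<Longrightarrow> 0 \<le> t \<Longrightarrow> t \<le> T \<Longrightarrow>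
    ((\<lambda>y. z6 s y t) has_real_derivative th_y s y t / (6 * z6 s y t ^ 5)) (at y within {0..1})"
  using deriv_z6[of s y t "\<lambda>y. y" "\<lambda>_. t"] dy(3) by simp

lemma dt_\<omega>: "s \<in> S \<Longrightarrow> 0 \<le> y \<Longrightarrow> y \<le> 1 \<Longrightarrow> 0 \<le> t \<Longrightarrow> t \<le> T \<Longrightarrow>
    (\<omega> s y has_real_derivative 2 * u s y t * u_t s y t / (3 * (\<omega> s y t)\<^sup>2)) (at t within {0..T})"
  using deriv_\<omega>[of s "\<lambda>_. y" "\<lambda>t. t"] dt(2) by simp

lemma dy_\<omega>: "s \<in> S \<Longrightarrow> 0 \<le> y \<Longrightarrow> y \<le> 1 \<Longrightarrow> 0 \<le> t \<Longrightarrow> t \<le> T \<Longrightarrow>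
    ((\<lambda>y. \<omega> s y t) has_real_derivative 2 * u s y t * u_y s y t / (3 * (\<omega> s y t)\<^sup>2)) (at y within {0..1})"
  using deriv_\<omega>[of s "\<lambda>y. y" "\<lambda>_. t"] dy(2) by simp

lemma jc_z6: "s \<in> S \<Longrightarrow> jcont T (z6 s)"
  unfolding z6_def by (auto intro!: continuous_intros jcs)

lemma jc_z: "s \<in> S \<Longrightarrow> jcont T (z s)"
  unfolding z_def by (auto intro!: continuous_intros jc_z6)

lemma jc_\<omega>: "s \<in> S \<Longrightarrow> jcont T (\<omega> s)"
proof -
  have "1 + x\<^sup>2 \<noteq> 0" for x :: real by (metis add_pos_nonneg less_irrefl zero_le_power2 zero_less_one)
  then show "s \<in> S \<Longrightarrow> jcont T (\<omega> s)"
    unfolding \<omega>_def by (auto intro!: continuous_intros jcs)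
qed

lemmas jzs = jc_z6 jc_z jc_\<omega>
lemmas jzy = jzs[THEN jcont_slice_y]

text \<open>Written with the flux because \<open>F\<close> is continuous and \<open>kap\<close> need
  not be; \<open>GX_eq\<close> recovers the form \<open>kap th_y^2 / z\<close>.\<close>

definition GX :: "'s \<Rightarrow> real \<Rightarrow> real \<Rightarrow> real" where
  "GX s y t = F s y t * th_y s y t * v s y t / z s y t"
definition GY :: "'s \<Rightarrow> real \<Rightarrow> real \<Rightarrow> real" where
  "GY s y t = (\<omega> s y t)\<^sup>2 * (u_y s y t)\<^sup>2"
definition IX :: "'s \<Rightarrow> real \<Rightarrow> real" where "IX s t = integral {0..1} (\<lambda>y. GX s y t)"
definition IY :: "'s \<Rightarrow> real \<Rightarrow> real" where "IY s t = integral {0..1} (\<lambda>y. GY s y t)"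

lemma jc_GX: "s \<in> S \<Longrightarrow> jcont T (GX s)" "s \<in> S \<Longrightarrow> jcont T (GY s)"
  unfolding GX_def GY_def by (auto intro!: continuous_intros jcs jzs)

lemmas GXy = jc_GX[THEN jcont_slice_y]

lemma GX_eq:
  assumes "s \<in> S" "y \<in> {0..1}" "t \<in> {0..T}"
  shows "GX s y t = kap s y t * (th_y s y t)\<^sup>2 / z s y t" "(th_y s y t)\<^sup>2 / z s y t \<le> 1 / k1 * GX s y t" "0 \<le> GX s y t"
proof -
  have pos: "0 < v s y t" "0 < z s y t" using v_bounds(1)[OF assms] z_pos[OF assms] by auto
  have k: "k1 \<le> kap s y t" using dissip_lower(5)[OF assms(1)] assms by auto
  show eq: "GX s y t = kap s y t * (th_y s y t)\<^sup>2 / z s y t"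
    using dissip_lower(6)[OF assms(1), of y t] assms pos by (simp add: GX_def)
  have "1 / k1 * (k1 * ((th_y s y t)\<^sup>2 / z s y t)) \<le> 1 / k1 * (kap s y t * ((th_y s y t)\<^sup>2 / z s y t))"
    using k pos param_pos by (intro mult_left_mono mult_right_mono) auto
  then show "(th_y s y t)\<^sup>2 / z s y t \<le> 1 / k1 * GX s y t" using param_pos by (simp add: eq)
  have "0 \<le> kap s y t" using k param_pos by linarith
  then show "0 \<le> GX s y t" unfolding eq using pos by simp
qed

lemma IX_nonneg: "s \<in> S \<Longrightarrow> t \<in> {0..T} \<Longrightarrow> 0 \<le> IX s t" "s \<in> S \<Longrightarrow> t \<in> {0..T} \<Longrightarrow> 0 \<le> IY s t"
  unfolding IX_def IY_def
  by (rule integral_nonneg_y; use GX_eq(3) GXy in \<open>auto simp: GY_def[symmetric]\<close>)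
    (rule integral_nonneg_y; use GXy in \<open>auto simp: GY_def\<close>)

lemma cont_IX: "s \<in> S \<Longrightarrow> continuous_on {0..T} (IX s)"  "s \<in> S \<Longrightarrow> continuous_on {0..T} (IY s)"
  unfolding IX_def IY_def by (intro jcont_integral jc_GX; simp)+

lemma integral_z12: "s \<in> S \<Longrightarrow> t \<in> {0..T} \<Longrightarrow> integral {0..1} (\<lambda>y. z s y t ^ 12) \<le> B"
proof -
  assume a: "s \<in> S" "t \<in> {0..T}"
  have "integral {0..1} (\<lambda>y. z s y t ^ 12) = integral {0..1} (\<lambda>y. th s y t ^ 4)"
    by (rule integral_cong) (use z_power(4)[OF a(1) _ a(2)] in auto)
  with bdi(1)[OF a] show ?thesis by simp
qed

text \<open>For \<open>f = z6^(n+5)\<close> and the weight \<open>z^n\<close> the squared derivative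
  over the weight is exactly a multiple of \<open>th_y^2 / z\<close>, the dissipation of the balance
  with weight \<open>z^2\<close>. The restriction on \<open>n\<close> keeps the mean of
  \<open>f\<close> below \<open>1 + B\<close>, since \<open>z6^24 = th^4\<close>.\<close>

lemma sup_z:
  assumes s: "s \<in> S" and t: "t \<in> {0..T}" and y: "y \<in> {0..1}" and n: "n \<le> 19"
  shows "z s y t ^ (n + 5) \<le> 2 * (1 + B)\<^sup>2 + (real (n + 5))\<^sup>2 / (18 * k1) * (IX s t * integral {0..1} (\<lambda>y. z s y t ^ n))"
proof -
  have main: "(z6 s y t ^ (n + 5))\<^sup>2 \<le> 2 * (integral {0..1} (\<lambda>y. \<bar>z6 s y t ^ (n + 5)\<bar>))\<^sup>2
    + 2 * (integral {0..1} (\<lambda>y. (real (n + 5) * z6 s y t ^ (n + 4) * (th_y s y t / (6 * z6 s y t ^ 5)))\<^sup>2 / z s y t ^ n)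
      * integral {0..1} (\<lambda>y. z s y t ^ n))"
  proof (rule sup_square_bound_mean[where f = "\<lambda>y. z6 s y t ^ (n + 5)"])
    fix y :: real assume y: "y \<in> {0..1}"
    show "((\<lambda>y. z6 s y t ^ (n + 5)) has_real_derivative real (n + 5) * z6 s y t ^ (n + 4) * (th_y s y t / (6 * z6 s y t ^ 5))) (at y within {0..1})"
    proof -
      have "((\<lambda>y. z6 s y t ^ (n + 5)) has_real_derivative
          real (n + 5) * (th_y s y t / (6 * z6 s y t ^ 5) * z6 s y t ^ (n + 5 - Suc 0))) (at y within {0..1})"
        by (rule DERIV_power[OF dy_z6]) (use s t y in auto)
      moreover have "n + 5 - Suc 0 = n + 4" by simp
      ultimately show ?thesis by (simp only: ac_simps)
    qed
  qed (use s t y z_pos in \<open>auto intro!: continuous_intros jcy jzy\<close>)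
  have i1: "integral {0..1} (\<lambda>y. \<bar>z6 s y t ^ (n + 5)\<bar>) \<le> 1 + B"
  proof -
    have "integral {0..1} (\<lambda>y. \<bar>z6 s y t ^ (n + 5)\<bar>) \<le> integral {0..1} (\<lambda>y. 1 + z s y t ^ 12)"
    proof (rule integral_mono_y)
      fix y :: real assume y: "y \<in> {0..1}"
      have "\<bar>z6 s y t ^ (n + 5)\<bar> = z6 s y t ^ (n + 5)" using z6_pos[OF s y t] by (intro abs_of_nonneg) auto
      also have "\<dots> \<le> 1 + z6 s y t ^ 24" using z6_pos[OF s y t] n by (intro power_le_one_plus_power) auto
      finally show "\<bar>z6 s y t ^ (n + 5)\<bar> \<le> 1 + z s y t ^ 12" by (simp add: z_def flip: power_mult)
    qed (use s t in \<open>auto intro!: continuous_intros jzy\<close>)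
    also have "\<dots> = 1 + integral {0..1} (\<lambda>y. z s y t ^ 12)"
      by (subst integral_add) (use s t in \<open>auto intro!: integrable_continuous_real continuous_intros jzy\<close>)
    finally show ?thesis using integral_z12[OF s t] by simp
  qed
  have i2: "integral {0..1} (\<lambda>y. (real (n + 5) * z6 s y t ^ (n + 4) * (th_y s y t / (6 * z6 s y t ^ 5)))\<^sup>2 / z s y t ^ n)
      \<le> (real (n + 5))\<^sup>2 / (36 * k1) * IX s t"
    unfolding IX_def
  proof (rule integral_mult_bound[OF _ _ _ order.refl])
    fix y :: real assume y: "y \<in> {0..1}"
    have "(real (n + 5) * z6 s y t ^ (n + 4) * (th_y s y t / (6 * z6 s y t ^ 5)))\<^sup>2 / z s y t ^ n
        = (real (n + 5))\<^sup>2 / 36 * ((th_y s y t)\<^sup>2 / z s y t)"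
    proof -
      have "(z6 s y t ^ (n + 4))\<^sup>2 = z6 s y t ^ (2 * n) * z6 s y t ^ 8"
        by (simp add: algebra_simps flip: power_mult power_add)
      moreover have "(z6 s y t ^ 5)\<^sup>2 = z6 s y t ^ 8 * (z6 s y t)\<^sup>2" by (simp flip: power_mult power_add)
      moreover have "z s y t ^ n = z6 s y t ^ (2 * n)" by (simp add: z_def power_mult)
      ultimately show ?thesis using z6_pos[OF s y t] unfolding power_mult_distrib power_divide
        by (simp add: z_def field_simps del: power_add_numeral power_add_numeral2)
    qed
    also have "\<dots> \<le> (real (n + 5))\<^sup>2 / 36 * (1 / k1 * GX s y t)"
      using GX_eq(2)[OF s y t] by (intro mult_left_mono) auto
    finally show "(real (n + 5) * z6 s y t ^ (n + 4) * (th_y s y t / (6 * z6 s y t ^ 5)))\<^sup>2 / z s y t ^ n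
        \<le> (real (n + 5))\<^sup>2 / (36 * k1) * GX s y t" by simp
  qed (use s t z_pos param_pos in \<open>auto intro!: continuous_intros jcy jzy GXy\<close>)
  have "0 \<le> integral {0..1} (\<lambda>y. \<bar>z6 s y t ^ (n + 5)\<bar>)" "0 \<le> integral {0..1} (\<lambda>y. z s y t ^ n)"
    using s t z_pos by (auto intro!: integral_nonneg_y continuous_intros jzy simp: less_imp_le)
  then have "(z6 s y t ^ (n + 5))\<^sup>2 \<le> 2 * (1 + B)\<^sup>2
    + 2 * ((real (n + 5))\<^sup>2 / (36 * k1) * IX s t * integral {0..1} (\<lambda>y. z s y t ^ n))"
    by (intro order_trans[OF main] add_mono mult_left_mono power_mono mult_right_mono i1 i2) auto
  moreover have "(z6 s y t ^ (n + 5))\<^sup>2 = z s y t ^ (n + 5)" by (simp add: z_def mult.commute flip: power_mult)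
  ultimately show ?thesis by (simp add: ac_simps)
qed

text \<open>For \<open>f = \<omega>^4\<close> and the weight \<open>1 + u^2\<close> the squared
  derivative over the weight is at most a multiple of \<open>\<omega>^2 u_y^2\<close>. The reference
  point is one where \<open>1 + u^2\<close> is at most its mean; there
  \<open>\<omega>^8 \<le> \<omega>^12\<close> is bounded by the energy.\<close>

lemma sup_\<omega>:
  assumes s: "s \<in> S" and t: "t \<in> {0..T}" and y: "y \<in> {0..1}"
  shows "\<omega> s y t ^ 8 \<le> 2 * (1 + B) ^ 4 + 128 / 9 * (1 + B) * IY s t"
proof -
  have iu: "integral {0..1} (\<lambda>y. 1 + (u s y t)\<^sup>2) \<le> 1 + B"
    by (subst integral_add) (use s t bdi(2) in \<open>auto intro!: integrable_continuous_real continuous_intros jcy\<close>)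
  obtain x where x: "x \<in> {0..1}" "1 + (u s x t)\<^sup>2 \<le> 1 + B"
  proof (rule exists_le_mean[of "\<lambda>y. 1 + (u s y t)\<^sup>2"])
    show "continuous_on {0..1} (\<lambda>y. 1 + (u s y t)\<^sup>2)" using s t by (auto intro!: continuous_intros jcy)
  qed (use iu that in force)
  have w3: "\<omega> s x t ^ 3 \<le> 1 + B" using x(2) \<omega>_power[of s x t] by simp
  have "(\<omega> s x t ^ 4)\<^sup>2 \<le> (\<omega> s x t ^ 3) ^ 4"
    using \<omega>_ge_1[of s x t] by (simp add: power_increasing flip: power_mult)
  also have "\<dots> \<le> (1 + B) ^ 4" using w3 \<omega>_ge_1[of s x t] by (intro power_mono) auto
  finally have wx: "(\<omega> s x t ^ 4)\<^sup>2 \<le> (1 + B) ^ 4" .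
  have "(\<omega> s y t ^ 4)\<^sup>2 \<le> 2 * (\<omega> s x t ^ 4)\<^sup>2
    + 2 * (integral {0..1} (\<lambda>y. (8 / 3 * (\<omega> s y t * u s y t * u_y s y t))\<^sup>2 / (1 + (u s y t)\<^sup>2))
      * integral {0..1} (\<lambda>y. 1 + (u s y t)\<^sup>2))"
  proof (rule sup_square_bound_point[where f = "\<lambda>y. \<omega> s y t ^ 4"])
    fix y :: real assume y: "y \<in> {0..1}"
    show "((\<lambda>y. \<omega> s y t ^ 4) has_real_derivative 8 / 3 * (\<omega> s y t * u s y t * u_y s y t)) (at y within {0..1})"
      using s t y by (auto intro!: derivative_eq_intros dy_\<omega>) (simp add: field_simps power_numeral_reduce)
    show "0 < 1 + (u s y t)\<^sup>2" by (simp add: add_pos_nonneg)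
  qed (use s t y x in \<open>auto intro!: continuous_intros jcy jzy\<close>)
  also have "\<dots> \<le> 2 * (1 + B) ^ 4 + 2 * (64 / 9 * IY s t * (1 + B))"
  proof (intro add_mono mult_left_mono mult_mono)
    show "integral {0..1} (\<lambda>y. (8 / 3 * (\<omega> s y t * u s y t * u_y s y t))\<^sup>2 / (1 + (u s y t)\<^sup>2)) \<le> 64 / 9 * IY s t"
      unfolding IY_def
    proof (rule integral_mult_bound[OF _ _ _ order.refl])
      have ne: "1 + x\<^sup>2 \<noteq> 0" for x :: real by (metis add_pos_nonneg less_irrefl zero_le_power2 zero_less_one)
      then show "continuous_on {0..1} (\<lambda>y. (8 / 3 * (\<omega> s y t * u s y t * u_y s y t))\<^sup>2 / (1 + (u s y t)\<^sup>2))"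
        using s t by (auto intro!: continuous_intros jcy jzy)
      fix y :: real assume y: "y \<in> {0..1}"
      have p: "0 < 1 + (u s y t)\<^sup>2" by (simp add: add_pos_nonneg)
      have "(8 / 3 * (\<omega> s y t * u s y t * u_y s y t))\<^sup>2 / (1 + (u s y t)\<^sup>2)
          = 64 / 9 * GY s y t * ((u s y t)\<^sup>2 / (1 + (u s y t)\<^sup>2))"
        by (simp add: GY_def power_mult_distrib power_divide)
      also have "\<dots> \<le> 64 / 9 * GY s y t * 1"
        using p by (intro mult_left_mono) (auto simp: GY_def)
      finally show "(8 / 3 * (\<omega> s y t * u s y t * u_y s y t))\<^sup>2 / (1 + (u s y t)\<^sup>2) \<le> 64 / 9 * GY s y t" by simp
    qed (use s t in \<open>auto intro!: GXy\<close>)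
  qed (use wx iu s t IX_nonneg B_ge_1 in \<open>auto intro!: integral_nonneg_y continuous_intros jcy\<close>)
  finally have "(\<omega> s y t ^ 4)\<^sup>2 \<le> 2 * (1 + B) ^ 4 + 2 * (64 / 9 * IY s t * (1 + B))" .
  moreover have "(\<omega> s y t ^ 4)\<^sup>2 = \<omega> s y t ^ 8" by (simp flip: power_mult)
  moreover have "2 * (64 / 9 * IY s t * (1 + B)) = 128 / 9 * (1 + B) * IY s t" by simp
  ultimately show ?thesis by linarith
qed

text \<open>One factor \<open>z^12\<close> is integrated by the energy. The supremum of the other
  factor \<open>\<omega>^2 z^12\<close> is split into \<open>\<omega>^8\<close> and
  \<open>z^17\<close>, and \<open>sup_\<omega>\<close> and \<open>sup_z\<close> with
  \<open>n = 12\<close> bound these linearly by the two dissipations. The splitting has small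
  coefficients, hence so has the result.\<close>

lemma \<omega>_pressure_bound:
  assumes \<eta>: "0 < \<eta>"
  shows "\<exists>C>0. \<forall>s\<in>S. \<forall>t\<in>{0..T}. integral {0..1} (\<lambda>y. (\<omega> s y t)\<^sup>2 * (1 + z s y t ^ 24)) \<le> \<eta> * (IX s t + IY s t) + C"
proof -
  define c1 where "c1 = 2 * (1 + B)\<^sup>2 + 2 * (1 + B) ^ 4"
  define c2 where "c2 = 289 / (18 * k1) * B + 128 / 9 * (1 + B)"
  have c12: "0 < c1" "0 < c2" using B_ge_1 param_pos
    by (auto simp: c1_def c2_def intro!: add_pos_pos mult_pos_pos zero_less_power)
  define \<delta> where "\<delta> = \<eta> / (c2 * B)"
  have \<delta>: "0 < \<delta>" using \<eta> c12 B_ge_1 by (simp add: \<delta>_def)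
  obtain C0 where C0: "0 < C0" "\<And>w z. 1 \<le> w \<Longrightarrow> 0 < z \<Longrightarrow> w\<^sup>2 * z ^ 12 \<le> \<delta> * w ^ 8 + \<delta> * z ^ 17 + (C0::real)"
    using mixed_power_bound[OF \<delta>] by blast
  define C where "C = (1 + B) + (\<delta> * c1 + C0) * B"
  have C: "0 < C" using B_ge_1 \<delta> c12 C0 by (auto simp: C_def intro!: add_pos_pos mult_pos_pos)
  have "integral {0..1} (\<lambda>y. (\<omega> s y t)\<^sup>2 * (1 + z s y t ^ 24)) \<le> \<eta> * (IX s t + IY s t) + C"
    if s: "s \<in> S" and t: "t \<in> {0..T}" for s t
  proof -
    define q where "q = \<delta> * (c1 + c2 * (IX s t + IY s t)) + C0"
    have q0: "0 \<le> q" using \<delta> c12 IX_nonneg[OF s t] C0 by (simp add: q_def)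
    have le: "(\<omega> s y t)\<^sup>2 * z s y t ^ 12 \<le> q" if y: "y \<in> {0..1}" for y
    proof -
      have "z s y t ^ 17 \<le> 2 * (1 + B)\<^sup>2 + 289 / (18 * k1) * (IX s t * integral {0..1} (\<lambda>y. z s y t ^ 12))"
        using sup_z[OF s t y, of 12] by simp
      also have "\<dots> \<le> 2 * (1 + B)\<^sup>2 + 289 / (18 * k1) * (IX s t * B)"
        using integral_z12[OF s t] IX_nonneg[OF s t] param_pos by (intro add_left_mono mult_left_mono) auto
      finally have z17: "z s y t ^ 17 \<le> 2 * (1 + B)\<^sup>2 + 289 / (18 * k1) * (IX s t * B)" .
      have "z s y t ^ 17 + \<omega> s y t ^ 8 \<le> c1 + c2 * (IX s t + IY s t)"
      proof -
        have "0 \<le> 128 / 9 * (1 + B) * IX s t" "0 \<le> 289 / (18 * k1) * B * IY s t"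
          using IX_nonneg[OF s t] B_ge_1 param_pos by auto
        moreover have "c2 * (IX s t + IY s t) = 289 / (18 * k1) * (IX s t * B) + 289 / (18 * k1) * B * IY s t
            + (128 / 9 * (1 + B) * IX s t + 128 / 9 * (1 + B) * IY s t)"
          unfolding c2_def distrib_right distrib_left by (simp add: ac_simps)
        ultimately show ?thesis using z17 sup_\<omega>[OF s t y] unfolding c1_def by linarith
      qed
      then have "\<delta> * (z s y t ^ 17 + \<omega> s y t ^ 8) \<le> \<delta> * (c1 + c2 * (IX s t + IY s t))"
        using \<delta> by (intro mult_left_mono) auto
      moreover have "(\<omega> s y t)\<^sup>2 * z s y t ^ 12 \<le> \<delta> * \<omega> s y t ^ 8 + \<delta> * z s y t ^ 17 + C0"
        by (rule C0(2)[OF \<omega>_ge_1 z_pos[OF s y t]])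
      ultimately show ?thesis unfolding q_def distrib_left[of \<delta> "z s y t ^ 17"] by linarith
    qed
    have "integral {0..1} (\<lambda>y. (\<omega> s y t)\<^sup>2 * (1 + z s y t ^ 24)) \<le> integral {0..1} (\<lambda>y. 1 + (u s y t)\<^sup>2 + q * z s y t ^ 12)"
    proof (rule integral_mono_y)
      fix y :: real assume y: "y \<in> {0..1}"
      have "(\<omega> s y t)\<^sup>2 \<le> \<omega> s y t ^ 3" using \<omega>_ge_1[of s y t] by (intro power_increasing) auto
      then have 1: "(\<omega> s y t)\<^sup>2 \<le> 1 + (u s y t)\<^sup>2" by (simp add: \<omega>_power)
      have "(\<omega> s y t)\<^sup>2 * z s y t ^ 24 = (\<omega> s y t)\<^sup>2 * z s y t ^ 12 * z s y t ^ 12" by (simp flip: power_add)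
      also have "\<dots> \<le> q * z s y t ^ 12" using le[OF y] z_pos[OF s y t] by (intro mult_right_mono) auto
      finally show "(\<omega> s y t)\<^sup>2 * (1 + z s y t ^ 24) \<le> 1 + (u s y t)\<^sup>2 + q * z s y t ^ 12"
        using 1 by (simp add: algebra_simps)
    qed (use s t in \<open>auto intro!: continuous_intros jcy jzy\<close>)
    also have "\<dots> = 1 + integral {0..1} (\<lambda>y. (u s y t)\<^sup>2) + q * integral {0..1} (\<lambda>y. z s y t ^ 12)"
      by (subst integral_add3) (use s t in \<open>auto intro!: continuous_intros jcy jzy\<close>)
    also have "\<dots> \<le> 1 + B + q * B"
      using bdi(2)[OF s t] integral_z12[OF s t] q0 by (intro add_mono mult_left_mono) auto
    also have "\<dots> = \<eta> * (IX s t + IY s t) + C"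
      using c12 B_ge_1 by (simp add: q_def C_def \<delta>_def field_simps)
    finally show ?thesis .
  qed
  then show ?thesis using C by blast
qed

end

context slow_flows
begin

definition heat_cap :: "'s \<Rightarrow> real \<Rightarrow> real \<Rightarrow> real" where
  "heat_cap s y t = Cv + 4 * a * v s y t * th s y t ^ 3"
definition ohmic :: "'s \<Rightarrow> real \<Rightarrow> real \<Rightarrow> real" where
  "ohmic s y t = mu * (w_y s y t \<bullet> w_y s y t) / v s y t + nu * (b_y s y t \<bullet> b_y s y t) / v s y t"
text \<open>\<open>Xi\<close> depends on \<open>th\<close>, so its time derivative contains
  \<open>Xi_th * th_t\<close>. The heat equation multiplied by \<open>zeta\<close> contains exactly
  this term, because \<open>zeta * heat_cap = Xi_th\<close>, and removes it.\<close>

definition zeta :: "real \<Rightarrow> real \<Rightarrow> 's \<Rightarrow> real \<Rightarrow> real \<Rightarrow> real" where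
  "zeta c l s y t = Xi_th c (l ^ 3) (u s y t) (z s y t) / heat_cap s y t"
definition zeta_y :: "real \<Rightarrow> real \<Rightarrow> 's \<Rightarrow> real \<Rightarrow> real \<Rightarrow> real" where
  "zeta_y c l s y t =
    (Xi_uth c (l ^ 3) (u s y t) (z s y t) * u_y s y t + Xi_thth c (l ^ 3) (u s y t) (z s y t) * th_y s y t) / heat_cap s y t
    - Xi_th c (l ^ 3) (u s y t) (z s y t) * (4 * a * th s y t ^ 3 * v_y s y t + 12 * a * v s y t * (th s y t)\<^sup>2 * th_y s y t)
      / (heat_cap s y t)\<^sup>2"
text \<open>Source term in the balance law with density \<open>3/5 Cv z\<^sup>5 + 6/7 a v z\<^sup>1\<^sup>4 + 2 \<Xi>\<close> and flux
  \<open>z\<^sup>2 F + 2 \<Xi>\<^sub>u sg + 2 \<zeta> F\<close>. The term \<open>2 \<Xi>\<close> reverses the sign of the production \<open>z\<^sup>2 sg u\<^sub>y\<close> of the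
  density without it, wherever \<open>u\<close> is not too large.\<close>

definition weighted_integrand :: "real \<Rightarrow> real \<Rightarrow> 's \<Rightarrow> real \<Rightarrow> real \<Rightarrow> real" where
  "weighted_integrand c l s y t = - (2 / (3 * z s y t) * th_y s y t * F s y t) - (z s y t)\<^sup>2 * (sg s y t * u_y s y t)
    + 2 * ((z s y t)\<^sup>2 - Xi_uu c (l ^ 3) (u s y t) (z s y t)) * (sg s y t * u_y s y t)
    - 2 * (Xi_uth c (l ^ 3) (u s y t) (z s y t) * th_y s y t) * sg s y t
    - 2 * Xi_u c (l ^ 3) (u s y t) (z s y t) * (b s y t \<bullet> b_y s y t)
    - 2 * zeta_y c l s y t * F s y t
    + 2 * zeta c l s y t * (sg s y t * u_y s y t - a * th s y t ^ 4 * u_y s y t + ohmic s y t)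
    + (z s y t)\<^sup>2 * ohmic s y t - a / 7 * z s y t ^ 14 * u_y s y t"
definition weighted_rest :: "real \<Rightarrow> 's \<Rightarrow> real \<Rightarrow> real \<Rightarrow> real" where
  "weighted_rest l s y t = (l\<^sup>2 + (\<omega> s y t)\<^sup>2) * ((u_y s y t)\<^sup>2 + 1 + z s y t ^ 24) + b_y s y t \<bullet> b_y s y t
    + (b s y t \<bullet> b s y t) * (1 + z s y t ^ 12) + (z s y t)\<^sup>2 * (w_y s y t \<bullet> w_y s y t + b_y s y t \<bullet> b_y s y t)
    + (z s y t)\<^sup>2 * (1 + z s y t ^ 24) + (v_y s y t)\<^sup>2 / l ^ 6"

lemma heat_cap_pos: "s \<in> S \<Longrightarrow> y \<in> {0..1} \<Longrightarrow> t \<in> {0..T} \<Longrightarrow> 0 < heat_cap s y t"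
  using v_bounds[of s y t] param_pos by (auto simp: heat_cap_def intro!: add_pos_pos)

text \<open>The pointwise analysis is applied with \<open>w = \<omega>\<close>. What matters is the
  uniformity: \<open>c\<close> and \<open>C\<close> are independent of \<open>l\<close>, which is
  chosen only at the very end.\<close>

lemma weighted_integrand_le:
  "\<exists>c C. 0 < c \<and> c \<le> 1 \<and> 0 < C \<and> (\<forall>s\<in>S. \<forall>y\<in>{0..1}. \<forall>t\<in>{0..T}. \<forall>l\<ge>1.
    weighted_integrand c l s y t + 1 / (3 * B) * GX s y t \<le> C * weighted_rest l s y t)"
proof -
  define k' where "k' = 2 * k3 * ((1 / Cv)\<^sup>2 + (B / (4 * a))\<^sup>2)"
  have k': "0 < k'" unfolding k'_def using k3 param_pos B_ge_1 by (intro mult_pos_pos add_pos_pos) auto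
  \<comment> \<open>\<open>\<delta>\<close> depends only on the coefficient of \<open>GX\<close> to
    be preserved; \<open>c\<close> is then chosen small in terms of \<open>\<delta>\<close>,
    according to the three assumptions of \<open>integrand_le\<close>.\<close>
  define \<delta> where "\<delta> = 1 / (6 * B) / (2 / k1 + 4 * B)"
  have kk: "0 < 2 / k1 + 4 * B" using param_pos B_ge_1 by (intro add_pos_pos) auto
  have \<delta>: "0 < \<delta>" "(2 / k1 + 4 * B) * \<delta> \<le> 1 / (6 * B)" using kk B_ge_1 by (auto simp: \<delta>_def)
  define q1 q2 where "q1 = 26 * B / Cv" and "q2 = 9 * (lam * B)\<^sup>2 / \<delta> + 9 * B * k' / (2 * \<delta>) + 4 / Cv * (lam * B + 1) + B"
  have q: "0 < q1" "0 < q2" unfolding q1_def q2_def using \<delta> k' param_pos B_ge_1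
    by (auto intro!: add_pos_pos mult_pos_pos divide_pos_pos)
  define c where "c = min 1 (min (1 / (6 * B) / q1) (lam / (8 * B) / q2))"
  have c: "0 < c" "c \<le> 1" using q param_pos B_ge_1 by (auto simp: c_def)
  have "c \<le> 1 / (6 * B) / q1" "c \<le> lam / (8 * B) / q2" by (auto simp: c_def)
  then have c': "q1 * c \<le> 1 / (6 * B)" "q2 * c \<le> lam / (8 * B)"
    unfolding pos_le_divide_eq[OF q(1)] pos_le_divide_eq[OF q(2)] by (simp_all only: mult.commute)
  define e where "e = 2 * k3 * ((1 / Cv) ^ 4 + (B / (4 * a)) ^ 4)"
  define C where "C = 2 * (2 + 12 / c) * (lam * B + 1) * (1 + cp) + 1 + (4 / Cv + 1) * (B * (mu + nu))
    + (B * cp / (2 * lam) + 9 * c * cp / \<delta> + 4 * c / Cv * (lam * B + 1) * cp + c * B + 2 * B * a\<^sup>2 / (49 * lam))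
    + 32 * B * a\<^sup>2 * e / \<delta>"
  have C: "0 < C"
  proof -
    have "0 \<le> e" using k3 param_pos B_ge_1 by (simp add: e_def)
    then show ?thesis unfolding C_def using param_pos B_ge_1 c \<delta> cp_pos
      by (intro add_pos_nonneg add_pos_pos mult_pos_pos divide_pos_pos) auto
  qed
  have "weighted_integrand c l s y t + 1 / (3 * B) * GX s y t \<le> C * weighted_rest l s y t"
    if s: "s \<in> S" and y: "y \<in> {0..1}" and t: "t \<in> {0..T}" and l: "1 \<le> l" for s y t l
  proof -
    note vb = v_bounds[OF s y t] and zp = z_power[OF s y t]
    interpret W: weighted_point lam mu nu a Cv k1 k3 cp B c \<delta> l "\<omega> s y t" "z s y t" "u s y t" "v s y t" "th_y s y t"
      "u_y s y t" "v_y s y t" "kap s y t" "p s y t" "b s y t \<bullet> b s y t" "b_y s y t \<bullet> b_y s y t" "b s y t \<bullet> b_y s y t"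
      "w_y s y t \<bullet> w_y s y t"
    proof unfold_locales
      show "k1 \<le> kap s y t" using dissip_lower(5)[OF s] y t by auto
      show "kap s y t \<le> k3 * (1 + z s y t ^ 6)" using kap_le[OF s y t] zp by simp
      show "(p s y t)\<^sup>2 \<le> cp * (1 + z s y t ^ 24)" using p_square_le[OF s y t] zp by simp
      show "(b s y t \<bullet> b_y s y t)\<^sup>2 \<le> b s y t \<bullet> b s y t * (b_y s y t \<bullet> b_y s y t)" by (rule Cauchy_Schwarz_ineq)
    qed (use param_pos B_ge_1 k3 cp_pos c \<delta> l \<omega>_ge_1 \<omega>_power z_pos[OF s y t] vb in auto)
    have kd: "W.kd = k'" "W.ke = e" by (simp_all add: W.kd_def W.ke_def k'_def e_def)
    have const: "W.const = C" unfolding W.const_def kd C_def by simp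
    have d: "W.d = heat_cap s y t" by (simp add: W.d_def heat_cap_def zp)
    have sg: "W.sg = sg s y t" by (simp add: W.sg_def sg_def)
    have F: "W.F = F s y t" using flux(1)[OF s] y t by (simp add: W.F_def)
    have Gd: "W.Gd = GX s y t" using GX_eq(1)[OF s y t] by (simp add: W.Gd_def)
    have rest: "W.rest = weighted_rest l s y t"
      by (simp add: W.rest_def W.Wt_def W.Q8_def weighted_rest_def)
    have Qw: "W.Qw = ohmic s y t" by (simp add: W.Qw_def ohmic_def)
    have int: "W.integrand = weighted_integrand c l s y t"
      unfolding W.integrand_def weighted_integrand_def d sg F Qw zeta_def zeta_y_def zp ..
    have "W.integrand + 1 / (3 * B) * W.Gd + lam / (4 * B) * W.Gu \<le> W.const * W.rest"
      by (rule W.integrand_le) (use \<delta> c' in \<open>simp_all add: kd q1_def q2_def\<close>)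
    moreover have "0 \<le> lam / (4 * B) * W.Gu" using W.nn param_pos B_ge_1 by simp
    ultimately show ?thesis unfolding int Gd const rest by linarith
  qed
  then show ?thesis using c C by blast
qed

section \<open>The integrated balance of the weighted density and the moment of
  \<open>u\<close>\<close>

definition IN :: "'s \<Rightarrow> real \<Rightarrow> real" where
  "IN s t = integral {0..1} (\<lambda>y. (z s y t)\<^sup>2 * (w_y s y t \<bullet> w_y s y t + b_y s y t \<bullet> b_y s y t))"
definition IA :: "'s \<Rightarrow> real \<Rightarrow> real" where
  "IA s t = integral {0..1} (\<lambda>y. (v_y s y t)\<^sup>2)"
definition MB :: "'s \<Rightarrow> real \<Rightarrow> real" where
  "MB s t = integral {0..1} (\<lambda>y. (b s y t \<bullet> b s y t) * (b_y s y t \<bullet> b_y s y t))"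

lemma cont_INA: "s \<in> S \<Longrightarrow> continuous_on {0..T} (IN s)" "s \<in> S \<Longrightarrow> continuous_on {0..T} (IA s)"
  "s \<in> S \<Longrightarrow> continuous_on {0..T} (MB s)"
  unfolding IN_def IA_def MB_def by (rule jcont_integral, auto intro!: continuous_intros jcs jzs)+

lemma INA_nonneg: "s \<in> S \<Longrightarrow> t \<in> {0..T} \<Longrightarrow> 0 \<le> IN s t" "s \<in> S \<Longrightarrow> t \<in> {0..T} \<Longrightarrow> 0 \<le> IA s t"
  "s \<in> S \<Longrightarrow> t \<in> {0..T} \<Longrightarrow> 0 \<le> MB s t"
  unfolding IN_def IA_def MB_def by (rule integral_nonneg_y, auto intro!: continuous_intros jcy jzy)+

text \<open>The momentum equation is tested with \<open>u \<omega>^2\<close>, because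
  \<open>\<omega>^2 u u_t\<close> is the time derivative of \<open>3/10 \<omega>^5\<close>. The
  resulting dissipation \<open>\<omega>^2 u_y^2\<close> is the term that the truncation leaves over
  for large \<open>u\<close>.\<close>

lemma \<omega>_pointwise:
  assumes s: "s \<in> S" and y: "y \<in> {0..1}" and t: "t \<in> {0..T}"
  shows "- (((\<omega> s y t)\<^sup>2 * u_y s y t + u s y t * (2 * \<omega> s y t * (2 * u s y t * u_y s y t / (3 * (\<omega> s y t)\<^sup>2)))) * sg s y t)
      - u s y t * (\<omega> s y t)\<^sup>2 * (b s y t \<bullet> b_y s y t) + lam / (2 * B) * GY s y t
    \<le> 7 * B * cp / (6 * lam) * ((\<omega> s y t)\<^sup>2 * (1 + z s y t ^ 24)) + (b s y t \<bullet> b s y t) * (b_y s y t \<bullet> b_y s y t) + \<omega> s y t ^ 7"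
proof -
  let ?w = "\<omega> s y t" and ?u = "u s y t" and ?uy = "u_y s y t" and ?v = "v s y t" and ?p = "p s y t"
  note vb = v_bounds[OF s y t]
  have w: "1 \<le> ?w" by (rule \<omega>_ge_1)
  have u2: "?u\<^sup>2 \<le> ?w ^ 3" by (simp add: \<omega>_power)
  \<comment> \<open>\<open>\<gamma>\<close> is the derivative of \<open>u \<omega>^2\<close> with
    respect to \<open>u\<close>; it lies between \<open>\<omega>^2\<close> and
    \<open>7/3 \<omega>^2\<close>.\<close>
  define \<gamma> where "\<gamma> = ?w\<^sup>2 + 4 / 3 * (?u\<^sup>2 / ?w)"
  have "?u\<^sup>2 / ?w \<le> ?w ^ 3 / ?w" using u2 w by (intro divide_right_mono) auto
  also have "\<dots> = ?w\<^sup>2" by (simp add: power_numeral_reduce)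
  finally have \<gamma>: "?w\<^sup>2 \<le> \<gamma>" "\<gamma> \<le> 7 / 3 * ?w\<^sup>2" using w by (auto simp: \<gamma>_def)
  have \<gamma>0: "0 \<le> \<gamma>" using \<gamma>(1) by (rule order_trans[rotated]) simp
  have eq: "?w\<^sup>2 * ?uy + ?u * (2 * ?w * (2 * ?u * ?uy / (3 * ?w\<^sup>2))) = \<gamma> * ?uy"
    using w by (simp add: \<gamma>_def field_simps power2_eq_square)
  have "?uy * ?p \<le> lam / (2 * ?v) * ?uy\<^sup>2 + ?p\<^sup>2 / (4 * (lam / (2 * ?v)))"
    by (rule young) (use vb param_pos in auto)
  also have "?p\<^sup>2 / (4 * (lam / (2 * ?v))) = ?v * (?p\<^sup>2 / (2 * lam))" using vb by simp
  also have "\<dots> \<le> B * (cp * (1 + z s y t ^ 24) / (2 * lam))"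
    using vb param_pos p_square_le[OF s y t] z_power[OF s y t] by (intro mult_mono divide_right_mono) auto
  finally have 1: "?uy * ?p \<le> lam / (2 * ?v) * ?uy\<^sup>2 + B * cp / (2 * lam) * (1 + z s y t ^ 24)" by (simp add: ac_simps)
  have "lam / 2 * ?uy\<^sup>2 * (1 / B) \<le> lam / 2 * ?uy\<^sup>2 * (1 / ?v)"
    using vb param_pos by (intro mult_left_mono) auto
  moreover have "sg s y t * ?uy = 2 * (lam / 2 * ?uy\<^sup>2 * (1 / ?v)) - ?uy * ?p"
    by (simp add: sg_def algebra_simps power2_eq_square)
  moreover have "lam / (2 * ?v) * ?uy\<^sup>2 = lam / 2 * ?uy\<^sup>2 * (1 / ?v)" by simp
  ultimately have "- (sg s y t * ?uy) + lam / (2 * B) * ?uy\<^sup>2 \<le> B * cp / (2 * lam) * (1 + z s y t ^ 24)"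
    using 1 by (simp add: mult.commute)
  then have "\<gamma> * (- (sg s y t * ?uy) + lam / (2 * B) * ?uy\<^sup>2) \<le> \<gamma> * (B * cp / (2 * lam) * (1 + z s y t ^ 24))"
    using \<gamma>0 by (rule mult_left_mono)
  also have "\<dots> \<le> 7 / 3 * ?w\<^sup>2 * (B * cp / (2 * lam) * (1 + z s y t ^ 24))"
    using \<gamma> cp_pos B_ge_1 param_pos z_pos[OF s y t] by (intro mult_right_mono) auto
  also have "\<dots> = 7 * B * cp / (6 * lam) * (?w\<^sup>2 * (1 + z s y t ^ 24))" by simp
  finally have A: "\<gamma> * (- (sg s y t * ?uy) + lam / (2 * B) * ?uy\<^sup>2) \<le> 7 * B * cp / (6 * lam) * (?w\<^sup>2 * (1 + z s y t ^ 24))" .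
  have A1: "lam / (2 * B) * GY s y t \<le> \<gamma> * (lam / (2 * B) * ?uy\<^sup>2)"
    using mult_right_mono[OF \<gamma>(1), of "lam / (2 * B) * ?uy\<^sup>2"] param_pos B_ge_1 by (simp add: GY_def ac_simps)
  have A2: "\<gamma> * (- (sg s y t * ?uy) + lam / (2 * B) * ?uy\<^sup>2) = - (\<gamma> * ?uy * sg s y t) + \<gamma> * (lam / (2 * B) * ?uy\<^sup>2)"
    by (simp add: algebra_simps)
  have Bt: "- (?u * ?w\<^sup>2 * (b s y t \<bullet> b_y s y t)) \<le> (b s y t \<bullet> b s y t) * (b_y s y t \<bullet> b_y s y t) + ?w ^ 7"
  proof -
    let ?x = "?u * ?w\<^sup>2" and ?i = "b s y t \<bullet> b_y s y t"
    have "0 \<le> (?x + ?i)\<^sup>2 + ?x\<^sup>2 + ?i\<^sup>2" by simp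
    then have "- (?x * ?i) \<le> ?x\<^sup>2 + ?i\<^sup>2" by (simp add: power2_sum)
    moreover have "?i\<^sup>2 \<le> (b s y t \<bullet> b s y t) * (b_y s y t \<bullet> b_y s y t)" by (rule Cauchy_Schwarz_ineq)
    moreover have "?x\<^sup>2 \<le> ?w ^ 7"
    proof -
      have "?x\<^sup>2 = ?u\<^sup>2 * ?w ^ 4" by (simp add: power_mult_distrib flip: power_mult)
      also have "\<dots> \<le> ?w ^ 3 * ?w ^ 4" using u2 w by (intro mult_right_mono) auto
      finally show ?thesis by (simp flip: power_add)
    qed
    ultimately show ?thesis by linarith
  qed
  show ?thesis unfolding eq using A A1 A2 Bt by linarith
qed

end

context slow_flows
begin

definition IZ :: "'s \<Rightarrow> real \<Rightarrow> real" where
  "IZ s t = integral {0..1} (\<lambda>y. z s y t ^ 14)"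

lemma jc_Xi:
  assumes s: "s \<in> S" and c: "0 < c" and l: "1 \<le> l"
  shows "jcont T (\<lambda>y t. Xi c (l ^ 3) (u s y t) (z s y t))"
    "jcont T (\<lambda>y t. Xi_u c (l ^ 3) (u s y t) (z s y t))"
    "jcont T (\<lambda>y t. Xi_th c (l ^ 3) (u s y t) (z s y t))"
proof -
  have x: "z s y t ^ 3 + l ^ 3 \<noteq> 0" if "0 \<le> y" "y \<le> 1" "0 \<le> t" "t \<le> T" for y t
  proof -
    have "0 < z s y t ^ 3" "0 < l ^ 3" using z_pos[OF s, of y t] that l by auto
    then have "0 < z s y t ^ 3 + l ^ 3" by (rule add_pos_pos)
    then show ?thesis by simp
  qed
  have w: "0 < width c (l ^ 3) (z s y t ^ 3)" if "0 \<le> y" "y \<le> 1" "0 \<le> t" "t \<le> T" for y t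
    using z_pos[OF s, of y t] that l c by (intro width_bounds) auto
  have D: "width c (l ^ 3) (z s y t ^ 3) + (u s y t)\<^sup>2 \<noteq> 0" if "0 \<le> y" "y \<le> 1" "0 \<le> t" "t \<le> T" for y t
    using cut_denominator[OF w[OF that], of "u s y t"] by simp
  have D2: "2 * width c (l ^ 3) (z s y t ^ 3) + 2 * (u s y t)\<^sup>2 \<noteq> 0" if "0 \<le> y" "y \<le> 1" "0 \<le> t" "t \<le> T" for y t
    using D[OF that] by linarith
  have jw: "jcont T (\<lambda>y t. width c (l ^ 3) (z s y t ^ 3))" "jcont T (\<lambda>y t. width1 c (l ^ 3) (z s y t ^ 3))"
    unfolding width_def width1_def using s x by (auto intro!: continuous_intros jzs)
  show "jcont T (\<lambda>y t. Xi c (l ^ 3) (u s y t) (z s y t))"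
    "jcont T (\<lambda>y t. Xi_u c (l ^ 3) (u s y t) (z s y t))"
    "jcont T (\<lambda>y t. Xi_th c (l ^ 3) (u s y t) (z s y t))"
    unfolding Xi_def Xi_u_def Xi_th_def cut_def cut_u_def cut_r_def
    using s D D2 by (auto intro!: continuous_intros jzs jw jcs)
qed

text \<open>The weighted density and \<open>\<Lambda>\<close> times the moment of \<open>u\<close>
  have to be estimated together: the weighted balance leaves \<open>\<omega>^2 u_y^2\<close>, which
  only the moment dissipates, and both leave \<open>\<omega>^2 th^8\<close>, which is paid by the
  two dissipations jointly. The constant is uniform in \<open>l\<close>.\<close>

lemma main_estimate:
  "\<exists>C>0. \<forall>s\<in>S. \<forall>l\<ge>1. \<forall>\<tau>\<in>{0..T}. \<forall>t\<in>{0..\<tau>}.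
    IZ s t + integral {0..t} (IX s) \<le> C * (l\<^sup>2 + integral {0..\<tau>} (IN s) + integral {0..\<tau>} (IA s) / l ^ 6)"
proof -
  obtain c C1 where c: "0 < c" "c \<le> 1" and C1: "0 < C1" and wi:
    "\<And>s y t l. s \<in> S \<Longrightarrow> y \<in> {0..1} \<Longrightarrow> t \<in> {0..T} \<Longrightarrow> 1 \<le> l \<Longrightarrow>
      weighted_integrand c l s y t + 1 / (3 * B) * GX s y t \<le> C1 * weighted_rest l s y t"
    using weighted_integrand_le by blast
  obtain CD where CD: "CD > 0" "\<And>s t. s \<in> S \<Longrightarrow> t \<in> {0..T} \<Longrightarrow> integral {0..t} (D s) \<le> CD"
    using D_integral by blast
  obtain CM where CM: "CM > 0" "\<And>s t. s \<in> S \<Longrightarrow> t \<in> {0..T} \<Longrightarrow> integral {0..t} (MB s) \<le> CM"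
    using magnetic_dissipation unfolding MB_def[abs_def] by blast
  \<comment> \<open>With this factor the moment dissipates \<open>C1 + 1\<close> times
    \<open>GY\<close>: \<open>C1\<close> cancels the remainder of the weighted balance and
    \<open>1\<close> is kept.\<close>
  define \<Lambda> where "\<Lambda> = 2 * B * (C1 + 1) / lam"
  have \<Lambda>: "0 < \<Lambda>" "\<Lambda> * (lam / (2 * B)) = C1 + 1"
    using B_ge_1 C1 param_pos by (auto simp: \<Lambda>_def)
  define C9 where "C9 = C1 + \<Lambda> * (7 * B * cp / (6 * lam))"
  have C9: "0 < C9" unfolding C9_def using C1 \<Lambda> B_ge_1 cp_pos param_pos
    by (intro add_pos_pos mult_pos_pos divide_pos_pos) auto
  define \<eta> where "\<eta> = 1 / (6 * B) / C9"
  have \<eta>: "0 < \<eta>" "C9 * \<eta> = 1 / (6 * B)" using C9 B_ge_1 by (auto simp: \<eta>_def)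
  obtain C\<eta> where C\<eta>: "0 < C\<eta>" "\<And>s t. s \<in> S \<Longrightarrow> t \<in> {0..T} \<Longrightarrow>
      integral {0..1} (\<lambda>y. (\<omega> s y t)\<^sup>2 * (1 + z s y t ^ 24)) \<le> \<eta> * (IX s t + IY s t) + C\<eta>"
    using \<omega>_pressure_bound[OF \<eta>(1)] by blast
  \<comment> \<open>\<open>e1\<close> and \<open>e2\<close> are the reciprocals of the coefficients
    of \<open>z^14\<close> (with \<open>1 / B \<le> v\<close>) and of \<open>\<omega>^5\<close> in
    the density \<open>f\<close> below.\<close>
  define e1 where "e1 = 7 * B / (6 * a)"
  define e2 where "e2 = 10 / (3 * \<Lambda>)"
  have e12: "0 < e1" "0 < e2" using B_ge_1 param_pos \<Lambda> by (auto simp: e1_def e2_def)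
  define c5 where "c5 = C1 * B * e1 + \<Lambda> * (2 * B) * e2"
  define c6 where "c6 = C1 + 2 * C1 * B\<^sup>2 + C9 * C\<eta> + C1 + C1 * (B * (1 + B)) + C1 + C1 * (1 + B) + C1 + \<Lambda>"
  have c56: "0 < c5" "0 < c6" unfolding c5_def c6_def using C1 \<Lambda> B_ge_1 e12 C9 C\<eta>
    by (intro add_pos_pos mult_pos_pos; simp)+
  define f0 where "f0 = 3 / 5 * Cv * K ^ 5 + 6 / 7 * a * K * K ^ 14 + c * K ^ 5 + \<Lambda> * (3 / 10) * (1 + K\<^sup>2) ^ 5"
  have f0: "0 < f0" unfolding f0_def using param_pos c \<Lambda>
    by (intro add_pos_pos mult_pos_pos zero_less_power add_pos_nonneg) auto
  define M where "M = exp (c5 * B) * (f0 + c6 * (CD + B + CM) + c6)"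
  have M: "0 < M" unfolding M_def using f0 c56 CD CM B_ge_1
    by (intro mult_pos_pos add_pos_pos) auto
  define C where "C = (e1 + 6 * B) * M"
  have C: "0 < C" unfolding C_def using e12 B_ge_1 M by (intro mult_pos_pos add_pos_pos) auto
  have "IZ s t + integral {0..t} (IX s) \<le> C * (l\<^sup>2 + integral {0..\<tau>} (IN s) + integral {0..\<tau>} (IA s) / l ^ 6)"
    if s: "s \<in> S" and l: "1 \<le> l" and \<tau>: "\<tau> \<in> {0..T}" and t: "t \<in> {0..\<tau>}" for s l \<tau> t
  proof -
    have l2: "1 \<le> l\<^sup>2" using l by simp
    have sub: "r \<in> {0..T}" if "r \<in> {0..\<tau>}" for r using that \<tau> by auto
    define f where "f y t = 3 / 5 * Cv * z s y t ^ 5 + 6 / 7 * a * v s y t * z s y t ^ 14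
      + 2 * Xi c (l ^ 3) (u s y t) (z s y t) + \<Lambda> * (3 / 10) * \<omega> s y t ^ 5" for y t
    define J where "J t = integral {0..1} (\<lambda>y. f y t)" for t
    note jX = jc_Xi[OF s c(1) l]
    have jf: "jcont T f" unfolding f_def using s by (auto intro!: continuous_intros jcs jzs jX)
    have cJ: "continuous_on {0..T} J" unfolding J_def by (rule jcont_integral[OF jf])
    have m1: "1 \<le> m s r" if "r \<in> {0..T}" for r by (rule m_ge_1[OF s that])
    have Xb: "0 \<le> Xi c (l ^ 3) (u s y r) (z s y r)" "Xi c (l ^ 3) (u s y r) (z s y r) \<le> c * z s y r ^ 5 / 2"
      if "y \<in> {0..1}" "r \<in> {0..T}" for y r
      using Xi_bounds(1,2)[OF z_pos[OF s that] c(1) l \<omega>_ge_1[of s y r], of "u s y r"] by (auto simp: \<omega>_power)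
    have f_lower: "z s y r ^ 14 \<le> e1 * f y r" "\<omega> s y r ^ 5 \<le> e2 * f y r" "0 \<le> f y r"
      if y: "y \<in> {0..1}" and r: "r \<in> {0..T}" for y r
    proof -
      note vb = v_bounds[OF s y r]
      have zz: "0 < z s y r" by (rule z_pos[OF s y r])
      have ww: "1 \<le> \<omega> s y r" by (rule \<omega>_ge_1)
      have t1: "0 \<le> 3 / 5 * Cv * z s y r ^ 5" using param_pos zz by simp
      have t2: "6 / 7 * a * (1 / B) * z s y r ^ 14 \<le> 6 / 7 * a * v s y r * z s y r ^ 14"
        using vb param_pos zz by (intro mult_right_mono mult_left_mono) auto
      have t2': "0 \<le> 6 / 7 * a * (1 / B) * z s y r ^ 14" using param_pos zz B_ge_1 by simp
      have t3: "0 \<le> 2 * Xi c (l ^ 3) (u s y r) (z s y r)" using Xb[OF y r] by simp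
      have t4: "0 \<le> \<Lambda> * (3 / 10) * \<omega> s y r ^ 5" using \<Lambda> ww by simp
      show "0 \<le> f y r" using t1 t2 t2' t3 t4 unfolding f_def by linarith
      have "6 / 7 * a * (1 / B) * z s y r ^ 14 \<le> f y r" using t1 t2 t3 t4 unfolding f_def by linarith
      then have "e1 * (6 / 7 * a * (1 / B) * z s y r ^ 14) \<le> e1 * f y r" using e12 by (intro mult_left_mono) auto
      then show "z s y r ^ 14 \<le> e1 * f y r" using param_pos B_ge_1 by (simp add: e1_def)
      have "\<Lambda> * (3 / 10) * \<omega> s y r ^ 5 \<le> f y r" using t1 t2 t2' t3 unfolding f_def by linarith
      then have "e2 * (\<Lambda> * (3 / 10) * \<omega> s y r ^ 5) \<le> e2 * f y r" using e12 by (intro mult_left_mono) auto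
      then show "\<omega> s y r ^ 5 \<le> e2 * f y r" using \<Lambda> by (simp add: e2_def)
    qed
    have J0: "0 \<le> J r" if "r \<in> {0..T}" for r
      unfolding J_def by (rule integral_nonneg_y[OF jcont_slice_y[OF jf that]]) (use f_lower that in auto)
    have IZJ: "IZ s r \<le> e1 * J r" if r: "r \<in> {0..T}" for r
      unfolding IZ_def J_def
      by (rule integral_mult_bound[OF _ jcont_slice_y[OF jf r] _ order.refl])
        (use s r f_lower e12 in \<open>auto intro!: continuous_intros jzy\<close>)
    \<comment> \<open>\<open>h\<close> is half of the available dissipation. It stands on the left
      of the balance and is subtracted once more inside \<open>g\<close>, where it pays for the
      pressure term with the factor \<open>C9\<close>; the choice of \<open>\<eta>\<close> is made
      for that.\<close>
    define h where "h y r = 1 / (6 * B) * GX s y r + 1 / 2 * GY s y r" for y r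
    have jh: "jcont T h" unfolding h_def using s B_ge_1 by (auto intro!: continuous_intros jc_GX)
    define ph where "ph r = integral {0..1} (\<lambda>y. h y r)" for r
    have ph: "ph r = 1 / (6 * B) * IX s r + 1 / 2 * IY s r" if r: "r \<in> {0..T}" for r
    proof -
      have "(\<lambda>y. GX s y r) integrable_on {0..1}" "(\<lambda>y. GY s y r) integrable_on {0..1}"
        by (intro jcont_integrable_y[OF _ r] jc_GX s)+
      then show ?thesis unfolding ph_def h_def IX_def IY_def
        by (intro integral_unique has_integral_add has_integral_mult_right integrable_integral)
    qed
    define Dd where "Dd y r = (u_y s y r)\<^sup>2 + w_y s y r \<bullet> w_y s y r + b_y s y r \<bullet> b_y s y r" for y r
    define g where "g y r = C1 * l\<^sup>2 * Dd y r + C1 * l\<^sup>2 * (1 + z s y r ^ 24)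
      + C9 * ((\<omega> s y r)\<^sup>2 * (1 + z s y r ^ 24)) + C1 * Dd y r + C1 * ((b s y r \<bullet> b s y r) * (1 + z s y r ^ 12))
      + C1 * ((z s y r)\<^sup>2 * (w_y s y r \<bullet> w_y s y r + b_y s y r \<bullet> b_y s y r))
      + C1 * ((z s y r)\<^sup>2 * (1 + z s y r ^ 24)) + C1 / l ^ 6 * (v_y s y r)\<^sup>2
      + \<Lambda> * ((b s y r \<bullet> b s y r) * (b_y s y r \<bullet> b_y s y r)) + \<Lambda> * \<omega> s y r ^ 7
      - h y r" for y r
    have jg: "jcont T g" unfolding g_def Dd_def using s l by (auto intro!: continuous_intros jcs jzs jh)
    define Q where "Q r = l\<^sup>2 * (D s r + m s r) + IN s r + IA s r / l ^ 6 + MB s r" for r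
    have cQ: "continuous_on {0..T} Q"
      unfolding Q_def using l by (auto intro!: continuous_intros cont_D cont_m cont_INA s)
    have Q0: "0 \<le> Q r" if "r \<in> {0..T}" for r
      unfolding Q_def using INA_nonneg[OF s that] D_nonneg[OF s that] m1[OF that] l by auto
    have int_g: "integral {0..1} (\<lambda>y. g y r) \<le> c5 * m s r * J r + c6 * Q r" if r: "r \<in> {0..T}" for r
    proof -
      have i1: "integral {0..1} (\<lambda>y. 1 + z s y r ^ 24) \<le> 2 * B\<^sup>2 * m s r"
      proof -
        have "integral {0..1} (\<lambda>y. z s y r ^ 24) = integral {0..1} (\<lambda>y. th s y r ^ 8)"
          by (rule integral_cong) (use z_power(5)[OF s _ r] in auto)
        then have "integral {0..1} (\<lambda>y. 1 + z s y r ^ 24) \<le> 1 + B * m s r * B"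
          using th8_integral[OF s r]
          by (subst integral_add) (use s r in \<open>auto intro!: integrable_continuous_real continuous_intros jzy\<close>)
        also have "1 \<le> B\<^sup>2 * m s r" using B_ge_1 m1[OF r] mult_mono[of 1 "B\<^sup>2" 1 "m s r"] by simp
        finally show ?thesis by (simp add: power2_eq_square algebra_simps)
      qed
      have i2: "integral {0..1} (\<lambda>y. (b s y r \<bullet> b s y r) * (1 + z s y r ^ 12)) \<le> B * m s r * (1 + B)"
      proof (rule integral_mult_bound[where g = "\<lambda>y. 1 + z s y r ^ 12"])
        show "integral {0..1} (\<lambda>y. 1 + z s y r ^ 12) \<le> 1 + B"
          using integral_z12[OF s r]
          by (subst integral_add) (use s r in \<open>auto intro!: integrable_continuous_real continuous_intros jzy\<close>)
        fix y :: real assume y: "y \<in> {0..1}"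
        show "(b s y r \<bullet> b s y r) * (1 + z s y r ^ 12) \<le> B * m s r * (1 + z s y r ^ 12)"
          using bd[OF s r y] z_pos[OF s y r] by (intro mult_right_mono) (auto intro: add_nonneg_nonneg)
      qed (use s r m1[OF r] B_ge_1 in \<open>auto intro!: continuous_intros jcy jzy\<close>)
      \<comment> \<open>\<open>z^26 = z^12 z^14\<close>: the supremum of the first factor is of
        order \<open>m\<close> and the integral of the second at most \<open>e1 * J\<close>, so this
        is a Gronwall term.\<close>
      have i3: "integral {0..1} (\<lambda>y. (z s y r)\<^sup>2 * (1 + z s y r ^ 24)) \<le> (1 + B) + B * m s r * (e1 * J r)"
      proof -
        have "integral {0..1} (\<lambda>y. (z s y r)\<^sup>2 * (1 + z s y r ^ 24))
            \<le> integral {0..1} (\<lambda>y. (1 + z s y r ^ 12) + B * m s r * z s y r ^ 14)"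
        proof (rule integral_mono_y)
          fix y :: real assume y: "y \<in> {0..1}"
          have zz: "0 < z s y r" by (rule z_pos[OF s y r])
          have "(z s y r)\<^sup>2 \<le> 1 + z s y r ^ 12" using zz by (intro power_le_one_plus_power) auto
          moreover have "(z s y r)\<^sup>2 * z s y r ^ 24 = z s y r ^ 12 * z s y r ^ 14" by (simp flip: power_add)
          moreover have "z s y r ^ 12 * z s y r ^ 14 \<le> B * m s r * z s y r ^ 14"
            using bd[OF s r y] z_power(4)[OF s y r] zz by (intro mult_right_mono) auto
          ultimately show "(z s y r)\<^sup>2 * (1 + z s y r ^ 24) \<le> (1 + z s y r ^ 12) + B * m s r * z s y r ^ 14"
            unfolding distrib_left by linarith
        qed (use s r in \<open>auto intro!: continuous_intros jzy\<close>)
        also have "\<dots> = 1 + integral {0..1} (\<lambda>y. z s y r ^ 12) + B * m s r * IZ s r"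
          unfolding IZ_def by (subst integral_add3) (use s r in \<open>auto intro!: continuous_intros jzy\<close>)
        also have "\<dots> \<le> 1 + B + B * m s r * (e1 * J r)"
          using integral_z12[OF s r] IZJ[OF r] m1[OF r] B_ge_1 by (intro add_mono mult_left_mono) auto
        finally show ?thesis by simp
      qed
      \<comment> \<open>The second Gronwall term: \<open>\<omega>^7 = \<omega>^2 \<omega>^5\<close>,
        where \<open>\<omega>^2 \<le> \<omega>^3 = 1 + u^2\<close> is of order
        \<open>m\<close>.\<close>
      have i4: "integral {0..1} (\<lambda>y. \<omega> s y r ^ 7) \<le> 2 * B * m s r * (e2 * J r)"
      proof (rule integral_mult_bound[where g = "\<lambda>y. e2 * f y r"])
        show "integral {0..1} (\<lambda>y. e2 * f y r) \<le> e2 * J r" by (simp add: J_def)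
        fix y :: real assume y: "y \<in> {0..1}"
        have ww: "1 \<le> \<omega> s y r" by (rule \<omega>_ge_1)
        have Bm: "1 \<le> B * m s r" using B_ge_1 m1[OF r] mult_mono[of 1 B 1 "m s r"] by simp
        have "\<omega> s y r ^ 2 \<le> \<omega> s y r ^ 3" using ww by (intro power_increasing) auto
        also have "\<dots> \<le> 2 * B * m s r" using bd[OF s r y] Bm by (simp add: \<omega>_power)
        finally have "\<omega> s y r ^ 2 * \<omega> s y r ^ 5 \<le> 2 * B * m s r * (e2 * f y r)"
          using f_lower(2)[OF y r] ww Bm by (intro mult_mono) auto
        then show "\<omega> s y r ^ 7 \<le> 2 * B * m s r * (e2 * f y r)" by (simp flip: power_add)
      qed (use s r m1[OF r] B_ge_1 jcont_slice_y[OF jf r] in \<open>auto intro!: continuous_intros jzy\<close>)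
      have int: "(\<lambda>y. Dd y r) integrable_on {0..1}" "(\<lambda>y. 1 + z s y r ^ 24) integrable_on {0..1}"
        "(\<lambda>y. (\<omega> s y r)\<^sup>2 * (1 + z s y r ^ 24)) integrable_on {0..1}"
        "(\<lambda>y. (b s y r \<bullet> b s y r) * (1 + z s y r ^ 12)) integrable_on {0..1}"
        "(\<lambda>y. (z s y r)\<^sup>2 * (w_y s y r \<bullet> w_y s y r + b_y s y r \<bullet> b_y s y r)) integrable_on {0..1}"
        "(\<lambda>y. (z s y r)\<^sup>2 * (1 + z s y r ^ 24)) integrable_on {0..1}"
        "(\<lambda>y. (v_y s y r)\<^sup>2) integrable_on {0..1}"
        "(\<lambda>y. (b s y r \<bullet> b s y r) * (b_y s y r \<bullet> b_y s y r)) integrable_on {0..1}"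
        "(\<lambda>y. \<omega> s y r ^ 7) integrable_on {0..1}" "(\<lambda>y. h y r) integrable_on {0..1}"
        by (rule integrable_continuous_real, use s r jcont_slice_y[OF jh r] in
            \<open>auto simp: Dd_def intro!: continuous_intros jcy jzy\<close>)+
      have "integral {0..1} (\<lambda>y. g y r) = C1 * l\<^sup>2 * integral {0..1} (\<lambda>y. Dd y r)
        + C1 * l\<^sup>2 * integral {0..1} (\<lambda>y. 1 + z s y r ^ 24)
        + C9 * integral {0..1} (\<lambda>y. (\<omega> s y r)\<^sup>2 * (1 + z s y r ^ 24)) + C1 * integral {0..1} (\<lambda>y. Dd y r)
        + C1 * integral {0..1} (\<lambda>y. (b s y r \<bullet> b s y r) * (1 + z s y r ^ 12))
        + C1 * integral {0..1} (\<lambda>y. (z s y r)\<^sup>2 * (w_y s y r \<bullet> w_y s y r + b_y s y r \<bullet> b_y s y r))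
        + C1 * integral {0..1} (\<lambda>y. (z s y r)\<^sup>2 * (1 + z s y r ^ 24))
        + C1 / l ^ 6 * integral {0..1} (\<lambda>y. (v_y s y r)\<^sup>2)
        + \<Lambda> * integral {0..1} (\<lambda>y. (b s y r \<bullet> b s y r) * (b_y s y r \<bullet> b_y s y r))
        + \<Lambda> * integral {0..1} (\<lambda>y. \<omega> s y r ^ 7) - integral {0..1} (\<lambda>y. h y r)"
        unfolding g_def
        by (intro integral_unique has_integral_add has_integral_diff has_integral_mult_right integrable_integral int)
      also have "\<dots> \<le> C1 * l\<^sup>2 * D s r + C1 * l\<^sup>2 * (2 * B\<^sup>2 * m s r)
        + C9 * (\<eta> * (IX s r + IY s r) + C\<eta>) + C1 * D s r
        + C1 * (B * m s r * (1 + B)) + C1 * IN s r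
        + C1 * ((1 + B) + B * m s r * (e1 * J r))
        + C1 / l ^ 6 * IA s r + \<Lambda> * MB s r + \<Lambda> * (2 * B * m s r * (e2 * J r)) - ph r"
        unfolding D_def Dd_def IN_def IA_def MB_def ph_def
        using C1 C9 \<Lambda> l i1 i2 i3 i4 C\<eta>(2)[OF s r]
        by (intro add_mono diff_mono mult_left_mono order.refl) auto
      also have "\<dots> \<le> c5 * m s r * J r + c6 * Q r"
      proof -
        have nn: "0 \<le> D s r" "0 \<le> IN s r" "0 \<le> IA s r / l ^ 6" "0 \<le> MB s r" "0 \<le> m s r"
          using INA_nonneg[OF s r] D_nonneg[OF s r] m1[OF r] l by auto
        have lD: "D s r \<le> l\<^sup>2 * D s r" "m s r \<le> l\<^sup>2 * m s r" using l2 nn by (auto simp: mult_le_cancel_right1)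
        have 1: "l\<^sup>2 * D s r \<le> Q r" "l\<^sup>2 * m s r \<le> Q r" "D s r \<le> Q r" "m s r \<le> Q r" "1 \<le> Q r" "IN s r \<le> Q r"
          "IA s r / l ^ 6 \<le> Q r" "MB s r \<le> Q r"
          using nn lD m1[OF r] unfolding Q_def distrib_left by linarith+
        have "C9 * (\<eta> * (IX s r + IY s r)) = C9 * \<eta> * (IX s r + IY s r)" by simp
        also have "\<dots> = 1 / (6 * B) * IX s r + 1 / (6 * B) * IY s r" unfolding \<eta>(2) by (rule distrib_left)
        also have "\<dots> \<le> ph r"
        proof -
          have "1 / (6 * B) * IY s r \<le> 1 / 2 * IY s r"
            using IX_nonneg[OF s r] B_ge_1 by (intro mult_right_mono) (auto simp: field_simps)
          then show ?thesis using ph[OF r] by simp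
        qed
        finally have 2: "C9 * (\<eta> * (IX s r + IY s r)) \<le> ph r" .
        have 3: "C1 * (l\<^sup>2 * D s r) \<le> C1 * Q r" "2 * C1 * B\<^sup>2 * (l\<^sup>2 * m s r) \<le> 2 * C1 * B\<^sup>2 * Q r"
          "C9 * C\<eta> * 1 \<le> C9 * C\<eta> * Q r" "C1 * D s r \<le> C1 * Q r" "C1 * (B * (1 + B)) * m s r \<le> C1 * (B * (1 + B)) * Q r"
          "C1 * IN s r \<le> C1 * Q r" "C1 * (1 + B) * 1 \<le> C1 * (1 + B) * Q r"
          "C1 * (IA s r / l ^ 6) \<le> C1 * Q r" "\<Lambda> * MB s r \<le> \<Lambda> * Q r"
          by (rule mult_left_mono; use 1 C1 C9 C\<eta> \<Lambda> B_ge_1 in simp)+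
        have "C1 * l\<^sup>2 * D s r + C1 * l\<^sup>2 * (2 * B\<^sup>2 * m s r)
          + C9 * (\<eta> * (IX s r + IY s r) + C\<eta>) + C1 * D s r
          + C1 * (B * m s r * (1 + B)) + C1 * IN s r
          + C1 * ((1 + B) + B * m s r * (e1 * J r))
          + C1 / l ^ 6 * IA s r + \<Lambda> * MB s r + \<Lambda> * (2 * B * m s r * (e2 * J r)) - ph r
          = (C1 * (l\<^sup>2 * D s r) + 2 * C1 * B\<^sup>2 * (l\<^sup>2 * m s r) + C9 * C\<eta> * 1 + C1 * D s r
            + C1 * (B * (1 + B)) * m s r + C1 * IN s r + C1 * (1 + B) * 1 + C1 * (IA s r / l ^ 6) + \<Lambda> * MB s r)
            + (C9 * (\<eta> * (IX s r + IY s r)) - ph r) + c5 * m s r * J r"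
          unfolding c5_def by (simp add: algebra_simps)
        also have "\<dots> \<le> (C1 * Q r + 2 * C1 * B\<^sup>2 * Q r + C9 * C\<eta> * Q r + C1 * Q r
            + C1 * (B * (1 + B)) * Q r + C1 * Q r + C1 * (1 + B) * Q r + C1 * Q r + \<Lambda> * Q r) + 0 + c5 * m s r * J r"
          by (intro add_mono 3 order.refl) (use 2 in simp)
        also have "\<dots> = c5 * m s r * J r + c6 * Q r" unfolding c6_def by (simp add: algebra_simps)
        finally show ?thesis .
      qed
      finally show ?thesis .
    qed
    have main: "J r + integral {0..r} ph \<le> J 0 + integral {0..r} (\<lambda>r. c5 * m s r * J r + c6 * Q r)"
      if r: "r \<in> {0..T}" for r
      unfolding J_def[of r] J_def[of 0] ph_def
    proof (rule balance_law_dissipative[where T = T and f = f and h = h and g = g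
          and ft = "\<lambda>y t. (z s y t)\<^sup>2 * heat_cap s y t * th_t s y t + 6 / 7 * a * u_y s y t * z s y t ^ 14
            + 2 * (Xi_u c (l ^ 3) (u s y t) (z s y t) * u_t s y t + Xi_th c (l ^ 3) (u s y t) (z s y t) * th_t s y t)
            + \<Lambda> * ((\<omega> s y t)\<^sup>2 * u s y t * u_t s y t)"
          and Z = "\<lambda>y t. (z s y t)\<^sup>2 * F s y t + 2 * (Xi_u c (l ^ 3) (u s y t) (z s y t) * sg s y t)
            + 2 * (zeta c l s y t * F s y t) + \<Lambda> * (u s y t * (\<omega> s y t)\<^sup>2 * sg s y t)"
          and Zy = "\<lambda>y t. (2 / (3 * z s y t) * th_y s y t * F s y t + (z s y t)\<^sup>2 * F_y s y t)
            + 2 * ((Xi_uu c (l ^ 3) (u s y t) (z s y t) * u_y s y t + Xi_uth c (l ^ 3) (u s y t) (z s y t) * th_y s y t) * sg s y t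
              + Xi_u c (l ^ 3) (u s y t) (z s y t) * (u_t s y t + b s y t \<bullet> b_y s y t))
            + 2 * (zeta_y c l s y t * F s y t + zeta c l s y t * F_y s y t)
            + \<Lambda> * (((\<omega> s y t)\<^sup>2 * u_y s y t + u s y t * (2 * \<omega> s y t * (2 * u s y t * u_y s y t / (3 * (\<omega> s y t)\<^sup>2)))) * sg s y t
              + u s y t * (\<omega> s y t)\<^sup>2 * (u_t s y t + b s y t \<bullet> b_y s y t))"])
      show "jcont T (\<lambda>y t. (z s y t)\<^sup>2 * heat_cap s y t * th_t s y t + 6 / 7 * a * u_y s y t * z s y t ^ 14
            + 2 * (Xi_u c (l ^ 3) (u s y t) (z s y t) * u_t s y t + Xi_th c (l ^ 3) (u s y t) (z s y t) * th_t s y t)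
            + \<Lambda> * ((\<omega> s y t)\<^sup>2 * u s y t * u_t s y t))"
        unfolding heat_cap_def using s by (auto intro!: continuous_intros jcs jzs jX)
      show "continuous_on {0..T} (\<lambda>r. c5 * m s r * J r + c6 * Q r)"
        by (intro continuous_intros cont_m s cQ cJ)
      show "integral {0..1} (\<lambda>y. g y t) \<le> c5 * m s t * J t + c6 * Q t" if "t \<in> {0..T}" for t
        by (rule int_g[OF that])
      fix y t assume y: "y \<in> {0..1::real}" and t: "t \<in> {0..T}"
      note vb = v_bounds[OF s y t]
      have zz: "0 < z s y t" by (rule z_pos[OF s y t])
      have y': "0 \<le> y" "y \<le> 1" and t': "0 \<le> t" "t \<le> T" using y t by auto
      have l3: "0 < l ^ 3" using l by simp
      have hc: "0 < heat_cap s y t" by (rule heat_cap_pos[OF s y t])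
      have zp: "z s y t ^ 9 = th s y t ^ 3" "z s y t ^ 12 = th s y t ^ 4" using z_power[OF s y t] by auto
      note dtz = dt_z[OF s y' t'] and dyz = dy_z[OF s y' t']
      note dtX = deriv_Xi[OF dt(2)[OF s y' t'] dtz zz c(1) l3] and dyX = deriv_Xi[OF dy(2)[OF s y' t'] dyz zz c(1) l3]
      show "(f y has_real_derivative (z s y t)\<^sup>2 * heat_cap s y t * th_t s y t + 6 / 7 * a * u_y s y t * z s y t ^ 14
            + 2 * (Xi_u c (l ^ 3) (u s y t) (z s y t) * u_t s y t + Xi_th c (l ^ 3) (u s y t) (z s y t) * th_t s y t)
            + \<Lambda> * ((\<omega> s y t)\<^sup>2 * u s y t * u_t s y t)) (at t within {0..T})"
      proof -
        have d1: "((\<lambda>t. 3 / 5 * Cv * z s y t ^ 5) has_real_derivative (z s y t)\<^sup>2 * Cv * th_t s y t) (at t within {0..T})"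
          using zz by (auto intro!: derivative_eq_intros dtz) (simp add: field_simps power_numeral_reduce)
        have d2: "((\<lambda>t. 6 / 7 * a * v s y t * z s y t ^ 14) has_real_derivative
            6 / 7 * a * u_y s y t * z s y t ^ 14 + (z s y t)\<^sup>2 * (4 * a * v s y t * th s y t ^ 3) * th_t s y t) (at t within {0..T})"
          unfolding zp(1)[symmetric] using zz
          by (auto intro!: derivative_eq_intros dtz dt(1)[OF s y' t']) (simp add: field_simps power_numeral_reduce)
        have d4: "((\<lambda>t. \<Lambda> * (3 / 10) * \<omega> s y t ^ 5) has_real_derivative \<Lambda> * ((\<omega> s y t)\<^sup>2 * u s y t * u_t s y t)) (at t within {0..T})"
          by (auto intro!: derivative_eq_intros dt_\<omega>[OF s y' t']) (simp add: field_simps power_numeral_reduce)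
        have d3: "((\<lambda>t. 2 * Xi c (l ^ 3) (u s y t) (z s y t)) has_real_derivative
            2 * (Xi_u c (l ^ 3) (u s y t) (z s y t) * u_t s y t + Xi_th c (l ^ 3) (u s y t) (z s y t) * th_t s y t)) (at t within {0..T})"
          by (intro DERIV_cmult dtX(1))
        show ?thesis unfolding f_def
          by (rule DERIV_cong[OF DERIV_add[OF DERIV_add[OF DERIV_add[OF d1 d2] d3] d4]])
            (simp add: heat_cap_def algebra_simps)
      qed
      have dzeta: "((\<lambda>y. zeta c l s y t) has_real_derivative zeta_y c l s y t) (at y within {0..1})"
      proof -
        have "((\<lambda>y. heat_cap s y t) has_real_derivative 4 * a * th s y t ^ 3 * v_y s y t + 12 * a * v s y t * (th s y t)\<^sup>2 * th_y s y t) (at y within {0..1})"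
          unfolding heat_cap_def by (auto intro!: derivative_eq_intros dy(1)[OF s y' t'] dy(3)[OF s y' t'])
        then show ?thesis unfolding zeta_def zeta_y_def using hc
          by (auto intro!: derivative_eq_intros dyX(3)) (simp add: field_simps power2_eq_square)
      qed
      show "((\<lambda>y. (z s y t)\<^sup>2 * F s y t + 2 * (Xi_u c (l ^ 3) (u s y t) (z s y t) * sg s y t)
            + 2 * (zeta c l s y t * F s y t) + \<Lambda> * (u s y t * (\<omega> s y t)\<^sup>2 * sg s y t)) has_real_derivative
          (2 / (3 * z s y t) * th_y s y t * F s y t + (z s y t)\<^sup>2 * F_y s y t)
            + 2 * ((Xi_uu c (l ^ 3) (u s y t) (z s y t) * u_y s y t + Xi_uth c (l ^ 3) (u s y t) (z s y t) * th_y s y t) * sg s y t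
              + Xi_u c (l ^ 3) (u s y t) (z s y t) * (u_t s y t + b s y t \<bullet> b_y s y t))
            + 2 * (zeta_y c l s y t * F s y t + zeta c l s y t * F_y s y t)
            + \<Lambda> * (((\<omega> s y t)\<^sup>2 * u_y s y t + u s y t * (2 * \<omega> s y t * (2 * u s y t * u_y s y t / (3 * (\<omega> s y t)\<^sup>2)))) * sg s y t
              + u s y t * (\<omega> s y t)\<^sup>2 * (u_t s y t + b s y t \<bullet> b_y s y t))) (at y within {0..1})"
      proof -
        have "((\<lambda>y. (z s y t)\<^sup>2 * F s y t) has_real_derivative 2 / (3 * z s y t) * th_y s y t * F s y t + (z s y t)\<^sup>2 * F_y s y t) (at y within {0..1})"
          using zz by (auto intro!: derivative_eq_intros dyz dy_F[OF s y' t']) (simp add: field_simps power2_eq_square)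
        moreover have "((\<lambda>y. Xi_u c (l ^ 3) (u s y t) (z s y t) * sg s y t) has_real_derivative
            (Xi_uu c (l ^ 3) (u s y t) (z s y t) * u_y s y t + Xi_uth c (l ^ 3) (u s y t) (z s y t) * th_y s y t) * sg s y t
              + Xi_u c (l ^ 3) (u s y t) (z s y t) * (u_t s y t + b s y t \<bullet> b_y s y t)) (at y within {0..1})"
          by (auto intro!: derivative_eq_intros dyX(2) dy_sg[OF s y' t'])
        moreover have "((\<lambda>y. zeta c l s y t * F s y t) has_real_derivative zeta_y c l s y t * F s y t + zeta c l s y t * F_y s y t) (at y within {0..1})"
          by (auto intro!: derivative_eq_intros dzeta dy_F[OF s y' t'])
        moreover have "((\<lambda>y. u s y t * (\<omega> s y t)\<^sup>2 * sg s y t) has_real_derivative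
            ((\<omega> s y t)\<^sup>2 * u_y s y t + u s y t * (2 * \<omega> s y t * (2 * u s y t * u_y s y t / (3 * (\<omega> s y t)\<^sup>2)))) * sg s y t
              + u s y t * (\<omega> s y t)\<^sup>2 * (u_t s y t + b s y t \<bullet> b_y s y t)) (at y within {0..1})"
          by (auto intro!: derivative_eq_intros dy(2)[OF s y' t'] dy_\<omega>[OF s y' t'] dy_sg[OF s y' t'])
        ultimately show ?thesis by (intro DERIV_add DERIV_cmult)
      qed
      have Fy: "F_y s y t = heat_cap s y t * th_t s y t + a * th s y t ^ 4 * u_y s y t - sg s y t * u_y s y t - ohmic s y t"
        by (simp add: F_y_def heat_cap_def ohmic_def)
      have zh: "zeta c l s y t * heat_cap s y t = Xi_th c (l ^ 3) (u s y t) (z s y t)" using hc by (simp add: zeta_def)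
      have z14: "(z s y t)\<^sup>2 * th s y t ^ 4 = z s y t ^ 14" unfolding zp(2)[symmetric] by (simp flip: power_add)
      define om_part where "om_part = - (((\<omega> s y t)\<^sup>2 * u_y s y t + u s y t * (2 * \<omega> s y t * (2 * u s y t * u_y s y t / (3 * (\<omega> s y t)\<^sup>2)))) * sg s y t)
            - u s y t * (\<omega> s y t)\<^sup>2 * (b s y t \<bullet> b_y s y t)"
      let ?ft = "(z s y t)\<^sup>2 * heat_cap s y t * th_t s y t + 6 / 7 * a * u_y s y t * z s y t ^ 14
            + 2 * (Xi_u c (l ^ 3) (u s y t) (z s y t) * u_t s y t + Xi_th c (l ^ 3) (u s y t) (z s y t) * th_t s y t)
            + \<Lambda> * ((\<omega> s y t)\<^sup>2 * u s y t * u_t s y t)"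
      let ?Zy = "(2 / (3 * z s y t) * th_y s y t * F s y t + (z s y t)\<^sup>2 * F_y s y t)
            + 2 * ((Xi_uu c (l ^ 3) (u s y t) (z s y t) * u_y s y t + Xi_uth c (l ^ 3) (u s y t) (z s y t) * th_y s y t) * sg s y t
              + Xi_u c (l ^ 3) (u s y t) (z s y t) * (u_t s y t + b s y t \<bullet> b_y s y t))
            + 2 * (zeta_y c l s y t * F s y t + zeta c l s y t * F_y s y t)
            + \<Lambda> * (((\<omega> s y t)\<^sup>2 * u_y s y t + u s y t * (2 * \<omega> s y t * (2 * u s y t * u_y s y t / (3 * (\<omega> s y t)\<^sup>2)))) * sg s y t
              + u s y t * (\<omega> s y t)\<^sup>2 * (u_t s y t + b s y t \<bullet> b_y s y t))"
      \<comment> \<open>All time derivatives cancel: \<open>z^2 F_y\<close> removes the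
        \<open>th_t\<close> of the first two densities, \<open>zeta * F_y\<close> that of
        \<open>Xi\<close>, and the fluxes with \<open>sg\<close> remove \<open>u_t\<close>.\<close>
      have eq: "?ft - ?Zy = weighted_integrand c l s y t + \<Lambda> * om_part"
      proof -
        have z2F: "(z s y t)\<^sup>2 * F_y s y t = (z s y t)\<^sup>2 * heat_cap s y t * th_t s y t + a * z s y t ^ 14 * u_y s y t
            - (z s y t)\<^sup>2 * (sg s y t * u_y s y t) - (z s y t)\<^sup>2 * ohmic s y t"
          unfolding Fy z14[symmetric] by (simp add: algebra_simps)
        have zF: "zeta c l s y t * F_y s y t = Xi_th c (l ^ 3) (u s y t) (z s y t) * th_t s y t
            - zeta c l s y t * (sg s y t * u_y s y t - a * th s y t ^ 4 * u_y s y t + ohmic s y t)"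
          unfolding Fy zh[symmetric] by (simp add: algebra_simps)
        show ?thesis unfolding z2F zF weighted_integrand_def om_part_def by (simp add: algebra_simps)
      qed
      have om: "om_part \<le> 7 * B * cp / (6 * lam) * ((\<omega> s y t)\<^sup>2 * (1 + z s y t ^ 24))
          + (b s y t \<bullet> b s y t) * (b_y s y t \<bullet> b_y s y t) + \<omega> s y t ^ 7 - lam / (2 * B) * GY s y t"
        using \<omega>_pointwise[OF s y t] unfolding om_part_def by linarith
      have om': "\<Lambda> * om_part \<le> \<Lambda> * (7 * B * cp / (6 * lam)) * ((\<omega> s y t)\<^sup>2 * (1 + z s y t ^ 24))
          + \<Lambda> * ((b s y t \<bullet> b s y t) * (b_y s y t \<bullet> b_y s y t)) + \<Lambda> * \<omega> s y t ^ 7 - (C1 * GY s y t + GY s y t)"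
      proof -
        have "\<Lambda> * om_part \<le> \<Lambda> * (7 * B * cp / (6 * lam) * ((\<omega> s y t)\<^sup>2 * (1 + z s y t ^ 24))
          + (b s y t \<bullet> b s y t) * (b_y s y t \<bullet> b_y s y t) + \<omega> s y t ^ 7 - lam / (2 * B) * GY s y t)"
          using om \<Lambda> by (intro mult_left_mono) auto
        also have "\<dots> = \<Lambda> * (7 * B * cp / (6 * lam)) * ((\<omega> s y t)\<^sup>2 * (1 + z s y t ^ 24))
          + \<Lambda> * ((b s y t \<bullet> b s y t) * (b_y s y t \<bullet> b_y s y t)) + \<Lambda> * \<omega> s y t ^ 7 - \<Lambda> * (lam / (2 * B)) * GY s y t"
          by (simp only: distrib_left right_diff_distrib mult.assoc)
        also have "\<Lambda> * (lam / (2 * B)) * GY s y t = C1 * GY s y t + GY s y t"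
          unfolding \<Lambda>(2) by (simp add: distrib_right)
        finally show ?thesis .
      qed
      have rest: "C1 * weighted_rest l s y t \<le> C1 * l\<^sup>2 * Dd y t + C1 * l\<^sup>2 * (1 + z s y t ^ 24)
          + C1 * ((\<omega> s y t)\<^sup>2 * (1 + z s y t ^ 24)) + C1 * GY s y t + C1 * Dd y t
          + C1 * ((b s y t \<bullet> b s y t) * (1 + z s y t ^ 12))
          + C1 * ((z s y t)\<^sup>2 * (w_y s y t \<bullet> w_y s y t + b_y s y t \<bullet> b_y s y t))
          + C1 * ((z s y t)\<^sup>2 * (1 + z s y t ^ 24)) + C1 / l ^ 6 * (v_y s y t)\<^sup>2"
      proof -
        have "weighted_rest l s y t \<le> l\<^sup>2 * Dd y t + l\<^sup>2 * (1 + z s y t ^ 24)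
          + (\<omega> s y t)\<^sup>2 * (1 + z s y t ^ 24) + GY s y t + Dd y t
          + (b s y t \<bullet> b s y t) * (1 + z s y t ^ 12)
          + (z s y t)\<^sup>2 * (w_y s y t \<bullet> w_y s y t + b_y s y t \<bullet> b_y s y t)
          + (z s y t)\<^sup>2 * (1 + z s y t ^ 24) + (v_y s y t)\<^sup>2 / l ^ 6"
        proof -
          have "(l\<^sup>2 + (\<omega> s y t)\<^sup>2) * ((u_y s y t)\<^sup>2 + 1 + z s y t ^ 24) = l\<^sup>2 * (u_y s y t)\<^sup>2 + l\<^sup>2 * (1 + z s y t ^ 24)
            + (\<omega> s y t)\<^sup>2 * (1 + z s y t ^ 24) + GY s y t" by (simp add: GY_def algebra_simps)
          moreover have "l\<^sup>2 * (u_y s y t)\<^sup>2 \<le> l\<^sup>2 * Dd y t" unfolding Dd_def by (intro mult_left_mono) auto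
          moreover have "b_y s y t \<bullet> b_y s y t \<le> Dd y t" unfolding Dd_def by simp
          ultimately show ?thesis unfolding weighted_rest_def by linarith
        qed
        then have "C1 * weighted_rest l s y t \<le> C1 * (l\<^sup>2 * Dd y t + l\<^sup>2 * (1 + z s y t ^ 24)
          + (\<omega> s y t)\<^sup>2 * (1 + z s y t ^ 24) + GY s y t + Dd y t
          + (b s y t \<bullet> b s y t) * (1 + z s y t ^ 12)
          + (z s y t)\<^sup>2 * (w_y s y t \<bullet> w_y s y t + b_y s y t \<bullet> b_y s y t)
          + (z s y t)\<^sup>2 * (1 + z s y t ^ 24) + (v_y s y t)\<^sup>2 / l ^ 6)"
          using C1 by (intro mult_left_mono) auto
        also have "\<dots> = C1 * l\<^sup>2 * Dd y t + C1 * l\<^sup>2 * (1 + z s y t ^ 24)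
          + C1 * ((\<omega> s y t)\<^sup>2 * (1 + z s y t ^ 24)) + C1 * GY s y t + C1 * Dd y t
          + C1 * ((b s y t \<bullet> b s y t) * (1 + z s y t ^ 12))
          + C1 * ((z s y t)\<^sup>2 * (w_y s y t \<bullet> w_y s y t + b_y s y t \<bullet> b_y s y t))
          + C1 * ((z s y t)\<^sup>2 * (1 + z s y t ^ 24)) + C1 / l ^ 6 * (v_y s y t)\<^sup>2"
          unfolding distrib_left[of C1] by (simp only: mult.assoc times_divide_eq_left times_divide_eq_right)
        finally show ?thesis .
      qed
      have "weighted_integrand c l s y t + 1 / (3 * B) * GX s y t \<le> C1 * weighted_rest l s y t"
        by (rule wi[OF s y t l])
      moreover have "1 / (3 * B) * GX s y t = 1 / (6 * B) * GX s y t + 1 / (6 * B) * GX s y t" by simp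
      moreover have "C9 * ((\<omega> s y t)\<^sup>2 * (1 + z s y t ^ 24)) = C1 * ((\<omega> s y t)\<^sup>2 * (1 + z s y t ^ 24))
          + \<Lambda> * (7 * B * cp / (6 * lam)) * ((\<omega> s y t)\<^sup>2 * (1 + z s y t ^ 24))"
        unfolding C9_def by (rule distrib_right)
      ultimately show "?ft + h y t \<le> g y t + ?Zy"
        using eq om' rest unfolding g_def h_def by linarith
    qed (use s r jf jh jg in \<open>auto simp: boundary sg_bdry\<close>)
    have cph: "continuous_on {0..T} ph" unfolding ph_def by (rule jcont_integral[OF jh])
    have ph0: "0 \<le> ph r" if "r \<in> {0..T}" for r
      unfolding ph[OF that] using IX_nonneg[OF s that] B_ge_1 by simp
    \<comment> \<open>Gronwall is applied on \<open>{0..\<tau>}\<close> so that \<open>IN\<close>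
      and \<open>IA\<close> are integrated up to \<open>\<tau>\<close> only.\<close>
    have g_est: "J t + integral {0..t} ph \<le> exp (integral {0..\<tau>} (\<lambda>r. c5 * m s r)) * (J 0 + integral {0..\<tau>} (\<lambda>r. c6 * Q r))"
    proof (rule gronwall[where T = \<tau>])
      show "continuous_on {0..\<tau>} J" "continuous_on {0..\<tau>} (\<lambda>r. c5 * m s r)" "continuous_on {0..\<tau>} (\<lambda>r. c6 * Q r)"
        "continuous_on {0..\<tau>} ph"
        by (rule continuous_on_subset[of "{0..T}"], use \<tau> in \<open>auto intro!: continuous_intros cJ cont_m s cQ cph\<close>)+
      show "0 \<le> c5 * m s r" "0 \<le> c6 * Q r" "0 \<le> ph r" if "r \<in> {0..\<tau>}" for r
        using m1[OF sub[OF that]] Q0[OF sub[OF that]] ph0[OF sub[OF that]] c56 by auto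
      show "J r + integral {0..r} ph \<le> J 0 + integral {0..r} (\<lambda>s'. c5 * m s s' * J s' + c6 * Q s')" if "r \<in> {0..\<tau>}" for r
        using main[OF sub[OF that]] .
    qed (use t J0[of 0] param_pos in auto)
    have init_f: "J 0 \<le> f0"
      unfolding J_def
    proof (rule integral_le_const)
      show "continuous_on {0..1} (\<lambda>y. f y 0)" using jcont_slice_y[OF jf] param_pos by auto
      fix y :: real assume y: "y \<in> {0..1}"
      have zero: "0 \<in> {0..T}" using param_pos by auto
      note i = init[OF s, of y]
      have K: "1 \<le> K" using param_pos by simp
      have zz: "0 < z s y 0" by (rule z_pos[OF s y zero])
      have "z s y 0 ^ 3 \<le> K" using i y z_power[OF s y zero] by auto
      also have "K \<le> K ^ 3" using K power_increasing[of 1 3 K] by simp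
      finally have zK: "z s y 0 \<le> K" using K zz power_le_imp_le_base[of "z s y 0" 2 K] by (simp add: numeral_3_eq_3)
      have "\<omega> s y 0 ^ 3 \<le> 1 + K\<^sup>2" using i y by (auto simp: \<omega>_power simp flip: abs_le_square_iff)
      also have "1 + K\<^sup>2 \<le> (1 + K\<^sup>2) ^ 3" using power_increasing[of 1 3 "1 + K\<^sup>2"] by simp
      finally have wK: "\<omega> s y 0 \<le> 1 + K\<^sup>2" using power_le_imp_le_base[of "\<omega> s y 0" 2 "1 + K\<^sup>2"] by (simp add: numeral_3_eq_3)
      have z5: "z s y 0 ^ 5 \<le> K ^ 5" "z s y 0 ^ 14 \<le> K ^ 14" using zK zz by (intro power_mono; simp)+
      have "3 / 5 * Cv * z s y 0 ^ 5 \<le> 3 / 5 * Cv * K ^ 5" using z5 param_pos by (intro mult_left_mono) auto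
      moreover have "6 / 7 * a * v s y 0 * z s y 0 ^ 14 \<le> 6 / 7 * a * K * K ^ 14"
        using z5 param_pos i y v_bounds(1)[OF s y zero] zz by (intro mult_mono mult_left_mono) auto
      moreover have "2 * Xi c (l ^ 3) (u s y 0) (z s y 0) \<le> c * K ^ 5"
        using Xb(2)[OF y zero] mult_left_mono[OF z5(1), of c] c by linarith
      moreover have "\<Lambda> * (3 / 10) * \<omega> s y 0 ^ 5 \<le> \<Lambda> * (3 / 10) * (1 + K\<^sup>2) ^ 5"
        using wK \<Lambda> \<omega>_ge_1[of s y 0] by (intro mult_left_mono power_mono) auto
      ultimately show "f y 0 \<le> f0" unfolding f_def f0_def by linarith
    qed
    define N where "N = l\<^sup>2 + integral {0..\<tau>} (IN s) + integral {0..\<tau>} (IA s) / l ^ 6"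
    have int: "m s integrable_on {0..\<tau>}" "D s integrable_on {0..\<tau>}" "IN s integrable_on {0..\<tau>}"
      "IA s integrable_on {0..\<tau>}" "MB s integrable_on {0..\<tau>}"
      by (rule integrable_continuous_real, rule continuous_on_subset[of "{0..T}"], use \<tau> s in \<open>auto intro!: cont_m cont_D cont_INA\<close>)+
    have ints: "0 \<le> integral {0..\<tau>} (IN s)" "0 \<le> integral {0..\<tau>} (IA s) / l ^ 6"
      using INA_nonneg[OF s sub] l int by (auto intro!: integral_nonneg divide_nonneg_nonneg)
    have N1: "1 \<le> N" "l\<^sup>2 \<le> N" using l2 ints by (auto simp: N_def)
    have intQ: "integral {0..\<tau>} (\<lambda>r. c6 * Q r) \<le> c6 * (CD + B + CM) * N + c6 * N"
    proof -
      have "integral {0..\<tau>} (\<lambda>r. c6 * Q r) = c6 * (l\<^sup>2 * (integral {0..\<tau>} (D s) + integral {0..\<tau>} (m s))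
        + integral {0..\<tau>} (IN s) + integral {0..\<tau>} (IA s) / l ^ 6 + integral {0..\<tau>} (MB s))"
        unfolding Q_def
        by (intro integral_unique has_integral_mult_right has_integral_add has_integral_divide integrable_integral int)
      also have "\<dots> \<le> c6 * (l\<^sup>2 * (CD + B) + integral {0..\<tau>} (IN s) + integral {0..\<tau>} (IA s) / l ^ 6 + CM)"
        using CD(2)[OF s \<tau>] CM(2)[OF s \<tau>] m_integral_le(1)[OF s \<tau>] c56
        by (intro mult_left_mono add_mono) auto
      also have "\<dots> \<le> c6 * ((CD + B) * N + N + CM * N)"
      proof (rule mult_left_mono)
        have "l\<^sup>2 * (CD + B) \<le> (CD + B) * N" using N1 CD B_ge_1 by (subst mult.commute) (intro mult_left_mono, auto)
        moreover have "integral {0..\<tau>} (IN s) + integral {0..\<tau>} (IA s) / l ^ 6 \<le> N" using l2 by (simp add: N_def)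
        moreover have "CM * 1 \<le> CM * N" using N1 CM by (intro mult_left_mono) auto
        ultimately show "l\<^sup>2 * (CD + B) + integral {0..\<tau>} (IN s) + integral {0..\<tau>} (IA s) / l ^ 6 + CM
          \<le> (CD + B) * N + N + CM * N" by linarith
      qed (use c56 in auto)
      also have "\<dots> = c6 * (CD + B + CM) * N + c6 * N" by (simp add: algebra_simps)
      finally show ?thesis .
    qed
    have JM: "J t + integral {0..t} ph \<le> M * N"
    proof -
      have "exp (integral {0..\<tau>} (\<lambda>r. c5 * m s r)) \<le> exp (c5 * B)"
        using m_integral_le[OF s \<tau>] c56 by (simp add: mult_left_mono)
      moreover have "J 0 + integral {0..\<tau>} (\<lambda>r. c6 * Q r) \<le> (f0 + c6 * (CD + B + CM) + c6) * N"
      proof -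
        have "f0 * 1 \<le> f0 * N" using N1 f0 by (intro mult_left_mono) auto
        then show ?thesis using init_f intQ unfolding distrib_right by linarith
      qed
      moreover have "0 \<le> J 0 + integral {0..\<tau>} (\<lambda>r. c6 * Q r)"
      proof -
        have "(\<lambda>r. c6 * Q r) integrable_on {0..\<tau>}"
          by (rule integrable_continuous_real, rule continuous_on_subset[of "{0..T}"])
            (use \<tau> in \<open>auto intro!: continuous_intros cQ\<close>)
        then have "0 \<le> integral {0..\<tau>} (\<lambda>r. c6 * Q r)"
          by (rule integral_nonneg) (use Q0[OF sub] c56 in auto)
        then show ?thesis using J0[of 0] param_pos by auto
      qed
      ultimately have "exp (integral {0..\<tau>} (\<lambda>r. c5 * m s r)) * (J 0 + integral {0..\<tau>} (\<lambda>r. c6 * Q r))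
          \<le> exp (c5 * B) * ((f0 + c6 * (CD + B + CM) + c6) * N)"
        by (intro mult_mono) auto
      with g_est show ?thesis by (simp add: M_def mult.assoc)
    qed
    have t': "t \<in> {0..T}" by (rule sub[OF t])
    have intIX: "IX s integrable_on {0..t}" "ph integrable_on {0..t}"
      by (rule integrable_continuous_real, rule continuous_on_subset[of "{0..T}"], use t' s in \<open>auto intro!: cont_IX cph\<close>)+
    have "integral {0..t} (IX s) \<le> integral {0..t} (\<lambda>r. 6 * B * ph r)"
    proof (rule integral_le[OF intIX(1)])
      show "(\<lambda>r. 6 * B * ph r) integrable_on {0..t}" using integrable_cmul[OF intIX(2), of "6 * B"] by simp
      fix r assume "r \<in> {0..t}"
      then have r: "r \<in> {0..T}" using t' by auto
      have "6 * B * (1 / (6 * B) * IX s r) \<le> 6 * B * ph r"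
        using IX_nonneg[OF s r] B_ge_1 by (intro mult_left_mono) (auto simp: ph[OF r])
      then show "IX s r \<le> 6 * B * ph r" using B_ge_1 by simp
    qed
    then have A: "integral {0..t} (IX s) \<le> 6 * B * integral {0..t} ph" by simp
    have phn: "0 \<le> integral {0..t} ph"
      using ph0 t' intIX by (auto intro!: integral_nonneg)
    have "IZ s t + integral {0..t} (IX s) \<le> e1 * J t + 6 * B * integral {0..t} ph"
      using A IZJ[OF t'] by linarith
    also have "\<dots> \<le> (e1 + 6 * B) * J t + (e1 + 6 * B) * integral {0..t} ph"
      using J0[OF t'] phn e12 B_ge_1 by (intro add_mono mult_right_mono) auto
    also have "\<dots> = (e1 + 6 * B) * (J t + integral {0..t} ph)" by (simp add: distrib_left)
    also have "\<dots> \<le> (e1 + 6 * B) * (M * N)" using JM e12 B_ge_1 by (intro mult_left_mono) auto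
    finally show ?thesis by (simp add: C_def N_def mult.assoc)
  qed
  then show ?thesis using C by blast
qed

end

section \<open>Closing the estimate\<close>

context slow_flows
begin

text \<open>The integrand of the square of \<open>HH\<close> is at most of order
  \<open>(z + z^19) th_y^2 / z\<close>, and \<open>sup_z\<close> with \<open>n = 14\<close> bounds
  \<open>z^19\<close> by \<open>1 + IX * IZ\<close>. Thus \<open>HH\<close> is at most of order
  \<open>sqrt M * (1 + IX)\<close>; integration in time gives another factor \<open>M\<close>, and
  the square is of order \<open>M ^ 3\<close>.\<close>

lemma HH_integral_le:
  "\<exists>C>0. \<forall>s\<in>S. \<forall>\<tau>\<in>{0..T}. \<forall>M\<ge>1. (\<forall>t\<in>{0..\<tau>}. IZ s t + integral {0..t} (IX s) \<le> M) \<longrightarrow>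
    (integral {0..\<tau>} (HH s))\<^sup>2 \<le> C * M ^ 3"
proof -
  define c1 where "c1 = 2 * (1 + B)\<^sup>2 + 361 / (18 * k1)"
  have c1: "0 < c1" using B_ge_1 param_pos by (auto simp: c1_def intro!: add_pos_pos)
  define c2 where "c2 = 2 / k1 * (1 + 2 * c1)"
  have c2: "0 < c2" unfolding c2_def using c1 param_pos by (intro mult_pos_pos) auto
  define C where "C = c2 * (T + 1)\<^sup>2"
  have C: "0 < C" using c2 param_pos by (simp add: C_def)
  have "(integral {0..\<tau>} (HH s))\<^sup>2 \<le> C * M ^ 3"
    if s: "s \<in> S" and \<tau>: "\<tau> \<in> {0..T}" and M: "1 \<le> M"
      and le: "\<And>t. t \<in> {0..\<tau>} \<Longrightarrow> IZ s t + integral {0..t} (IX s) \<le> M" for s \<tau> M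
  proof -
    have sub: "r \<in> {0..T}" if "r \<in> {0..\<tau>}" for r using that \<tau> by auto
    have intIX: "IX s integrable_on {0..r}" if "r \<in> {0..T}" for r
      by (rule integrable_continuous_real, rule continuous_on_subset[OF cont_IX(1)[OF s]]) (use that in auto)
    have IX0: "0 \<le> integral {0..r} (IX s)" if "r \<in> {0..T}" for r
      by (rule integral_nonneg[OF intIX[OF that]]) (use IX_nonneg[OF s] that in auto)
    have IZ0: "0 \<le> IZ s r" if "r \<in> {0..T}" for r
      unfolding IZ_def by (rule integral_nonneg_y) (use s that in \<open>auto intro!: continuous_intros jzy\<close>)
    have IZM: "IZ s r \<le> M" if "r \<in> {0..\<tau>}" for r using le[OF that] IX0[OF sub[OF that]] by linarith
    have HHle: "HH s r \<le> sqrt (c2 * M) * (1 + IX s r)" if r': "r \<in> {0..\<tau>}" for r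
    proof -
      have r: "r \<in> {0..T}" by (rule sub[OF r'])
      have x0: "0 \<le> IX s r" by (rule IX_nonneg[OF s r])
      have z19: "z s y r ^ 19 \<le> c1 * (1 + IX s r * M)" if y: "y \<in> {0..1}" for y
      proof -
        have "z s y r ^ 19 \<le> 2 * (1 + B)\<^sup>2 + 361 / (18 * k1) * (IX s r * IZ s r)"
          using sup_z[OF s r y, of 14] by (simp add: IZ_def)
        also have "\<dots> \<le> 2 * (1 + B)\<^sup>2 + 361 / (18 * k1) * (IX s r * M)"
          using IZM[OF r'] x0 param_pos by (intro add_left_mono mult_left_mono) auto
        also have "\<dots> \<le> c1 * (1 + IX s r * M)"
        proof -
          have "0 \<le> 2 * (1 + B)\<^sup>2 * (IX s r * M)" "0 \<le> 361 / (18 * k1)" using x0 M param_pos by auto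
          moreover have "c1 * (1 + IX s r * M) = 2 * (1 + B)\<^sup>2 + 361 / (18 * k1)
              + (2 * (1 + B)\<^sup>2 * (IX s r * M) + 361 / (18 * k1) * (IX s r * M))"
            unfolding c1_def by (simp only: distrib_left distrib_right mult_1_right)
          ultimately show ?thesis by linarith
        qed
        finally show ?thesis .
      qed
      have "integral {0..1} (\<lambda>y. ((1 + th s y r ^ 3) * th_y s y r)\<^sup>2) \<le> c2 * ((1 + IX s r) * M) * (1 + IX s r)"
      proof (rule integral_mult_bound[where g = "\<lambda>y. GX s y r"])
        fix y :: real assume y: "y \<in> {0..1}"
        have zz: "0 < z s y r" by (rule z_pos[OF s y r])
        note zp = z_power[OF s y r]
        have "(1 + z s y r ^ 9)\<^sup>2 \<le> 2 * (1 + z s y r ^ 18)"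
          using zero_le_power2[of "1 - z s y r ^ 9"] by (simp add: power2_sum power2_diff flip: power_mult)
        then have "(1 + z s y r ^ 9)\<^sup>2 * z s y r \<le> 2 * (1 + z s y r ^ 18) * z s y r"
          using zz by (intro mult_right_mono) auto
        also have "\<dots> = 2 * (z s y r + z s y r ^ 19)"
          using power_Suc[of "z s y r" 18] by (simp add: algebra_simps)
        also have "\<dots> \<le> 2 * ((1 + 2 * c1) * ((1 + IX s r) * M))"
        proof -
          have "z s y r \<le> 1 + z s y r ^ 19" using power_le_one_plus_power[of "z s y r" 1 19] zz by simp
          moreover have "1 + IX s r * M \<le> (1 + IX s r) * M" using M by (simp add: algebra_simps)
          then have "c1 * (1 + IX s r * M) \<le> c1 * ((1 + IX s r) * M)" using c1 by (intro mult_left_mono) auto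
          moreover have "1 \<le> (1 + IX s r) * M" using M x0 mult_mono[of 1 "1 + IX s r" 1 M] by simp
          ultimately have "z s y r + z s y r ^ 19 \<le> (1 + 2 * c1) * ((1 + IX s r) * M)"
            using z19[OF y] by (simp add: algebra_simps)
          then show ?thesis by (rule mult_left_mono) simp
        qed
        finally have A: "(1 + z s y r ^ 9)\<^sup>2 * z s y r \<le> 2 * ((1 + 2 * c1) * ((1 + IX s r) * M))" .
        have "((1 + th s y r ^ 3) * th_y s y r)\<^sup>2 = ((1 + z s y r ^ 9)\<^sup>2 * z s y r) * ((th_y s y r)\<^sup>2 / z s y r)"
          using zz zp by (simp add: power_mult_distrib)
        also have "\<dots> \<le> (2 * ((1 + 2 * c1) * ((1 + IX s r) * M))) * (1 / k1 * GX s y r)"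
          using A GX_eq(2)[OF s y r] zz x0 c1 M by (intro mult_mono[OF A]) auto
        finally show "((1 + th s y r ^ 3) * th_y s y r)\<^sup>2 \<le> c2 * ((1 + IX s r) * M) * GX s y r"
          using param_pos by (simp add: c2_def field_simps)
      qed (use s r x0 M c2 in \<open>auto intro!: continuous_intros jcy GXy simp: IX_def\<close>)
      then have "HH s r \<le> sqrt (c2 * M * (1 + IX s r)\<^sup>2)"
        unfolding HH_def by (simp add: power2_eq_square ac_simps)
      also have "\<dots> = sqrt (c2 * M) * (1 + IX s r)" using x0 by (simp add: real_sqrt_mult)
      finally show ?thesis .
    qed
    have intHH: "HH s integrable_on {0..\<tau>}"
      by (rule integrable_continuous_real, rule continuous_on_subset[OF cont_HH[OF s]]) (use \<tau> in auto)
    have "integral {0..\<tau>} (HH s) \<le> integral {0..\<tau>} (\<lambda>r. sqrt (c2 * M) * (1 + IX s r))"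
      by (rule integral_le[OF intHH _ HHle], rule integrable_continuous_real,
          rule continuous_on_subset[of "{0..T}"]) (use \<tau> in \<open>auto intro!: continuous_intros cont_IX s\<close>)
    also have "\<dots> = sqrt (c2 * M) * (\<tau> + integral {0..\<tau>} (IX s))"
    proof -
      have "integral {0..\<tau>} (\<lambda>r. 1 + IX s r) = integral {0..\<tau>} (\<lambda>r. 1) + integral {0..\<tau>} (IX s)"
        by (rule integral_add) (use intIX[OF \<tau>] in auto)
      then show ?thesis using \<tau> by simp
    qed
    also have "\<dots> \<le> sqrt (c2 * M) * ((T + 1) * M)"
    proof (rule mult_left_mono)
      have "integral {0..\<tau>} (IX s) \<le> M" using le[of \<tau>] IZ0[OF \<tau>] \<tau> by auto
      moreover have "T * 1 \<le> T * M" using M param_pos by (intro mult_left_mono) auto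
      ultimately show "\<tau> + integral {0..\<tau>} (IX s) \<le> (T + 1) * M" using \<tau> by (auto simp: algebra_simps)
    qed (use c2 M in auto)
    finally have "integral {0..\<tau>} (HH s) \<le> sqrt (c2 * M) * ((T + 1) * M)" .
    moreover have "0 \<le> integral {0..\<tau>} (HH s)" by (rule integral_nonneg[OF intHH]) (use HH_nonneg[OF s] sub in auto)
    ultimately have "(integral {0..\<tau>} (HH s))\<^sup>2 \<le> (sqrt (c2 * M) * ((T + 1) * M))\<^sup>2" by (rule power_mono)
    also have "\<dots> = C * M ^ 3"
      using c2 M by (simp add: C_def power_mult_distrib power_numeral_reduce)
    finally show ?thesis .
  qed
  then show ?thesis using C by blast
qed

text \<open>The maximum \<open>A\<close> of \<open>IA\<close> occurs on both sides, on the right to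
  the third power but divided by \<open>l ^ 18\<close>. As \<open>main_estimate\<close> is uniform
  in \<open>l\<close>, the level may depend on the solution through \<open>A\<close>, which makes
  the right-hand side sublinear in \<open>A\<close>.\<close>

lemma v_y_le_weighted:
  "\<exists>C>0. \<forall>s\<in>S. \<forall>\<tau>\<in>{0..T}. \<forall>t\<in>{0..\<tau>}.
    IA s t + integral {0..t} (\<lambda>r. integral {0..1} (\<lambda>y. th s y r * (v_y s y r)\<^sup>2)) \<le> C * (1 + (integral {0..\<tau>} (IN s)) ^ 3)"
proof -
  obtain C3 where C3: "C3 > 0" "\<And>s \<tau> t. s \<in> S \<Longrightarrow> \<tau> \<in> {0..T} \<Longrightarrow> t \<in> {0..\<tau>} \<Longrightarrow>
    IA s t + integral {0..t} (\<lambda>r. integral {0..1} (\<lambda>y. th s y r * (v_y s y r)\<^sup>2))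
    \<le> C3 * (1 + (integral {0..\<tau>} (HH s))\<^sup>2)"
    using v_y_bound unfolding IA_def by blast
  obtain C5 where C5: "C5 > 0" "\<And>s l \<tau> t. s \<in> S \<Longrightarrow> 1 \<le> l \<Longrightarrow> \<tau> \<in> {0..T} \<Longrightarrow> t \<in> {0..\<tau>} \<Longrightarrow>
    IZ s t + integral {0..t} (IX s) \<le> C5 * (l\<^sup>2 + integral {0..\<tau>} (IN s) + integral {0..\<tau>} (IA s) / l ^ 6)"
    using main_estimate by blast
  obtain c2 where c2: "c2 > 0" "\<And>s \<tau> M. s \<in> S \<Longrightarrow> \<tau> \<in> {0..T} \<Longrightarrow> 1 \<le> M \<Longrightarrow>
    (\<And>t. t \<in> {0..\<tau>} \<Longrightarrow> IZ s t + integral {0..t} (IX s) \<le> M) \<Longrightarrow> (integral {0..\<tau>} (HH s))\<^sup>2 \<le> c2 * M ^ 3"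
    using HH_integral_le by blast
  define C6 where "C6 = (C5 + 1) * (1 + T)"
  have C6: "0 < C6" using C5 param_pos by (simp add: C6_def)
  define C7 where "C7 = C3 * (1 + c2) * (4 * C6 ^ 3)"
  have C7: "0 < C7" using C3 c2 C6 by (simp add: C7_def)
  define C8 where "C8 = C7 + 1"
  have C8: "0 < C8" using C7 by (simp add: C8_def)
  define C where "C = C7 * (8 * C8 ^ 3 + 2 * C8 + 1)"
  have C: "0 < C" unfolding C_def using C7 C8 by (intro mult_pos_pos add_pos_pos) auto
  have "IA s t + integral {0..t} (\<lambda>r. integral {0..1} (\<lambda>y. th s y r * (v_y s y r)\<^sup>2)) \<le> C * (1 + (integral {0..\<tau>} (IN s)) ^ 3)"
    if s: "s \<in> S" and \<tau>: "\<tau> \<in> {0..T}" and t: "t \<in> {0..\<tau>}" for s \<tau> t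
  proof -
    have sub: "r \<in> {0..T}" if "r \<in> {0..\<tau>}" for r using that \<tau> by auto
    define N where "N = integral {0..\<tau>} (IN s)"
    have N: "0 \<le> N"
      unfolding N_def by (rule integral_nonneg, rule integrable_continuous_real,
        rule continuous_on_subset[OF cont_INA(1)[OF s]]) (use \<tau> INA_nonneg(1)[OF s] in auto)
    have cA: "continuous_on {0..\<tau>} (IA s)" by (rule continuous_on_subset[OF cont_INA(2)[OF s]]) (use \<tau> in auto)
    obtain r0 where r0: "r0 \<in> {0..\<tau>}" "\<And>r. r \<in> {0..\<tau>} \<Longrightarrow> IA s r \<le> IA s r0"
      using continuous_attains_sup[of "{0..\<tau>}" "IA s"] cA \<tau> by auto
    define A where "A = IA s r0"
    have A: "0 \<le> A" using INA_nonneg(2)[OF s sub[OF r0(1)]] by (simp add: A_def)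
    \<comment> \<open>With \<open>l\<^sup>2 = P = (1 + A)\<^sup>1\<^sup>/\<^sup>4\<close>, both \<open>(l\<^sup>2)\<^sup>3\<close> and \<open>(A / l\<^sup>6)\<^sup>3\<close> are of order \<open>A\<^sup>3\<^sup>/\<^sup>4\<close>, hence absorbed by \<open>A\<close>.\<close>
    define P where "P = (1 + A) powr (1 / 4)"
    have P4: "P ^ 4 = 1 + A" using A by (simp add: P_def powr_power)
    have P1: "1 \<le> P" unfolding P_def using A by (intro ge_one_powr_ge_zero) auto
    define l where "l = sqrt P"
    have l: "1 \<le> l" "l\<^sup>2 = P" using P1 by (auto simp: l_def)
    have l6: "l ^ 6 = P ^ 3" unfolding l(2)[symmetric] by (simp flip: power_mult)
    have "integral {0..\<tau>} (IA s) \<le> integral {0..\<tau>} (\<lambda>r. A)"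
      by (rule integral_le) (use r0 cA in \<open>auto simp: A_def intro: integrable_continuous_real\<close>)
    also have "\<dots> \<le> T * A" using \<tau> A by (auto intro: mult_right_mono)
    also have "\<dots> \<le> T * P ^ 4" using P4 param_pos by (intro mult_left_mono) auto
    finally have "integral {0..\<tau>} (IA s) / l ^ 6 \<le> T * P ^ 4 / P ^ 3" unfolding l6 using P1 by (intro divide_right_mono) auto
    also have "\<dots> = T * P" using P1 by (simp add: power_numeral_reduce)
    finally have IAl: "integral {0..\<tau>} (IA s) / l ^ 6 \<le> T * P" .
    define M where "M = C6 * (P + N)"
    have M1: "1 \<le> M"
    proof -
      have "1 * 1 \<le> (C5 + 1) * (1 + T)" using C5 param_pos by (intro mult_mono) auto
      then have "1 \<le> C6" by (simp add: C6_def)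
      then have "1 * 1 \<le> C6 * (P + N)" using P1 N by (intro mult_mono) auto
      then show ?thesis by (simp add: M_def)
    qed
    have le: "IZ s r + integral {0..r} (IX s) \<le> M" if r: "r \<in> {0..\<tau>}" for r
    proof -
      have "IZ s r + integral {0..r} (IX s) \<le> C5 * (l\<^sup>2 + N + integral {0..\<tau>} (IA s) / l ^ 6)"
        unfolding N_def by (rule C5(2)[OF s l(1) \<tau> r])
      also have "\<dots> \<le> C5 * (P + N + T * P)" using IAl l C5 by (intro mult_left_mono) auto
      also have "\<dots> \<le> (C5 + 1) * ((1 + T) * (P + N))"
      proof (rule mult_mono)
        have "0 \<le> T * N" using param_pos N by simp
        then show "P + N + T * P \<le> (1 + T) * (P + N)" by (simp add: algebra_simps)
      qed (use C5 P1 N param_pos in auto)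
      finally show ?thesis by (simp add: M_def C6_def mult.assoc)
    qed
    have M3: "M ^ 3 \<le> 4 * C6 ^ 3 * (P ^ 3 + N ^ 3)"
    proof -
      have "0 \<le> 3 * (P + N) * (P - N)\<^sup>2" using P1 N by simp
      also have "\<dots> = 4 * (P ^ 3 + N ^ 3) - (P + N) ^ 3" by algebra
      finally have "C6 ^ 3 * (P + N) ^ 3 \<le> C6 ^ 3 * (4 * (P ^ 3 + N ^ 3))" using C6 by (intro mult_left_mono) auto
      moreover have "M ^ 3 = C6 ^ 3 * (P + N) ^ 3" by (simp add: M_def power_mult_distrib)
      ultimately show ?thesis by (simp add: algebra_simps)
    qed
    have est: "IA s r + integral {0..r} (\<lambda>r. integral {0..1} (\<lambda>y. th s y r * (v_y s y r)\<^sup>2)) \<le> C7 * (P ^ 3 + N ^ 3)"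
      if r: "r \<in> {0..\<tau>}" for r
    proof -
      have "IA s r + integral {0..r} (\<lambda>r. integral {0..1} (\<lambda>y. th s y r * (v_y s y r)\<^sup>2))
        \<le> C3 * (1 + (integral {0..\<tau>} (HH s))\<^sup>2)" by (rule C3(2)[OF s \<tau> r])
      also have "\<dots> \<le> C3 * (M ^ 3 + c2 * M ^ 3)"
        using c2(2)[OF s \<tau> M1 le] C3 M1 by (intro mult_left_mono add_mono) auto
      also have "\<dots> = C3 * (1 + c2) * M ^ 3" by (simp add: algebra_simps)
      also have "\<dots> \<le> C3 * (1 + c2) * (4 * C6 ^ 3 * (P ^ 3 + N ^ 3))" using M3 C3 c2 by (intro mult_left_mono) auto
      finally show ?thesis by (simp add: C7_def mult.assoc)
    qed
    have nn: "0 \<le> integral {0..r0} (\<lambda>r. integral {0..1} (\<lambda>y. th s y r * (v_y s y r)\<^sup>2))"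
    proof (rule integral_nonneg)
      show "(\<lambda>r. integral {0..1} (\<lambda>y. th s y r * (v_y s y r)\<^sup>2)) integrable_on {0..r0}"
        by (rule jcont_integrable_t[OF _ sub[OF r0(1)]]) (use s in \<open>auto intro!: continuous_intros jcs\<close>)
      fix r assume "r \<in> {0..r0}"
      then have r: "r \<in> {0..T}" using r0(1) \<tau> by auto
      show "0 \<le> integral {0..1} (\<lambda>y. th s y r * (v_y s y r)\<^sup>2)"
        by (rule integral_nonneg_y) (use s r v_bounds(6)[OF s _ r] in \<open>auto intro!: continuous_intros jcy simp: less_imp_le\<close>)
    qed
    have "1 + A \<le> 1 + C7 * (P ^ 3 + N ^ 3)" using est[OF r0(1)] nn by (simp add: A_def)
    also have "\<dots> \<le> C8 * (P ^ 3 + N ^ 3)"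
    proof -
      have "1 \<le> P ^ 3 + N ^ 3" using P1 N one_le_power[of P 3] by (simp add: add_increasing2)
      then show ?thesis by (simp add: C8_def algebra_simps)
    qed
    finally have P4': "P ^ 4 \<le> C8 * (P ^ 3 + N ^ 3)" by (simp add: P4)
    \<comment> \<open>Either \<open>P\<close> is bounded by a constant, or \<open>C8 * P ^ 3\<close>
      is at most half of \<open>P ^ 4\<close> and is absorbed.\<close>
    have P3: "P ^ 3 \<le> 8 * C8 ^ 3 + 2 * C8 * N ^ 3"
    proof (cases "P \<le> 2 * C8")
      case True
      then have "P ^ 3 \<le> (2 * C8) ^ 3" using P1 by (intro power_mono) auto
      moreover have "0 \<le> 2 * C8 * N ^ 3" using C8 N by simp
      ultimately show ?thesis by (simp add: power_mult_distrib)
    next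
      case False
      then have "2 * C8 * P ^ 3 \<le> P * P ^ 3" using P1 by (intro mult_right_mono) auto
      also have "P * P ^ 3 = P ^ 4" by (simp add: power_numeral_reduce)
      finally have "2 * (C8 * P ^ 3) \<le> P ^ 4" by simp
      moreover have "P ^ 4 \<le> C8 * P ^ 3 + C8 * N ^ 3" using P4' unfolding distrib_left .
      ultimately have "P ^ 4 \<le> 2 * (C8 * N ^ 3)" by linarith
      moreover have "P ^ 3 \<le> P ^ 4" using P1 by (intro power_increasing) auto
      moreover have "0 \<le> 8 * C8 ^ 3" using C8 by simp
      ultimately show ?thesis unfolding mult.assoc by linarith
    qed
    have "IA s t + integral {0..t} (\<lambda>r. integral {0..1} (\<lambda>y. th s y r * (v_y s y r)\<^sup>2)) \<le> C7 * (P ^ 3 + N ^ 3)"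
      by (rule est[OF t])
    also have "\<dots> \<le> C7 * ((8 * C8 ^ 3 + 2 * C8 + 1) * (1 + N ^ 3))"
    proof (rule mult_left_mono)
      have "0 \<le> 8 * C8 ^ 3 * N ^ 3" using C8 N by simp
      then show "P ^ 3 + N ^ 3 \<le> (8 * C8 ^ 3 + 2 * C8 + 1) * (1 + N ^ 3)" using P3 C8 by (simp add: algebra_simps)
    qed (use C7 in auto)
    finally show ?thesis by (simp add: C_def N_def mult.assoc)
  qed
  then show ?thesis using C by blast
qed

section \<open>Interpolation with the second derivatives of \<open>w\<close> and \<open>b\<close>,
  and the choice of the small factor\<close>

definition WW :: "'s \<Rightarrow> real \<Rightarrow> real" where
  "WW s t = integral {0..1} (\<lambda>y. w_yy s y t \<bullet> w_yy s y t)"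
definition BB :: "'s \<Rightarrow> real \<Rightarrow> real" where
  "BB s t = integral {0..1} (\<lambda>y. b_yy s y t \<bullet> b_yy s y t)"

lemma cont_WB: "s \<in> S \<Longrightarrow> continuous_on {0..T} (WW s)" "s \<in> S \<Longrightarrow> continuous_on {0..T} (BB s)"
  unfolding WW_def BB_def by (rule jcont_integral, auto intro!: continuous_intros jcs)+

lemma WB_nonneg: "s \<in> S \<Longrightarrow> t \<in> {0..T} \<Longrightarrow> 0 \<le> WW s t" "s \<in> S \<Longrightarrow> t \<in> {0..T} \<Longrightarrow> 0 \<le> BB s t"
  unfolding WW_def BB_def by (rule integral_nonneg_y, auto intro!: continuous_intros jcy)+

text \<open>The variation of \<open>f \<bullet> f\<close> is split by Young's inequality with a free
  parameter \<open>n\<close>, which later balances the first derivatives against the second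
  ones.\<close>

lemma sup_gradient:
  fixes f f' :: "real \<Rightarrow> 'a"
  assumes "\<And>y. y \<in> {0..1} \<Longrightarrow> (f has_vector_derivative f' y) (at y within {0..1})"
    and c: "continuous_on {0..1} f'" and n: "0 < n" and y: "y \<in> {0..1}"
  shows "f y \<bullet> f y \<le> (1 + n) * integral {0..1} (\<lambda>y. f y \<bullet> f y) + integral {0..1} (\<lambda>y. f' y \<bullet> f' y) / n"
proof -
  have cf: "continuous_on {0..1} f"
    by (rule continuous_on_vector_derivative) (use assms(1) in auto)
  have "f y \<bullet> f y \<le> integral {0..1} (\<lambda>y. f y \<bullet> f y) + integral {0..1} (\<lambda>y. \<bar>2 * (f y \<bullet> f' y)\<bar>)"
    by (rule le_mean_plus_variation[where f = "\<lambda>y. f y \<bullet> f y"])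
      (use y cf c in \<open>auto intro!: has_real_derivative_inner[OF assms(1) assms(1)] continuous_intros simp: inner_commute\<close>)
  also have "integral {0..1} (\<lambda>y. \<bar>2 * (f y \<bullet> f' y)\<bar>) \<le> integral {0..1} (\<lambda>y. n * (f y \<bullet> f y) + f' y \<bullet> f' y / n)"
  proof (rule integral_mono_y)
    fix y
    have "\<bar>2 * (f y \<bullet> f' y)\<bar> \<le> norm (f y) * (2 * norm (f' y))"
      using Cauchy_Schwarz_ineq2[of "f y" "f' y"] by (simp add: abs_mult)
    also have "\<dots> \<le> n * (norm (f y))\<^sup>2 + (2 * norm (f' y))\<^sup>2 / (4 * n)" by (rule young[OF n])
    finally show "\<bar>2 * (f y \<bullet> f' y)\<bar> \<le> n * (f y \<bullet> f y) + f' y \<bullet> f' y / n"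
      by (simp add: power_mult_distrib power2_norm_eq_inner)
  qed (use cf c n in \<open>auto intro!: continuous_intros\<close>)
  also have "\<dots> = n * integral {0..1} (\<lambda>y. f y \<bullet> f y) + integral {0..1} (\<lambda>y. f' y \<bullet> f' y) / n"
    by (intro integral_unique has_integral_add has_integral_mult_right has_integral_divide integrable_integral
        integrable_continuous_real continuous_intros cf c)
  finally show ?thesis by (simp add: algebra_simps)
qed

text \<open>\<open>z^2 \<le> g + z^12 / g^5\<close> separates moderate from large temperatures. The
  first part is paid by \<open>D\<close>; in the second, \<open>z^12\<close> is integrated by the
  energy and the gradients are estimated by their supremum, whose time integral for
  \<open>n = g ^ 6\<close> is of order \<open>g ^ 6\<close>. Both parts are then of order
  \<open>g\<close>, which is where the sixth root comes from.\<close>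

lemma IN_integral_le:
  "\<exists>C>0. \<forall>s\<in>S. \<forall>\<tau>\<in>{0..T}. \<forall>g\<ge>1. 1 + sqrt (integral {0..\<tau>} (WW s)) + sqrt (integral {0..\<tau>} (BB s)) = g ^ 6 \<longrightarrow>
    integral {0..\<tau>} (IN s) \<le> C * g"
proof -
  obtain CD where CD: "CD > 0" "\<And>s t. s \<in> S \<Longrightarrow> t \<in> {0..T} \<Longrightarrow> integral {0..t} (D s) \<le> CD"
    using D_integral by blast
  define C where "C = CD + B * (4 * CD + 2)"
  have C: "0 < C" unfolding C_def using CD B_ge_1 by (intro add_pos_pos mult_pos_pos) auto
  have "integral {0..\<tau>} (IN s) \<le> C * g"
    if s: "s \<in> S" and \<tau>: "\<tau> \<in> {0..T}" and g: "1 \<le> g"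
      and g6: "1 + sqrt (integral {0..\<tau>} (WW s)) + sqrt (integral {0..\<tau>} (BB s)) = g ^ 6" for s \<tau> g
  proof -
    define n where "n = g ^ 6"
    have n: "1 \<le> n" using g by (simp add: n_def)
    have INle: "IN s r \<le> g * D s r + 1 / g ^ 5 * (B * (2 * (1 + n) * D s r + (WW s r + BB s r) / n))" if r: "r \<in> {0..T}" for r
    proof -
      define Q where "Q = 2 * (1 + n) * D s r + (WW s r + BB s r) / n"
      have wd: "integral {0..1} (\<lambda>y. w_y s y r \<bullet> w_y s y r) \<le> D s r" "integral {0..1} (\<lambda>y. b_y s y r \<bullet> b_y s y r) \<le> D s r"
        unfolding D_def by (rule integral_mono_y, use s r in \<open>auto intro!: continuous_intros jcy\<close>)+
      have Q: "w_y s y r \<bullet> w_y s y r + b_y s y r \<bullet> b_y s y r \<le> Q" if y: "y \<in> {0..1}" for y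
      proof -
        have "w_y s y r \<bullet> w_y s y r \<le> (1 + n) * integral {0..1} (\<lambda>y. w_y s y r \<bullet> w_y s y r) + WW s r / n"
          unfolding WW_def by (rule sup_gradient) (use s r y n in \<open>auto intro!: dyv jcy\<close>)
        moreover have "b_y s y r \<bullet> b_y s y r \<le> (1 + n) * integral {0..1} (\<lambda>y. b_y s y r \<bullet> b_y s y r) + BB s r / n"
          unfolding BB_def by (rule sup_gradient) (use s r y n in \<open>auto intro!: dyv jcy\<close>)
        moreover have "(1 + n) * integral {0..1} (\<lambda>y. w_y s y r \<bullet> w_y s y r) \<le> (1 + n) * D s r"
          "(1 + n) * integral {0..1} (\<lambda>y. b_y s y r \<bullet> b_y s y r) \<le> (1 + n) * D s r"
          using wd n by (intro mult_left_mono; simp)+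
        moreover have "Q = (1 + n) * D s r + (1 + n) * D s r + (WW s r / n + BB s r / n)"
          by (simp add: Q_def algebra_simps add_divide_distrib)
        ultimately show ?thesis by linarith
      qed
      have Q0: "0 \<le> Q" unfolding Q_def using WB_nonneg[OF s r] D_nonneg[OF s r] n by auto
      have "IN s r \<le> integral {0..1} (\<lambda>y. g * ((u_y s y r)\<^sup>2 + w_y s y r \<bullet> w_y s y r + b_y s y r \<bullet> b_y s y r)
          + Q / g ^ 5 * z s y r ^ 12)"
        unfolding IN_def
      proof (rule integral_mono_y)
        fix y :: real assume y: "y \<in> {0..1}"
        have zz: "0 < z s y r" by (rule z_pos[OF s y r])
        have z2: "(z s y r)\<^sup>2 \<le> g + z s y r ^ 12 / g ^ 5"
        proof (cases "(z s y r)\<^sup>2 \<le> g")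
          case True
          moreover have "0 \<le> z s y r ^ 12 / g ^ 5" using g zz by simp
          ultimately show ?thesis by linarith
        next
          case False
          then have "g ^ 5 \<le> ((z s y r)\<^sup>2) ^ 5" using g by (intro power_mono) auto
          then have "(z s y r)\<^sup>2 * g ^ 5 \<le> (z s y r)\<^sup>2 * ((z s y r)\<^sup>2) ^ 5" by (rule mult_left_mono) simp
          also have "\<dots> = z s y r ^ 12" by (simp flip: power_mult power_add)
          finally have "(z s y r)\<^sup>2 \<le> z s y r ^ 12 / g ^ 5" using g by (simp add: field_simps)
          then show ?thesis using g by linarith
        qed
        let ?q = "w_y s y r \<bullet> w_y s y r + b_y s y r \<bullet> b_y s y r"
        have "(z s y r)\<^sup>2 * ?q \<le> (g + z s y r ^ 12 / g ^ 5) * ?q" using z2 by (rule mult_right_mono) auto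
        also have "\<dots> = g * ?q + z s y r ^ 12 / g ^ 5 * ?q" by (rule distrib_right)
        also have "\<dots> \<le> g * ((u_y s y r)\<^sup>2 + w_y s y r \<bullet> w_y s y r + b_y s y r \<bullet> b_y s y r) + z s y r ^ 12 / g ^ 5 * Q"
          using Q[OF y] g zz by (intro add_mono mult_left_mono) auto
        finally show "(z s y r)\<^sup>2 * ?q \<le> g * ((u_y s y r)\<^sup>2 + w_y s y r \<bullet> w_y s y r + b_y s y r \<bullet> b_y s y r)
          + Q / g ^ 5 * z s y r ^ 12" by (simp add: ac_simps)
      qed (use s r g in \<open>auto intro!: continuous_intros jcy jzy\<close>)
      also have "\<dots> = g * D s r + Q / g ^ 5 * integral {0..1} (\<lambda>y. z s y r ^ 12)"
        unfolding D_def
        by (intro integral_unique has_integral_add has_integral_mult_right integrable_integral integrable_continuous_real)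
          (use s r in \<open>auto intro!: continuous_intros jcy jzy\<close>)
      also have "\<dots> \<le> g * D s r + Q / g ^ 5 * B"
        using integral_z12[OF s r] Q0 g by (intro add_left_mono mult_left_mono) auto
      finally show ?thesis by (simp add: Q_def ac_simps)
    qed
    have int: "IN s integrable_on {0..\<tau>}" "D s integrable_on {0..\<tau>}" "WW s integrable_on {0..\<tau>}" "BB s integrable_on {0..\<tau>}"
      by (rule integrable_continuous_real, rule continuous_on_subset[of "{0..T}"], use \<tau> s in \<open>auto intro!: cont_INA cont_D cont_WB\<close>)+
    have iW: "0 \<le> integral {0..\<tau>} (WW s)" "0 \<le> integral {0..\<tau>} (BB s)"
      by (rule integral_nonneg, use int \<tau> WB_nonneg[OF s] in auto)+
    have "integral {0..\<tau>} (IN s) \<le> integral {0..\<tau>} (\<lambda>r. g * D s r + 1 / g ^ 5 * (B * (2 * (1 + n) * D s r + (WW s r + BB s r) / n)))"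
      by (rule integral_le[OF int(1)], rule integrable_continuous_real, rule continuous_on_subset[of "{0..T}"])
        (use \<tau> n g INle in \<open>auto intro!: continuous_intros cont_D cont_WB s\<close>)
    also have "\<dots> = g * integral {0..\<tau>} (D s) + 1 / g ^ 5 * (B * (2 * (1 + n) * integral {0..\<tau>} (D s)
        + (integral {0..\<tau>} (WW s) + integral {0..\<tau>} (BB s)) / n))"
      by (intro integral_unique has_integral_add has_integral_mult_right has_integral_divide integrable_integral int)
    also have "\<dots> \<le> g * CD + 1 / g ^ 5 * (B * (4 * n * CD + 2 * n))"
    proof (intro add_mono mult_left_mono)
      show "2 * (1 + n) * integral {0..\<tau>} (D s) \<le> 4 * n * CD"
      proof -
        have "0 \<le> integral {0..\<tau>} (D s)" by (rule integral_nonneg) (use int \<tau> D_nonneg[OF s] in auto)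
        then show ?thesis using CD(2)[OF s \<tau>] n mult_mono[of "2 * (1 + n)" "4 * n" "integral {0..\<tau>} (D s)" CD] by simp
      qed
      have a: "sqrt (integral {0..\<tau>} (WW s)) \<le> n" "sqrt (integral {0..\<tau>} (BB s)) \<le> n"
        using g6 iW real_sqrt_ge_zero unfolding n_def[symmetric] by (smt (verit))+
      have "integral {0..\<tau>} (WW s) \<le> n\<^sup>2" "integral {0..\<tau>} (BB s) \<le> n\<^sup>2"
        using a by (auto intro: sqrt_le_D)
      then show "(integral {0..\<tau>} (WW s) + integral {0..\<tau>} (BB s)) / n \<le> 2 * n"
        using n by (simp add: divide_le_eq power2_eq_square)
    qed (use CD(2)[OF s \<tau>] g B_ge_1 in auto)
    also have "\<dots> = g * CD + (n / g ^ 5) * (B * (4 * CD + 2))" by (simp add: algebra_simps add_divide_distrib)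
    also have "n / g ^ 5 = g" using g by (simp add: n_def power_numeral_reduce)
    finally show ?thesis by (simp add: C_def algebra_simps)
  qed
  then show ?thesis using C by blast
qed

text \<open>The integral of \<open>IN\<close> is at most \<open>C2 * g\<close> with
  \<open>g ^ 6 = n\<close>, so its cube is of order \<open>sqrt n\<close>, and Young's inequality
  trades this for a small multiple of \<open>n\<close> plus a constant. \<open>d\<close> is chosen
  to make that multiple equal to \<open>e\<close>; the summand \<open>1\<close> of \<open>n\<close>
  accounts for the \<open>e\<close> in \<open>C\<close>.\<close>

lemma slow_estimate:
  assumes e: "0 < e"
  shows "\<exists>C>0. \<forall>s\<in>S. \<forall>t\<in>{0..T}.
    IA s t + integral {0..t} (\<lambda>r. integral {0..1} (\<lambda>y. th s y r * (v_y s y r)\<^sup>2))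
    \<le> C + e * sqrt (integral {0..t} (WW s)) + e * sqrt (integral {0..t} (BB s))"
proof -
  obtain C1 where C1: "C1 > 0" "\<And>s t. s \<in> S \<Longrightarrow> t \<in> {0..T} \<Longrightarrow>
    IA s t + integral {0..t} (\<lambda>r. integral {0..1} (\<lambda>y. th s y r * (v_y s y r)\<^sup>2)) \<le> C1 * (1 + (integral {0..t} (IN s)) ^ 3)"
  proof -
    obtain C1 where "C1 > 0" "\<And>s \<tau> t. s \<in> S \<Longrightarrow> \<tau> \<in> {0..T} \<Longrightarrow> t \<in> {0..\<tau>} \<Longrightarrow>
      IA s t + integral {0..t} (\<lambda>r. integral {0..1} (\<lambda>y. th s y r * (v_y s y r)\<^sup>2)) \<le> C1 * (1 + (integral {0..\<tau>} (IN s)) ^ 3)"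
      using v_y_le_weighted by blast
    then show thesis by (intro that[of C1]) auto
  qed
  obtain C2 where C2: "C2 > 0" "\<And>s \<tau> g. s \<in> S \<Longrightarrow> \<tau> \<in> {0..T} \<Longrightarrow> 1 \<le> g \<Longrightarrow>
      1 + sqrt (integral {0..\<tau>} (WW s)) + sqrt (integral {0..\<tau>} (BB s)) = g ^ 6 \<Longrightarrow> integral {0..\<tau>} (IN s) \<le> C2 * g"
    using IN_integral_le by blast
  define d where "d = e / (C1 * C2 ^ 3)"
  have d: "0 < d" "C1 * C2 ^ 3 * d = e" using e C1 C2 by (auto simp: d_def)
  define C where "C = C1 + C1 * C2 ^ 3 / (4 * d) + e"
  have C: "0 < C" unfolding C_def using C1 C2 d e by (intro add_pos_pos divide_pos_pos mult_pos_pos) auto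
  have "IA s t + integral {0..t} (\<lambda>r. integral {0..1} (\<lambda>y. th s y r * (v_y s y r)\<^sup>2))
    \<le> C + e * sqrt (integral {0..t} (WW s)) + e * sqrt (integral {0..t} (BB s))" if s: "s \<in> S" and t: "t \<in> {0..T}" for s t
  proof -
    have int: "IN s integrable_on {0..t}" "WW s integrable_on {0..t}" "BB s integrable_on {0..t}"
      by (rule integrable_continuous_real, rule continuous_on_subset[of "{0..T}"], use t s in \<open>auto intro!: cont_INA cont_WB\<close>)+
    have iW: "0 \<le> integral {0..t} (WW s)" "0 \<le> integral {0..t} (BB s)" "0 \<le> integral {0..t} (IN s)"
      by (rule integral_nonneg, use int t WB_nonneg[OF s] INA_nonneg[OF s] in auto)+
    define n where "n = 1 + sqrt (integral {0..t} (WW s)) + sqrt (integral {0..t} (BB s))"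
    have n: "1 \<le> n" using iW by (simp add: n_def)
    define g where "g = n powr (1 / 6)"
    have g: "1 \<le> g" "g ^ 6 = n" unfolding g_def using n by (auto simp: powr_power intro: ge_one_powr_ge_zero)
    have "integral {0..t} (IN s) \<le> C2 * g" by (rule C2(2)[OF s t g(1)]) (simp add: g n_def)
    then have "(integral {0..t} (IN s)) ^ 3 \<le> (C2 * g) ^ 3" using iW by (intro power_mono) auto
    also have "\<dots> = C2 ^ 3 * (g ^ 3 * 1)" by (simp add: power_mult_distrib)
    also have "\<dots> \<le> C2 ^ 3 * (d * (g ^ 3)\<^sup>2 + 1\<^sup>2 / (4 * d))"
      using young[OF d(1), of "g ^ 3" 1] C2 by (intro mult_left_mono) auto
    also have "(g ^ 3)\<^sup>2 = n" using g(2) by (simp flip: power_mult)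
    finally have "C1 * (1 + (integral {0..t} (IN s)) ^ 3) \<le> C1 * (1 + C2 ^ 3 * (d * n + 1\<^sup>2 / (4 * d)))"
      using C1 by (intro mult_left_mono) auto
    also have "\<dots> = C1 + C1 * C2 ^ 3 / (4 * d) + C1 * C2 ^ 3 * d * n" by (simp add: algebra_simps)
    also have "\<dots> = C + e * sqrt (integral {0..t} (WW s)) + e * sqrt (integral {0..t} (BB s))"
      unfolding d(2) by (simp add: C_def n_def algebra_simps)
    finally show ?thesis using C1(2)[OF s t] by linarith
  qed
  then show ?thesis using C by blast
qed

end

text \<open>Of the growth of \<open>kap\<close> only a comparison with \<open>1 + th^2\<close>, from
  below or from above, enters. In the first alternative a constant suffices and the square roots are
  merely added as nonnegative terms.\<close>

lemma (in flows) v_y_estimate: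
  assumes e: "0 < e"
    and kap_cases: "(\<exists>k2>0. \<forall>s\<in>S. \<forall>y\<in>{0..1}. \<forall>t\<in>{0..T}. k2 * (1 + (th s y t)\<^sup>2) \<le> kap s y t) \<or>
      (\<exists>k3>0. \<forall>s\<in>S. \<forall>y\<in>{0..1}. \<forall>t\<in>{0..T}. kap s y t \<le> k3 * (1 + (th s y t)\<^sup>2))"
  shows "\<exists>C>0. \<forall>s\<in>S. \<forall>t\<in>{0..T}.
    integral {0..1} (\<lambda>y. (v_y s y t)\<^sup>2) + integral {0..t} (\<lambda>r. integral {0..1} (\<lambda>y. th s y r * (v_y s y r)\<^sup>2))
    \<le> C + e * sqrt (integral {0..t} (\<lambda>r. integral {0..1} (\<lambda>y. w_yy s y r \<bullet> w_yy s y r)))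
        + e * sqrt (integral {0..t} (\<lambda>r. integral {0..1} (\<lambda>y. b_yy s y r \<bullet> b_yy s y r)))"
proof -
  obtain B where "bounded_flows lam mu nu R a Cv k1 K T S v v_y u u_y u_t th th_y th_t F kap w w_y w_yy w_t b b_y b_yy b_t B"
    using bounded_flows_exists by blast
  then interpret bounded_flows lam mu nu R a Cv k1 K T S v v_y u u_y u_t th th_y th_t F kap w w_y w_yy w_t b b_y b_yy b_t B .
  from kap_cases show ?thesis
  proof
    assume "\<exists>k2>0. \<forall>s\<in>S. \<forall>y\<in>{0..1}. \<forall>t\<in>{0..T}. k2 * (1 + (th s y t)\<^sup>2) \<le> kap s y t"
    then obtain k2 where k2: "0 < k2" "\<And>s y t. s \<in> S \<Longrightarrow> y \<in> {0..1} \<Longrightarrow> t \<in> {0..T} \<Longrightarrow> k2 * (1 + (th s y t)\<^sup>2) \<le> kap s y t"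
      by blast
    obtain C where C: "C > 0" "\<And>s t. s \<in> S \<Longrightarrow> t \<in> {0..T} \<Longrightarrow> integral {0..t} (HH s) \<le> C"
      using HH_integral_large_conductivity[OF k2] by blast
    obtain C3 where C3: "C3 > 0" "\<And>s \<tau> t. s \<in> S \<Longrightarrow> \<tau> \<in> {0..T} \<Longrightarrow> t \<in> {0..\<tau>} \<Longrightarrow>
      integral {0..1} (\<lambda>y. (v_y s y t)\<^sup>2) + integral {0..t} (\<lambda>r. integral {0..1} (\<lambda>y. th s y r * (v_y s y r)\<^sup>2))
      \<le> C3 * (1 + (integral {0..\<tau>} (HH s))\<^sup>2)"
      using v_y_bound by blast
    have "integral {0..1} (\<lambda>y. (v_y s y t)\<^sup>2) + integral {0..t} (\<lambda>r. integral {0..1} (\<lambda>y. th s y r * (v_y s y r)\<^sup>2))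
      \<le> C3 * (1 + C\<^sup>2) + e * sqrt (integral {0..t} (\<lambda>r. integral {0..1} (\<lambda>y. w_yy s y r \<bullet> w_yy s y r)))
        + e * sqrt (integral {0..t} (\<lambda>r. integral {0..1} (\<lambda>y. b_yy s y r \<bullet> b_yy s y r)))" if s: "s \<in> S" and t: "t \<in> {0..T}" for s t
    proof -
      have "HH s integrable_on {0..t}"
        by (rule integrable_continuous_real, rule continuous_on_subset[OF cont_HH[OF s]]) (use t in auto)
      then have "0 \<le> integral {0..t} (HH s)" by (rule integral_nonneg) (use HH_nonneg[OF s] t in auto)
      then have "(integral {0..t} (HH s))\<^sup>2 \<le> C\<^sup>2" using C(2)[OF s t] by (intro power_mono) auto
      then have "C3 * (1 + (integral {0..t} (HH s))\<^sup>2) \<le> C3 * (1 + C\<^sup>2)" using C3 by (intro mult_left_mono) auto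
      moreover have nn: "0 \<le> sqrt (integral {0..t} (\<lambda>r. integral {0..1} (\<lambda>y. f y r \<bullet> f y r)))" if f: "jcont T f" for f :: "real \<Rightarrow> real \<Rightarrow> 'a"
      proof -
        have j: "jcont T (\<lambda>y r. f y r \<bullet> f y r)" using f by (intro continuous_intros)
        show ?thesis
          by (rule real_sqrt_ge_zero, rule integral_nonneg[OF jcont_integrable_t[OF j t]],
              rule integral_nonneg_y[OF jcont_slice_y[OF j]]) (use t in auto)
      qed
      moreover have "t \<in> {0..t}" using t by auto
      ultimately show ?thesis
        using C3(2)[OF s t, of t] mult_nonneg_nonneg[OF less_imp_le[OF e] nn[OF jc(12)[OF s]]]
          mult_nonneg_nonneg[OF less_imp_le[OF e] nn[OF jc(16)[OF s]]] by linarith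
    qed
    moreover have "0 < C3 * (1 + C\<^sup>2)" using C3 by (intro mult_pos_pos add_pos_nonneg) auto
    ultimately show ?thesis by blast
  next
    assume "\<exists>k3>0. \<forall>s\<in>S. \<forall>y\<in>{0..1}. \<forall>t\<in>{0..T}. kap s y t \<le> k3 * (1 + (th s y t)\<^sup>2)"
    then obtain k3 where k3: "0 < k3" "\<And>s y t. s \<in> S \<Longrightarrow> y \<in> {0..1} \<Longrightarrow> t \<in> {0..T} \<Longrightarrow> kap s y t \<le> k3 * (1 + (th s y t)\<^sup>2)"
      by blast
    interpret slow_flows lam mu nu R a Cv k1 K T S v v_y u u_y u_t th th_y th_t F kap w w_y w_yy w_t b b_y b_yy b_t B k3
      by unfold_locales (use k3 in auto)
    show ?thesis using slow_estimate[OF e] unfolding IA_def WW_def[abs_def] BB_def[abs_def] .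
  qed
qed

section \<open>Smooth solutions of the initial-boundary value problem\<close>

text \<open>The flux \<open>heat_flux \<kappa> v \<theta>\<close> is not assumed to be continuous in time, and \<open>\<kappa>\<close> need not be continuous;
  its continuity is recovered from the space derivative and the boundary condition.\<close>

lemma jcont_of_dy:
  fixes f fy :: "real \<Rightarrow> real \<Rightarrow> real"
  assumes fy: "\<And>y t. y \<in> {0..1} \<Longrightarrow> t \<in> {0..T} \<Longrightarrow>
      ((\<lambda>y. f y t) has_vector_derivative fy y t) (at y within {0..1})"
    and c: "jcont T fy" and f0: "\<And>t. t \<in> {0..T} \<Longrightarrow> f 0 t = 0"
  shows "jcont T f"
proof (rule jcont_of_slices[OF fy c])
  fix y :: real assume y: "y \<in> {0..1}"
  have "continuous_on ({0..T} \<times> {0..y}) (\<lambda>(t, x). fy x t)"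
    by (rule continuous_on_subset[OF jcont_swap[OF c]]) (use y in auto)
  then have "continuous_on {0..T} (\<lambda>t. integral {0..y} (\<lambda>x. fy x t))"
    using integral_continuous_on_param[of "{0..T}" 0 y "\<lambda>t x. fy x t"] by simp
  moreover have "integral {0..y} (\<lambda>x. fy x t) = f y t" if t: "t \<in> {0..T}" for t
  proof -
    have "((\<lambda>x. fy x t) has_integral (f y t - f 0 t)) {0..y}"
      by (rule fundamental_theorem_of_calculus)
        (use y t in \<open>auto intro!: has_vector_derivative_within_subset[OF fy]\<close>)
    then show ?thesis using f0[OF t] by (simp add: integral_unique)
  qed
  ultimately show "continuous_on {0..T} (f y)" by (rule continuous_on_eq)
qed

text \<open>The problem states its equations in the open rectangle; continuity of both sides carries
  them to the closure, on which the balance laws are integrated.\<close>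

lemma jcont_eq_closed:
  fixes f g :: "real \<Rightarrow> real \<Rightarrow> 'a::real_normed_vector"
  assumes "jcont T f" "jcont T g" "0 < T"
    and eq: "\<And>y t. y \<in> {0<..<1} \<Longrightarrow> t \<in> {0<..<T} \<Longrightarrow> f y t = g y t"
    and "y \<in> {0..1}" "t \<in> {0..T}"
  shows "f y t = g y t"
proof -
  have cl: "closure ({0<..<1} \<times> {0<..<T}) = {0..1::real} \<times> {0..T}"
    using \<open>0 < T\<close> by (simp add: closure_Times)
  have "f (fst z) (snd z) - g (fst z) (snd z) = 0" if "z \<in> closure ({0<..<1} \<times> {0<..<T})" for z
    by (rule continuous_constant_on_closure[OF _ _ that])
      (use assms(1,2) eq in \<open>auto simp: cl intro!: continuous_intros\<close>)
  from this[of "(y, t)"] show ?thesis using assms(5,6) by (simp add: cl)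
qed

lemma eq_on_closed_interval:
  fixes f g :: "real \<Rightarrow> 'a::real_normed_vector"
  assumes "continuous_on {0..T} f" "continuous_on {0..T} g" "0 < T"
    and eq: "\<And>t. t \<in> {0<..<T} \<Longrightarrow> f t = g t" and t: "t \<in> {0..T}"
  shows "f t = g t"
proof -
  have cl: "closure {0<..<T} = {0..T}" using \<open>0 < T\<close> by simp
  have "f t - g t = 0"
    by (rule continuous_constant_on_closure[where S = "{0<..<T}"])
      (use assms(1,2) eq t in \<open>auto simp: cl intro!: continuous_intros\<close>)
  then show ?thesis by simp
qed

lemma D_y_eqI:
  "((\<lambda>x. f x t) has_vector_derivative d) (at y within {0..1}) \<Longrightarrow> y \<in> {0..1} \<Longrightarrow> D_y f y t = d"
  unfolding D_y_def by (rule vector_derivative_within_cbox[of 0 1, simplified]) auto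

lemma D_t_eqI:
  "((\<lambda>s. f y s) has_vector_derivative d) (at t within {0..T}) \<Longrightarrow> t \<in> {0..T} \<Longrightarrow> 0 < T \<Longrightarrow> D_t T f y t = d"
  unfolding D_t_def by (rule vector_derivative_within_cbox[of 0 T, simplified]) auto

lemma has_cont_D_yD:
  assumes "has_cont_D_y T f"
  shows "y \<in> {0..1} \<Longrightarrow> t \<in> {0..T} \<Longrightarrow> ((\<lambda>x. f x t) has_vector_derivative D_y f y t) (at y within {0..1})"
    and "jcont T (D_y f)"
  using assms unfolding has_cont_D_y_def D_y_def by (auto simp: case_prod_unfold vector_derivative_works)

lemma has_cont_D_tD:
  assumes "has_cont_D_t T f"
  shows "y \<in> {0..1} \<Longrightarrow> t \<in> {0..T} \<Longrightarrow> (f y has_vector_derivative D_t T f y t) (at t within {0..T})"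
    and "jcont T (D_t T f)"
  using assms unfolding has_cont_D_t_def D_t_def by (auto simp: case_prod_unfold vector_derivative_works)

lemma jcont_of_smooth:
  fixes f :: "real \<Rightarrow> real \<Rightarrow> 'a::euclidean_space"
  assumes "has_cont_D_y T f" "has_cont_D_t T f"
  shows "jcont T f"
  by (rule jcont_of_partials[OF has_cont_D_yD(1)[OF assms(1)] has_cont_D_tD(1)[OF assms(2)]
    has_cont_D_yD(2)[OF assms(1)] has_cont_D_tD(2)[OF assms(2)]])

text \<open>The flux is differentiable up to the boundary with a continuous derivative
  \<open>g'\<close>. The equation identifies \<open>g'\<close> with \<open>h\<close> in the interior
  and therefore everywhere.\<close>

lemma derivative_eq_closed:
  fixes g g' h :: "real \<Rightarrow> real \<Rightarrow> 'a::real_normed_vector"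
  assumes g: "\<And>y t. y \<in> {0..1} \<Longrightarrow> t \<in> {0..T} \<Longrightarrow> ((\<lambda>y. g y t) has_vector_derivative g' y t) (at y within {0..1})"
    and "jcont T g'" "jcont T h" "0 < T"
    and "\<And>y t. y \<in> {0<..<1} \<Longrightarrow> t \<in> {0<..<T} \<Longrightarrow> g' y t = h y t"
    and yt: "y \<in> {0..1}" "t \<in> {0..T}"
  shows "((\<lambda>y. g y t) has_vector_derivative h y t) (at y within {0..1})"
  using g[OF yt] jcont_eq_closed[OF assms(2-5) yt] by simp

section \<open>From the stated problem to the reduced equations on the closed rectangle\<close>

locale smooth_solution =
  fixes lam \<mu> \<nu> R a Cv T :: real and \<kappa> :: "real \<Rightarrow> real \<Rightarrow> real" and v0 u0 w0 b0 \<theta>0 v u w b \<theta>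
  assumes T: "0 < T"
    and P: "solves_P lam \<mu> \<nu> R a Cv \<kappa> T v0 u0 w0 b0 \<theta>0 v u w b \<theta>"
    and smooth: "sufficiently_smooth \<kappa> T v u w b \<theta>"
begin

lemma smooth_t: "has_cont_D_t T v" "has_cont_D_t T u" "has_cont_D_t T w" "has_cont_D_t T b" "has_cont_D_t T \<theta>"
  and smooth_y: "has_cont_D_y T v" "has_cont_D_y T u" "has_cont_D_y T w" "has_cont_D_y T b" "has_cont_D_y T \<theta>"
    "has_cont_D_y T (D_y u)" "has_cont_D_y T (D_y w)" "has_cont_D_y T (D_y b)" "has_cont_D_y T (heat_flux \<kappa> v \<theta>)"
  using smooth by (auto simp: sufficiently_smooth_def)

lemma pos: "y \<in> {0..1} \<Longrightarrow> t \<in> {0..T} \<Longrightarrow> 0 < v y t" "y \<in> {0..1} \<Longrightarrow> t \<in> {0..T} \<Longrightarrow> 0 < \<theta> y t"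
  using P by (auto simp: solves_P_def Let_def)

lemma v_ne: "y \<in> {0..1} \<Longrightarrow> t \<in> {0..T} \<Longrightarrow> v y t \<noteq> 0" "0 \<le> y \<and> y \<le> 1 \<and> 0 \<le> t \<and> t \<le> T \<Longrightarrow> v y t \<noteq> 0"
  "\<forall>z\<in>{0..1} \<times> {0..T}. v (fst z) (snd z) \<noteq> 0"
  using pos(1) by force+

lemma jct: "jcont T (D_t T v)" "jcont T (D_t T u)" "jcont T (D_t T w)" "jcont T (D_t T b)" "jcont T (D_t T \<theta>)"
  using smooth_t by (auto intro: has_cont_D_tD(2))

lemma jcy: "jcont T (D_y v)" "jcont T (D_y u)" "jcont T (D_y w)" "jcont T (D_y b)" "jcont T (D_y \<theta>)"
    "jcont T (D_y (D_y u))" "jcont T (D_y (D_y w))" "jcont T (D_y (D_y b))" "jcont T (D_y (heat_flux \<kappa> v \<theta>))"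
  using smooth_y by (auto intro: has_cont_D_yD(2))

lemma jc0: "jcont T v" "jcont T u" "jcont T w" "jcont T b" "jcont T \<theta>"
  using smooth_y smooth_t by (auto intro: jcont_of_smooth)

lemmas jc = jct jcy jc0

lemma v_t: "y \<in> {0..1} \<Longrightarrow> t \<in> {0..T} \<Longrightarrow> D_t T v y t = D_y u y t"
  by (rule jcont_eq_closed[OF jc(1) jc(7) T]) (use P in \<open>auto simp: solves_P_def Let_def\<close>)

lemmas dyv = has_cont_D_yD(1)[OF smooth_y(1)] has_cont_D_yD(1)[OF smooth_y(2)] has_cont_D_yD(1)[OF smooth_y(3)]
  has_cont_D_yD(1)[OF smooth_y(4)] has_cont_D_yD(1)[OF smooth_y(5)] has_cont_D_yD(1)[OF smooth_y(6)]
  has_cont_D_yD(1)[OF smooth_y(7)] has_cont_D_yD(1)[OF smooth_y(8)] has_cont_D_yD(1)[OF smooth_y(9)]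

lemmas dtv = has_cont_D_tD(1)[OF smooth_t(1)] has_cont_D_tD(1)[OF smooth_t(2)]
  has_cont_D_tD(1)[OF smooth_t(3)] has_cont_D_tD(1)[OF smooth_t(4)] has_cont_D_tD(1)[OF smooth_t(5)]

lemma dt_v: "y \<in> {0..1} \<Longrightarrow> t \<in> {0..T} \<Longrightarrow> (v y has_vector_derivative D_y u y t) (at t within {0..T})"
  using dtv(1) v_t by metis

lemmas dy = dyv(1,2,5,6,9)[folded has_real_derivative_iff_has_vector_derivative]
lemmas dt = dt_v[folded has_real_derivative_iff_has_vector_derivative]
  dtv(2,5)[folded has_real_derivative_iff_has_vector_derivative]

text \<open>The magnetic pressure moves to the right-hand side as \<open>b \<bullet> D_y b\<close>,
  which leaves a flux that vanishes at the end points.\<close>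

lemma momentum_closed:
  assumes "y \<in> {0..1}" "t \<in> {0..T}"
  shows "((\<lambda>y. lam * D_y u y t / v y t - pressure R a (v y t) (\<theta> y t)) has_real_derivative
    D_t T u y t + b y t \<bullet> D_y b y t) (at y within {0..1})"
proof -
  let ?g = "\<lambda>y t. lam * (D_y (D_y u) y t * v y t - D_y u y t * D_y v y t) / (v y t)\<^sup>2
    - (R * (D_y \<theta> y t * v y t - \<theta> y t * D_y v y t) / (v y t)\<^sup>2 + 4 * a / 3 * \<theta> y t ^ 3 * D_y \<theta> y t)"
  have g: "((\<lambda>y. lam * D_y u y t / v y t - pressure R a (v y t) (\<theta> y t)) has_real_derivative ?g y t) (at y within {0..1})"
    if "y \<in> {0..1}" "t \<in> {0..T}" for y t
    unfolding pressure_def using that v_ne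
    by (auto intro!: derivative_eq_intros dy simp: power2_eq_square field_simps)
  show ?thesis
    unfolding has_real_derivative_iff_has_vector_derivative
  proof (rule derivative_eq_closed[where g = "\<lambda>y t. lam * D_y u y t / v y t - pressure R a (v y t) (\<theta> y t)" and g' = ?g])
    fix y t assume "y \<in> {0<..<1::real}" "t \<in> {0<..<T}"
    then have yt: "y \<in> {0..1}" "t \<in> {0..T}" and eq: "D_t T u y t =
            D_y (\<lambda>y t. - pressure R a (v y t) (\<theta> y t) - 1/2 * (norm (b y t))\<^sup>2 + lam * D_y u y t / v y t) y t"
      using P by (auto simp: solves_P_def Let_def)
    have "((\<lambda>y. - pressure R a (v y t) (\<theta> y t) - 1/2 * (norm (b y t))\<^sup>2 + lam * D_y u y t / v y t)
        has_real_derivative ?g y t - b y t \<bullet> D_y b y t) (at y within {0..1})"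
    proof -
      have "((\<lambda>y. (lam * D_y u y t / v y t - pressure R a (v y t) (\<theta> y t)) - 1/2 * (b y t \<bullet> b y t))
        has_real_derivative ?g y t - 1/2 * (b y t \<bullet> D_y b y t + D_y b y t \<bullet> b y t)) (at y within {0..1})"
        by (intro DERIV_diff g yt DERIV_cmult has_real_derivative_inner[OF dyv(4)[OF yt] dyv(4)[OF yt] refl])
      then show ?thesis by (simp add: power2_norm_eq_inner inner_commute algebra_simps)
    qed
    then have "D_y (\<lambda>y t. - pressure R a (v y t) (\<theta> y t) - 1/2 * (norm (b y t))\<^sup>2 + lam * D_y u y t / v y t) y t
        = ?g y t - b y t \<bullet> D_y b y t"
      unfolding has_real_derivative_iff_has_vector_derivative by (rule D_y_eqI) (rule yt)
    with eq show "?g y t = D_t T u y t + b y t \<bullet> D_y b y t" by simp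
  next
    show "jcont T ?g" using v_ne by (auto intro!: continuous_intros jc)
    show "jcont T (\<lambda>y t. D_t T u y t + b y t \<bullet> D_y b y t)" by (intro continuous_intros jc)
  qed (use g T assms in \<open>auto simp: has_real_derivative_iff_has_vector_derivative\<close>)
qed

lemma scaled_derivative:
  fixes f g :: "real \<Rightarrow> real \<Rightarrow> real^2"
  assumes f: "has_cont_D_y T f" and g: "has_cont_D_y T g" and yt: "y \<in> {0..1}" "t \<in> {0..T}"
  shows "((\<lambda>y. f y t + (c / v y t) *\<^sub>R g y t) has_vector_derivative
    D_y f y t + ((c / v y t) *\<^sub>R D_y g y t + (- c * D_y v y t / (v y t)\<^sup>2) *\<^sub>R g y t)) (at y within {0..1})"
proof (intro has_vector_derivative_add has_vector_derivative_scaleR has_cont_D_yD(1)[OF f] has_cont_D_yD(1)[OF g] yt)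
  show "((\<lambda>y. c / v y t) has_real_derivative - c * D_y v y t / (v y t)\<^sup>2) (at y within {0..1})"
    using yt v_ne by (auto intro!: derivative_eq_intros dy simp: power2_eq_square)
qed

lemma scaled_derivative_jcont:
  fixes f g :: "real \<Rightarrow> real \<Rightarrow> real^2"
  assumes "jcont T (D_y f)" "jcont T (D_y g)" "jcont T g"
  shows "jcont T (\<lambda>y t. D_y f y t + ((c / v y t) *\<^sub>R D_y g y t + (- c * D_y v y t / (v y t)\<^sup>2) *\<^sub>R g y t))"
  using v_ne by (auto intro!: continuous_intros jc assms)

lemma transversal_closed:
  assumes "y \<in> {0..1}" "t \<in> {0..T}"
  shows "((\<lambda>y. b y t + (\<mu> / v y t) *\<^sub>R D_y w y t) has_vector_derivative D_t T w y t) (at y within {0..1})"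
proof (rule derivative_eq_closed[OF scaled_derivative[OF smooth_y(4,7)] scaled_derivative_jcont jc(3) T _ assms])
  fix y t assume "y \<in> {0<..<1::real}" "t \<in> {0<..<T}"
  then have yt: "y \<in> {0..1}" "t \<in> {0..T}" and "D_t T w y t = D_y (\<lambda>y t. b y t + (\<mu> / v y t) *\<^sub>R D_y w y t) y t"
    using P by (auto simp: solves_P_def Let_def)
  moreover have "D_y (\<lambda>y t. b y t + (\<mu> / v y t) *\<^sub>R D_y w y t) y t
      = D_y b y t + ((\<mu> / v y t) *\<^sub>R D_y (D_y w) y t + (- \<mu> * D_y v y t / (v y t)\<^sup>2) *\<^sub>R D_y w y t)"
    by (rule D_y_eqI, rule scaled_derivative[OF smooth_y(4,7) yt], rule yt)
  ultimately
  show "D_y b y t + ((\<mu> / v y t) *\<^sub>R D_y (D_y w) y t + (- \<mu> * D_y v y t / (v y t)\<^sup>2) *\<^sub>R D_y w y t) = D_t T w y t"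
    by simp
qed (auto intro: jc)

text \<open>The time derivative of \<open>v b\<close> is expanded by the product rule, and
  \<open>v_t\<close> is replaced by \<open>u_y\<close>.\<close>

lemma induction_closed:
  assumes "y \<in> {0..1}" "t \<in> {0..T}"
  shows "((\<lambda>y. w y t + (\<nu> / v y t) *\<^sub>R D_y b y t) has_vector_derivative
    v y t *\<^sub>R D_t T b y t + D_y u y t *\<^sub>R b y t) (at y within {0..1})"
proof (rule derivative_eq_closed[OF scaled_derivative[OF smooth_y(3,8)] scaled_derivative_jcont _ T _ assms])
  fix y t assume "y \<in> {0<..<1::real}" "t \<in> {0<..<T}"
  then have yt: "y \<in> {0..1}" "t \<in> {0..T}"
    and "D_t T (\<lambda>y t. v y t *\<^sub>R b y t) y t = D_y (\<lambda>y t. w y t + (\<nu> / v y t) *\<^sub>R D_y b y t) y t"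
    using P by (auto simp: solves_P_def Let_def)
  moreover have "D_t T (\<lambda>y t. v y t *\<^sub>R b y t) y t = v y t *\<^sub>R D_t T b y t + D_y u y t *\<^sub>R b y t"
    by (rule D_t_eqI, rule has_vector_derivative_scaleR[OF dt(1) dtv(4)]) (use yt T in auto)
  moreover have "D_y (\<lambda>y t. w y t + (\<nu> / v y t) *\<^sub>R D_y b y t) y t
      = D_y w y t + ((\<nu> / v y t) *\<^sub>R D_y (D_y b) y t + (- \<nu> * D_y v y t / (v y t)\<^sup>2) *\<^sub>R D_y b y t)"
    by (rule D_y_eqI, rule scaled_derivative[OF smooth_y(3,8) yt], rule yt)
  ultimately show "D_y w y t + ((\<nu> / v y t) *\<^sub>R D_y (D_y b) y t + (- \<nu> * D_y v y t / (v y t)\<^sup>2) *\<^sub>R D_y b y t)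
      = v y t *\<^sub>R D_t T b y t + D_y u y t *\<^sub>R b y t"
    by simp
qed (auto intro!: continuous_intros jc)

lemma heat_closed:
  assumes "y \<in> {0..1}" "t \<in> {0..T}"
  shows "((\<lambda>y. heat_flux \<kappa> v \<theta> y t) has_real_derivative
        (Cv + 4 * a * v y t * \<theta> y t ^ 3) * D_t T \<theta> y t + a * \<theta> y t ^ 4 * D_y u y t
        - (lam * D_y u y t / v y t - pressure R a (v y t) (\<theta> y t)) * D_y u y t
        - \<mu> * (D_y w y t \<bullet> D_y w y t) / v y t - \<nu> * (D_y b y t \<bullet> D_y b y t) / v y t)
      (at y within {0..1})"
  unfolding has_real_derivative_iff_has_vector_derivative
proof (rule derivative_eq_closed[OF dyv(9) jc(14) _ T _ assms])
  fix y t assume "y \<in> {0<..<1::real}" "t \<in> {0<..<T}"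
  then have yt: "y \<in> {0..1}" "t \<in> {0..T}"
    and eq: "D_t T (\<lambda>y t. internal_energy Cv a (v y t) (\<theta> y t)) y t =
            D_y (heat_flux \<kappa> v \<theta>) y t
            + (- pressure R a (v y t) (\<theta> y t) + lam / v y t * D_y u y t) * D_y u y t
            + \<mu> * (norm (D_y w y t))\<^sup>2 / v y t
            + \<nu> * (norm (D_y b y t))\<^sup>2 / v y t"
    using P by (auto simp: solves_P_def Let_def)
  have "((\<lambda>t. internal_energy Cv a (v y t) (\<theta> y t)) has_real_derivative
      (Cv + 4 * a * v y t * \<theta> y t ^ 3) * D_t T \<theta> y t + a * \<theta> y t ^ 4 * D_y u y t) (at t within {0..T})"
    unfolding internal_energy_def using yt
    by (auto intro!: derivative_eq_intros dt simp: algebra_simps)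
  then have "D_t T (\<lambda>y t. internal_energy Cv a (v y t) (\<theta> y t)) y t
      = (Cv + 4 * a * v y t * \<theta> y t ^ 3) * D_t T \<theta> y t + a * \<theta> y t ^ 4 * D_y u y t"
    unfolding has_real_derivative_iff_has_vector_derivative by (rule D_t_eqI) (use yt T in auto)
  with eq show "D_y (heat_flux \<kappa> v \<theta>) y t = (Cv + 4 * a * v y t * \<theta> y t ^ 3) * D_t T \<theta> y t + a * \<theta> y t ^ 4 * D_y u y t
        - (lam * D_y u y t / v y t - pressure R a (v y t) (\<theta> y t)) * D_y u y t
        - \<mu> * (D_y w y t \<bullet> D_y w y t) / v y t - \<nu> * (D_y b y t \<bullet> D_y b y t) / v y t"
    by (simp add: power2_norm_eq_inner algebra_simps)
qed (use v_ne in \<open>auto intro!: continuous_intros jc simp: pressure_def\<close>)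

text \<open>The conditions are given for \<open>0 < t < T\<close> and reach \<open>t = 0\<close> and
  \<open>t = T\<close> by continuity. Continuity in time of the heat flux is not yet known at this
  point, so for it the limit is taken in \<open>D_y \<theta>\<close>.\<close>

lemma boundary_closed:
  assumes y: "y = 0 \<or> y = 1" and t: "t \<in> {0..T}"
  shows "lam * D_y u y t / v y t - pressure R a (v y t) (\<theta> y t) = 0" "w y t = 0" "b y t = 0" "heat_flux \<kappa> v \<theta> y t = 0"
proof -
  have y': "y \<in> {0..1}" using y by auto
  have bdry: "lam * D_y u y t / v y t - pressure R a (v y t) (\<theta> y t) = 0" "w y t = 0" "b y t = 0" "D_y \<theta> y t = 0"
    if "t \<in> {0<..<T}" for t using P y that by (auto simp: solves_P_def Let_def)
  have "jcont T (\<lambda>y t. lam * D_y u y t / v y t - pressure R a (v y t) (\<theta> y t))"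
    unfolding pressure_def using v_ne by (auto intro!: continuous_intros jc)
  from eq_on_closed_interval[OF jcont_slice_t[OF this y'] continuous_on_const[of _ 0] T bdry(1) t]
  show "lam * D_y u y t / v y t - pressure R a (v y t) (\<theta> y t) = 0" .
  show "w y t = 0"
    by (rule eq_on_closed_interval[OF jcont_slice_t[OF jc(17) y'] continuous_on_const[of _ 0] T bdry(2) t])
  show "b y t = 0"
    by (rule eq_on_closed_interval[OF jcont_slice_t[OF jc(18) y'] continuous_on_const[of _ 0] T bdry(3) t])
  have "D_y \<theta> y t = 0"
    by (rule eq_on_closed_interval[OF jcont_slice_t[OF jc(10) y'] continuous_on_const[of _ 0] T bdry(4) t])
  then show "heat_flux \<kappa> v \<theta> y t = 0" by (simp add: heat_flux_def)
qed

lemma jc_flux: "jcont T (heat_flux \<kappa> v \<theta>)"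
  by (rule jcont_of_dy[OF dyv(9) jc(14)]) (use boundary_closed(4) in auto)

lemma initial_bound:
  "\<exists>K\<ge>1. \<forall>y\<in>{0..1}. 1 / K \<le> v y 0 \<and> v y 0 \<le> K \<and> 1 / K \<le> \<theta> y 0 \<and> \<theta> y 0 \<le> K \<and>
    \<bar>u y 0\<bar> \<le> K \<and> norm (w y 0) \<le> K \<and> norm (b y 0) \<le> K \<and> \<bar>D_y v y 0\<bar> \<le> K"
proof -
  have 0: "0 \<in> {0..T}" using T by auto
  let ?f = "\<lambda>y. 1 + v y 0 + 1 / v y 0 + \<theta> y 0 + 1 / \<theta> y 0 + \<bar>u y 0\<bar> + norm (w y 0) + norm (b y 0) + \<bar>D_y v y 0\<bar>"
  have ne: "\<forall>y\<in>{0..1}. v y 0 \<noteq> 0" "\<forall>y\<in>{0..1}. \<theta> y 0 \<noteq> 0" using pos[OF _ 0] by force+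
  have cf: "continuous_on {0..1} ?f"
    using ne by (intro continuous_intros jcont_slice_y[OF _ 0] jc) auto
  have "\<exists>x\<in>{0..1}. \<forall>y\<in>{0..1}. ?f y \<le> ?f x"
    by (rule continuous_attains_sup[OF compact_Icc _ cf]) simp
  then obtain K where K: "\<And>y. y \<in> {0..1} \<Longrightarrow> ?f y \<le> K" by blast
  have le: "1 \<le> K \<and> 1 / K \<le> v y 0 \<and> v y 0 \<le> K \<and> 1 / K \<le> \<theta> y 0 \<and> \<theta> y 0 \<le> K \<and>
    \<bar>u y 0\<bar> \<le> K \<and> norm (w y 0) \<le> K \<and> norm (b y 0) \<le> K \<and> \<bar>D_y v y 0\<bar> \<le> K" if y: "y \<in> {0..1}" for y
  proof -
    note p = pos[OF y 0]
    have nn: "0 < 1 / v y 0" "0 < 1 / \<theta> y 0" "0 \<le> \<bar>u y 0\<bar>" "0 \<le> norm (w y 0)" "0 \<le> norm (b y 0)" "0 \<le> \<bar>D_y v y 0\<bar>"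
      using p by auto
    have "1 / v y 0 \<le> K" "1 / \<theta> y 0 \<le> K" "1 \<le> K" using K[OF y] nn p by linarith+
    then have "1 / K \<le> v y 0" "1 / K \<le> \<theta> y 0" using p by (auto simp: field_simps)
    then show ?thesis using K[OF y] nn p by linarith
  qed
  show ?thesis using le le[of 0] by auto
qed

lemma initial_values:
  assumes "y \<in> {0<..<1}"
  shows "v y 0 = v0 y" "u y 0 = u0 y" "w y 0 = w0 y" "b y 0 = b0 y" "\<theta> y 0 = \<theta>0 y"
  using assms P by (auto simp: solves_P_def Let_def)

end

text \<open>This makes the bound from \<open>initial_bound\<close> uniform over all solutions: the
  initial values agree inside by the initial condition and at the ends by continuity, and equal
  functions have equal derivatives in \<open>y\<close>.\<close>

lemma initial_values_unique:
  assumes "smooth_solution lam \<mu> \<nu> R a Cv T \<kappa> v0 u0 w0 b0 \<theta>0 v u w b \<theta>"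
    and "smooth_solution lam \<mu> \<nu> R a Cv T \<kappa> v0 u0 w0 b0 \<theta>0 v' u' w' b' \<theta>'"
    and y: "y \<in> {0..1}"
  shows "v y 0 = v' y 0" "u y 0 = u' y 0" "w y 0 = w' y 0" "b y 0 = b' y 0" "\<theta> y 0 = \<theta>' y 0"
    "D_y v y 0 = D_y v' y 0"
proof -
  interpret X: smooth_solution lam \<mu> \<nu> R a Cv T \<kappa> v0 u0 w0 b0 \<theta>0 v u w b \<theta> by fact
  interpret Y: smooth_solution lam \<mu> \<nu> R a Cv T \<kappa> v0 u0 w0 b0 \<theta>0 v' u' w' b' \<theta>' by fact
  have 0: "0 \<in> {0..T}" using X.T by auto
  note e = eq_on_closed_interval[OF _ _ zero_less_one]
  have v: "v y 0 = v' y 0" if "y \<in> {0..1}" for y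
    by (rule e[OF jcont_slice_y[OF X.jc(15) 0] jcont_slice_y[OF Y.jc(15) 0] _ that])
      (use X.initial_values Y.initial_values in auto)
  show "v y 0 = v' y 0" by (rule v[OF y])
  show "u y 0 = u' y 0"
    by (rule e[OF jcont_slice_y[OF X.jc(16) 0] jcont_slice_y[OF Y.jc(16) 0] _ y])
      (use X.initial_values Y.initial_values in auto)
  show "w y 0 = w' y 0"
    by (rule e[OF jcont_slice_y[OF X.jc(17) 0] jcont_slice_y[OF Y.jc(17) 0] _ y])
      (use X.initial_values Y.initial_values in auto)
  show "b y 0 = b' y 0"
    by (rule e[OF jcont_slice_y[OF X.jc(18) 0] jcont_slice_y[OF Y.jc(18) 0] _ y])
      (use X.initial_values Y.initial_values in auto)
  show "\<theta> y 0 = \<theta>' y 0"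
    by (rule e[OF jcont_slice_y[OF X.jc(19) 0] jcont_slice_y[OF Y.jc(19) 0] _ y])
      (use X.initial_values Y.initial_values in auto)
  have "((\<lambda>x. v x 0) has_vector_derivative D_y v' y 0) (at y within {0..1})"
    by (rule has_vector_derivative_transform[OF y _ Y.dyv(1)[OF y 0]]) (rule v)
  then show "D_y v y 0 = D_y v' y 0" by (rule D_y_eqI) (rule y)
qed

text \<open>A solution is a quintuple and the fields of \<open>flows\<close> are its components and
  their derivatives, so the set of all solutions can itself serve as the index set.\<close>

abbreviation solution_flows where
  "solution_flows lam \<mu> \<nu> R a Cv \<kappa>1 K T \<kappa> S \<equiv> flows lam \<mu> \<nu> R a Cv \<kappa>1 K T S
    (\<lambda>(v, u, w, b, \<theta>). v) (\<lambda>(v, u, w, b, \<theta>). D_y v)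
    (\<lambda>(v, u, w, b, \<theta>). u) (\<lambda>(v, u, w, b, \<theta>). D_y u) (\<lambda>(v, u, w, b, \<theta>). D_t T u)
    (\<lambda>(v, u, w, b, \<theta>). \<theta>) (\<lambda>(v, u, w, b, \<theta>). D_y \<theta>) (\<lambda>(v, u, w, b, \<theta>). D_t T \<theta>)
    (\<lambda>(v, u, w, b, \<theta>). heat_flux \<kappa> v \<theta>) (\<lambda>(v, u, w, b, \<theta>) y t. \<kappa> (1 / v y t) (\<theta> y t))
    (\<lambda>(v, u, w, b, \<theta>). w) (\<lambda>(v, u, w, b, \<theta>). D_y w) (\<lambda>(v, u, w, b, \<theta>). D_y (D_y w)) (\<lambda>(v, u, w, b, \<theta>). D_t T w)
    (\<lambda>(v, u, w, b, \<theta>). b) (\<lambda>(v, u, w, b, \<theta>). D_y b) (\<lambda>(v, u, w, b, \<theta>). D_y (D_y b)) (\<lambda>(v, u, w, b, \<theta>). D_t T b)"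

lemma flows_of_solutions:
  assumes param: "0 < lam" "0 < \<mu>" "0 < \<nu>" "0 < R" "0 < a" "0 < Cv" "0 < \<kappa>1" "0 < T"
    and kap: "\<And>\<rho> \<theta>. 0 < \<rho> \<Longrightarrow> 0 < \<theta> \<Longrightarrow> \<kappa>1 \<le> \<kappa> \<rho> \<theta>"
    and S: "\<And>v u w b \<theta>. (v, u, w, b, \<theta>) \<in> S \<Longrightarrow> smooth_solution lam \<mu> \<nu> R a Cv T \<kappa> v0 u0 w0 b0 \<theta>0 v u w b \<theta>"
  shows "\<exists>K. solution_flows lam \<mu> \<nu> R a Cv \<kappa>1 K T \<kappa> S"
proof -
  have "\<exists>K\<ge>1. \<forall>v u w b \<theta>. (v, u, w, b, \<theta>) \<in> S \<longrightarrow> (\<forall>y\<in>{0..1}. 1 / K \<le> v y 0 \<and> v y 0 \<le> K \<and>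
    1 / K \<le> \<theta> y 0 \<and> \<theta> y 0 \<le> K \<and>
    \<bar>u y 0\<bar> \<le> K \<and> norm (w y 0) \<le> K \<and> norm (b y 0) \<le> K \<and> \<bar>D_y v y 0\<bar> \<le> K)"
  proof (cases "S = {}")
    \<comment> \<open>\<open>K\<close> is taken from an arbitrary solution and transferred to the
      others; if there is none, any \<open>K\<close> will do.\<close>
    case False
    then obtain v' u' w' b' \<theta>' where s': "(v', u', w', b', \<theta>') \<in> S" by (metis ex_in_conv prod_cases5)
    obtain K where K: "K \<ge> 1" "\<And>y. y \<in> {0..1} \<Longrightarrow> 1 / K \<le> v' y 0 \<and> v' y 0 \<le> K \<and> 1 / K \<le> \<theta>' y 0 \<and> \<theta>' y 0 \<le> K \<and>
      \<bar>u' y 0\<bar> \<le> K \<and> norm (w' y 0) \<le> K \<and> norm (b' y 0) \<le> K \<and> \<bar>D_y v' y 0\<bar> \<le> K"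
      using smooth_solution.initial_bound[OF S[OF s']] by blast
    show ?thesis
    proof (intro exI[of _ K] conjI allI impI ballI)
      fix v u w b \<theta> y assume s: "(v, u, w, b, \<theta>) \<in> S" and y: "y \<in> {0..1::real}"
      note i = initial_values_unique[OF S[OF s] S[OF s'] y]
      show "1 / K \<le> v y 0" "v y 0 \<le> K" "1 / K \<le> \<theta> y 0" "\<theta> y 0 \<le> K"
        "\<bar>u y 0\<bar> \<le> K" "norm (w y 0) \<le> K" "norm (b y 0) \<le> K" "\<bar>D_y v y 0\<bar> \<le> K"
        unfolding i using K(2)[OF y] by auto
    qed (rule K(1))
  qed auto
  then obtain K where K: "K \<ge> 1" "\<And>v u w b \<theta> y. (v, u, w, b, \<theta>) \<in> S \<Longrightarrow> y \<in> {0..1} \<Longrightarrow> 1 / K \<le> v y 0 \<and> v y 0 \<le> K \<and>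
    1 / K \<le> \<theta> y 0 \<and> \<theta> y 0 \<le> K \<and>
    \<bar>u y 0\<bar> \<le> K \<and> norm (w y 0) \<le> K \<and> norm (b y 0) \<le> K \<and> \<bar>D_y v y 0\<bar> \<le> K"
    by blast
  have "solution_flows lam \<mu> \<nu> R a Cv \<kappa>1 K T \<kappa> S"
    apply unfold_locales
    apply (simp_all only: split_paired_all prod.case)
    apply (rule param K(1)
      | (rule smooth_solution.pos[OF S], assumption, simp, simp)
      | (rule smooth_solution.jc[OF S], assumption)
      | (rule smooth_solution.jc_flux[OF S], assumption)
      | (rule smooth_solution.dt[OF S], assumption, simp, simp)
      | (rule smooth_solution.dtv(3,4)[OF S], assumption, simp, simp)
      | (rule smooth_solution.dy[OF S], assumption, simp, simp)
      | (rule smooth_solution.dyv(3,4,7,8)[OF S], assumption, simp, simp)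
      | (rule smooth_solution.momentum_closed[OF S], assumption, simp, simp)
      | (rule smooth_solution.transversal_closed[OF S], assumption, simp, simp)
      | (rule smooth_solution.induction_closed[OF S], assumption, simp, simp)
      | (rule smooth_solution.heat_closed[OF S], assumption, simp, simp)
      | (rule smooth_solution.boundary_closed[OF S], assumption, assumption, simp)
      | (simp add: heat_flux_def; fail)
      | (rule kap, rule divide_pos_pos, rule zero_less_one, rule smooth_solution.pos[OF S], assumption, simp, simp,
          rule smooth_solution.pos[OF S], assumption, simp, simp)
      | (rule K(2), assumption, simp))+
    done
  then show ?thesis by blast
qed

section \<open>The two ranges of the exponent \<open>q\<close> and the final constant\<close>

lemma one_plus_square_le_powr:
  assumes "0 < (x::real)" "2 \<le> q"
  shows "1 + x\<^sup>2 \<le> 2 * (1 + x powr q)"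
proof (cases "1 \<le> x")
  case True
  then have "x powr 2 \<le> x powr q" using assms by (intro powr_mono) auto
  then have "x\<^sup>2 \<le> x powr q" using assms by simp
  then show ?thesis using powr_ge_zero[of x q] unfolding distrib_left by linarith
next
  case False
  then have "x\<^sup>2 \<le> 1" using assms by (intro power_le_one) auto
  then show ?thesis using powr_ge_zero[of x q] unfolding distrib_left by linarith
qed

lemma powr_le_one_plus_square:
  assumes "0 < (x::real)" "0 \<le> q" "q \<le> 2"
  shows "x powr q \<le> 1 + x\<^sup>2"
proof (cases "1 \<le> x")
  case True
  then have "x powr q \<le> x powr 2" using assms by (intro powr_mono) auto
  then show ?thesis using assms by simp
next
  case False
  then have "x powr q \<le> 1" using assms by (intro powr_le1) auto
  then show ?thesis using zero_le_power2[of x] by linarith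
qed

theorem lemma3p10:
  fixes lam \<mu> \<nu> R a Cv \<kappa>1 \<kappa>2 q T \<epsilon> :: real
    and \<kappa> :: "real \<Rightarrow> real \<Rightarrow> real"
    and v0 u0 \<theta>0 :: "real \<Rightarrow> real"
    and w0 b0 :: "real \<Rightarrow> real^2"
  assumes "lam > 0" "\<mu> > 0" "\<nu> > 0" "R > 0" "a > 0" "Cv > 0" "\<kappa>1 > 0" "\<kappa>2 > 0" "q \<ge> 0"
    and "conductivity \<kappa>1 \<kappa>2 q \<kappa>"
    and "initial_data v0 u0 w0 b0 \<theta>0"
    and "T > 0" "\<epsilon> > 0"
  shows "\<exists>C>0. \<forall>v u w b \<theta>.
    solves_P lam \<mu> \<nu> R a Cv \<kappa> T v0 u0 w0 b0 \<theta>0 v u w b \<theta> \<and> sufficiently_smooth \<kappa> T v u w b \<theta> \<longrightarrow>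
    (\<forall>t\<in>{0..T}.
       integral {0..1} (\<lambda>y. (D_y v y t)\<^sup>2)
       + integral {0..t} (\<lambda>s. integral {0..1} (\<lambda>y. \<theta> y s * (D_y v y s)\<^sup>2))
       \<le> C
         + \<epsilon> * sqrt (integral {0..t} (\<lambda>s. integral {0..1} (\<lambda>y. (norm (D_y (D_y w) y s))\<^sup>2)))
         + \<epsilon> * sqrt (integral {0..t} (\<lambda>s. integral {0..1} (\<lambda>y. (norm (D_y (D_y b) y s))\<^sup>2))))"
proof -
  define S where "S = {(v, u, w, b, \<theta>). smooth_solution lam \<mu> \<nu> R a Cv T \<kappa> v0 u0 w0 b0 \<theta>0 v u w b \<theta>}"
  have S: "smooth_solution lam \<mu> \<nu> R a Cv T \<kappa> v0 u0 w0 b0 \<theta>0 v u w b \<theta>" if "(v, u, w, b, \<theta>) \<in> S" for v u w b \<theta>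
    using that by (simp add: S_def)
  have bd: "\<kappa>1 * (1 + \<theta> powr q) \<le> \<kappa> \<rho> \<theta>" "\<kappa> \<rho> \<theta> \<le> \<kappa>2 * (1 + \<theta> powr q)" if "0 < \<rho>" "0 < \<theta>" for \<rho> \<theta>
    using assms(10) that by (auto simp: conductivity_def)
  have "\<kappa>1 \<le> \<kappa> \<rho> \<theta>" if "0 < \<rho>" "0 < \<theta>" for \<rho> \<theta>
  proof -
    have "\<kappa>1 * 1 \<le> \<kappa>1 * (1 + \<theta> powr q)" using assms(7) by (intro mult_left_mono) auto
    then show ?thesis using bd(1)[OF that] by simp
  qed
  then obtain K where "solution_flows lam \<mu> \<nu> R a Cv \<kappa>1 K T \<kappa> S"
    using flows_of_solutions[OF assms(1-7,12) _ S] by blast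
  note est = flows.v_y_estimate[OF this assms(13)]
  have pos: "0 < 1 / v y t" "0 < \<theta> y t" if "(v, u, w, b, \<theta>) \<in> S" "y \<in> {0..1}" "t \<in> {0..T}" for v u w b \<theta> y t
    using smooth_solution.pos[OF S[OF that(1)] that(2,3)] by auto
  obtain C where C: "C > 0" "\<And>v u w b \<theta> t. (v, u, w, b, \<theta>) \<in> S \<Longrightarrow> t \<in> {0..T} \<Longrightarrow>
       integral {0..1} (\<lambda>y. (D_y v y t)\<^sup>2)
       + integral {0..t} (\<lambda>s. integral {0..1} (\<lambda>y. \<theta> y s * (D_y v y s)\<^sup>2))
       \<le> C
         + \<epsilon> * sqrt (integral {0..t} (\<lambda>s. integral {0..1} (\<lambda>y. D_y (D_y w) y s \<bullet> D_y (D_y w) y s)))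
         + \<epsilon> * sqrt (integral {0..t} (\<lambda>s. integral {0..1} (\<lambda>y. D_y (D_y b) y s \<bullet> D_y (D_y b) y s)))"
  proof (cases "2 \<le> q")
    case True
    have "\<kappa>1 / 2 * (1 + (\<theta> y t)\<^sup>2) \<le> \<kappa> (1 / v y t) (\<theta> y t)"
      if "(v, u, w, b, \<theta>) \<in> S" "y \<in> {0..1}" "t \<in> {0..T}" for v u w b \<theta> y t
    proof -
      note p = pos[OF that]
      have "\<kappa>1 / 2 * (1 + (\<theta> y t)\<^sup>2) \<le> \<kappa>1 / 2 * (2 * (1 + \<theta> y t powr q))"
        using one_plus_square_le_powr[OF p(2) True] assms(7) by (intro mult_left_mono) auto
      also have "\<dots> \<le> \<kappa> (1 / v y t) (\<theta> y t)" using bd(1)[OF p] by (simp add: algebra_simps)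
      finally show ?thesis .
    qed
    then have "\<exists>k>0. \<forall>s\<in>S. \<forall>y\<in>{0..1}. \<forall>t\<in>{0..T}. k * (1 + ((case s of (v, u, w, b, \<theta>) \<Rightarrow> \<theta>) y t)\<^sup>2)
        \<le> (case s of (v, u, w, b, \<theta>) \<Rightarrow> \<lambda>y t. \<kappa> (1 / v y t) (\<theta> y t)) y t"
      using assms(7) by (intro exI[of _ "\<kappa>1 / 2"]) auto
    from est[OF disjI1[OF this]] show thesis
    proof (elim exE conjE, goal_cases)
      case (1 C)
      show thesis
        by (rule that[OF 1(1)], drule bspec[OF 1(2)], drule (1) bspec, simp only: prod.case)
    qed
  next
    case False
    have "\<kappa> (1 / v y t) (\<theta> y t) \<le> 2 * \<kappa>2 * (1 + (\<theta> y t)\<^sup>2)"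
      if "(v, u, w, b, \<theta>) \<in> S" "y \<in> {0..1}" "t \<in> {0..T}" for v u w b \<theta> y t
    proof -
      note p = pos[OF that]
      have "1 + \<theta> y t powr q \<le> 2 * (1 + (\<theta> y t)\<^sup>2)"
        using powr_le_one_plus_square[OF p(2) assms(9) less_imp_le] False zero_le_power2[of "\<theta> y t"]
        unfolding distrib_left not_le by linarith
      then have "\<kappa>2 * (1 + \<theta> y t powr q) \<le> \<kappa>2 * (2 * (1 + (\<theta> y t)\<^sup>2))" using assms(8) by (intro mult_left_mono) auto
      then show ?thesis using bd(2)[OF p] by (simp add: ac_simps)
    qed
    then have "\<exists>k>0. \<forall>s\<in>S. \<forall>y\<in>{0..1}. \<forall>t\<in>{0..T}. (case s of (v, u, w, b, \<theta>) \<Rightarrow> \<lambda>y t. \<kappa> (1 / v y t) (\<theta> y t)) y t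
        \<le> k * (1 + ((case s of (v, u, w, b, \<theta>) \<Rightarrow> \<theta>) y t)\<^sup>2)"
      using assms(8) by (intro exI[of _ "2 * \<kappa>2"]) auto
    from est[OF disjI2[OF this]] show thesis
    proof (elim exE conjE, goal_cases)
      case (1 C)
      show thesis
        by (rule that[OF 1(1)], drule bspec[OF 1(2)], drule (1) bspec, simp only: prod.case)
    qed
  qed
  then show ?thesis
    by (intro exI[of _ C]) (auto simp: power2_norm_eq_inner S_def smooth_solution_def assms(12))
qed

end
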